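(* For partitions $\lambda,\mu,\nu$ (with $\mu\subseteq\nu$ in the formula for $\widehat c_{\lambda\mu}^{\,\nu}(a)$) we have $$\widehat K_{\lambda\mu}(a)=\sum_R\sum_{k=0}^l\frac{h_\mu(a_{\rho^{(k)}}\|a)}{\prod_{0\leqslant j\leqslant l,\ j\neq k}\big(|a_{\rho^{(k)}}|-|a_{\rho^{(j)}}|\big)},$$ $$\chi^\lambda_\mu(a)=\sum_R\sum_{k=0}^l\frac{p_\mu(a_{\rho^{(k)}}\|a)}{\prod_{0\leqslant j\leqslant l,\ j\neq k}\big(|a_{\rho^{(k)}}|-|a_{\rho^{(j)}}|\big)},$$ $$\widehat c_{\lambda\mu}^{\,\nu}(a)=\sum_R\sum_{k=0}^l\frac{s_{\nu/\mu}(a_{\rho^{(k)}}\|a)}{\prod_{0\leqslant j\leqslant l,\ j\neq k}\big(|a_{\rho^{(k)}}|-|a_{\rho^{(j)}}|\big)},$$ summed over all sequences of partitions $R$ of the form $\varnothing=\rho^{(0)}\to\rho^{(1)}\to\dots\to\rho^{(l-1)}\to\rho^{(l)}=\lambda$. Moreover, $$c_{\lambda\mu}^{\nu}(a)=\sum_R\sum_{k=0}^l\frac{s_\lambda(a_{\rho^{(k)}}\|a)}{\prod_{0\leqslant j\leqslant l,\ j\neq k}\big(|a_{\rho^{(k)}}|-|a_{\rho^{(j)}}|\big)},$$ summed over all sequences of partitions $R$ of the form $\mu=\rho^{(0)}\to\rho^{(1)}\to\dots\to\rho^{(l-1)}\to\rho^{(l)}=\nu$.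
   Context: Let $a=(a_i)_{i\in\mathbb Z}$ be a sequence of commuting indeterminates and $\mathbb Q[a]$ the polynomial ring in the $a_i$. $\rho\to\sigma$ means that the diagram $\sigma$ is obtained from $\rho$ by adding one box. For a partition $\rho$, $a_\rho=(a_{1-\rho_1},a_{2-\rho_2},\dots)$, and $|a_\rho|-|a_\sigma|$ denotes the (finite) sum $\sum_{i\geqslant 1}(a_{i-\rho_i}-a_{i-\sigma_i})$. The ring $\Lambda(x\|a)$: its elements are sequences $P=(P_0,P_1,P_2,\dots)$, where $P_n$ is a symmetric polynomial in $x_1,\dots,x_n$ with coefficients in $\mathbb Q[a]$, the total degrees of the $P_n$ in the $x_i$ are bounded, and $P_n(x_1,\dots,x_{n-1},a_n)=P_{n-1}(x_1,\dots,x_{n-1})$ for all $n\geqslant 1$; multiplication is componentwise. The value $P(a_\rho)\in\mathbb Q[a]$ is $P_n(a_{1-\rho_1},\dots,a_{n-\rho_n})$ for any $n\geqslant\ell(\rho)$. $\Lambda(x\|a)$ is freely generated over $\mathbb Q[a]$ by $p_k(x\|a)=\sum_{i\geqslant 1}(x_i^k-a_i^k)$, $k\geqslant 1$. Double Schur functions: for a partition $\lambda$ with $\ell(\lambda)\leqslant n$, $$s_\lambda(x_1,\dots,x_n\|a)=\frac{\det\big[(x_i\|a)^{\lambda_j+n-j}\big]_{i,j=1}^n}{\prod_{1\leqslant i<j\leqslant n}(x_i-x_j)},\qquad (x_i\|a)^r=(x_i-a_n)(x_i-a_{n-1})\cdots(x_i-a_{n-r+1}),\ (x_i\|a)^0=1,$$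 and $0$ if $\ell(\lambda)>n$. This sequence is $s_\lambda(x\|a)\in\Lambda(x\|a)$; the $s_\lambda(x\|a)$ form a $\mathbb Q[a]$-basis. Put $h_k(x\|a)=s_{(k)}(x\|a)$, $h_\mu(x\|a)=\prod_ih_{\mu_i}(x\|a)$, $p_\mu(x\|a)=\prod_ip_{\mu_i}(x\|a)$ (products over nonzero parts). Skew double Schur functions: $s_{\nu/\mu}(x\|a)\in\Lambda(x\|a)$ is the sequence of polynomials, for $x=(x_1,\dots,x_n)$, $$s_{\nu/\mu}(x\|a)=\sum_{\mu\subseteq\rho\subseteq\nu}\widetilde s_{\nu/\rho}(x\|a)\,s_{\rho'/\mu'}(-a^{(n)}\,|\,{-}a),\qquad a^{(n)}=(a_1,\dots,a_n),$$ where $\widetilde s_\theta(x\|a)=\sum_T\prod_{\alpha\in\theta}(x_{T(\alpha)}-a_{T(\alpha)-c(\alpha)})$ over fillings $T$ of $\theta$ by $\{1,\dots,n\}$ weakly decreasing along rows and strictly decreasing down columns, $s_\theta(-a^{(n)}\,|\,{-}a)=\sum_T\prod_{\alpha\in\theta}(-a_{T(\alpha)}+a_{T(\alpha)+c(\alpha)})$ over fillings $T$ of $\theta$ by $\{1,\dots,n\}$ weakly increasing along rows and strictly increasing down columns, $c(\alpha)=j-i$ for the box in row $i$, column $j$, and $\rho'$ is the conjugate of $\rho$. Dual Schur functions: let $\widehat\Lambda(y\|a)$ be the ring of formal (possibly infinite) sums $\sum_{\lambda}c_\lambda(a)s_\lambda(y)$, $c_\lambda(a)\in\mathbb Q[a]$,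 with $s_\lambda(y)$ ordinary Schur functions. With $d$ the number of diagonal boxes of $\lambda$ and $n\geqslant\ell(\lambda)$, $\widehat s_\lambda(y_1,\dots,y_n\|a)=\det[A_{ij}]_{i,j=1}^n/\prod_{i<j}(y_i-y_j)$, where $A_{ij}=\dfrac{y_i^{\lambda_j+n-j}}{(1-a_0y_i)(1-a_{-1}y_i)\cdots(1-a_{j-\lambda_j}y_i)}$ for $j\leqslant d$ and $A_{ij}=y_i^{\lambda_j+n-j}(1-a_1y_i)\cdots(1-a_{j-\lambda_j-1}y_i)$ for $d<j\leqslant n$ (and $0$ if $\ell(\lambda)>n$); these are compatible with $y_n=0$ and define $\widehat s_\lambda(y\|a)\in\widehat\Lambda(y\|a)$. The dual monomial symmetric function $\widehat m_\mu(y\|a)\in\widehat\Lambda(y\|a)$ is obtained from the monomial symmetric function $m_\mu(y)$ by replacing each power $y_i^r$, $r\geqslant 1$, in each monomial by $(y_i,a)^r=\dfrac{y_i^r}{(1-a_0y_i)(1-a_{-1}y_i)\cdots(1-a_{1-r}y_i)}$. Polynomials: $\widehat K_{\lambda\mu}(a)$, $\chi^\lambda_\mu(a)$, $c_{\lambda\mu}^{\nu}(a)$, $\widehat c_{\lambda\mu}^{\,\nu}(a)\in\mathbb Q[a]$ are defined by the expansions $\widehat s_\lambda(y\|a)=\sum_\mu\widehat K_{\lambda\mu}(a)\,\widehat m_\mu(y\|a)$; $p_\mu(x\|a)=\sum_\lambda\chi^\lambda_\mu(a)\,s_\lambda(x\|a)$; $s_\lambda(x\|a)s_\mu(x\|a)=\sum_\nu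 c_{\lambda\mu}^{\nu}(a)s_\nu(x\|a)$; $\Delta(s_\nu(x\|a))=\sum_{\lambda,\mu}\widehat c_{\lambda\mu}^{\,\nu}(a)\,s_\lambda(x\|a)\otimes s_\mu(x\|a)$, where $\Delta:\Lambda(x\|a)\to\Lambda(x\|a)\otimes_{\mathbb Q[a]}\Lambda(x\|a)$ is the $\mathbb Q[a]$-linear ring homomorphism with $\Delta(p_k(x\|a))=p_k(x\|a)\otimes 1+1\otimes p_k(x\|a)$. *)

theory Defs
  imports
    "HOL-Library.Poly_Mapping"
    "HOL-Library.FuncSet"
    "HOL-Library.Multiset"
    "HOL-Combinatorics.Permutations"
    "HOL-Computational_Algebra.Polynomial_Factorial"
    "Jordan_Normal_Form.Determinant"
begin

section \<open>Partitions\<close>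

text \<open>The parts \<open>part \<kappa> 1 \<ge> part \<kappa> 2 \<ge> \<dots>\<close> are indexed from 1; the value at 0 is
  a dummy, fixed to be 0 so that equality of partitions is equality of all parts.\<close>

typedef partition =
  "{f :: nat \<Rightarrow> nat. f 0 = 0 \<and> (\<forall>i\<ge>1. f (Suc i) \<le> f i) \<and> finite {i. f i \<noteq> 0}}"
  morphisms part Abs_partition
  by (rule exI[of _ "\<lambda>_. 0"]) auto

setup_lifting type_definition_partition

lift_definition empty_part :: partition is "\<lambda>_. 0"
  by auto

lift_definition row_part :: "nat \<Rightarrow> partition" is "\<lambda>k i. if i = 1 then k else 0"
  by auto

lift_definition conj_part :: "partition \<Rightarrow> partition"
  is "\<lambda>f j. if j = 0 then 0 else card {i. 1 \<le> i \<and> j \<le> f i}"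
proof -
  fix f :: "nat \<Rightarrow> nat"
  assume f: "f 0 = 0 \<and> (\<forall>i\<ge>1. f (Suc i) \<le> f i) \<and> finite {i. f i \<noteq> 0}"
  have fin: "finite {i. 1 \<le> i \<and> j \<le> f i}" if "j \<ge> 1" for j
    by (rule finite_subset[of _ "{i. f i \<noteq> 0}"]) (use f that in auto)
  have le: "f i \<le> f 1" if "1 \<le> i" for i
    using that by (induction i rule: dec_induct) (use f le_trans in auto)
  have "{j. card {i. 1 \<le> i \<and> j \<le> f i} \<noteq> 0} \<subseteq> {..f 1}"
  proof
    fix j assume "j \<in> {j. card {i. 1 \<le> i \<and> j \<le> f i} \<noteq> 0}"
    then obtain i where "1 \<le> i" "j \<le> f i" by (auto simp: card_eq_0_iff)
    with le[of i] show "j \<in> {..f 1}" by simp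
  qed
  then have "finite {j. (if j = 0 then 0 else card {i. 1 \<le> i \<and> j \<le> f i}) \<noteq> 0}"
    by (intro finite_subset[OF _ finite_atMost[of "f 1"]]) (auto split: if_splits)
  moreover have "card {i. 1 \<le> i \<and> Suc j \<le> f i} \<le> card {i. 1 \<le> i \<and> j \<le> f i}" if "j \<ge> 1" for j
    by (rule card_mono[OF fin[OF that]]) auto
  ultimately show "(if (0::nat) = 0 then 0 else card {i. 1 \<le> i \<and> 0 \<le> f i}) = 0 \<and>
      (\<forall>j\<ge>1. (if Suc j = 0 then 0 else card {i. 1 \<le> i \<and> Suc j \<le> f i}) \<le>
              (if j = 0 then 0 else card {i. 1 \<le> i \<and> j \<le> f i})) \<and>
      finite {j. (if j = 0 then 0 else card {i. 1 \<le> i \<and> j \<le> f i}) \<noteq> 0}"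
    by auto
qed

definition plength :: "partition \<Rightarrow> nat" where
  "plength \<kappa> = card {i. part \<kappa> i \<noteq> 0}"

definition diagram :: "partition \<Rightarrow> (nat \<times> nat) set" where
  "diagram \<kappa> = {(i, j). 1 \<le> i \<and> 1 \<le> j \<and> j \<le> part \<kappa> i}"

definition diag_len :: "partition \<Rightarrow> nat" where
  "diag_len \<kappa> = card {i. (i, i) \<in> diagram \<kappa>}"

definition part_le :: "partition \<Rightarrow> partition \<Rightarrow> bool" where
  "part_le \<mu> \<nu> \<longleftrightarrow> diagram \<mu> \<subseteq> diagram \<nu>"

definition add_box :: "partition \<Rightarrow> partition \<Rightarrow> bool" where
  "add_box \<rho> \<sigma> \<longleftrightarrow> (\<exists>\<alpha>. \<alpha> \<notin> diagram \<rho> \<and> diagram \<sigma> = insert \<alpha> (diagram \<rho>))"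

definition content :: "nat \<times> nat \<Rightarrow> int" where
  "content \<alpha> = int (snd \<alpha>) - int (fst \<alpha>)"

text \<open>The sequences \<open>\<mu> = \<rho>\<^bsup>(0)\<^esup> \<rightarrow> \<dots> \<rightarrow> \<rho>\<^bsup>(l)\<^esup> = \<kappa>\<close>, as lists of length \<open>l + 1\<close>.\<close>

definition chains :: "partition \<Rightarrow> partition \<Rightarrow> partition list set" where
  "chains \<mu> \<kappa> = {R. R \<noteq> [] \<and> hd R = \<mu> \<and> last R = \<kappa> \<and>
                    (\<forall>i. Suc i < length R \<longrightarrow> add_box (R ! i) (R ! Suc i))}"


section \<open>Polynomials\<close>

text \<open>\<open>('v \<Rightarrow>\<^sub>0 nat) \<Rightarrow>\<^sub>0 'c\<close> is the ring of polynomials over \<open>'c\<close> in the variables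
  indexed by \<open>'v\<close>; thus \<open>qa\<close> is \<open>\<rat>[a]\<close> and \<open>xpoly\<close> is \<open>\<rat>[a][x\<^sub>0, x\<^sub>1, \<dots>]\<close>, of which
  \<open>x\<^sub>0\<close> is never used.\<close>

type_synonym qa = "(int \<Rightarrow>\<^sub>0 nat) \<Rightarrow>\<^sub>0 rat"
type_synonym xpoly = "(nat \<Rightarrow>\<^sub>0 nat) \<Rightarrow>\<^sub>0 qa"

definition av :: "int \<Rightarrow> qa" where
  "av i = Poly_Mapping.single (Poly_Mapping.single i 1) 1"

definition xv :: "nat \<Rightarrow> xpoly" where
  "xv i = Poly_Mapping.single (Poly_Mapping.single i 1) 1"

definition xconst :: "qa \<Rightarrow> xpoly" where
  "xconst c = Poly_Mapping.single 0 c"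

definition monom_val :: "('v \<Rightarrow> 'b::comm_semiring_1) \<Rightarrow> ('v \<Rightarrow>\<^sub>0 nat) \<Rightarrow> 'b" where
  "monom_val f u = (\<Prod>i\<in>Poly_Mapping.keys u. f i ^ Poly_Mapping.lookup u i)"

text \<open>Apply \<open>\<phi>\<close> to the coefficients and substitute \<open>f\<close> for the variables.\<close>

definition poly_subst ::
    "('c::comm_semiring_1 \<Rightarrow> 'b::comm_semiring_1) \<Rightarrow> ('v \<Rightarrow> 'b) \<Rightarrow> (('v \<Rightarrow>\<^sub>0 nat) \<Rightarrow>\<^sub>0 'c) \<Rightarrow> 'b" where
  "poly_subst \<phi> f p =
     (\<Sum>u\<in>Poly_Mapping.keys p. \<phi> (Poly_Mapping.lookup p u) * monom_val f u)"

abbreviation xsubst :: "(nat \<Rightarrow> xpoly) \<Rightarrow> xpoly \<Rightarrow> xpoly" where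
  "xsubst \<equiv> poly_subst xconst"

definition mdeg :: "(nat \<Rightarrow>\<^sub>0 nat) \<Rightarrow> nat" where
  "mdeg u = (\<Sum>i\<in>Poly_Mapping.keys u. Poly_Mapping.lookup u i)"

lemma monom_val_superset:
  assumes "finite S" "Poly_Mapping.keys u \<subseteq> S"
  shows "monom_val f u = (\<Prod>i\<in>S. f i ^ Poly_Mapping.lookup u i)"
  unfolding monom_val_def
  by (rule prod.mono_neutral_left) (use assms in \<open>auto simp: in_keys_iff\<close>)

lemma monom_val_add: "monom_val f (u + v) = monom_val f u * monom_val f v"
proof -
  let ?S = "Poly_Mapping.keys u \<union> Poly_Mapping.keys v"
  have "monom_val f (u + v) = (\<Prod>i\<in>?S. f i ^ Poly_Mapping.lookup (u + v) i)"
    by (rule monom_val_superset) (use Poly_Mapping.keys_add[of u v] in auto)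
  also have "\<dots> = (\<Prod>i\<in>?S. f i ^ Poly_Mapping.lookup u i) * (\<Prod>i\<in>?S. f i ^ Poly_Mapping.lookup v i)"
    by (simp add: lookup_add power_add prod.distrib)
  also have "\<dots> = monom_val f u * monom_val f v"
    by (simp add: monom_val_superset[of ?S])
  finally show ?thesis .
qed

lemma monom_val_0 [simp]: "monom_val f 0 = 1"
  by (simp add: monom_val_def)

lemma poly_subst_superset:
  assumes "finite S" "Poly_Mapping.keys p \<subseteq> S" "\<phi> 0 = 0"
  shows "poly_subst \<phi> f p = (\<Sum>u\<in>S. \<phi> (Poly_Mapping.lookup p u) * monom_val f u)"
  unfolding poly_subst_def
  by (rule sum.mono_neutral_left) (use assms in \<open>auto simp: in_keys_iff\<close>)

lemma poly_subst_0 [simp]: "poly_subst \<phi> f 0 = 0"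
  by (simp add: poly_subst_def)

lemma poly_subst_add:
  assumes "\<phi> 0 = 0" "\<And>c d. \<phi> (c + d) = \<phi> c + \<phi> d"
  shows "poly_subst \<phi> f (p + q) = poly_subst \<phi> f p + poly_subst \<phi> f q"
proof -
  let ?S = "Poly_Mapping.keys p \<union> Poly_Mapping.keys q"
  have "poly_subst \<phi> f (p + q) = (\<Sum>u\<in>?S. \<phi> (Poly_Mapping.lookup (p + q) u) * monom_val f u)"
    by (rule poly_subst_superset) (use Poly_Mapping.keys_add[of p q] assms in auto)
  also have "\<dots> = (\<Sum>u\<in>?S. \<phi> (Poly_Mapping.lookup p u) * monom_val f u)
      + (\<Sum>u\<in>?S. \<phi> (Poly_Mapping.lookup q u) * monom_val f u)"
    by (simp add: lookup_add assms algebra_simps sum.distrib)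
  also have "\<dots> = poly_subst \<phi> f p + poly_subst \<phi> f q"
    by (simp add: poly_subst_superset[of ?S] assms)
  finally show ?thesis .
qed

lemma poly_subst_sum:
  assumes "\<phi> 0 = 0" "\<And>c d. \<phi> (c + d) = \<phi> c + \<phi> d"
  shows "poly_subst \<phi> f (\<Sum>i\<in>A. g i) = (\<Sum>i\<in>A. poly_subst \<phi> f (g i))"
  by (induction A rule: infinite_finite_induct) (simp_all add: poly_subst_add assms)

lemma poly_subst_single:
  assumes "\<phi> 0 = 0"
  shows "poly_subst \<phi> f (Poly_Mapping.single u c) = \<phi> c * monom_val f u"
  by (cases "c = 0") (simp_all add: poly_subst_def assms)

lemma poly_sum_single:
  fixes p :: "'a \<Rightarrow>\<^sub>0 'c::comm_monoid_add"
  shows "p = (\<Sum>u\<in>Poly_Mapping.keys p. Poly_Mapping.single u (Poly_Mapping.lookup p u))"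
  by (rule poly_mapping_eqI)
    (auto simp: lookup_sum lookup_single when_def in_keys_iff sum.delta')

lemma poly_subst_mult:
  assumes "\<phi> 0 = 0" "\<And>c d. \<phi> (c + d) = \<phi> c + \<phi> d" "\<And>c d. \<phi> (c * d) = \<phi> c * \<phi> d"
  shows "poly_subst \<phi> f (p * q) = poly_subst \<phi> f p * poly_subst \<phi> f q"
proof -
  have "p * q = (\<Sum>u\<in>Poly_Mapping.keys p. \<Sum>v\<in>Poly_Mapping.keys q.
      Poly_Mapping.single (u + v) (Poly_Mapping.lookup p u * Poly_Mapping.lookup q v))"
    by (subst poly_sum_single[of p], subst poly_sum_single[of q])
      (simp add: sum_product mult_single)
  then have "poly_subst \<phi> f (p * q) = (\<Sum>u\<in>Poly_Mapping.keys p. \<Sum>v\<in>Poly_Mapping.keys q.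
      (\<phi> (Poly_Mapping.lookup p u) * monom_val f u) * (\<phi> (Poly_Mapping.lookup q v) * monom_val f v))"
    by (simp add: poly_subst_sum poly_subst_single assms monom_val_add algebra_simps)
  then show ?thesis
    by (simp add: poly_subst_def sum_product)
qed

lemma xconst_hom [simp]:
  "xconst 0 = 0" "xconst 1 = 1"
  "xconst (c + d) = xconst c + xconst d" "xconst (c * d) = xconst c * xconst d"
  "xconst (- c) = - xconst c"
  by (simp_all add: xconst_def single_add mult_single single_uminus)

lemma xsubst_hom [simp]:
  "xsubst f (p + q) = xsubst f p + xsubst f q"
  "xsubst f (p * q) = xsubst f p * xsubst f q"
  "xsubst f (xconst c) = xconst c"
  "xsubst f (- p) = - xsubst f p"
proof -
  show add: "xsubst f (p + q) = xsubst f p + xsubst f q" for p q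
    by (simp add: poly_subst_add)
  show "xsubst f (p * q) = xsubst f p * xsubst f q"
    by (simp add: poly_subst_mult)
  show "xsubst f (xconst c) = xconst c"
    using poly_subst_single[of xconst f 0 c] by (simp flip: xconst_def)
  have "xsubst f p + xsubst f (- p) = 0"
    by (simp flip: add)
  then show "xsubst f (- p) = - xsubst f p"
    by (metis add_eq_0_iff)
qed

lemma mdeg_add: "mdeg (u + v) = mdeg u + mdeg v"
proof -
  let ?S = "Poly_Mapping.keys u \<union> Poly_Mapping.keys v"
  have *: "mdeg w = (\<Sum>i\<in>?S. Poly_Mapping.lookup w i)" if "Poly_Mapping.keys w \<subseteq> ?S" for w
    unfolding mdeg_def
    by (rule sum.mono_neutral_left) (use that in \<open>auto simp: in_keys_iff\<close>)
  show ?thesis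
    using Poly_Mapping.keys_add[of u v] by (simp add: * lookup_add sum.distrib)
qed


section \<open>The ring \<open>\<Lambda>(x\<parallel>a)\<close>\<close>

definition dsym_seqs :: "(nat \<Rightarrow> xpoly) set" where
  "dsym_seqs = {P.
     (\<forall>n. \<forall>u\<in>Poly_Mapping.keys (P n). Poly_Mapping.keys u \<subseteq> {1..n}) \<and>
     (\<forall>n \<sigma>. \<sigma> permutes {1..n} \<longrightarrow> xsubst (\<lambda>i. xv (\<sigma> i)) (P n) = P n) \<and>
     (\<exists>d. \<forall>n. \<forall>u\<in>Poly_Mapping.keys (P n). mdeg u \<le> d) \<and>
     (\<forall>n\<ge>1. xsubst (xv(n := xconst (av (int n)))) (P n) = P (n - 1))}"

lemma dsym_seqsI:
  assumes "\<And>n u. u \<in> Poly_Mapping.keys (P n) \<Longrightarrow> Poly_Mapping.keys u \<subseteq> {1..n}"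
    and "\<And>n \<sigma>. \<sigma> permutes {1..n} \<Longrightarrow> xsubst (\<lambda>i. xv (\<sigma> i)) (P n) = P n"
    and "\<And>n u. u \<in> Poly_Mapping.keys (P n) \<Longrightarrow> mdeg u \<le> d"
    and "\<And>n. n \<ge> 1 \<Longrightarrow> xsubst (xv(n := xconst (av (int n)))) (P n) = P (n - 1)"
  shows "P \<in> dsym_seqs"
  unfolding dsym_seqs_def mem_Collect_eq using assms by blast

lemma dsym_seqsE:
  assumes "P \<in> dsym_seqs"
  obtains d where "\<And>n u. u \<in> Poly_Mapping.keys (P n) \<Longrightarrow> Poly_Mapping.keys u \<subseteq> {1..n}"
    and "\<And>n \<sigma>. \<sigma> permutes {1..n} \<Longrightarrow> xsubst (\<lambda>i. xv (\<sigma> i)) (P n) = P n"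
    and "\<And>n u. u \<in> Poly_Mapping.keys (P n) \<Longrightarrow> mdeg u \<le> d"
    and "\<And>n. n \<ge> 1 \<Longrightarrow> xsubst (xv(n := xconst (av (int n)))) (P n) = P (n - 1)"
  using assms unfolding dsym_seqs_def mem_Collect_eq by blast

lemma dsym_seqs_const: "(\<lambda>_. xconst c) \<in> dsym_seqs"
proof -
  have *: "u = 0" if "u \<in> Poly_Mapping.keys (xconst c)" for u
    using that by (cases "c = 0") (simp_all add: xconst_def)
  show ?thesis
    by (rule dsym_seqsI[where d = 0]) (auto dest!: * simp: mdeg_def)
qed

lemma dsym_seqs_add:
  assumes P: "P \<in> dsym_seqs" and Q: "Q \<in> dsym_seqs"
  shows "(\<lambda>n. P n + Q n) \<in> dsym_seqs"
proof -
  from P obtain d where p: "\<And>n u. u \<in> Poly_Mapping.keys (P n) \<Longrightarrow> Poly_Mapping.keys u \<subseteq> {1..n}"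
    "\<And>n \<sigma>. \<sigma> permutes {1..n} \<Longrightarrow> xsubst (\<lambda>i. xv (\<sigma> i)) (P n) = P n"
    "\<And>n u. u \<in> Poly_Mapping.keys (P n) \<Longrightarrow> mdeg u \<le> d"
    "\<And>n. n \<ge> 1 \<Longrightarrow> xsubst (xv(n := xconst (av (int n)))) (P n) = P (n - 1)"
    by (rule dsym_seqsE) blast
  from Q obtain e where q: "\<And>n u. u \<in> Poly_Mapping.keys (Q n) \<Longrightarrow> Poly_Mapping.keys u \<subseteq> {1..n}"
    "\<And>n \<sigma>. \<sigma> permutes {1..n} \<Longrightarrow> xsubst (\<lambda>i. xv (\<sigma> i)) (Q n) = Q n"
    "\<And>n u. u \<in> Poly_Mapping.keys (Q n) \<Longrightarrow> mdeg u \<le> e"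
    "\<And>n. n \<ge> 1 \<Longrightarrow> xsubst (xv(n := xconst (av (int n)))) (Q n) = Q (n - 1)"
    by (rule dsym_seqsE) blast
  have *: "u \<in> Poly_Mapping.keys (P n) \<or> u \<in> Poly_Mapping.keys (Q n)"
    if "u \<in> Poly_Mapping.keys (P n + Q n)" for n u
    using that Poly_Mapping.keys_add[of "P n" "Q n"] by blast
  show ?thesis
  proof (rule dsym_seqsI[where d = "d + e"])
    fix n u assume "u \<in> Poly_Mapping.keys (P n + Q n)"
    note u = *[OF this]
    show "Poly_Mapping.keys u \<subseteq> {1..n}"
      using u p(1)[of u n] q(1)[of u n] by blast
    show "mdeg u \<le> d + e"
      using u p(3)[of u n] q(3)[of u n] by linarith
  qed (simp_all only: xsubst_hom p q)
qed

lemma dsym_seqs_mult: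
  assumes P: "P \<in> dsym_seqs" and Q: "Q \<in> dsym_seqs"
  shows "(\<lambda>n. P n * Q n) \<in> dsym_seqs"
proof -
  from P obtain d where p: "\<And>n u. u \<in> Poly_Mapping.keys (P n) \<Longrightarrow> Poly_Mapping.keys u \<subseteq> {1..n}"
    "\<And>n \<sigma>. \<sigma> permutes {1..n} \<Longrightarrow> xsubst (\<lambda>i. xv (\<sigma> i)) (P n) = P n"
    "\<And>n u. u \<in> Poly_Mapping.keys (P n) \<Longrightarrow> mdeg u \<le> d"
    "\<And>n. n \<ge> 1 \<Longrightarrow> xsubst (xv(n := xconst (av (int n)))) (P n) = P (n - 1)"
    by (rule dsym_seqsE) blast
  from Q obtain e where q: "\<And>n u. u \<in> Poly_Mapping.keys (Q n) \<Longrightarrow> Poly_Mapping.keys u \<subseteq> {1..n}"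
    "\<And>n \<sigma>. \<sigma> permutes {1..n} \<Longrightarrow> xsubst (\<lambda>i. xv (\<sigma> i)) (Q n) = Q n"
    "\<And>n u. u \<in> Poly_Mapping.keys (Q n) \<Longrightarrow> mdeg u \<le> e"
    "\<And>n. n \<ge> 1 \<Longrightarrow> xsubst (xv(n := xconst (av (int n)))) (Q n) = Q (n - 1)"
    by (rule dsym_seqsE) blast
  show ?thesis
  proof (rule dsym_seqsI[where d = "d + e"])
    fix n u assume "u \<in> Poly_Mapping.keys (P n * Q n)"
    then obtain v w where vw: "u = v + w" "v \<in> Poly_Mapping.keys (P n)" "w \<in> Poly_Mapping.keys (Q n)"
      using keys_mult[of "P n" "Q n"] by blast
    show "Poly_Mapping.keys u \<subseteq> {1..n}"
      using p(1)[OF vw(2)] q(1)[OF vw(3)] Poly_Mapping.keys_add[of v w] unfolding vw(1) by blast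
    show "mdeg u \<le> d + e"
      using p(3)[OF vw(2)] q(3)[OF vw(3)] by (simp add: vw(1) mdeg_add)
  qed (simp_all only: xsubst_hom p q)
qed

lemma dsym_seqs_uminus:
  assumes "P \<in> dsym_seqs"
  shows "(\<lambda>n. - P n) \<in> dsym_seqs"
  using dsym_seqs_mult[OF dsym_seqs_const[of "- 1"] assms] by simp

typedef dsym = dsym_seqs
  using dsym_seqs_const by blast

setup_lifting type_definition_dsym

lift_definition dconst :: "qa \<Rightarrow> dsym" is "\<lambda>c _. xconst c"
  by (rule dsym_seqs_const)

instantiation dsym :: comm_ring_1
begin

lift_definition zero_dsym :: dsym is "\<lambda>_. 0"
  using dsym_seqs_const[of 0] by simp

lift_definition one_dsym :: dsym is "\<lambda>_. 1"
  using dsym_seqs_const[of 1] by simp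

lift_definition plus_dsym :: "dsym \<Rightarrow> dsym \<Rightarrow> dsym" is "\<lambda>P Q n. P n + Q n"
  by (rule dsym_seqs_add)

lift_definition times_dsym :: "dsym \<Rightarrow> dsym \<Rightarrow> dsym" is "\<lambda>P Q n. P n * Q n"
  by (rule dsym_seqs_mult)

lift_definition uminus_dsym :: "dsym \<Rightarrow> dsym" is "\<lambda>P n. - P n"
  by (rule dsym_seqs_uminus)

lift_definition minus_dsym :: "dsym \<Rightarrow> dsym \<Rightarrow> dsym" is "\<lambda>P Q n. P n - Q n"
proof -
  fix P Q assume P: "P \<in> dsym_seqs" and Q: "Q \<in> dsym_seqs"
  from dsym_seqs_add[OF P dsym_seqs_uminus[OF Q]] show "(\<lambda>n. P n - Q n) \<in> dsym_seqs" by simp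
qed

instance
  by standard (transfer; simp add: fun_eq_iff algebra_simps)+

end

definition dscale :: "qa \<Rightarrow> dsym \<Rightarrow> dsym" where
  "dscale c P = dconst c * P"

text \<open>The value \<open>P(a\<^sub>\<rho>)\<close>. By the compatibility of the components of \<open>P\<close>, the component
  with index \<open>plength \<rho>\<close> may be replaced by any later one.\<close>

definition dval :: "dsym \<Rightarrow> partition \<Rightarrow> qa" where
  "dval P \<rho> = poly_subst id (\<lambda>i. av (int i - int (part \<rho> i))) (Rep_dsym P (plength \<rho>))"

text \<open>\<open>|a\<^sub>\<rho>| - |a\<^sub>\<sigma>|\<close>; all other summands vanish.\<close>

definition adiff :: "partition \<Rightarrow> partition \<Rightarrow> qa" where
  "adiff \<rho> \<sigma> = (\<Sum>i | part \<rho> i \<noteq> part \<sigma> i.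
      av (int i - int (part \<rho> i)) - av (int i - int (part \<sigma> i)))"


section \<open>The tensor product of \<open>\<Lambda>(x\<parallel>a)\<close> with itself over \<open>\<rat>[a]\<close>\<close>

text \<open>The monoid ring over \<open>\<int>\<close> of the multiplicative monoid \<open>\<Lambda> \<times> \<Lambda>\<close>, as a group freely
  generated by the pairs, modulo the bilinearity relations. The relations are stable under
  multiplication by pairs, so that the ideal they generate is also the subgroup they generate.
  Keys of polynomial mappings multiply by \<open>+\<close>, so the monoid is written additively.\<close>

datatype dpair = DPair dsym dsym

instantiation dpair :: comm_monoid_add
begin

definition zero_dpair :: dpair where
  "zero_dpair = DPair 1 1"

fun plus_dpair :: "dpair \<Rightarrow> dpair \<Rightarrow> dpair" where
  "plus_dpair (DPair P Q) (DPair P' Q') = DPair (P * P') (Q * Q')"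

instance
proof
  fix x y z :: dpair
  show "x + y + z = x + (y + z)" by (cases x; cases y; cases z) (simp add: mult.assoc)
  show "x + y = y + x" by (cases x; cases y) (simp add: mult.commute)
  show "0 + x = x" by (cases x) (simp add: zero_dpair_def)
qed

end

definition pair_gen :: "dsym \<Rightarrow> dsym \<Rightarrow> dpair \<Rightarrow>\<^sub>0 int" where
  "pair_gen P Q = Poly_Mapping.single (DPair P Q) 1"

inductive_set bilinear_ideal :: "(dpair \<Rightarrow>\<^sub>0 int) set" where
  zero: "0 \<in> bilinear_ideal"
| add_left: "pair_gen (P + P') Q - pair_gen P Q - pair_gen P' Q \<in> bilinear_ideal"
| add_right: "pair_gen P (Q + Q') - pair_gen P Q - pair_gen P Q' \<in> bilinear_ideal"
| scale: "pair_gen (dscale c P) Q - pair_gen P (dscale c Q) \<in> bilinear_ideal"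
| add: "s \<in> bilinear_ideal \<Longrightarrow> t \<in> bilinear_ideal \<Longrightarrow> s + t \<in> bilinear_ideal"
| mult: "s \<in> bilinear_ideal \<Longrightarrow> r * s \<in> bilinear_ideal"

lemma bilinear_ideal_uminus: "s \<in> bilinear_ideal \<Longrightarrow> - s \<in> bilinear_ideal"
  using bilinear_ideal.mult[of s "- 1"] by simp

lemma bilinear_ideal_cong:
  assumes "s - s' \<in> bilinear_ideal" "t - t' \<in> bilinear_ideal"
  shows "s + t - (s' + t') \<in> bilinear_ideal" "s * t - s' * t' \<in> bilinear_ideal"
    "- s - (- s') \<in> bilinear_ideal" "s - t - (s' - t') \<in> bilinear_ideal"
proof -
  have eq: "s + t - (s' + t') = (s - s') + (t - t')" "s * t - s' * t' = t * (s - s') + s' * (t - t')"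
    "- s - (- s') = - (s - s')" "s - t - (s' - t') = (s - s') + - (t - t')"
    for s s' t t' :: "'a::comm_ring"
    by (simp_all add: algebra_simps)
  show "s + t - (s' + t') \<in> bilinear_ideal"
    unfolding eq(1) by (intro bilinear_ideal.add assms)
  show "s * t - s' * t' \<in> bilinear_ideal"
    unfolding eq(2) by (intro bilinear_ideal.add bilinear_ideal.mult assms)
  show "- s - (- s') \<in> bilinear_ideal"
    unfolding eq(3) by (intro bilinear_ideal_uminus assms)
  show "s - t - (s' - t') \<in> bilinear_ideal"
    unfolding eq(4) by (intro bilinear_ideal.add bilinear_ideal_uminus assms)
qed

quotient_type dtensor = "dpair \<Rightarrow>\<^sub>0 int" / "\<lambda>s t. s - t \<in> bilinear_ideal"
proof (rule equivpI)
  show "reflp (\<lambda>s t. s - t \<in> bilinear_ideal)"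
    by (rule reflpI) (simp add: bilinear_ideal.zero)
  show "symp (\<lambda>s t. s - t \<in> bilinear_ideal)"
    by (rule sympI) (drule bilinear_ideal_uminus, simp only: minus_diff_eq)
  show "transp (\<lambda>s t. s - t \<in> bilinear_ideal)"
    by (rule transpI) (drule (1) bilinear_ideal.add, simp only: diff_add_cancel add_diff_eq)
qed

instantiation dtensor :: "{comm_ring, comm_monoid_mult}"
begin

lift_definition zero_dtensor :: dtensor is 0 .
lift_definition one_dtensor :: dtensor is 1 .
lift_definition plus_dtensor :: "dtensor \<Rightarrow> dtensor \<Rightarrow> dtensor" is "(+)"
  by (rule bilinear_ideal_cong)
lift_definition times_dtensor :: "dtensor \<Rightarrow> dtensor \<Rightarrow> dtensor" is "(*)"
  by (rule bilinear_ideal_cong)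
lift_definition uminus_dtensor :: "dtensor \<Rightarrow> dtensor" is uminus
  by (rule bilinear_ideal_cong)
lift_definition minus_dtensor :: "dtensor \<Rightarrow> dtensor \<Rightarrow> dtensor" is "(-)"
  by (rule bilinear_ideal_cong)

instance
proof
  fix r s t :: dtensor
  have refl: "x - y \<in> bilinear_ideal" if "x = y" for x y
    using that by (simp add: bilinear_ideal.zero)
  show "r + s + t = r + (s + t)" by transfer (rule refl, rule add.assoc)
  show "r + s = s + r" by transfer (rule refl, rule add.commute)
  show "0 + r = r" by transfer (rule refl, rule add_0_left)
  show "- r + r = 0" by transfer (rule refl, rule left_minus)
  show "r - s = r + - s" by transfer (rule refl, rule diff_conv_add_uminus)
  show "r * s * t = r * (s * t)" by transfer (rule refl, rule mult.assoc)
  show "r * s = s * r" by transfer (rule refl, rule mult.commute)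
  show "(r + s) * t = r * t + s * t" by transfer (rule refl, rule distrib_right)
  show "1 * r = r" by transfer (rule refl, rule mult_1_left)
qed

end

lift_definition tensor :: "dsym \<Rightarrow> dsym \<Rightarrow> dtensor" is pair_gen .

definition tscale :: "qa \<Rightarrow> dtensor \<Rightarrow> dtensor" where
  "tscale c t = tensor (dconst c) 1 * t"


section \<open>Double Schur functions\<close>

definition vandermonde :: "(nat \<Rightarrow> 'a::comm_ring_1) \<Rightarrow> nat \<Rightarrow> 'a" where
  "vandermonde z n = (\<Prod>i\<in>{1..n}. \<Prod>j\<in>{i<..n}. z i - z j)"

definition det_fun :: "nat \<Rightarrow> (nat \<Rightarrow> nat \<Rightarrow> 'a::comm_ring_1) \<Rightarrow> 'a" where
  "det_fun n A = det (mat n n (\<lambda>(i, j). A (Suc i) (Suc j)))"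

text \<open>\<open>(x\<^sub>i\<parallel>a)\<^sup>r\<close>, which depends on the number \<open>n\<close> of variables.\<close>

definition xpow :: "nat \<Rightarrow> nat \<Rightarrow> nat \<Rightarrow> xpoly" where
  "xpow n i r = (\<Prod>t<r. xv i - xconst (av (int n - int t)))"

text \<open>The quotient of the determinant by the Vandermonde product.\<close>

definition dschur_poly :: "partition \<Rightarrow> nat \<Rightarrow> xpoly" where
  "dschur_poly \<kappa> n = (if plength \<kappa> > n then 0 else
     (THE p. p * vandermonde xv n = det_fun n (\<lambda>i j. xpow n i (part \<kappa> j + n - j))))"

definition dschur :: "partition \<Rightarrow> dsym" where
  "dschur \<kappa> = Abs_dsym (dschur_poly \<kappa>)"

definition dpow :: "nat \<Rightarrow> dsym" where
  "dpow k = Abs_dsym (\<lambda>n. \<Sum>i=1..n. xv i ^ k - xconst (av (int i)) ^ k)"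

definition dpow_part :: "partition \<Rightarrow> dsym" where
  "dpow_part \<mu> = (\<Prod>i | part \<mu> i \<noteq> 0. dpow (part \<mu> i))"

definition dcomplete :: "nat \<Rightarrow> dsym" where
  "dcomplete k = dschur (row_part k)"

definition dcomplete_part :: "partition \<Rightarrow> dsym" where
  "dcomplete_part \<mu> = (\<Prod>i | part \<mu> i \<noteq> 0. dcomplete (part \<mu> i))"

text \<open>Fillings are extended by \<open>undefined\<close> outside the shape, so that distinct functions
  are distinct fillings.\<close>

definition rev_tableaux :: "(nat \<times> nat) set \<Rightarrow> nat \<Rightarrow> (nat \<times> nat \<Rightarrow> nat) set" where
  "rev_tableaux \<theta> n = {T \<in> \<theta> \<rightarrow>\<^sub>E {1..n}.
     (\<forall>i j j'. (i, j) \<in> \<theta> \<and> (i, j') \<in> \<theta> \<and> j < j' \<longrightarrow> T (i, j) \<ge> T (i, j')) \<and>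
     (\<forall>i i' j. (i, j) \<in> \<theta> \<and> (i', j) \<in> \<theta> \<and> i < i' \<longrightarrow> T (i, j) > T (i', j))}"

definition tableaux :: "(nat \<times> nat) set \<Rightarrow> nat \<Rightarrow> (nat \<times> nat \<Rightarrow> nat) set" where
  "tableaux \<theta> n = {T \<in> \<theta> \<rightarrow>\<^sub>E {1..n}.
     (\<forall>i j j'. (i, j) \<in> \<theta> \<and> (i, j') \<in> \<theta> \<and> j < j' \<longrightarrow> T (i, j) \<le> T (i, j')) \<and>
     (\<forall>i i' j. (i, j) \<in> \<theta> \<and> (i', j) \<in> \<theta> \<and> i < i' \<longrightarrow> T (i, j) < T (i', j))}"

text \<open>\<open>\<tilde>s\<^sub>\<theta>(x\<parallel>a)\<close> and \<open>s\<^sub>\<theta>(-a\<^bsup>(n)\<^esup> | -a)\<close>.\<close>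

definition stilde :: "(nat \<times> nat) set \<Rightarrow> nat \<Rightarrow> xpoly" where
  "stilde \<theta> n = (\<Sum>T\<in>rev_tableaux \<theta> n.
     \<Prod>\<alpha>\<in>\<theta>. xv (T \<alpha>) - xconst (av (int (T \<alpha>) - content \<alpha>)))"

definition sneg :: "(nat \<times> nat) set \<Rightarrow> nat \<Rightarrow> qa" where
  "sneg \<theta> n = (\<Sum>T\<in>tableaux \<theta> n.
     \<Prod>\<alpha>\<in>\<theta>. - av (int (T \<alpha>)) + av (int (T \<alpha>) + content \<alpha>))"

definition dskew_poly :: "partition \<Rightarrow> partition \<Rightarrow> nat \<Rightarrow> xpoly" where
  "dskew_poly \<nu> \<mu> n = (\<Sum>\<rho> | part_le \<mu> \<rho> \<and> part_le \<rho> \<nu>.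
     stilde (diagram \<nu> - diagram \<rho>) n *
     xconst (sneg (diagram (conj_part \<rho>) - diagram (conj_part \<mu>)) n))"

definition dskew :: "partition \<Rightarrow> partition \<Rightarrow> dsym" where
  "dskew \<nu> \<mu> = Abs_dsym (dskew_poly \<nu> \<mu>)"


section \<open>Formal power series in \<open>y\<^sub>1, y\<^sub>2, \<dots>\<close>\<close>

typedef 'a yseries = "UNIV :: ((nat \<Rightarrow>\<^sub>0 nat) \<Rightarrow> 'a) set"
  morphisms ycoeff Abs_yseries ..

setup_lifting type_definition_yseries

lemma yseries_eqI: "(\<And>u. ycoeff F u = ycoeff G u) \<Longrightarrow> F = G"
  by transfer auto

definition splits :: "(nat \<Rightarrow>\<^sub>0 nat) \<Rightarrow> ((nat \<Rightarrow>\<^sub>0 nat) \<times> (nat \<Rightarrow>\<^sub>0 nat)) set" where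
  "splits w = {(u, v). u + v = w}"

lemma finite_splits: "finite (splits w)"
proof -
  let ?K = "Poly_Mapping.keys w"
  let ?B = "{f. \<forall>i. (i \<in> ?K \<longrightarrow> f i \<in> {..Max (insert 0 (Poly_Mapping.lookup w ` ?K))}) \<and>
                    (i \<notin> ?K \<longrightarrow> f i = 0)}"
  have le: "Poly_Mapping.lookup u i \<le> Poly_Mapping.lookup w i"
    "Poly_Mapping.lookup v i \<le> Poly_Mapping.lookup w i" if "(u, v) \<in> splits w" for u v i
    using that by (auto simp: splits_def lookup_add)
  have B: "f \<in> ?B" if "\<And>i. f i \<le> Poly_Mapping.lookup w i" for f
  proof -
    have "f i \<le> Max (insert 0 (Poly_Mapping.lookup w ` ?K))" if "i \<in> ?K" for i
      by (rule order_trans[OF \<open>f i \<le> _\<close>]) (use that in auto)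
    moreover have "f i = 0" if "i \<notin> ?K" for i
      using \<open>f i \<le> Poly_Mapping.lookup w i\<close> that by (simp add: in_keys_iff)
    ultimately show ?thesis by auto
  qed
  have fin: "finite ?B"
    by (rule finite_set_of_finite_funs) auto
  have "map_prod Poly_Mapping.lookup Poly_Mapping.lookup ` splits w \<subseteq> ?B \<times> ?B"
  proof (rule image_subsetI)
    fix p assume "p \<in> splits w"
    then show "map_prod Poly_Mapping.lookup Poly_Mapping.lookup p \<in> ?B \<times> ?B"
      unfolding mem_Times_iff fst_map_prod snd_map_prod
      by (intro conjI B) (cases p; simp add: le)+
  qed
  then have "finite (map_prod Poly_Mapping.lookup Poly_Mapping.lookup ` splits w)"
    by (rule finite_subset) (use fin in simp)
  moreover have "inj_on (map_prod Poly_Mapping.lookup Poly_Mapping.lookup) (splits w)"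
    by (auto simp: inj_on_def)
  ultimately show ?thesis
    by (rule finite_imageD)
qed

instantiation yseries :: (comm_ring_1) comm_ring_1
begin

lift_definition zero_yseries :: "'a yseries" is "\<lambda>_. 0" .
lift_definition one_yseries :: "'a yseries" is "\<lambda>u. if u = 0 then 1 else 0" .
lift_definition plus_yseries :: "'a yseries \<Rightarrow> 'a yseries \<Rightarrow> 'a yseries" is "\<lambda>F G u. F u + G u" .
lift_definition uminus_yseries :: "'a yseries \<Rightarrow> 'a yseries" is "\<lambda>F u. - F u" .
lift_definition minus_yseries :: "'a yseries \<Rightarrow> 'a yseries \<Rightarrow> 'a yseries" is "\<lambda>F G u. F u - G u" .
lift_definition times_yseries :: "'a yseries \<Rightarrow> 'a yseries \<Rightarrow> 'a yseries"
  is "\<lambda>F G w. \<Sum>(u, v)\<in>splits w. F u * G v" .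

instance
proof
  fix F G H :: "'a yseries"
  show "F * G * H = F * (G * H)"
  proof (rule yseries_eqI)
    fix w
    have "ycoeff (F * G * H) w =
        (\<Sum>(s, z)\<in>splits w. \<Sum>(u, v)\<in>splits s. ycoeff F u * ycoeff G v * ycoeff H z)"
      by (simp add: times_yseries.rep_eq sum_distrib_right case_prod_unfold)
    also have "\<dots> = (\<Sum>((s, z), (u, v))\<in>(SIGMA p:splits w. splits (fst p)).
        ycoeff F u * ycoeff G v * ycoeff H z)"
      by (simp add: sum.Sigma finite_splits case_prod_unfold)
    also have "\<dots> = (\<Sum>((u, t), (v, z))\<in>(SIGMA p:splits w. splits (snd p)).
        ycoeff F u * (ycoeff G v * ycoeff H z))"
      by (rule sum.reindex_bij_witness
          [of _ "\<lambda>((u, t), (v, z)). ((u + v, z), (u, v))" "\<lambda>((s, z), (u, v)). ((u, v + z), (v, z))"])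
        (auto simp: splits_def ac_simps)
    also have "\<dots> = (\<Sum>(u, t)\<in>splits w. \<Sum>(v, z)\<in>splits t. ycoeff F u * (ycoeff G v * ycoeff H z))"
      by (simp add: sum.Sigma finite_splits case_prod_unfold)
    also have "\<dots> = ycoeff (F * (G * H)) w"
      by (simp add: times_yseries.rep_eq sum_distrib_left case_prod_unfold)
    finally show "ycoeff (F * G * H) w = ycoeff (F * (G * H)) w" .
  qed
  show "F * G = G * F"
  proof (rule yseries_eqI)
    fix w
    show "ycoeff (F * G) w = ycoeff (G * F) w"
      unfolding times_yseries.rep_eq
      by (rule sum.reindex_bij_witness[of _ prod.swap prod.swap]) (auto simp: splits_def ac_simps)
  qed
  show "1 * F = F"
  proof (rule yseries_eqI)
    fix w
    have "ycoeff (1 * F) w = (\<Sum>(u, v)\<in>splits w. if u = 0 then ycoeff F v else 0)"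
      unfolding times_yseries.rep_eq one_yseries.rep_eq
      by (intro sum.cong refl) (simp add: case_prod_unfold)
    also have "\<dots> = (\<Sum>(u, v)\<in>{(0 :: nat \<Rightarrow>\<^sub>0 nat, w)}. if u = 0 then ycoeff F v else 0)"
      by (rule sum.mono_neutral_right[OF finite_splits]) (auto simp: splits_def split: if_splits)
    finally show "ycoeff (1 * F) w = ycoeff F w" by simp
  qed
  show "(F + G) * H = F * H + G * H"
    by (rule yseries_eqI)
      (simp add: times_yseries.rep_eq plus_yseries.rep_eq case_prod_unfold algebra_simps sum.distrib)
  show "(0 :: 'a yseries) \<noteq> 1"
    by (metis one_yseries.rep_eq zero_yseries.rep_eq zero_neq_one)
qed (transfer; simp add: fun_eq_iff algebra_simps)+

end

lift_definition yconst :: "'a::zero \<Rightarrow> 'a yseries" is "\<lambda>c u. if u = 0 then c else 0" .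

lift_definition yv :: "nat \<Rightarrow> 'a::zero_neq_one yseries"
  is "\<lambda>i u. if u = Poly_Mapping.single i 1 then 1 else 0" .

text \<open>The geometric series \<open>1 / (1 - c y\<^sub>i) = \<Sum>\<^sub>r c\<^sup>r y\<^sub>i\<^sup>r\<close>.\<close>

lift_definition ygeom :: "'a::comm_ring_1 \<Rightarrow> nat \<Rightarrow> 'a yseries"
  is "\<lambda>c i u. if Poly_Mapping.keys u \<subseteq> {i} then c ^ Poly_Mapping.lookup u i else 0" .

lemma ycoeff_mult_monom:
  assumes "\<And>u. u \<noteq> m \<Longrightarrow> ycoeff M u = 0"
  shows "ycoeff (M * F) (m + v) = ycoeff M m * ycoeff F v"
    and "(\<And>v. w \<noteq> m + v) \<Longrightarrow> ycoeff (M * F) w = 0"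
proof -
  have "ycoeff (M * F) (m + v) = (\<Sum>(u, v)\<in>{(m, v)}. ycoeff M u * ycoeff F v)"
    unfolding times_yseries.rep_eq
    by (rule sum.mono_neutral_right[OF finite_splits])
      (auto simp: splits_def, (metis assms add_left_cancel mult_zero_left)+)
  then show "ycoeff (M * F) (m + v) = ycoeff M m * ycoeff F v" by simp
  assume "\<And>v. w \<noteq> m + v"
  then show "ycoeff (M * F) w = 0"
    unfolding times_yseries.rep_eq
    by (intro sum.neutral) (auto simp: splits_def, metis assms mult_zero_left)
qed

lemma ygeom_inverse: "ygeom c i * (1 - yconst c * yv i) = 1"
proof -
  let ?e = "Poly_Mapping.single i (1::nat)"
  let ?M = "yconst c * yv i"
  have "ycoeff ?M u = (if u = ?e then c else 0)" for u
    using ycoeff_mult_monom(1)[where m = 0 and M = "yconst c" and F = "yv i" and v = u]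
    by (simp add: yconst.rep_eq yv.rep_eq)
  then have M: "ycoeff (?M * ygeom c i) (?e + v) = c * ycoeff (ygeom c i) v"
    "(\<And>v. w \<noteq> ?e + v) \<Longrightarrow> ycoeff (?M * ygeom c i) w = 0" for v w
    using ycoeff_mult_monom[where m = ?e and M = ?M and F = "ygeom c i"] by simp_all
  have "ygeom c i = 1 + ?M * ygeom c i"
  proof (rule yseries_eqI)
    fix w
    show "ycoeff (ygeom c i) w = ycoeff (1 + ?M * ygeom c i) w"
    proof (cases "\<exists>v. w = ?e + v")
      case True
      then obtain v where w: "w = ?e + v" by blast
      then have "w \<noteq> 0"
        by (metis add_eq_0_iff_both_eq_0 lookup_add lookup_single_eq lookup_zero zero_neq_one)
      moreover have "Poly_Mapping.keys w \<subseteq> {i} \<longleftrightarrow> Poly_Mapping.keys v \<subseteq> {i}"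
        by (auto simp: w subset_iff in_keys_iff lookup_add lookup_single when_def)
      ultimately show ?thesis
        using M(1)[of v]
        by (simp add: w plus_yseries.rep_eq one_yseries.rep_eq ygeom.rep_eq lookup_add)
    next
      case False
      have "Poly_Mapping.lookup w i = 0"
      proof (rule ccontr)
        assume "Poly_Mapping.lookup w i \<noteq> 0"
        then have "w = ?e + (w - ?e)"
          by (intro poly_mapping_eqI)
            (auto simp: lookup_add lookup_minus lookup_single when_def)
        with False show False by blast
      qed
      then have "Poly_Mapping.keys w \<subseteq> {i} \<longleftrightarrow> w = 0"
        by (auto simp: subset_iff in_keys_iff intro!: poly_mapping_eqI)
      with False \<open>Poly_Mapping.lookup w i = 0\<close> show ?thesis
        by (simp add: plus_yseries.rep_eq one_yseries.rep_eq ygeom.rep_eq M(2))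
    qed
  qed
  then show ?thesis
    by (simp add: algebra_simps)
qed

text \<open>A possibly infinite formal sum, coefficient by coefficient.\<close>

definition formal_sums :: "('i \<Rightarrow> 'a::comm_monoid_add yseries) \<Rightarrow> 'a yseries \<Rightarrow> bool" where
  "formal_sums f F \<longleftrightarrow> (\<forall>u. finite {i. ycoeff (f i) u \<noteq> 0} \<and>
     ycoeff F u = (\<Sum>i | ycoeff (f i) u \<noteq> 0. ycoeff (f i) u))"


section \<open>Dual Schur functions and dual monomial symmetric functions\<close>

text \<open>An element of \<open>\<Lambda>\<close>-hat \<open>(y\<parallel>a)\<close> is represented by its images in the
  rings of power series in \<open>y\<^sub>1, \<dots>, y\<^sub>n\<close>, \<open>n \<ge> 0\<close>, which determine it.\<close>

definition dual_schur :: "partition \<Rightarrow> nat \<Rightarrow> qa yseries" where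
  "dual_schur \<kappa> n = (if plength \<kappa> > n then 0 else
     (THE F. F * vandermonde yv n = det_fun n (\<lambda>i j.
        if j \<le> diag_len \<kappa>
        then yv i ^ (part \<kappa> j + n - j) *
               (\<Prod>k\<in>{int j - int (part \<kappa> j)..0}. ygeom (av k) i)
        else yv i ^ (part \<kappa> j + n - j) *
               (\<Prod>k\<in>{1..int j - int (part \<kappa> j) - 1}. 1 - yconst (av k) * yv i))))"

definition ypow :: "nat \<Rightarrow> nat \<Rightarrow> qa yseries" where
  "ypow i r = yv i ^ r * (\<Prod>k\<in>{1 - int r..0}. ygeom (av k) i)"

text \<open>Exponents of the monomials of \<open>m\<^sub>\<mu>(y\<^sub>1, \<dots>, y\<^sub>n)\<close>.\<close>

definition monomials :: "partition \<Rightarrow> nat \<Rightarrow> (nat \<Rightarrow>\<^sub>0 nat) set" where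
  "monomials \<mu> n = {u. Poly_Mapping.keys u \<subseteq> {1..n} \<and>
     image_mset (Poly_Mapping.lookup u) (mset_set (Poly_Mapping.keys u)) =
     image_mset (part \<mu>) (mset_set {i. part \<mu> i \<noteq> 0})}"

definition dual_monomial :: "partition \<Rightarrow> nat \<Rightarrow> qa yseries" where
  "dual_monomial \<mu> n = (\<Sum>u\<in>monomials \<mu> n.
     \<Prod>i\<in>Poly_Mapping.keys u. ypow i (Poly_Mapping.lookup u i))"


section \<open>The polynomials defined by expansions\<close>

definition dual_kostka :: "partition \<Rightarrow> partition \<Rightarrow> qa" where
  "dual_kostka \<kappa> = (THE K. \<forall>n.
     formal_sums (\<lambda>\<mu>. yconst (K \<mu>) * dual_monomial \<mu> n) (dual_schur \<kappa> n))"

definition schur_coeffs :: "dsym \<Rightarrow> partition \<Rightarrow> qa" where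
  "schur_coeffs P = (THE c. finite {\<kappa>. c \<kappa> \<noteq> 0} \<and> P = (\<Sum>\<kappa> | c \<kappa> \<noteq> 0. dscale (c \<kappa>) (dschur \<kappa>)))"

definition dchar :: "partition \<Rightarrow> partition \<Rightarrow> qa" where
  "dchar \<kappa> \<mu> = schur_coeffs (dpow_part \<mu>) \<kappa>"

definition lr_coeff :: "partition \<Rightarrow> partition \<Rightarrow> partition \<Rightarrow> qa" where
  "lr_coeff \<kappa> \<mu> \<nu> = schur_coeffs (dschur \<kappa> * dschur \<mu>) \<nu>"

definition comult :: "dsym \<Rightarrow> dtensor" where
  "comult = (THE D.
     (\<forall>P Q. D (P + Q) = D P + D Q) \<and> (\<forall>P Q. D (P * Q) = D P * D Q) \<and> D 1 = 1 \<and>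
     (\<forall>c P. D (dscale c P) = tscale c (D P)) \<and>
     (\<forall>k\<ge>1. D (dpow k) = tensor (dpow k) 1 + tensor 1 (dpow k)))"

definition dual_lr_coeff :: "partition \<Rightarrow> partition \<Rightarrow> partition \<Rightarrow> qa" where
  "dual_lr_coeff \<kappa> \<mu> \<nu> = (THE c :: partition \<times> partition \<Rightarrow> qa.
     finite {q. c q \<noteq> 0} \<and>
     comult (dschur \<nu>) =
       (\<Sum>q | c q \<noteq> 0. tscale (c q) (tensor (dschur (fst q)) (dschur (snd q))))) (\<kappa>, \<mu>)"

definition chain_sum :: "dsym \<Rightarrow> partition \<Rightarrow> partition \<Rightarrow> qa fract" where
  "chain_sum P \<mu> \<kappa> = (\<Sum>R\<in>chains \<mu> \<kappa>. \<Sum>k<length R.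
     to_fract (dval P (R ! k)) /
     (\<Prod>j\<in>{..<length R} - {k}. to_fract (adiff (R ! k) (R ! j))))"

end

theory Submission
  imports Defs
begin

text \<open>Since \<open>p\<^sub>1(x\<parallel>a)\<close> takes the value \<open>|a\<^sub>\<rho>|\<close> minus \<open>|a\<^sub>\<emptyset>|\<close> at \<open>a\<^sub>\<rho>\<close> and obeys the Pieri rule
  \<open>p\<^sub>1 s\<^sub>\<mu> = p\<^sub>1(a\<^sub>\<mu>) s\<^sub>\<mu> + \<Sum>\<^bsub>\<mu>\<rightarrow>\<nu>\<^esub> s\<^sub>\<nu>\<close>, multiplying \<open>P s\<^sub>\<mu>\<close> by \<open>p\<^sub>1\<close> gives a recursion for its
  coefficients at \<open>\<nu>\<close>. The sum over chains satisfies the same recursion, because the inner sums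
  are divided differences of \<open>\<rho> \<mapsto> P(a\<^sub>\<rho>)\<close>; so it is the coefficient of \<open>s\<^sub>\<nu>\<close> in \<open>P s\<^sub>\<mu>\<close>. This
  settles \<open>\<chi>\<close> and \<open>c\<close>. For the dual Kostka numbers, the Cauchy identity identifies them with the
  coefficients of \<open>h\<^sub>\<mu>\<close>. For the coproduct, the inverse pair of matrices of horizontal and
  vertical strips gives a branching rule that splits \<open>s\<^sub>\<nu>(x\<^sub>1, \<dots>, x\<^sub>N)\<close> into products of
  \<open>s\<^bsub>\<nu>/\<mu>\<^esub>(x\<^sub>1, \<dots>, x\<^sub>n)\<close> and \<open>s\<^sub>\<mu>(a\<^sub>1, \<dots>, a\<^sub>n, x\<^bsub>n+1\<^esub>, \<dots>, x\<^sub>N)\<close>, whence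
  \<open>\<Delta>(s\<^sub>\<nu>) = \<Sum>\<^sub>\<mu> s\<^bsub>\<nu>/\<mu>\<^esub> \<otimes> s\<^sub>\<mu>\<close>, and the coefficients are those of \<open>s\<^bsub>\<nu>/\<mu>\<^esub>\<close>.\<close>

text \<open>No linear system is solved to find a coefficient. In n variables, P times the
  Vandermonde product is expanded in products of Newton polynomials with nodes a_n, a_(n-1), ...,
  and the coefficient of s_\<kappa> sits at the exponents of its alternant; the functional
  \<open>ncoeff\<close> reads it off. Multiplication by x_i is triangular in the Newton basis with
  the nodes as eigenvalues, so multiplication by P is triangular on Schur functions with eigenvalues
  P(a_\<mu>). These are the initial values of the recursion. It determines the rest because
  |a_\<nu>| - |a_\<mu>|, a difference of eigenvalues of p_1, is nonzero for \<mu> \<noteq> \<nu>.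
  Applied coefficientwise to power series in y, \<open>ncoeff\<close> turns Cauchy's determinant
  into that of a dual Schur function. With some variables kept as parameters it proves uniqueness in
  branching formulas, which yields the symmetry of skew polynomials and shows that the evaluations
  separate tensors. A dual Schur function is 0 by definition in fewer variables than its length, so
  the matching vanishing of coefficients needs its own proof.\<close>

declare One_nat_def [simp del]

subsection \<open>Determinants and alternants\<close>

lemma sum_from_1: "sum g {1..n} = (\<Sum>k=0..<n. g (Suc k))"
  and prod_from_1: "prod h {1..n} = (\<Prod>k=0..<n. h (Suc k))"
  by (simp_all add: One_nat_def sum.atLeast1_atMost_eq prod.atLeast1_atMost_eq lessThan_atLeast0)

lemma det_fun_cong:
  assumes "\<And>i j. i \<in> {1..n} \<Longrightarrow> j \<in> {1..n} \<Longrightarrow> A i j = B i j"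
  shows "det_fun n A = det_fun n B"
  unfolding det_fun_def by (intro arg_cong[where f = det] cong_mat) (use assms in auto)

text \<open>The matrix inside \<open>det_fun\<close> is indexed from 0. Conjugating permutations by
  \<open>Suc\<close> gives the Leibniz sum over permutations of {1..n}, on which all later sign
  arguments rest.\<close>

lemma det_fun_leibniz:
  "det_fun n A = (\<Sum>p | p permutes {1..n}. of_int (sign p) * (\<Prod>i=1..n. A i (p i)))"
proof -
  have S: "bij_betw Suc {0..<n} {1..n}"
    by (rule bij_betwI[where g = "\<lambda>x. x - 1"]) auto
  have S': "bij_betw (\<lambda>x. x - 1) {1..n} {0..<n}"
    by (rule bij_betwI[where g = Suc]) auto
  have "det_fun n A = (\<Sum>p | p permutes {0..<n}.
      of_int (sign p) * (\<Prod>i=0..<n. mat n n (\<lambda>(i, j). A (Suc i) (Suc j)) $$ (i, p i)))"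
    unfolding det_fun_def by (subst det_def'[of _ n]) auto
  also have "\<dots> = (\<Sum>p | p permutes {0..<n}. of_int (sign p) * (\<Prod>i=0..<n. A (Suc i) (Suc (p i))))"
    by (intro sum.cong refl arg_cong2[where f = times] prod.cong) (auto dest: permutes_in_image)
  also have "\<dots> = (\<Sum>p | p permutes {1..n}. of_int (sign p) * (\<Prod>i=1..n. A i (p i)))"
  proof (rule sum.reindex_bij_witness
      [of _ "map_permutation {1..n} (\<lambda>x. x - 1)" "map_permutation {0..<n} Suc"])
    fix p assume "p \<in> {p. p permutes {0..<n}}"
    then have p: "p permutes {0..<n}" by simp
    show "map_permutation {1..n} (\<lambda>x. x - 1) (map_permutation {0..<n} Suc p) = p"
      by (rule map_permutation_compose_inv[OF S p]) simp
    show "map_permutation {0..<n} Suc p \<in> {p. p permutes {1..n}}"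
      using map_permutation_permutes[OF S p] by simp
    have "(\<Prod>i=1..n. A i (map_permutation {0..<n} Suc p i)) =
        (\<Prod>i=0..<n. A (Suc i) (map_permutation {0..<n} Suc p (Suc i)))"
      using prod.reindex_bij_betw[OF S, of "\<lambda>i. A i (map_permutation {0..<n} Suc p i)"] by simp
    then show "of_int (sign (map_permutation {0..<n} Suc p)) *
        (\<Prod>i=1..n. A i (map_permutation {0..<n} Suc p i)) =
        of_int (sign p) * (\<Prod>i=0..<n. A (Suc i) (Suc (p i)))"
      by (simp add: sign_map_permutation p map_permutation_apply)
  next
    fix p assume "p \<in> {p. p permutes {1..n}}"
    then have p: "p permutes {1..n}" by simp
    show "map_permutation {0..<n} Suc (map_permutation {1..n} (\<lambda>x. x - 1) p) = p"
      by (rule map_permutation_compose_inv[OF S' p]) simp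
    show "map_permutation {1..n} (\<lambda>x. x - 1) p \<in> {p. p permutes {0..<n}}"
      using map_permutation_permutes[OF S' p] by simp
  qed
  finally show ?thesis .
qed

lemma det_fun_transpose: "det_fun n (\<lambda>i j. A j i) = det_fun n A"
proof -
  have "mat n n (\<lambda>(i, j). A (Suc j) (Suc i)) = transpose_mat (mat n n (\<lambda>(i, j). A (Suc i) (Suc j)))"
    by (rule eq_matI) auto
  then show ?thesis
    unfolding det_fun_def by (simp add: det_transpose[of _ n])
qed

lemma det_fun_leibniz_col:
  "det_fun n A = (\<Sum>p | p permutes {1..n}. of_int (sign p) * (\<Prod>j=1..n. A (p j) j))"
  by (subst det_fun_transpose[symmetric], subst det_fun_leibniz) (rule refl)

lemma det_fun_permute_rows:
  assumes \<sigma>: "\<sigma> permutes {1..n}"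
  shows "det_fun n (\<lambda>i. A (\<sigma> i)) = of_int (sign \<sigma>) * det_fun n A"
proof -
  have "det_fun n (\<lambda>i. A (\<sigma> i)) =
      (\<Sum>p | p permutes {1..n}. of_int (sign (p \<circ> \<sigma>)) * (\<Prod>i=1..n. A (\<sigma> i) ((p \<circ> \<sigma>) i)))"
    unfolding det_fun_leibniz by (rule sum_permutations_compose_right[OF \<sigma>])
  also have "\<dots> = (\<Sum>p | p permutes {1..n}. of_int (sign \<sigma>) * (of_int (sign p) * (\<Prod>i=1..n. A i (p i))))"
  proof (rule sum.cong[OF refl])
    fix p assume "p \<in> {p. p permutes {1..n}}"
    then have "sign (p \<circ> \<sigma>) = sign p * sign \<sigma>"
      using \<sigma> by (intro sign_compose permutes_imp_permutation[of "{1..n}"]) auto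
    moreover have "(\<Prod>i=1..n. A (\<sigma> i) (p (\<sigma> i))) = (\<Prod>i=1..n. A i (p i))"
      using prod.permute[OF \<sigma>, of "\<lambda>i. A i (p i)"] by (simp add: o_def)
    ultimately show "of_int (sign (p \<circ> \<sigma>)) * (\<Prod>i=1..n. A (\<sigma> i) ((p \<circ> \<sigma>) i)) =
        of_int (sign \<sigma>) * (of_int (sign p) * (\<Prod>i=1..n. A i (p i)))"
      by (simp add: mult_ac)
  qed
  finally show ?thesis
    unfolding det_fun_leibniz by (simp add: sum_distrib_left)
qed

lemma det_fun_permute_cols:
  assumes "\<sigma> permutes {1..n}"
  shows "det_fun n (\<lambda>i j. A i (\<sigma> j)) = of_int (sign \<sigma>) * det_fun n A"
  using det_fun_permute_rows[OF assms, of "\<lambda>i j. A j i"]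
  by (simp add: det_fun_transpose[of n A] det_fun_transpose[of n "\<lambda>i j. A i (\<sigma> j)"])

lemma det_fun_identical_cols:
  assumes "j \<in> {1..n}" "k \<in> {1..n}" "j \<noteq> k" "\<And>i. i \<in> {1..n} \<Longrightarrow> A i j = A i k"
  shows "det_fun n A = 0"
  unfolding det_fun_def
proof (rule det_identical_columns[of _ n "j - 1" "k - 1"])
  show "col (mat n n (\<lambda>(i, j). A (Suc i) (Suc j))) (j - 1) =
      col (mat n n (\<lambda>(i, j). A (Suc i) (Suc j))) (k - 1)"
    by (rule eq_vecI) (use assms in auto)
qed (use assms in auto)

lemma det_fun_mult:
  "det_fun n (\<lambda>i j. \<Sum>k=1..n. A i k * B k j) = det_fun n A * det_fun n B"
proof -
  have "mat n n (\<lambda>(i, j). \<Sum>k=1..n. A (Suc i) k * B k (Suc j)) =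
      mat n n (\<lambda>(i, j). A (Suc i) (Suc j)) * mat n n (\<lambda>(i, j). B (Suc i) (Suc j))"
    by (rule eq_matI) (auto simp: scalar_prod_def sum_from_1)
  then show ?thesis
    unfolding det_fun_def by (simp add: det_mult[of _ n])
qed

lemma det_fun_upper_triangular:
  assumes "\<And>i j. i \<in> {1..n} \<Longrightarrow> j \<in> {1..n} \<Longrightarrow> j < i \<Longrightarrow> A i j = 0"
  shows "det_fun n A = (\<Prod>i=1..n. A i i)"
proof -
  have "det_fun n A = prod_list (diag_mat (mat n n (\<lambda>(i, j). A (Suc i) (Suc j))))"
    unfolding det_fun_def
    by (rule det_upper_triangular[of _ n]) (use assms in \<open>auto simp: upper_triangular_def\<close>)
  also have "\<dots> = (\<Prod>i\<in>{0..<n}. A (Suc i) (Suc i))"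
    by (simp add: diag_mat_def prod.list_conv_set_nth)
  also have "\<dots> = (\<Prod>i=1..n. A i i)"
    by (simp add: prod_from_1)
  finally show ?thesis .
qed

lemma det_fun_lower_triangular:
  assumes "\<And>i j. i \<in> {1..n} \<Longrightarrow> j \<in> {1..n} \<Longrightarrow> i < j \<Longrightarrow> A i j = 0"
  shows "det_fun n A = (\<Prod>i=1..n. A i i)"
  by (subst det_fun_transpose[symmetric], rule det_fun_upper_triangular) (use assms in auto)

lemma hom_det_fun:
  assumes "comm_ring_hom \<phi>"
  shows "\<phi> (det_fun n A) = det_fun n (\<lambda>i j. \<phi> (A i j))"
proof -
  interpret comm_ring_hom \<phi> by (rule assms)
  show ?thesis
    unfolding det_fun_leibniz by (simp add: hom_sum hom_mult hom_prod)
qed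

lemma hom_vandermonde:
  assumes "comm_ring_hom \<phi>"
  shows "\<phi> (vandermonde z n) = vandermonde (\<lambda>i. \<phi> (z i)) n"
proof -
  interpret comm_ring_hom \<phi> by (rule assms)
  show ?thesis
    unfolding vandermonde_def by (simp add: hom_prod hom_minus)
qed

lemma det_fun_scale_cols: "det_fun n (\<lambda>i j. c j * A i j) = (\<Prod>j=1..n. c j) * det_fun n A"
  unfolding det_fun_leibniz_col by (simp add: prod.distrib sum_distrib_left mult_ac)

lemma det_fun_scale_rows: "det_fun n (\<lambda>i j. c i * A i j) = (\<Prod>j=1..n. c j) * det_fun n A"
  unfolding det_fun_leibniz by (simp add: prod.distrib sum_distrib_left mult_ac)

lemma det_fun_sum_cols:
  assumes "\<And>j. j \<in> {1..n} \<Longrightarrow> finite (S j)"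
  shows "det_fun n (\<lambda>i j. \<Sum>r\<in>S j. F i j r) =
    (\<Sum>f\<in>PiE {1..n} S. det_fun n (\<lambda>i j. F i j (f j)))"
proof -
  have "det_fun n (\<lambda>i j. \<Sum>r\<in>S j. F i j r) = (\<Sum>p | p permutes {1..n}.
      of_int (sign p) * (\<Sum>f\<in>PiE {1..n} S. \<Prod>j=1..n. F (p j) j (f j)))"
    unfolding det_fun_leibniz_col
    by (intro sum.cong refl arg_cong2[where f = times] prod_sum_PiE) (use assms in auto)
  also have "\<dots> = (\<Sum>f\<in>PiE {1..n} S. \<Sum>p | p permutes {1..n}.
      of_int (sign p) * (\<Prod>j=1..n. F (p j) j (f j)))"
    by (subst sum.swap) (simp add: sum_distrib_left)
  finally show ?thesis
    unfolding det_fun_leibniz_col .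
qed

text \<open>In the Leibniz term of p, multiplying column j by z contributes the factor z (p j), and
  these factors add up to the full sum of z whatever p is. This is the source of the Pieri
  rule.\<close>

lemma det_fun_derivation:
  "(\<Sum>i=1..n. z i) * det_fun n A =
    (\<Sum>j=1..n. det_fun n (\<lambda>i k. if k = j then z i * A i k else A i k))"
proof -
  have *: "(\<Prod>k=1..n. if k = j then z (p k) * A (p k) k else A (p k) k) =
      z (p j) * (\<Prod>k=1..n. A (p k) k)" if "j \<in> {1..n}" for p :: "nat \<Rightarrow> nat" and j
    using that by (simp add: prod.remove[of _ j] mult_ac)
  have "(\<Sum>j=1..n. det_fun n (\<lambda>i k. if k = j then z i * A i k else A i k)) =
     (\<Sum>j=1..n. \<Sum>p | p permutes {1..n}. of_int (sign p) * (z (p j) * (\<Prod>k=1..n. A (p k) k)))"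
    unfolding det_fun_leibniz_col by (intro sum.cong refl) (simp add: *)
  also have "\<dots> = (\<Sum>p | p permutes {1..n}.
      (\<Sum>j=1..n. z (p j)) * (of_int (sign p) * (\<Prod>k=1..n. A (p k) k)))"
    by (subst sum.swap) (simp add: sum_distrib_right sum_distrib_left mult_ac)
  also have "\<dots> = (\<Sum>i=1..n. z i) * det_fun n A"
    unfolding det_fun_leibniz_col sum_distrib_left
  proof (intro sum.cong refl)
    fix p assume "p \<in> {p. p permutes {1..n}}"
    then show "(\<Sum>j=1..n. z (p j)) * (of_int (sign p) * (\<Prod>k=1..n. A (p k) k)) =
        (\<Sum>i=1..n. z i) * (of_int (sign p) * (\<Prod>k=1..n. A (p k) k))"
      using sum.permute[of p "{1..n}" z] by (simp add: o_def)
  qed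
  finally show ?thesis ..
qed

text \<open>The hypothesis factors the matrix A through the Newton polynomials with nodes z n, ...,
  z 1 evaluated at the nodes themselves. That matrix is triangular because its factor z i - z i is 0
  for k < i, and its diagonal multiplies to the Vandermonde product.\<close>

lemma det_fun_newton:
  assumes "\<And>i j. i \<in> {1..n} \<Longrightarrow> j \<in> {1..n} \<Longrightarrow>
    A i j = (\<Sum>k=1..n. (\<Prod>m\<in>{k<..n}. z i - z m) * D k j)"
  shows "det_fun n A = vandermonde z n * det_fun n D"
proof -
  have "det_fun n A = det_fun n (\<lambda>i k. \<Prod>m\<in>{k<..n}. z i - z m) * det_fun n D"
    by (subst det_fun_mult[symmetric], rule det_fun_cong) (rule assms)
  also have "det_fun n (\<lambda>i k. \<Prod>m\<in>{k<..n}. z i - z m) = vandermonde z n"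
    unfolding vandermonde_def
    by (rule det_fun_upper_triangular) (auto simp: prod_zero_iff intro!: prod_zero)
  finally show ?thesis .
qed

text \<open>The Newton basis with nodes c 0, c 1, ...; with c t = a_(n-t) it is the generalized
  power (x||a)^r.\<close>

definition npow :: "(nat \<Rightarrow> 'a::comm_ring_1) \<Rightarrow> 'a \<Rightarrow> nat \<Rightarrow> 'a" where
  "npow c x r = (\<Prod>t<r. x - c t)"

lemma npow_0 [simp]: "npow c x 0 = 1"
  by (simp add: npow_def)

lemma npow_Suc: "npow c x (Suc r) = npow c x r * (x - c r)"
  by (simp add: npow_def)

text \<open>The coefficient of \<open>\<Prod>\<^sub>m\<^sub>>\<^sub>k (x - z\<^sub>m)\<close> in the Newton interpolation of
  \<open>npow c x r\<close> at the nodes \<open>z\<^sub>n, \<dots>, z\<^sub>1\<close>.\<close>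

fun newt :: "nat \<Rightarrow> (nat \<Rightarrow> 'a::comm_ring_1) \<Rightarrow> (nat \<Rightarrow> 'a) \<Rightarrow> nat \<Rightarrow> nat \<Rightarrow> 'a" where
  "newt n z c 0 k = (if k = n then 1 else 0)"
| "newt n z c (Suc r) k = (if k < n then newt n z c r (Suc k) else 0) + (z k - c r) * newt n z c r k"

lemma newt_interpolation:
  assumes "i \<in> {1..n}"
  shows "npow c (z i) r = (\<Sum>k=1..n. (\<Prod>m\<in>{k<..n}. z i - z m) * newt n z c r k)"
proof (induction r)
  case 0
  have "(\<Sum>k=1..n. (\<Prod>m\<in>{k<..n}. z i - z m) * newt n z c 0 k) =
      (\<Sum>k=1..n. if k = n then 1 else 0)"
    by (intro sum.cong) auto
  then show ?case using assms by simp
next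
  case (Suc r)
  let ?N = "\<lambda>k. \<Prod>m\<in>{k<..n}. z i - z m"
  have N: "?N k * (z i - z k) = ?N (k - 1)" if "k \<in> {1..n}" for k
  proof -
    have "{k - 1<..n} = insert k {k<..n}" using that by auto
    then show ?thesis by (simp add: mult.commute)
  qed
  \<comment> \<open>The product over all nodes vanishes at the node z i, so the term k = 0 created
    by the index shift drops out.\<close>
  have N0: "?N 0 = 0"
    using assms by (intro prod_zero) (auto intro!: bexI[of _ i])
  have "(\<Sum>k=1..n. ?N (k - 1) * newt n z c r k) =
      (\<Sum>k=1..n. ?N k * (if k < n then newt n z c r (Suc k) else 0))"
  proof -
    have "(\<Sum>k=1..n. ?N (k - 1) * newt n z c r k) = (\<Sum>k\<in>{0..<n}. ?N k * newt n z c r (Suc k))"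
      by (subst sum_from_1) simp
    also have "\<dots> = (\<Sum>k\<in>{1..<n}. ?N k * newt n z c r (Suc k))"
      by (rule sum.mono_neutral_right) (use N0 in \<open>auto simp: not_le\<close>)
    also have "\<dots> = (\<Sum>k=1..n. ?N k * (if k < n then newt n z c r (Suc k) else 0))"
      by (rule sum.mono_neutral_cong_left) auto
    finally show ?thesis .
  qed
  \<comment> \<open>Write the new factor z i - c r as (z i - z k) + (z k - c r): the first part
    extends the Newton polynomial by one node, the second is a scalar. These are the two terms in
    the recursion of \<open>newt\<close>.\<close>
  moreover have "npow c (z i) (Suc r) = (\<Sum>k=1..n. (?N k * (z i - z k)) * newt n z c r k
      + ?N k * ((z k - c r) * newt n z c r k))"
    unfolding npow_Suc Suc.IH sum_distrib_right
    by (intro sum.cong refl) (simp add: algebra_simps)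
  ultimately show ?case
    by (simp add: N sum.distrib distrib_left)
qed

text \<open>As a divided difference of order n - k of a polynomial of degree r, \<open>newt\<close>
  vanishes for r < n - k and is 1 for r = n - k.\<close>

lemma newt_eq_0: "r < n - k \<Longrightarrow> newt n z c r k = 0"
  by (induction r arbitrary: k) auto

lemma newt_eq_1: "k \<le> n \<Longrightarrow> newt n z c (n - k) k = 1"
proof (induction "n - k" arbitrary: k)
  case (Suc d)
  then have "newt n z c (n - Suc k) (Suc k) = 1" "n - k = Suc (n - Suc k)"
    using Suc.hyps(1)[of "Suc k"] by auto
  then show ?case using newt_eq_0[of "n - Suc k" n k z c] Suc.hyps(2) by simp
qed auto

lemma hom_newt:
  assumes "comm_ring_hom \<phi>"
  shows "\<phi> (newt n z c r k) = newt n (\<lambda>i. \<phi> (z i)) (\<lambda>i. \<phi> (c i)) r k"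
proof -
  interpret comm_ring_hom \<phi> by (rule assms)
  show ?thesis
    by (induction r arbitrary: k) (auto simp: hom_add hom_mult hom_minus)
qed

definition alternant :: "nat \<Rightarrow> (nat \<Rightarrow> 'a::comm_ring_1) \<Rightarrow> (nat \<Rightarrow> 'a) \<Rightarrow> (nat \<Rightarrow> nat) \<Rightarrow> 'a" where
  "alternant n z c \<alpha> = det_fun n (\<lambda>i j. npow c (z i) (\<alpha> j))"

text \<open>The quotient of an alternant by the Vandermonde product, obtained without division. It
  therefore exists over every commutative ring and commutes with ring homomorphisms, including
  substitutions that make variables coincide, and its degree can be read off.\<close>

definition fschur :: "nat \<Rightarrow> (nat \<Rightarrow> 'a::comm_ring_1) \<Rightarrow> (nat \<Rightarrow> 'a) \<Rightarrow> (nat \<Rightarrow> nat) \<Rightarrow> 'a" where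
  "fschur n z c \<kappa> = det_fun n (\<lambda>k j. newt n z c (\<kappa> j + n - j) k)"

lemma fschur_vandermonde:
  "fschur n z c \<kappa> * vandermonde z n = alternant n z c (\<lambda>j. \<kappa> j + n - j)"
proof -
  have "alternant n z c (\<lambda>j. \<kappa> j + n - j) =
      vandermonde z n * det_fun n (\<lambda>k j. newt n z c (\<kappa> j + n - j) k)"
    unfolding alternant_def by (rule det_fun_newton, rule newt_interpolation) auto
  then show ?thesis by (simp add: fschur_def mult.commute)
qed

lemma fschur_empty: "fschur n z c (\<lambda>_. 0) = 1"
  unfolding fschur_def
proof (subst det_fun_lower_triangular)
  fix i j assume "i \<in> {1..n}" "j \<in> {1..n}" "i < j"
  then show "newt n z c (0 + n - j) i = 0" by (intro newt_eq_0) auto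
next
  show "(\<Prod>i=1..n. newt n z c (0 + n - i) i) = 1"
    by (intro prod.neutral ballI) (auto simp: newt_eq_1)
qed

text \<open>Since the nodes do not matter here, sign and congruence laws of alternants transfer to
  the Vandermonde product.\<close>

lemma alternant_empty: "alternant n z c (\<lambda>j. n - j) = vandermonde z n"
  using fschur_vandermonde[of n z c "\<lambda>_. 0"] by (simp add: fschur_empty)

lemma hom_npow:
  assumes "comm_ring_hom \<phi>"
  shows "\<phi> (npow c x r) = npow (\<lambda>i. \<phi> (c i)) (\<phi> x) r"
proof -
  interpret comm_ring_hom \<phi> by (rule assms)
  show ?thesis unfolding npow_def by (simp add: hom_prod hom_minus)
qed

lemma hom_fschur:
  assumes "comm_ring_hom \<phi>"
  shows "\<phi> (fschur n z c \<kappa>) = fschur n (\<lambda>i. \<phi> (z i)) (\<lambda>i. \<phi> (c i)) \<kappa>"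
  unfolding fschur_def hom_det_fun[OF assms] hom_newt[OF assms] ..

lemma alternant_permute:
  "\<sigma> permutes {1..n} \<Longrightarrow> alternant n (\<lambda>i. z (\<sigma> i)) c \<alpha> = of_int (sign \<sigma>) * alternant n z c \<alpha>"
  unfolding alternant_def by (rule det_fun_permute_rows)

lemma vandermonde_permute:
  "\<sigma> permutes {1..n} \<Longrightarrow> vandermonde (\<lambda>i. z (\<sigma> i)) n = of_int (sign \<sigma>) * vandermonde z n"
  unfolding alternant_empty[where c = "\<lambda>_. 0", symmetric] by (rule alternant_permute)

lemma alternant_cong:
  assumes "\<And>i. i \<in> {1..n} \<Longrightarrow> z i = z' i" "\<And>i. i \<in> {1..n} \<Longrightarrow> \<alpha> i = \<alpha>' i"
  shows "alternant n z c \<alpha> = alternant n z' c \<alpha>'"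
  unfolding alternant_def by (rule det_fun_cong) (simp add: assms)

lemma vandermonde_cong:
  assumes "\<And>i. i \<in> {1..n} \<Longrightarrow> z i = z' i"
  shows "vandermonde z n = vandermonde z' n"
  unfolding alternant_empty[where c = "\<lambda>_. 0", symmetric] using assms by (rule alternant_cong) auto

lemma vandermonde_nonzero:
  fixes z :: "nat \<Rightarrow> 'a::idom"
  assumes "inj_on z {1..n}"
  shows "vandermonde z n \<noteq> 0"
  unfolding vandermonde_def using assms by (fastforce simp: prod_zero_iff inj_on_def)


subsection \<open>Polynomials\<close>

lemma comm_ring_hom_poly_subst:
  fixes \<phi> :: "'c::comm_ring_1 \<Rightarrow> 'b::comm_ring_1"
  assumes "comm_ring_hom \<phi>"
  shows "comm_ring_hom (poly_subst \<phi> f)"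
proof -
  interpret comm_ring_hom \<phi> by (rule assms)
  have "poly_subst \<phi> f 1 = 1"
    using poly_subst_single[of \<phi> f 0 1] by simp
  then show ?thesis
    by unfold_locales (simp_all add: poly_subst_add poly_subst_mult hom_add hom_mult)
qed

lemma comm_ring_hom_id: "comm_ring_hom (id :: 'c::comm_ring_1 \<Rightarrow> 'c)"
  by unfold_locales auto

lemma comm_ring_hom_xconst: "comm_ring_hom xconst"
  by unfold_locales auto

lemmas comm_ring_hom_xsubst = comm_ring_hom_poly_subst[OF comm_ring_hom_xconst]
lemmas comm_ring_hom_eval = comm_ring_hom_poly_subst[OF comm_ring_hom_id]

interpretation xconst: comm_ring_hom xconst
  by (rule comm_ring_hom_xconst)

interpretation xsubst: comm_ring_hom "xsubst f" for f
  by (rule comm_ring_hom_xsubst)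

interpretation eval: comm_ring_hom "poly_subst id f" for f :: "'v \<Rightarrow> 'b::comm_ring_1"
  by (rule comm_ring_hom_eval)

lemma poly_subst_xv [simp]: "\<phi> 0 = 0 \<Longrightarrow> \<phi> 1 = 1 \<Longrightarrow> poly_subst \<phi> f (xv i) = f i"
  by (simp add: xv_def poly_subst_single monom_val_def)

lemma poly_subst_xconst [simp]: "\<phi> 0 = 0 \<Longrightarrow> poly_subst \<phi> f (xconst c) = \<phi> c"
  by (simp add: xconst_def poly_subst_single)

lemma lookup_xconst: "Poly_Mapping.lookup (xconst c) u = (if u = 0 then c else 0)"
  by (simp add: xconst_def lookup_single when_def)

lemma xconst_inject [simp]: "xconst c = xconst d \<longleftrightarrow> c = d"
  by (metis lookup_xconst)

lemma xconst_eq_0_iff [simp]: "xconst c = 0 \<longleftrightarrow> c = 0"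
  using xconst_inject[of c 0] by simp

lemma xconst_mult_single: "xconst c * Poly_Mapping.single u d = Poly_Mapping.single u (c * d)"
  by (simp add: xconst_def mult_single)

lemma xv_mult_single: "xv i * Poly_Mapping.single u c = Poly_Mapping.single (Poly_Mapping.single i 1 + u) c"
  by (simp add: xv_def mult_single)

lemma inj_xv: "inj_on xv A"
  by (rule inj_onI) (metis xv_def lookup_single_eq lookup_single_not_eq zero_neq_one)

section \<open>Variables and degrees of polynomials\<close>

definition xin :: "nat set \<Rightarrow> xpoly \<Rightarrow> bool" where
  "xin S p \<longleftrightarrow> (\<forall>u\<in>Poly_Mapping.keys p. Poly_Mapping.keys u \<subseteq> S)"

definition xbound :: "nat set \<Rightarrow> nat \<Rightarrow> xpoly \<Rightarrow> bool" where
  "xbound S d p \<longleftrightarrow> xin S p \<and> (\<forall>u\<in>Poly_Mapping.keys p. mdeg u \<le> d)"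

text \<open>A monomial is reached from a constant by multiplying by one variable at a time. The rule
  thus suits maps for which only the effect of multiplying by a single variable is known, such as
  \<open>ncoeff\<close>.\<close>

lemma xpoly_induct [consumes 1, case_names const add var]:
  assumes p: "xin S p"
    and const: "\<And>c. P (xconst c)"
    and add: "\<And>p q. P p \<Longrightarrow> P q \<Longrightarrow> P (p + q)"
    and var: "\<And>i p. i \<in> S \<Longrightarrow> P p \<Longrightarrow> P (xv i * p)"
  shows "P p"
proof -
  have single: "P (Poly_Mapping.single u c)" if "Poly_Mapping.keys u \<subseteq> S" for u c
    using that
  proof (induction "mdeg u" arbitrary: u rule: less_induct)
    case (less u)
    show ?case
    proof (cases "Poly_Mapping.keys u = {}")
      case True
      then show ?thesis using const[of c] by (simp add: xconst_def)
    next
      case False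
      then obtain i where i: "i \<in> Poly_Mapping.keys u" by blast
      define v where "v = u - Poly_Mapping.single i 1"
      have u: "u = Poly_Mapping.single i 1 + v"
        using i by (intro poly_mapping_eqI)
          (auto simp: v_def lookup_add lookup_minus lookup_single when_def in_keys_iff)
      have "Poly_Mapping.keys v \<subseteq> Poly_Mapping.keys u"
        by (auto simp: v_def in_keys_iff lookup_minus)
      moreover have "mdeg v < mdeg u"
        by (subst u) (simp add: mdeg_add, simp add: mdeg_def)
      ultimately have "P (Poly_Mapping.single v c)"
        using less by blast
      then have "P (xv i * Poly_Mapping.single v c)"
        using i less.prems by (intro var) auto
      then show ?thesis by (simp add: xv_mult_single u[symmetric])
    qed
  qed
  have "P (\<Sum>u\<in>A. Poly_Mapping.single u (Poly_Mapping.lookup p u))"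
    if "finite A" "A \<subseteq> Poly_Mapping.keys p" for A
    using that
  proof (induction A rule: finite_induct)
    case empty
    then show ?case using const[of 0] by simp
  next
    case (insert u A)
    then show ?case using p by (auto simp: xin_def intro!: add single)
  qed
  then show ?thesis
    by (subst poly_sum_single) auto
qed

lemma xin_const [simp, intro]: "xin S (xconst c)"
  by (cases "c = 0") (auto simp: xin_def xconst_def)

lemma xin_xv [intro]: "i \<in> S \<Longrightarrow> xin S (xv i)"
  by (auto simp: xin_def xv_def)

lemma xin_add [intro]: "xin S p \<Longrightarrow> xin S q \<Longrightarrow> xin S (p + q)"
  using Poly_Mapping.keys_add[of p q] by (auto simp: xin_def)

lemma xin_mult [intro]: "xin S p \<Longrightarrow> xin S q \<Longrightarrow> xin S (p * q)"
  unfolding xin_def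
proof (intro ballI)
  fix u assume p: "\<forall>u\<in>Poly_Mapping.keys p. Poly_Mapping.keys u \<subseteq> S"
    and q: "\<forall>u\<in>Poly_Mapping.keys q. Poly_Mapping.keys u \<subseteq> S"
    and "u \<in> Poly_Mapping.keys (p * q)"
  then obtain v w where "u = v + w" "v \<in> Poly_Mapping.keys p" "w \<in> Poly_Mapping.keys q"
    using keys_mult[of p q] by blast
  then show "Poly_Mapping.keys u \<subseteq> S"
    using p q Poly_Mapping.keys_add[of v w] by blast
qed

lemma xin_uminus [intro]: "xin S p \<Longrightarrow> xin S (- p)"
  by (auto simp: xin_def in_keys_iff)

lemma xin_diff [intro]: "xin S p \<Longrightarrow> xin S q \<Longrightarrow> xin S (p - q)"
  using xin_add[of S p "- q"] by auto

lemma xin_0 [simp]: "xin S 0" and xin_1 [simp]: "xin S 1"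
  using xin_const[of S 0] xin_const[of S 1] by auto

lemma xin_sum [intro]: "(\<And>i. i \<in> A \<Longrightarrow> xin S (f i)) \<Longrightarrow> xin S (\<Sum>i\<in>A. f i)"
  by (induction A rule: infinite_finite_induct) auto

lemma xin_prod [intro]: "(\<And>i. i \<in> A \<Longrightarrow> xin S (f i)) \<Longrightarrow> xin S (\<Prod>i\<in>A. f i)"
  by (induction A rule: infinite_finite_induct) auto

lemma xin_power [intro]: "xin S p \<Longrightarrow> xin S (p ^ k)"
  by (induction k) auto

lemma xin_of_int [simp]: "xin S (of_int k)"
proof -
  have "xconst (of_int k) = (of_int k :: xpoly)" by (rule xconst.hom_of_int)
  then show ?thesis using xin_const[of S "of_int k"] by simp
qed

lemma xin_UNIV [simp]: "xin UNIV p"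
  by (simp add: xin_def)

lemma xbound_mono: "xbound S d p \<Longrightarrow> d \<le> e \<Longrightarrow> xbound S e p"
  by (force simp: xbound_def)

lemma xbound_const [simp, intro]: "xbound S d (xconst c)"
  by (cases "c = 0") (auto simp: xbound_def xin_def xconst_def mdeg_def)

lemma xbound_xv: "i \<in> S \<Longrightarrow> d \<ge> 1 \<Longrightarrow> xbound S d (xv i)"
  by (auto simp: xbound_def xv_def xin_def mdeg_def)

lemma xbound_add [intro]: "xbound S d p \<Longrightarrow> xbound S d q \<Longrightarrow> xbound S d (p + q)"
  using Poly_Mapping.keys_add[of p q] by (auto simp: xbound_def)

lemma xbound_mult:
  assumes "xbound S d p" "xbound S e q"
  shows "xbound S (d + e) (p * q)"
  unfolding xbound_def
proof (intro conjI ballI)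
  fix u assume "u \<in> Poly_Mapping.keys (p * q)"
  then obtain v w where "u = v + w" "v \<in> Poly_Mapping.keys p" "w \<in> Poly_Mapping.keys q"
    using keys_mult[of p q] by blast
  then show "mdeg u \<le> d + e"
    using assms by (auto simp: xbound_def mdeg_add intro: add_mono)
qed (use assms in \<open>auto simp: xbound_def\<close>)

lemma xbound_uminus [intro]: "xbound S d p \<Longrightarrow> xbound S d (- p)"
  by (auto simp: xbound_def)

lemma xbound_diff [intro]: "xbound S d p \<Longrightarrow> xbound S d q \<Longrightarrow> xbound S d (p - q)"
  using xbound_add[of S d p "- q"] by auto

lemma xbound_0 [simp]: "xbound S d 0" and xbound_1 [simp]: "xbound S d 1"
  using xbound_const[of S d 0] xbound_const[of S d 1] by auto

lemma xbound_sum [intro]: "(\<And>i. i \<in> A \<Longrightarrow> xbound S d (f i)) \<Longrightarrow> xbound S d (\<Sum>i\<in>A. f i)"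
  by (induction A rule: infinite_finite_induct) auto

lemma xbound_prod:
  "(\<And>i. i \<in> A \<Longrightarrow> xbound S (d i) (f i)) \<Longrightarrow> xbound S (\<Sum>i\<in>A. d i) (\<Prod>i\<in>A. f i)"
  by (induction A rule: infinite_finite_induct) (auto intro: xbound_mult)

lemma xbound_const_mult: "xbound S d p \<Longrightarrow> xbound S d (xconst c * p)"
  using xbound_mult[of S 0 "xconst c" d p] by auto

lemma xbound_of_int_mult: "xbound S d p \<Longrightarrow> xbound S d (of_int k * p)"
  using xbound_const_mult[of S d p "of_int k"] by (simp add: xconst.hom_of_int)

lemma xbound_power: "xbound S d p \<Longrightarrow> xbound S (k * d) (p ^ k)"
  by (induction k) (auto intro: xbound_mult)

lemma xin_npow [intro]: "i \<in> S \<Longrightarrow> xin S (npow (\<lambda>t. xconst (c t)) (xv i) r)"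
  unfolding npow_def by auto

lemma xin_vandermonde:
  assumes "\<And>i. i \<in> {1..n} \<Longrightarrow> z i \<in> S"
  shows "xin S (vandermonde (\<lambda>i. xv (z i)) n)"
  unfolding vandermonde_def by (intro xin_prod xin_diff xin_xv assms) auto

text \<open>The divided difference of order n - k lowers the degree r by n - k. Where the truncated
  subtraction would lie, for r < n - k, the polynomial is 0.\<close>

lemma xbound_newt:
  assumes "\<And>i. i \<in> {1..n} \<Longrightarrow> z i \<in> S" "k \<in> {1..n}"
  shows "xbound S (r - (n - k)) (newt n (\<lambda>i. xv (z i)) (\<lambda>t. xconst (c t)) r k)"
  using assms(2)
proof (induction r arbitrary: k)
  case (Suc r)
  let ?N = "newt n (\<lambda>i. xv (z i)) (\<lambda>t. xconst (c t))"
  have 1: "xbound S (Suc r - (n - k)) (if k < n then ?N r (Suc k) else 0)"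
    using Suc.IH[of "Suc k"] Suc.prems by (auto elim!: xbound_mono)
  have 2: "xbound S (Suc r - (n - k)) ((xv (z k) - xconst (c r)) * ?N r k)"
  proof (cases "r < n - k")
    case True
    then show ?thesis by (simp add: newt_eq_0)
  next
    case False
    have "xbound S (1 + (r - (n - k))) ((xv (z k) - xconst (c r)) * ?N r k)"
      using Suc assms(1) by (intro xbound_mult xbound_diff xbound_xv) auto
    then show ?thesis using False by (auto elim: xbound_mono)
  qed
  from xbound_add[OF 1 2] show ?case by simp
qed auto

text \<open>In the Leibniz term of p the degrees add up to the sum of \<kappa> j + n - j minus the
  sum of n - p j. The two sums of n - j cancel because p permutes the indices. Terms in which a
  truncated subtraction would occur contain a zero factor.\<close>

lemma xbound_fschur:
  assumes "\<And>i. i \<in> {1..n} \<Longrightarrow> z i \<in> S"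
  shows "xbound S (\<Sum>i=1..n. \<kappa> i) (fschur n (\<lambda>i. xv (z i)) (\<lambda>t. xconst (c t)) \<kappa>)"
  unfolding fschur_def det_fun_leibniz_col
proof (intro xbound_sum xbound_of_int_mult)
  fix p assume "p \<in> {p. p permutes {1..n}}"
  then have p: "p permutes {1..n}" by simp
  let ?N = "newt n (\<lambda>i. xv (z i)) (\<lambda>t. xconst (c t))"
  have pin: "p j \<in> {1..n}" if "j \<in> {1..n}" for j
    using permutes_in_image[OF p] that by blast
  show "xbound S (\<Sum>i=1..n. \<kappa> i) (\<Prod>j=1..n. ?N (\<kappa> j + n - j) (p j))"
  proof (cases "\<exists>j\<in>{1..n}. \<kappa> j + n - j < n - p j")
    case True
    then have "(\<Prod>j=1..n. ?N (\<kappa> j + n - j) (p j)) = 0"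
      by (intro prod_zero) (auto intro: newt_eq_0)
    then show ?thesis by (simp only: xbound_0)
  next
    case False
    have "xbound S (\<Sum>j=1..n. \<kappa> j + n - j - (n - p j)) (\<Prod>j=1..n. ?N (\<kappa> j + n - j) (p j))"
      by (intro xbound_prod xbound_newt assms pin)
    also have "(\<Sum>j=1..n. \<kappa> j + n - j - (n - p j)) =
        (\<Sum>j=1..n. \<kappa> j + (n - j)) - (\<Sum>j=1..n. n - p j)"
      using False by (subst sum_subtractf_nat[symmetric]) (auto simp: not_less intro!: sum.cong)
    also have "(\<Sum>j=1..n. n - p j) = (\<Sum>j=1..n. n - j)"
      using sum.permute[OF p, of "\<lambda>j. n - j"] by (simp add: o_def)
    finally have "xbound S ((\<Sum>j=1..n. \<kappa> j + (n - j)) - (\<Sum>j=1..n. n - j))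
        (\<Prod>j=1..n. ?N (\<kappa> j + n - j) (p j))" .
    then show ?thesis unfolding sum.distrib by simp
  qed
qed

lemma xpoly_hom_eqI:
  fixes \<phi> \<psi> :: "xpoly \<Rightarrow> 'b::comm_ring_1"
  assumes "comm_ring_hom \<phi>" "comm_ring_hom \<psi>" "xin S p"
    and "\<And>c. \<phi> (xconst c) = \<psi> (xconst c)" "\<And>i. i \<in> S \<Longrightarrow> \<phi> (xv i) = \<psi> (xv i)"
  shows "\<phi> p = \<psi> p"
proof -
  interpret \<phi>: comm_ring_hom \<phi> by (rule assms)
  interpret \<psi>: comm_ring_hom \<psi> by (rule assms)
  show ?thesis
    using assms(3) by (induction rule: xpoly_induct)
      (simp_all add: assms \<phi>.hom_add \<psi>.hom_add \<phi>.hom_mult \<psi>.hom_mult)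
qed

lemma poly_subst_cong:
  fixes f g :: "nat \<Rightarrow> 'b::comm_ring_1"
  assumes "comm_ring_hom \<phi>" "xin S p" "\<And>i. i \<in> S \<Longrightarrow> f i = g i"
  shows "poly_subst \<phi> f p = poly_subst \<phi> g p"
proof -
  interpret comm_ring_hom \<phi> by (rule assms)
  show ?thesis
    by (rule xpoly_hom_eqI[OF comm_ring_hom_poly_subst[OF assms(1)]
      comm_ring_hom_poly_subst[OF assms(1)] assms(2)]) (simp_all add: assms)
qed

lemma xsubst_id [simp]: "xsubst xv p = p"
  by (rule xpoly_hom_eqI[OF comm_ring_hom_xsubst _ xin_UNIV]) (auto intro!: comm_ring_hom_id[unfolded id_def])

lemma xsubst_fix: "xin S p \<Longrightarrow> (\<And>i. i \<in> S \<Longrightarrow> f i = xv i) \<Longrightarrow> xsubst f p = p"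
  using poly_subst_cong[OF comm_ring_hom_xconst, of S p f xv] by simp

lemma xin_xsubst:
  assumes "xin S p" "\<And>i. i \<in> S \<Longrightarrow> xin T (f i)"
  shows "xin T (xsubst f p)"
  using assms(1) by (induction rule: xpoly_induct) (auto intro: assms(2))


subsection \<open>Coefficients with respect to Newton bases\<close>

text \<open>\<open>nexp c k r\<close> is the coefficient of \<open>npow c x r\<close> in \<open>x\<^sup>k\<close>.\<close>

fun nexp :: "(nat \<Rightarrow> 'a::comm_ring_1) \<Rightarrow> nat \<Rightarrow> nat \<Rightarrow> 'a" where
  "nexp c 0 r = (if r = 0 then 1 else 0)"
| "nexp c (Suc k) r = (if r = 0 then 0 else nexp c k (r - 1)) + c r * nexp c k r"

text \<open>The coefficient of \<open>\<Prod>\<^sub>i\<^sub>\<in>\<^sub>S npow c (x\<^sub>i) (\<alpha> i)\<close>, with \<open>h i\<close> substituted for the variables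
  \<open>x\<^sub>i\<close>, \<open>i \<notin> S\<close>, and \<open>\<phi>\<close> applied to the constants.\<close>

definition ncoeff :: "(qa \<Rightarrow> 'b::comm_ring_1) \<Rightarrow> (nat \<Rightarrow> 'b) \<Rightarrow> (nat \<Rightarrow> qa) \<Rightarrow> nat set \<Rightarrow>
    (nat \<Rightarrow> nat) \<Rightarrow> xpoly \<Rightarrow> 'b" where
  "ncoeff \<phi> h c S \<alpha> p = (\<Sum>u\<in>Poly_Mapping.keys p. \<phi> (Poly_Mapping.lookup p u) *
     ((\<Prod>i\<in>S. \<phi> (nexp c (Poly_Mapping.lookup u i) (\<alpha> i))) *
      (\<Prod>i\<in>Poly_Mapping.keys u - S. h i ^ Poly_Mapping.lookup u i)))"

context
  fixes \<phi> :: "qa \<Rightarrow> 'b::comm_ring_1" and h :: "nat \<Rightarrow> 'b" and c :: "nat \<Rightarrow> qa" and S :: "nat set"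
  assumes \<phi>: "comm_ring_hom \<phi>" and S: "finite S"
begin

interpretation \<phi>: comm_ring_hom \<phi> by (rule \<phi>)

lemma ncoeff_superset:
  assumes "finite K" "Poly_Mapping.keys p \<subseteq> K"
  shows "ncoeff \<phi> h c S \<alpha> p = (\<Sum>u\<in>K. \<phi> (Poly_Mapping.lookup p u) *
     ((\<Prod>i\<in>S. \<phi> (nexp c (Poly_Mapping.lookup u i) (\<alpha> i))) *
      (\<Prod>i\<in>Poly_Mapping.keys u - S. h i ^ Poly_Mapping.lookup u i)))"
  unfolding ncoeff_def
  by (rule sum.mono_neutral_left) (use assms in \<open>auto simp: in_keys_iff\<close>)

lemma ncoeff_add: "ncoeff \<phi> h c S \<alpha> (p + q) = ncoeff \<phi> h c S \<alpha> p + ncoeff \<phi> h c S \<alpha> q"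
  using Poly_Mapping.keys_add[of p q]
  by (simp add: ncoeff_superset[of "Poly_Mapping.keys p \<union> Poly_Mapping.keys q"]
      lookup_add \<phi>.hom_add distrib_right sum.distrib)

lemma ncoeff_0 [simp]: "ncoeff \<phi> h c S \<alpha> 0 = 0"
  by (simp add: ncoeff_def)

lemma ncoeff_sum: "ncoeff \<phi> h c S \<alpha> (\<Sum>i\<in>A. f i) = (\<Sum>i\<in>A. ncoeff \<phi> h c S \<alpha> (f i))"
  by (induction A rule: infinite_finite_induct) (simp_all add: ncoeff_add)

lemma ncoeff_single: "ncoeff \<phi> h c S \<alpha> (Poly_Mapping.single u d) = \<phi> d *
    ((\<Prod>i\<in>S. \<phi> (nexp c (Poly_Mapping.lookup u i) (\<alpha> i))) *
     (\<Prod>i\<in>Poly_Mapping.keys u - S. h i ^ Poly_Mapping.lookup u i))"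
  by (cases "d = 0") (simp_all add: ncoeff_def)

lemma ncoeff_const_mult: "ncoeff \<phi> h c S \<alpha> (xconst d * p) = \<phi> d * ncoeff \<phi> h c S \<alpha> p"
proof -
  have "xconst d * p = (\<Sum>u\<in>Poly_Mapping.keys p. Poly_Mapping.single u (d * Poly_Mapping.lookup p u))"
    by (subst poly_sum_single[of p]) (simp add: sum_distrib_left xconst_mult_single)
  then have "ncoeff \<phi> h c S \<alpha> (xconst d * p) = (\<Sum>u\<in>Poly_Mapping.keys p.
      ncoeff \<phi> h c S \<alpha> (Poly_Mapping.single u (d * Poly_Mapping.lookup p u)))"
    by (simp only: ncoeff_sum)
  also have "\<dots> = (\<Sum>u\<in>Poly_Mapping.keys p. \<phi> d * (\<phi> (Poly_Mapping.lookup p u) *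
     ((\<Prod>i\<in>S. \<phi> (nexp c (Poly_Mapping.lookup u i) (\<alpha> i))) *
      (\<Prod>i\<in>Poly_Mapping.keys u - S. h i ^ Poly_Mapping.lookup u i))))"
    by (simp only: ncoeff_single \<phi>.hom_mult mult.assoc)
  finally show ?thesis
    by (simp add: ncoeff_def sum_distrib_left)
qed

lemma ncoeff_of_int_mult: "ncoeff \<phi> h c S \<alpha> (of_int k * p) = of_int k * ncoeff \<phi> h c S \<alpha> p"
  using ncoeff_const_mult[of \<alpha> "of_int k" p] by (simp add: xconst.hom_of_int \<phi>.hom_of_int)

lemma ncoeff_uminus: "ncoeff \<phi> h c S \<alpha> (- p) = - ncoeff \<phi> h c S \<alpha> p"
  using ncoeff_of_int_mult[of \<alpha> "- 1" p] by simp

lemma ncoeff_diff: "ncoeff \<phi> h c S \<alpha> (p - q) = ncoeff \<phi> h c S \<alpha> p - ncoeff \<phi> h c S \<alpha> q"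
  using ncoeff_add[of \<alpha> p "- q"] by (simp add: ncoeff_uminus)

lemma ncoeff_1: "ncoeff \<phi> h c S \<alpha> 1 = (if \<forall>i\<in>S. \<alpha> i = 0 then 1 else 0)"
proof -
  have "ncoeff \<phi> h c S \<alpha> 1 = (\<Prod>i\<in>S. if \<alpha> i = 0 then 1 else 0)"
    using ncoeff_single[of \<alpha> 0 1] by (auto intro: prod.cong)
  also have "\<dots> = (if \<forall>i\<in>S. \<alpha> i = 0 then 1 else 0)"
  proof (cases "\<forall>i\<in>S. \<alpha> i = 0")
    case False
    then have "(\<Prod>i\<in>S. if \<alpha> i = 0 then 1 else (0::'b)) = 0"
      using S by (intro prod_zero) auto
    then show ?thesis using False by simp
  qed simp
  finally show ?thesis .
qed

text \<open>Dual to the rule x (x - c 0) ... (x - c (r-1)) =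
  \<open>npow c x (Suc r) + c r * npow c x r\<close>.\<close>

lemma ncoeff_var_mult:
  assumes i: "i \<in> S"
  shows "ncoeff \<phi> h c S \<alpha> (xv i * p) =
    (if \<alpha> i = 0 then 0 else ncoeff \<phi> h c S (\<alpha>(i := \<alpha> i - 1)) p) + \<phi> (c (\<alpha> i)) * ncoeff \<phi> h c S \<alpha> p"
proof -
  let ?E = "\<lambda>\<alpha> u. (\<Prod>i\<in>S. \<phi> (nexp c (Poly_Mapping.lookup u i) (\<alpha> i)))"
  let ?h = "\<lambda>u. \<Prod>i\<in>Poly_Mapping.keys u - S. h i ^ Poly_Mapping.lookup u i"
  have h: "?h (Poly_Mapping.single i 1 + u) = ?h u" for u
  proof (rule prod.cong)
    show "Poly_Mapping.keys (Poly_Mapping.single i 1 + u) - S = Poly_Mapping.keys u - S"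
      using i by (auto simp: in_keys_iff lookup_add lookup_single when_def split: if_splits)
  next
    fix j assume "j \<in> Poly_Mapping.keys u - S"
    then show "h j ^ Poly_Mapping.lookup (Poly_Mapping.single i 1 + u) j = h j ^ Poly_Mapping.lookup u j"
      using i by (auto simp: lookup_add lookup_single when_def)
  qed
  have E: "?E \<alpha> (Poly_Mapping.single i 1 + u) =
      (if \<alpha> i = 0 then 0 else ?E (\<alpha>(i := \<alpha> i - 1)) u) + \<phi> (c (\<alpha> i)) * ?E \<alpha> u" for u
  proof -
    have rest: "(\<Prod>j\<in>S - {i}. \<phi> (nexp c (Poly_Mapping.lookup (Poly_Mapping.single i 1 + u) j) (\<alpha> j))) =
        (\<Prod>j\<in>S - {i}. \<phi> (nexp c (Poly_Mapping.lookup u j) (\<alpha> j)))"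
      by (rule prod.cong) (auto simp: lookup_add lookup_single when_def)
    have rest': "(\<Prod>j\<in>S - {i}. \<phi> (nexp c (Poly_Mapping.lookup u j) ((\<alpha>(i := \<alpha> i - 1)) j))) =
        (\<Prod>j\<in>S - {i}. \<phi> (nexp c (Poly_Mapping.lookup u j) (\<alpha> j)))"
      by (rule prod.cong) auto
    show ?thesis
      using S i by (simp add: prod.remove[of S i] rest rest' lookup_add lookup_single plus_1_eq_Suc
          \<phi>.hom_add \<phi>.hom_mult distrib_right mult.assoc)
  qed
  have "xv i * p = (\<Sum>u\<in>Poly_Mapping.keys p.
      Poly_Mapping.single (Poly_Mapping.single i 1 + u) (Poly_Mapping.lookup p u))"
    by (subst poly_sum_single[of p]) (simp add: sum_distrib_left xv_mult_single)
  then have "ncoeff \<phi> h c S \<alpha> (xv i * p) = (\<Sum>u\<in>Poly_Mapping.keys p. \<phi> (Poly_Mapping.lookup p u) *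
      (((if \<alpha> i = 0 then 0 else ?E (\<alpha>(i := \<alpha> i - 1)) u) + \<phi> (c (\<alpha> i)) * ?E \<alpha> u) * ?h u))"
    by (simp only: ncoeff_sum ncoeff_single E h)
  then show ?thesis
    by (cases "\<alpha> i = 0")
      (simp_all add: ncoeff_def sum.distrib[symmetric] sum_distrib_left algebra_simps)
qed

text \<open>A variable outside S only contributes its value under h. The functional is thus linear
  over the polynomials in the remaining variables, which act as parameters.\<close>

lemma ncoeff_mult_outside:
  assumes "xin T q" "T \<inter> S = {}"
  shows "ncoeff \<phi> h c S \<alpha> (q * p) = poly_subst \<phi> h q * ncoeff \<phi> h c S \<alpha> p"
proof -
  interpret ps: comm_ring_hom "poly_subst \<phi> h"
    by (rule comm_ring_hom_poly_subst[OF \<phi>])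
  have var: "ncoeff \<phi> h c S \<alpha> (xv i * p) = h i * ncoeff \<phi> h c S \<alpha> p" if "i \<in> T" for i p
  proof -
    have i: "i \<notin> S" using that assms(2) by auto
    let ?h = "\<lambda>u. \<Prod>i\<in>Poly_Mapping.keys u - S. h i ^ Poly_Mapping.lookup u i"
    have h: "?h (Poly_Mapping.single i 1 + u) = h i * ?h u" for u
    proof -
      let ?K = "insert i (Poly_Mapping.keys u) - S"
      have "?h (Poly_Mapping.single i 1 + u) =
          (\<Prod>j\<in>?K. h j ^ Poly_Mapping.lookup (Poly_Mapping.single i 1 + u) j)"
        by (rule prod.cong) (auto simp: in_keys_iff lookup_add lookup_single when_def split: if_splits)
      also have "\<dots> = (\<Prod>j\<in>?K. (if j = i then h i else 1) * h j ^ Poly_Mapping.lookup u j)"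
        by (rule prod.cong) (auto simp: lookup_add lookup_single when_def plus_1_eq_Suc)
      also have "\<dots> = h i * (\<Prod>j\<in>?K. h j ^ Poly_Mapping.lookup u j)"
        using i by (simp add: prod.distrib prod.delta plus_1_eq_Suc)
      also have "(\<Prod>j\<in>?K. h j ^ Poly_Mapping.lookup u j) = ?h u"
        by (rule prod.mono_neutral_right) (auto simp: in_keys_iff intro!: gr0I)
      finally show ?thesis .
    qed
    have E: "(\<Prod>j\<in>S. \<phi> (nexp c (Poly_Mapping.lookup (Poly_Mapping.single i 1 + u) j) (\<alpha> j))) =
        (\<Prod>j\<in>S. \<phi> (nexp c (Poly_Mapping.lookup u j) (\<alpha> j)))" for u
      using i by (intro prod.cong) (auto simp: lookup_add lookup_single when_def)
    have "xv i * p = (\<Sum>u\<in>Poly_Mapping.keys p.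
        Poly_Mapping.single (Poly_Mapping.single i 1 + u) (Poly_Mapping.lookup p u))"
      by (subst poly_sum_single[of p]) (simp add: sum_distrib_left xv_mult_single)
    then have "ncoeff \<phi> h c S \<alpha> (xv i * p) = (\<Sum>u\<in>Poly_Mapping.keys p. \<phi> (Poly_Mapping.lookup p u) *
        ((\<Prod>i\<in>S. \<phi> (nexp c (Poly_Mapping.lookup u i) (\<alpha> i))) * (h i * ?h u)))"
      by (simp only: ncoeff_sum ncoeff_single E h)
    then show ?thesis
      by (simp add: ncoeff_def sum_distrib_left mult_ac)
  qed
  show ?thesis
    using assms(1) by (induction rule: xpoly_induct)
      (simp_all add: ncoeff_const_mult ncoeff_add var distrib_right mult.assoc ps.hom_add ps.hom_mult)
qed

text \<open>Newton products and \<open>ncoeff\<close> are dual bases. The induction strips the last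
  Newton factor of some variable with positive exponent.\<close>

lemma ncoeff_npow_prod:
  "ncoeff \<phi> h c S \<alpha> (\<Prod>i\<in>S. npow (\<lambda>t. xconst (c t)) (xv i) (\<beta> i)) =
    (if \<forall>i\<in>S. \<alpha> i = \<beta> i then 1 else 0)"
proof (induction "\<Sum>i\<in>S. \<beta> i" arbitrary: \<alpha> \<beta>)
  case 0
  then have "\<forall>i\<in>S. \<beta> i = 0" using S by simp
  then show ?case by (simp add: ncoeff_1)
next
  case (Suc d)
  then obtain i where i: "i \<in> S" "\<beta> i \<noteq> 0"
    by (metis sum.neutral nat.distinct(1))
  let ?c = "\<lambda>t. xconst (c t)"
  define \<beta>' where "\<beta>' = \<beta>(i := \<beta> i - 1)"
  let ?p = "\<Prod>i\<in>S. npow ?c (xv i) (\<beta>' i)"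
  have \<beta>: "\<beta> i = Suc (\<beta>' i)" "\<And>j. j \<noteq> i \<Longrightarrow> \<beta> j = \<beta>' j"
    using i(2) by (auto simp: \<beta>'_def)
  have "(\<Sum>j\<in>S. \<beta>' j) = d"
  proof -
    have "(\<Sum>j\<in>S - {i}. \<beta>' j) = (\<Sum>j\<in>S - {i}. \<beta> j)"
      by (rule sum.cong) (auto simp: \<beta>)
    then show ?thesis using Suc.hyps(2) S i(1) by (simp add: sum.remove \<beta>(1))
  qed
  then have IH: "ncoeff \<phi> h c S \<alpha> ?p = (if \<forall>i\<in>S. \<alpha> i = \<beta>' i then 1 else 0)" for \<alpha>
    using Suc.hyps(1)[of \<beta>' \<alpha>] by simp
  have "(\<Prod>j\<in>S - {i}. npow ?c (xv j) (\<beta> j)) = (\<Prod>j\<in>S - {i}. npow ?c (xv j) (\<beta>' j))"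
    by (rule prod.cong) (auto simp: \<beta>)
  then have "(\<Prod>j\<in>S. npow ?c (xv j) (\<beta> j)) = (xv i - xconst (c (\<beta>' i))) * ?p"
    using S i(1) by (simp add: prod.remove \<beta>(1) npow_Suc mult_ac)
  also have "\<dots> = xv i * ?p - xconst (c (\<beta>' i)) * ?p"
    by (simp add: algebra_simps)
  finally have "ncoeff \<phi> h c S \<alpha> (\<Prod>j\<in>S. npow ?c (xv j) (\<beta> j)) =
      (if \<alpha> i = 0 then 0 else ncoeff \<phi> h c S (\<alpha>(i := \<alpha> i - 1)) ?p)
      + \<phi> (c (\<alpha> i)) * ncoeff \<phi> h c S \<alpha> ?p - \<phi> (c (\<beta>' i)) * ncoeff \<phi> h c S \<alpha> ?p"
    by (simp add: ncoeff_diff ncoeff_var_mult[OF i(1)] ncoeff_const_mult)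
  \<comment> \<open>The difference of the two nodes is multiplied by an indicator that forces
    \<alpha> i = \<open>\<beta>' i\<close>, so these two terms cancel.\<close>
  also have "\<dots> = (if \<alpha> i = 0 then 0 else ncoeff \<phi> h c S (\<alpha>(i := \<alpha> i - 1)) ?p)"
    using i(1) by (auto simp: IH)
  also have "\<dots> = (if \<forall>i\<in>S. \<alpha> i = \<beta> i then 1 else 0)"
  proof (cases "\<alpha> i = 0")
    case True
    then have "\<not> (\<forall>j\<in>S. \<alpha> j = \<beta> j)" using i by fastforce
    with True show ?thesis by simp
  next
    case False
    have "(\<alpha>(i := \<alpha> i - 1)) j = \<beta>' j \<longleftrightarrow> \<alpha> j = \<beta> j" for j
      using False \<beta> by (cases "j = i") auto
    with False show ?thesis by (simp only: IH if_False)
  qed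
  finally show ?case .
qed

end

text \<open>Multiplication by x_i sends a Newton product to the next one plus c (\<beta> i) times
  itself. Multiplication by q is therefore triangular, with q evaluated at the nodes as diagonal
  entry. This is where values such as P(a_\<rho>) come from.\<close>

lemma ncoeff_triangular:
  fixes \<beta> :: "nat \<Rightarrow> nat" and c :: "nat \<Rightarrow> qa"
  assumes S: "finite S" and q: "xin S q"
  defines "p \<equiv> \<Prod>i\<in>S. npow (\<lambda>t. xconst (c t)) (xv i) (\<beta> i)"
  shows "ncoeff id h c S \<beta> (q * p) = poly_subst id (\<lambda>i. c (\<beta> i)) q"
    and "ncoeff id h c S \<alpha> (q * p) \<noteq> 0 \<Longrightarrow> \<forall>i\<in>S. \<beta> i \<le> \<alpha> i"
proof -
  note nc = comm_ring_hom_id S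
  have "ncoeff id h c S \<beta> (q * p) = poly_subst id (\<lambda>i. c (\<beta> i)) q \<and>
    (\<forall>\<alpha>. ncoeff id h c S \<alpha> (q * p) \<noteq> 0 \<longrightarrow> (\<forall>i\<in>S. \<beta> i \<le> \<alpha> i))"
    using q
  proof (induction rule: xpoly_induct)
    case (const d)
    show ?case
      unfolding ncoeff_const_mult[OF nc] p_def ncoeff_npow_prod[OF nc] by simp
  next
    case (add p' q)
    have "\<forall>i\<in>S. \<beta> i \<le> \<alpha> i"
      if "ncoeff id h c S \<alpha> (p' * p) + ncoeff id h c S \<alpha> (q * p) \<noteq> 0" for \<alpha>
    proof (cases "ncoeff id h c S \<alpha> (p' * p) = 0")
      case True
      with that have "ncoeff id h c S \<alpha> (q * p) \<noteq> 0" by (simp only: add_0 simp_thms)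
      with add show ?thesis by blast
    qed (use add in blast)
    moreover have "ncoeff id h c S \<beta> (p' * p) = poly_subst id (\<lambda>i. c (\<beta> i)) p'"
      "ncoeff id h c S \<beta> (q * p) = poly_subst id (\<lambda>i. c (\<beta> i)) q"
      using add by blast+
    ultimately show ?case
      unfolding distrib_right ncoeff_add[OF nc] eval.hom_add by (simp only: simp_thms) blast
  next
    case (var i q)
    have "ncoeff id h c S (\<beta>(i := \<beta> i - 1)) (q * p) = 0" if "\<beta> i \<noteq> 0"
    proof (rule ccontr)
      assume "ncoeff id h c S (\<beta>(i := \<beta> i - 1)) (q * p) \<noteq> 0"
      then have "\<forall>j\<in>S. \<beta> j \<le> (\<beta>(i := \<beta> i - 1)) j" using var by blast
      then have "\<beta> i \<le> \<beta> i - 1" using var(1) by (metis fun_upd_same)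
      with that show False by simp
    qed
    moreover have "\<forall>j\<in>S. \<beta> j \<le> \<alpha> j" if "ncoeff id h c S \<alpha> (xv i * q * p) \<noteq> 0" for \<alpha>
    proof -
      from that have "ncoeff id h c S (\<alpha>(i := \<alpha> i - 1)) (q * p) \<noteq> 0 \<or> ncoeff id h c S \<alpha> (q * p) \<noteq> 0"
        by (auto simp: mult.assoc ncoeff_var_mult[OF nc var(1)] split: if_splits)
      then show ?thesis
      proof
        assume "ncoeff id h c S (\<alpha>(i := \<alpha> i - 1)) (q * p) \<noteq> 0"
        then have "\<beta> j \<le> (\<alpha>(i := \<alpha> i - 1)) j" if "j \<in> S" for j using var that by blast
        note * = this
        show ?thesis
        proof
          fix j assume "j \<in> S"
          from *[OF this] show "\<beta> j \<le> \<alpha> j" by (cases "j = i") auto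
        qed
      qed (use var in blast)
    qed
    moreover have "ncoeff id h c S \<beta> (xv i * q * p) = poly_subst id (\<lambda>i. c (\<beta> i)) (xv i * q)"
    proof -
      have "(if \<beta> i = 0 then 0 else ncoeff id h c S (\<beta>(i := \<beta> i - 1)) (q * p)) = 0"
        using calculation(1) by (cases "\<beta> i = 0") (simp_all only: if_True if_False simp_thms)
      then have "ncoeff id h c S \<beta> (xv i * q * p) = id (c (\<beta> i)) * ncoeff id h c S \<beta> (q * p)"
        unfolding mult.assoc ncoeff_var_mult[OF nc var(1)] by (simp only: add_0)
      moreover have "ncoeff id h c S \<beta> (q * p) = poly_subst id (\<lambda>i. c (\<beta> i)) q"
        using var(2) by blast
      ultimately show ?thesis by (simp add: eval.hom_mult)
    qed
    ultimately show ?case by blast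
  qed
  then show "ncoeff id h c S \<beta> (q * p) = poly_subst id (\<lambda>i. c (\<beta> i)) q"
    and "ncoeff id h c S \<alpha> (q * p) \<noteq> 0 \<Longrightarrow> \<forall>i\<in>S. \<beta> i \<le> \<alpha> i"
    by blast+
qed

lemma npow_prod_spanning:
  assumes S: "finite S" and p: "xin S p"
  shows "\<exists>F d. finite F \<and>
    p = (\<Sum>\<alpha>\<in>F. xconst (d \<alpha>) * (\<Prod>i\<in>S. npow (\<lambda>t. xconst (c t)) (xv i) (\<alpha> i)))"
proof -
  let ?m = "\<lambda>\<alpha>. \<Prod>i\<in>S. npow (\<lambda>t. xconst (c t)) (xv i) (\<alpha> i)"
  let ?sp = "\<lambda>p. \<exists>F d. finite F \<and> p = (\<Sum>\<alpha>\<in>F. xconst (d \<alpha>) * ?m \<alpha>)"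
  have add: "?sp (p + q)" if "?sp p" "?sp q" for p q
  proof -
    from that obtain F d G e where F: "finite F" "p = (\<Sum>\<alpha>\<in>F. xconst (d \<alpha>) * ?m \<alpha>)"
      and G: "finite G" "q = (\<Sum>\<alpha>\<in>G. xconst (e \<alpha>) * ?m \<alpha>)" by blast
    have "p = (\<Sum>\<alpha>\<in>F \<union> G. xconst (if \<alpha> \<in> F then d \<alpha> else 0) * ?m \<alpha>)"
      unfolding F(2) by (rule sum.mono_neutral_cong_left) (use F G in auto)
    moreover have "q = (\<Sum>\<alpha>\<in>F \<union> G. xconst (if \<alpha> \<in> G then e \<alpha> else 0) * ?m \<alpha>)"
      unfolding G(2) by (rule sum.mono_neutral_cong_left) (use F G in auto)
    ultimately have "p + q = (\<Sum>\<alpha>\<in>F \<union> G.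
        xconst ((if \<alpha> \<in> F then d \<alpha> else 0) + (if \<alpha> \<in> G then e \<alpha> else 0)) * ?m \<alpha>)"
      by (simp add: sum.distrib distrib_right)
    then show ?thesis
      by (intro exI[of _ "F \<union> G"] exI[of _ "\<lambda>\<alpha>. (if \<alpha> \<in> F then d \<alpha> else 0) + (if \<alpha> \<in> G then e \<alpha> else 0)"])
        (use F G in simp)
  qed
  have mono: "?sp (xconst e * ?m \<alpha>)" for e \<alpha>
    by (intro exI[of _ "{\<alpha>}"] exI[of _ "\<lambda>_. e"]) simp
  have sum: "?sp (\<Sum>\<alpha>\<in>F. f \<alpha>)" if "\<And>\<alpha>. \<alpha> \<in> F \<Longrightarrow> ?sp (f \<alpha>)" "finite F" for F :: "(nat \<Rightarrow> nat) set" and f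
    using that(2,1)
  proof (induction F rule: finite_induct)
    case empty
    then show ?case by (intro exI[of _ "{}"]) auto
  next
    case (insert \<alpha> F)
    have "?sp (f \<alpha> + (\<Sum>\<alpha>\<in>F. f \<alpha>))" by (rule add) (use insert in auto)
    then show ?case unfolding sum.insert[OF insert(1,2)] .
  qed
  show ?thesis
    using p
  proof (induction rule: xpoly_induct)
    case (const e)
    then show ?case using mono[of e "\<lambda>_. 0"] by simp
  next
    case (add p q)
    then show ?case by (rule \<open>\<And>p q. ?sp p \<Longrightarrow> ?sp q \<Longrightarrow> ?sp (p + q)\<close>)
  next
    case (var i p)
    from var(2) obtain F d where F: "finite F" "p = (\<Sum>\<alpha>\<in>F. xconst (d \<alpha>) * ?m \<alpha>)" by blast
    have "?sp (xv i * (xconst (d \<alpha>) * ?m \<alpha>))" for \<alpha>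
    proof -
      have "(\<Prod>j\<in>S - {i}. npow (\<lambda>t. xconst (c t)) (xv j) ((\<alpha>(i := Suc (\<alpha> i))) j)) =
          (\<Prod>j\<in>S - {i}. npow (\<lambda>t. xconst (c t)) (xv j) (\<alpha> j))"
        by (rule prod.cong) auto
      then have "?m (\<alpha>(i := Suc (\<alpha> i))) = (xv i - xconst (c (\<alpha> i))) * ?m \<alpha>"
        using S var(1) by (simp add: prod.remove[of S i] npow_Suc mult_ac)
      moreover have "v * (e * m) = e * ((v - f) * m) + e * f * m" for v e f m :: xpoly
        by (simp add: algebra_simps)
      ultimately have "xv i * (xconst (d \<alpha>) * ?m \<alpha>) =
          xconst (d \<alpha>) * ?m (\<alpha>(i := Suc (\<alpha> i))) + xconst (d \<alpha> * c (\<alpha> i)) * ?m \<alpha>"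
        by (simp only: xconst_hom)
      then show ?thesis by (simp only: add[OF mono mono])
    qed
    then show ?case
      unfolding F(2) sum_distrib_left using F(1) by (intro sum)
  qed
qed


subsection \<open>Partitions\<close>

lemma part_0 [simp]: "part \<kappa> 0 = 0"
  and part_Suc_le: "i \<ge> 1 \<Longrightarrow> part \<kappa> (Suc i) \<le> part \<kappa> i"
  and finite_part: "finite {i. part \<kappa> i \<noteq> 0}"
  using part[of \<kappa>] by auto

lemma part_antimono:
  assumes "1 \<le> i" "i \<le> j"
  shows "part \<kappa> j \<le> part \<kappa> i"
  using assms(2)
proof (induction j rule: dec_induct)
  case (step j)
  then show ?case using part_Suc_le[of j \<kappa>] assms(1) by linarith
qed simp

lemma part_support: "{i. part \<kappa> i \<noteq> 0} = {1..plength \<kappa>}"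
proof (cases "{i. part \<kappa> i \<noteq> 0} = {}")
  case True
  then show ?thesis unfolding plength_def True by simp
next
  case False
  define m where "m = Max {i. part \<kappa> i \<noteq> 0}"
  have m: "part \<kappa> m \<noteq> 0" and le: "\<And>i. part \<kappa> i \<noteq> 0 \<Longrightarrow> i \<le> m"
    using Max_in[OF finite_part False] Max_ge[OF finite_part[of \<kappa>]] unfolding m_def by auto
  have "part \<kappa> i \<noteq> 0" if "1 \<le> i" "i \<le> m" for i
    using part_antimono[OF that, of \<kappa>] m by linarith
  moreover have "1 \<le> i" if "part \<kappa> i \<noteq> 0" for i
    using that by (cases i) auto
  ultimately have eq: "{i. part \<kappa> i \<noteq> 0} = {1..m}"
    using le unfolding set_eq_iff mem_Collect_eq atLeastAtMost_iff by blast
  show ?thesis unfolding plength_def eq by simp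
qed

lemma plength_le_iff: "plength \<kappa> \<le> n \<longleftrightarrow> (\<forall>i>n. part \<kappa> i = 0)"
proof
  assume "plength \<kappa> \<le> n"
  moreover have "i \<in> {1..plength \<kappa>}" if "part \<kappa> i \<noteq> 0" for i
    unfolding part_support[symmetric] using that by simp
  ultimately show "\<forall>i>n. part \<kappa> i = 0"
    by (meson atLeastAtMost_iff le_trans not_le)
next
  assume *: "\<forall>i>n. part \<kappa> i = 0"
  show "plength \<kappa> \<le> n"
  proof (rule ccontr)
    assume "\<not> plength \<kappa> \<le> n"
    then have "plength \<kappa> \<in> {i. part \<kappa> i \<noteq> 0}"
      unfolding part_support by simp
    with * \<open>\<not> plength \<kappa> \<le> n\<close> show False by auto
  qed
qed

lemma part_eq_0: "plength \<kappa> \<le> n \<Longrightarrow> n < i \<Longrightarrow> part \<kappa> i = 0"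
  using plength_le_iff by blast

lemma part_pos_iff: "part \<kappa> i > 0 \<longleftrightarrow> 1 \<le> i \<and> i \<le> plength \<kappa>"
  using part_support[of \<kappa>] by auto

lemma partition_eqI: "(\<And>i. i \<ge> 1 \<Longrightarrow> part \<kappa> i = part \<mu> i) \<Longrightarrow> \<kappa> = \<mu>"
  by (subst part_inject[symmetric], rule ext) (metis part_0 less_one not_le)

lemma ex_partition:
  assumes "\<And>i. 1 \<le> i \<Longrightarrow> i < n \<Longrightarrow> f (Suc i) \<le> f i"
  shows "\<exists>\<kappa>. plength \<kappa> \<le> n \<and> (\<forall>i\<in>{1..n}. part \<kappa> i = f i)"
proof -
  define g where "g = (\<lambda>i. if i \<in> {1..n} then f i else (0::nat))"
  have "{i. g i \<noteq> 0} \<subseteq> {1..n}" by (auto simp: g_def)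
  then have "finite {i. g i \<noteq> 0}" by (rule finite_subset) simp
  moreover have "g 0 = 0" by (simp add: g_def)
  moreover have "g (Suc i) \<le> g i" if "i \<ge> 1" for i
    using assms[of i] that by (auto simp: g_def)
  ultimately have part: "part (Abs_partition g) = g"
    by (intro Abs_partition_inverse) auto
  then show ?thesis
    by (intro exI[of _ "Abs_partition g"]) (auto simp: part plength_le_iff g_def)
qed

definition psize :: "partition \<Rightarrow> nat" where
  "psize \<kappa> = (\<Sum>i | part \<kappa> i \<noteq> 0. part \<kappa> i)"

lemma psize_eq: "plength \<kappa> \<le> n \<Longrightarrow> psize \<kappa> = (\<Sum>i=1..n. part \<kappa> i)"
  unfolding psize_def part_support
  by (rule sum.mono_neutral_left) (auto simp: part_eq_0[OF order_refl])

lemma plength_le_psize: "plength \<kappa> \<le> psize \<kappa>"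
proof -
  have "plength \<kappa> = (\<Sum>i=1..plength \<kappa>. 1)" by simp
  also have "\<dots> \<le> (\<Sum>i=1..plength \<kappa>. part \<kappa> i)"
    by (rule sum_mono) (use part_pos_iff[of \<kappa>] in \<open>auto simp: Suc_le_eq[symmetric] One_nat_def\<close>)
  finally show ?thesis by (simp add: psize_eq[OF order_refl])
qed

lemma part_le_psize: "part \<kappa> i \<le> psize \<kappa>"
proof (cases "part \<kappa> i = 0")
  case False
  then show ?thesis
    unfolding psize_def by (intro member_le_sum) (use finite_part in auto)
qed simp

lemma finite_psize_le: "finite {\<kappa>. psize \<kappa> \<le> d}"
proof (rule inj_on_finite)
  show "inj_on (\<lambda>\<kappa>. restrict (part \<kappa>) {1..d}) {\<kappa>. psize \<kappa> \<le> d}"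
  proof (rule inj_onI, rule partition_eqI)
    fix \<kappa> \<mu> i assume d: "\<kappa> \<in> {\<kappa>. psize \<kappa> \<le> d}" "\<mu> \<in> {\<kappa>. psize \<kappa> \<le> d}"
      and eq: "restrict (part \<kappa>) {1..d} = restrict (part \<mu>) {1..d}" and i: "(1::nat) \<le> i"
    show "part \<kappa> i = part \<mu> i"
    proof (cases "i \<le> d")
      case True
      then show ?thesis using fun_cong[OF eq, of i] i by simp
    next
      case False
      then show ?thesis
        using d plength_le_psize[of \<kappa>] plength_le_psize[of \<mu>]
        by (simp add: part_eq_0[of \<kappa> d] part_eq_0[of \<mu> d])
    qed
  qed
  show "(\<lambda>\<kappa>. restrict (part \<kappa>) {1..d}) ` {\<kappa>. psize \<kappa> \<le> d} \<subseteq> PiE {1..d} (\<lambda>_. {..d})"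
    by (auto intro: order_trans[OF part_le_psize])
qed (auto intro: finite_PiE)

text \<open>The exponents \<kappa> + \<delta> of the alternant. On {1..n} they decrease strictly,
  which makes permuted alternants distinguishable.\<close>

definition shifted :: "partition \<Rightarrow> nat \<Rightarrow> nat \<Rightarrow> nat" where
  "shifted \<kappa> n j = part \<kappa> j + n - j"

lemma shifted_strict: "1 \<le> i \<Longrightarrow> i < j \<Longrightarrow> j \<le> n \<Longrightarrow> shifted \<kappa> n j < shifted \<kappa> n i"
  using part_antimono[of i j \<kappa>] by (simp add: shifted_def)

lemma shifted_antimono: "1 \<le> i \<Longrightarrow> i \<le> j \<Longrightarrow> j \<le> n \<Longrightarrow> shifted \<kappa> n j \<le> shifted \<kappa> n i"
  using shifted_strict[of i j n \<kappa>] by (cases "i = j") auto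

lemma shifted_inject:
  assumes "plength \<kappa> \<le> n" "plength \<mu> \<le> n"
  shows "(\<forall>i\<in>{1..n}. shifted \<kappa> n i = shifted \<mu> n i) \<longleftrightarrow> \<kappa> = \<mu>"
proof
  assume *: "\<forall>i\<in>{1..n}. shifted \<kappa> n i = shifted \<mu> n i"
  show "\<kappa> = \<mu>"
  proof (rule partition_eqI)
    fix i :: nat assume "1 \<le> i"
    show "part \<kappa> i = part \<mu> i"
    proof (cases "i \<le> n")
      case True
      with * \<open>1 \<le> i\<close> have "shifted \<kappa> n i = shifted \<mu> n i" by simp
      then show ?thesis using True by (simp add: shifted_def)
    qed (use assms part_eq_0[of \<kappa> n i] part_eq_0[of \<mu> n i] in simp)
  qed
qed simp

text \<open>By the pigeonhole principle some \<open>k \<ge> i\<close> has \<open>p k \<le> i\<close>.\<close>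

lemma permuted_dominance:
  fixes f g :: "nat \<Rightarrow> nat"
  assumes p: "p permutes {1..n}" and le: "\<And>i. i \<in> {1..n} \<Longrightarrow> g (p i) \<le> f i"
    and f: "\<And>i j. 1 \<le> i \<Longrightarrow> i \<le> j \<Longrightarrow> j \<le> n \<Longrightarrow> f j \<le> f i"
    and g: "\<And>i j. 1 \<le> i \<Longrightarrow> i \<le> j \<Longrightarrow> j \<le> n \<Longrightarrow> g j \<le> g i"
    and i: "i \<in> {1..n}"
  shows "g i \<le> f i"
proof -
  have "\<exists>k\<in>{i..n}. p k \<le> i"
  proof (rule ccontr)
    assume "\<not> ?thesis"
    have "p ` {i..n} \<subseteq> {i<..n}"
    proof (rule image_subsetI)
      fix k assume k: "k \<in> {i..n}"
      then have "p k \<in> {1..n}" using permutes_in_image[OF p, of k] i by auto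
      moreover have "\<not> p k \<le> i" using k \<open>\<not> (\<exists>k\<in>{i..n}. p k \<le> i)\<close> by blast
      ultimately show "p k \<in> {i<..n}" by auto
    qed
    then have "card (p ` {i..n}) \<le> card {i<..n}"
      by (intro card_mono) auto
    moreover have "card (p ` {i..n}) = card {i..n}"
      by (rule card_image) (rule permutes_inj_on[OF p])
    ultimately show False using i by (simp add: Suc_diff_le)
  qed
  then obtain k where k: "k \<in> {i..n}" "p k \<le> i" by blast
  have "p k \<in> {1..n}" using permutes_in_image[OF p, of k] k i by auto
  then have "g i \<le> g (p k)" using g[of "p k" i] k i by auto
  also have "\<dots> \<le> f k" using le[of k] k i by auto
  also have "\<dots> \<le> f i" using f[of i k] k i by auto
  finally show ?thesis .
qed

text \<open>For strictly decreasing g the hypothesis says i \<le> p i for all i, and only the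
  identity does not move any index down.\<close>

lemma permuted_dominance_id:
  fixes g :: "nat \<Rightarrow> nat"
  assumes p: "p permutes {1..n}" and le: "\<And>i. i \<in> {1..n} \<Longrightarrow> g (p i) \<le> g i"
    and g: "\<And>i j. 1 \<le> i \<Longrightarrow> i < j \<Longrightarrow> j \<le> n \<Longrightarrow> g j < g i"
  shows "p = id"
proof (rule permutes_natset_ge[OF p])
  show "\<forall>i\<in>{1..n}. i \<le> p i"
  proof
    fix i assume i: "i \<in> {1..n}"
    then have "p i \<in> {1..n}" using permutes_in_image[OF p] by blast
    then show "i \<le> p i"
      using g[of "p i" i] le[OF i] i by (cases "p i < i") auto
  qed
qed

section \<open>Newton coefficients of alternants\<close>

lemma ncoeff_alternant_leibniz:
  assumes \<phi>: "comm_ring_hom \<phi>" and z: "inj_on z {1..n}"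
  shows "ncoeff \<phi> h c (z ` {1..n}) \<alpha> (alternant n (\<lambda>i. xv (z i)) (\<lambda>t. xconst (c t)) \<beta>) =
    (\<Sum>p | p permutes {1..n}. of_int (sign p) * (if \<forall>i\<in>{1..n}. \<alpha> (z i) = \<beta> (p i) then 1 else 0))"
proof -
  let ?S = "z ` {1..n}"
  have S: "finite ?S" by simp
  let ?inv = "inv_into {1..n} z"
  have "(\<Prod>i=1..n. npow (\<lambda>t. xconst (c t)) (xv (z i)) (\<beta> (p i))) =
      (\<Prod>s\<in>?S. npow (\<lambda>t. xconst (c t)) (xv s) (\<beta> (p (?inv s))))" for p
    by (subst prod.reindex[OF z]) (auto simp: inv_into_f_f[OF z])
  then show ?thesis
    unfolding alternant_def det_fun_leibniz
    by (simp add: ncoeff_sum[OF \<phi> S] ncoeff_of_int_mult[OF \<phi> S] ncoeff_npow_prod[OF \<phi> S]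
        inv_into_f_f[OF z])
qed

text \<open>Two strictly decreasing sequences that agree up to a permutation are equal, and the
  permutation is the identity. At most one Leibniz term survives, with sign 1.\<close>

lemma ncoeff_alternant:
  assumes \<phi>: "comm_ring_hom \<phi>" and z: "inj_on z {1..n}"
    and \<alpha>: "\<And>i j. 1 \<le> i \<Longrightarrow> i < j \<Longrightarrow> j \<le> n \<Longrightarrow> \<alpha> (z j) < \<alpha> (z i)"
    and \<beta>: "\<And>i j. 1 \<le> i \<Longrightarrow> i < j \<Longrightarrow> j \<le> n \<Longrightarrow> \<beta> j < \<beta> i"
  shows "ncoeff \<phi> h c (z ` {1..n}) \<alpha> (alternant n (\<lambda>i. xv (z i)) (\<lambda>t. xconst (c t)) \<beta>) =
    (if \<forall>i\<in>{1..n}. \<alpha> (z i) = \<beta> i then 1 else 0)"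
proof -
  have id_iff: "(\<forall>i\<in>{1..n}. \<alpha> (z i) = \<beta> (p i)) \<longleftrightarrow> p = id \<and> (\<forall>i\<in>{1..n}. \<alpha> (z i) = \<beta> i)"
    if p: "p permutes {1..n}" for p
  proof
    assume *: "\<forall>i\<in>{1..n}. \<alpha> (z i) = \<beta> (p i)"
    have \<alpha>': "\<alpha> (z j) \<le> \<alpha> (z i)" and \<beta>': "\<beta> j \<le> \<beta> i" if "1 \<le> i" "i \<le> j" "j \<le> n" for i j
      using \<alpha>[of i j] \<beta>[of i j] that by (cases "i = j"; force)+
    have "\<beta> i \<le> \<alpha> (z i)" if "i \<in> {1..n}" for i
      by (rule permuted_dominance[OF p _ _ _ that]) (use * \<alpha>' \<beta>' in auto)
    moreover have "\<alpha> (z i) \<le> \<beta> i" if "i \<in> {1..n}" for i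
    proof (rule permuted_dominance[OF permutes_inv[OF p] _ _ _ that])
      fix k assume k: "k \<in> {1..n}"
      then have "Hilbert_Choice.inv p k \<in> {1..n}" using permutes_in_image[OF permutes_inv[OF p]] by blast
      with * show "\<alpha> (z (Hilbert_Choice.inv p k)) \<le> \<beta> k" by (simp add: permutes_inverses[OF p])
    qed (use \<alpha>' \<beta>' in auto)
    ultimately have eq: "\<forall>i\<in>{1..n}. \<alpha> (z i) = \<beta> i" by (simp add: order_antisym)
    moreover have "p = id"
      by (rule permuted_dominance_id[OF p, of \<beta>]) (use * eq \<beta> in auto)
    ultimately show "p = id \<and> (\<forall>i\<in>{1..n}. \<alpha> (z i) = \<beta> i)" by simp
  qed auto
  have "(\<Sum>p | p permutes {1..n}.
      of_int (sign p) * (if \<forall>i\<in>{1..n}. \<alpha> (z i) = \<beta> (p i) then 1 else 0)) =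
    (\<Sum>p | p permutes {1..n}. if p = id then (if \<forall>i\<in>{1..n}. \<alpha> (z i) = \<beta> i then 1 else 0) else (0::'a))"
  proof (rule sum.cong[OF refl])
    fix p assume "p \<in> {p. p permutes {1..n}}"
    then have "p permutes {1..n}" by simp
    from id_iff[OF this] show "of_int (sign p) * (if \<forall>i\<in>{1..n}. \<alpha> (z i) = \<beta> (p i) then 1 else 0) =
        (if p = id then (if \<forall>i\<in>{1..n}. \<alpha> (z i) = \<beta> i then 1 else 0) else (0::'a))"
      by (cases "p = id") (simp_all only: simp_thms if_True if_False sign_id of_int_1 mult_1 mult_zero_right)
  qed
  also have "\<dots> = (if \<forall>i\<in>{1..n}. \<alpha> (z i) = \<beta> i then 1 else 0)"
    by (subst sum.delta) (auto simp: finite_permutations permutes_id)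
  finally show ?thesis
    unfolding ncoeff_alternant_leibniz[OF \<phi> z] .
qed

text \<open>Triangularity holds for every Leibniz term with permuted exponents. On the diagonal,
  dominance excludes every permutation except the identity; off the diagonal, dominance by a
  permuted sequence implies dominance by the sorted one.\<close>

lemma ncoeff_mult_alternant:
  assumes q: "xin {1..n} q"
    and \<beta>: "\<And>i j. 1 \<le> i \<Longrightarrow> i < j \<Longrightarrow> j \<le> n \<Longrightarrow> \<beta> j < \<beta> i"
  shows "ncoeff id h c {1..n} \<beta> (q * alternant n xv (\<lambda>t. xconst (c t)) \<beta>) =
      poly_subst id (\<lambda>i. c (\<beta> i)) q"
    and "(\<And>i j. 1 \<le> i \<Longrightarrow> i \<le> j \<Longrightarrow> j \<le> n \<Longrightarrow> \<alpha> j \<le> \<alpha> i) \<Longrightarrow>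
      ncoeff id h c {1..n} \<alpha> (q * alternant n xv (\<lambda>t. xconst (c t)) \<beta>) \<noteq> 0 \<Longrightarrow>
      i \<in> {1..n} \<Longrightarrow> \<beta> i \<le> \<alpha> i"
proof -
  note nc = comm_ring_hom_id finite_atLeastAtMost[of 1 n]
  let ?m = "\<lambda>p. \<Prod>i=1..n. npow (\<lambda>t. xconst (c t)) (xv i) (\<beta> (p i))"
  have *: "ncoeff id h c {1..n} \<alpha> (q * alternant n xv (\<lambda>t. xconst (c t)) \<beta>) =
    (\<Sum>p | p permutes {1..n}. of_int (sign p) * ncoeff id h c {1..n} \<alpha> (q * ?m p))" for \<alpha>
    unfolding alternant_def det_fun_leibniz sum_distrib_left ncoeff_sum[OF nc]
      mult.left_commute[of q] ncoeff_of_int_mult[OF nc] ..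
  have \<beta>': "\<beta> j \<le> \<beta> i" if "1 \<le> i" "i \<le> j" "j \<le> n" for i j
    using \<beta>[of i j] that by (cases "i = j") force+
  have "ncoeff id h c {1..n} \<beta> (q * ?m p) = 0" if p: "p permutes {1..n}" "p \<noteq> id" for p
  proof (rule ccontr)
    assume "ncoeff id h c {1..n} \<beta> (q * ?m p) \<noteq> 0"
    then have "\<forall>i\<in>{1..n}. \<beta> (p i) \<le> \<beta> i"
      by (rule ncoeff_triangular(2)[OF _ q, where \<beta> = "\<lambda>i. \<beta> (p i)", rotated]) simp
    with permuted_dominance_id[OF p(1), of \<beta>] \<beta> p(2) show False by blast
  qed
  then have "ncoeff id h c {1..n} \<beta> (q * alternant n xv (\<lambda>t. xconst (c t)) \<beta>) =
      (\<Sum>p\<in>{id}. of_int (sign p) * ncoeff id h c {1..n} \<beta> (q * ?m p))"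
    unfolding * by (intro sum.mono_neutral_right) (auto simp: finite_permutations permutes_id)
  then show "ncoeff id h c {1..n} \<beta> (q * alternant n xv (\<lambda>t. xconst (c t)) \<beta>) =
      poly_subst id (\<lambda>i. c (\<beta> i)) q"
    using ncoeff_triangular(1)[OF _ q, of h c \<beta>] by simp
  assume \<alpha>: "\<And>i j. 1 \<le> i \<Longrightarrow> i \<le> j \<Longrightarrow> j \<le> n \<Longrightarrow> \<alpha> j \<le> \<alpha> i"
    and "ncoeff id h c {1..n} \<alpha> (q * alternant n xv (\<lambda>t. xconst (c t)) \<beta>) \<noteq> 0" and i: "i \<in> {1..n}"
  then obtain p where p: "p permutes {1..n}" "ncoeff id h c {1..n} \<alpha> (q * ?m p) \<noteq> 0"
    unfolding * by (metis (no_types, lifting) mem_Collect_eq mult_zero_right sum.neutral)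
  from p(2) have *: "\<forall>i\<in>{1..n}. \<beta> (p i) \<le> \<alpha> i"
    by (rule ncoeff_triangular(2)[OF _ q, where \<beta> = "\<lambda>i. \<beta> (p i)", rotated]) simp
  show "\<beta> i \<le> \<alpha> i"
  proof (rule permuted_dominance[OF p(1) _ _ _ i])
    fix k assume "k \<in> {1..n}"
    with * show "\<beta> (p k) \<le> \<alpha> k" by blast
  qed (fact \<alpha> \<beta>')+
qed

lemma nexp_eq_0: "k < r \<Longrightarrow> nexp c k r = 0"
  by (induction k arbitrary: r) auto

text \<open>A monomial of too small degree has some exponent below \<alpha> i, and a power of x has
  no component along Newton polynomials of higher degree.\<close>

lemma ncoeff_degree:
  assumes \<phi>: "comm_ring_hom \<phi>" and S: "finite S" and p: "xbound S d p" and d: "d < (\<Sum>i\<in>S. \<alpha> i)"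
  shows "ncoeff \<phi> h c S \<alpha> p = 0"
  unfolding ncoeff_def
proof (rule sum.neutral, rule ballI)
  interpret comm_ring_hom \<phi> by (rule \<phi>)
  fix u assume u: "u \<in> Poly_Mapping.keys p"
  have "\<exists>i\<in>S. Poly_Mapping.lookup u i < \<alpha> i"
  proof (rule ccontr)
    assume "\<not> ?thesis"
    then have "(\<Sum>i\<in>S. \<alpha> i) \<le> (\<Sum>i\<in>S. Poly_Mapping.lookup u i)"
      by (intro sum_mono) (auto simp: not_less)
    also have "\<dots> = mdeg u"
      unfolding mdeg_def using p u S
      by (intro sum.mono_neutral_right) (auto simp: xbound_def xin_def in_keys_iff)
    finally show False using p u d by (auto simp: xbound_def)
  qed
  then have "(\<Prod>i\<in>S. \<phi> (nexp c (Poly_Mapping.lookup u i) (\<alpha> i))) = 0"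
    using S by (intro prod_zero) (auto simp: nexp_eq_0 intro!: bexI)
  then show "\<phi> (Poly_Mapping.lookup p u) * ((\<Prod>i\<in>S. \<phi> (nexp c (Poly_Mapping.lookup u i) (\<alpha> i))) *
      (\<Prod>i\<in>Poly_Mapping.keys u - S. h i ^ Poly_Mapping.lookup u i)) = 0"
    by simp
qed


subsection \<open>Double Schur functions\<close>

abbreviation nodes :: "nat \<Rightarrow> nat \<Rightarrow> qa" where
  "nodes n \<equiv> \<lambda>t. av (int n - int t)"

lemma vandermonde_xv: "vandermonde xv n \<noteq> 0"
  by (rule vandermonde_nonzero[OF inj_xv])

lemma dschur_poly_eq_fschur:
  assumes "plength \<kappa> \<le> n"
  shows "dschur_poly \<kappa> n = fschur n xv (\<lambda>t. xconst (nodes n t)) (part \<kappa>)"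
proof -
  have det: "det_fun n (\<lambda>i j. xpow n i (part \<kappa> j + n - j)) =
      alternant n xv (\<lambda>t. xconst (nodes n t)) (\<lambda>j. part \<kappa> j + n - j)"
    by (simp add: alternant_def xpow_def npow_def)
  have "(THE p. p * vandermonde xv n = det_fun n (\<lambda>i j. xpow n i (part \<kappa> j + n - j))) =
      fschur n xv (\<lambda>t. xconst (nodes n t)) (part \<kappa>)"
    unfolding det fschur_vandermonde[symmetric] using vandermonde_xv[of n] by auto
  then show ?thesis using assms by (simp add: dschur_poly_def)
qed

lemma dschur_poly_eq_0: "n < plength \<kappa> \<Longrightarrow> dschur_poly \<kappa> n = 0"
  by (simp add: dschur_poly_def)

lemma dschur_poly_vandermonde:
  assumes "plength \<kappa> \<le> n"
  shows "dschur_poly \<kappa> n * vandermonde xv n =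
    alternant n xv (\<lambda>t. xconst (nodes n t)) (shifted \<kappa> n)"
  unfolding dschur_poly_eq_fschur[OF assms] fschur_vandermonde shifted_def ..

lemma vandermonde_Suc:
  "vandermonde z (Suc n) = vandermonde z n * (\<Prod>i=1..n. z i - z (Suc n))"
proof -
  have "(\<Prod>j\<in>{i<..Suc n}. z i - z j) = (\<Prod>j\<in>{i<..n}. z i - z j) * (z i - z (Suc n))"
    if "i \<in> {1..n}" for i
  proof -
    have "{i<..Suc n} = insert (Suc n) {i<..n}" using that by auto
    then show ?thesis by (simp add: mult.commute)
  qed
  then have "(\<Prod>i=1..n. \<Prod>j\<in>{i<..Suc n}. z i - z j) =
      (\<Prod>i=1..n. \<Prod>j\<in>{i<..n}. z i - z j) * (\<Prod>i=1..n. z i - z (Suc n))"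
    by (simp add: prod.distrib)
  then show ?thesis
    unfolding vandermonde_def by (simp add: atLeastAtMostSuc_conv)
qed

lemma det_fun_last_row:
  assumes "\<And>j. j \<in> {1..n} \<Longrightarrow> A (Suc n) j = 0"
  shows "det_fun (Suc n) A = A (Suc n) (Suc n) * det_fun n A"
proof -
  let ?f = "\<lambda>p. of_int (sign p) * (\<Prod>i=1..Suc n. A i (p i))"
  have "det_fun (Suc n) A = sum ?f {p. p permutes {1..Suc n}}"
    by (rule det_fun_leibniz)
  also have "\<dots> = sum ?f {p. p permutes {1..n}}"
  proof (rule sum.mono_neutral_right)
    show "{p. p permutes {1..n}} \<subseteq> {p. p permutes {1..Suc n}}"
      by (auto intro: permutes_subset)
    show "\<forall>p\<in>{p. p permutes {1..Suc n}} - {p. p permutes {1..n}}. ?f p = 0"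
    proof
      fix p assume p: "p \<in> {p. p permutes {1..Suc n}} - {p. p permutes {1..n}}"
      have "p (Suc n) \<noteq> Suc n"
      proof
        assume "p (Suc n) = Suc n"
        have "p permutes {1..n}"
        proof (rule permutes_superset)
          show "p permutes {1..Suc n}" using p by blast
          fix x assume "x \<in> {1..Suc n} - {1..n}"
          then have "x = Suc n" by auto
          then show "p x = x" by (simp only: \<open>p (Suc n) = Suc n\<close>)
        qed
        with p show False by blast
      qed
      moreover have "p permutes {1..Suc n}" using p by blast
      then have "p (Suc n) \<in> {1..Suc n}"
        by (simp only: permutes_in_image) simp
      ultimately have "A (Suc n) (p (Suc n)) = 0" by (intro assms) simp
      then show "?f p = 0" by simp
    qed
  qed (simp add: finite_permutations)
  also have "\<dots> = A (Suc n) (Suc n) * det_fun n A"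
    unfolding det_fun_leibniz sum_distrib_left
  proof (rule sum.cong[OF refl])
    fix p assume "p \<in> {p. p permutes {1..n}}"
    then have "p (Suc n) = Suc n" by (simp add: permutes_not_in)
    then show "?f p = A (Suc n) (Suc n) * (of_int (sign p) * (\<Prod>i=1..n. A i (p i)))"
      by (simp add: mult_ac)
  qed
  finally show ?thesis .
qed

lemma npow_Suc': "npow c x (Suc r) = (x - c 0) * npow (\<lambda>t. c (Suc t)) x r"
  unfolding npow_def by (rule prod.lessThan_Suc_shift)

text \<open>Since a_n is the first node, x_n = a_n kills every Newton polynomial of positive degree.
  If \<kappa> has n parts, the last row of the determinant is 0. Otherwise it has its only nonzero
  entry, 1, in the last column, and each other row i has the factor x_i - a_n. These factors also
  split off the Vandermonde product, and what remains uses the nodes a_(n-1), a_(n-2), ... of one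
  variable fewer.\<close>

lemma dschur_poly_stable:
  assumes "n \<ge> 1"
  shows "xsubst (xv(n := xconst (av (int n)))) (dschur_poly \<kappa> n) = dschur_poly \<kappa> (n - 1)"
proof (cases "plength \<kappa> \<le> n")
  case False
  then show ?thesis by (simp add: dschur_poly_eq_0)
next
  case True
  from assms obtain m where n: "n = Suc m" by (metis Suc_pred' less_eq_Suc_le One_nat_def)
  let ?z = "xv(n := xconst (av (int n)))"
  let ?c = "\<lambda>n t. xconst (nodes n t)"
  have "xsubst ?z (xv i) = ?z i" for i by simp
  then have "xsubst ?z (dschur_poly \<kappa> n) = fschur n ?z (?c n) (part \<kappa>)"
    by (simp only: dschur_poly_eq_fschur[OF True] hom_fschur[OF comm_ring_hom_xsubst] xsubst_hom)
  then have eq: "xsubst ?z (dschur_poly \<kappa> n) * vandermonde ?z n = alternant n ?z (?c n) (shifted \<kappa> n)"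
    by (simp only: fschur_vandermonde shifted_def[abs_def])
  have Vm: "vandermonde ?z m = vandermonde xv m"
    by (rule vandermonde_cong) (auto simp: n)
  have V: "vandermonde ?z n = vandermonde xv m * (\<Prod>i=1..m. xv i - xconst (av (int n)))"
    unfolding n vandermonde_Suc Vm[unfolded n] by (intro arg_cong2[where f = times] prod.cong) auto
  have ne: "xv i \<noteq> xconst c" for i c
    by (metis lookup_xconst xv_def lookup_single_eq single_zero one_neq_zero lookup_single_not_eq zero_neq_one)
  have V0: "vandermonde ?z n \<noteq> 0"
    unfolding V using vandermonde_xv[of m] ne by (simp add: prod_zero_iff)
  have row: "npow (?c n) (?z n) (shifted \<kappa> n j) = (if shifted \<kappa> n j = 0 then 1 else 0)" for j
  proof (cases "shifted \<kappa> n j")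
    case (Suc r)
    then show ?thesis by (simp only: Suc npow_Suc') simp
  qed simp
  show ?thesis
  proof (cases "plength \<kappa> \<le> m")
    case False
    then have "part \<kappa> n > 0" using True n by (simp add: part_pos_iff)
    then have "shifted \<kappa> n j \<noteq> 0" if "j \<in> {1..n}" for j
      using that by (cases "j = n") (auto simp: shifted_def)
    then have r0: "npow (?c n) (?z n) (shifted \<kappa> n j) = 0" if "j \<in> {1..n}" for j
      using row[of j] that by presburger
    have "alternant n ?z (?c n) (shifted \<kappa> n) = det_fun (Suc m) (\<lambda>i j. npow (?c n) (?z i) (shifted \<kappa> n j))"
      by (simp only: alternant_def n)
    also have "\<dots> = npow (?c n) (?z n) (shifted \<kappa> n n) * det_fun m (\<lambda>i j. npow (?c n) (?z i) (shifted \<kappa> n j))"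
      by (subst det_fun_last_row) (use r0 n in force, simp only: n)
    also have "npow (?c n) (?z n) (shifted \<kappa> n n) = 0"
      by (rule r0) (use n in simp)
    finally have "alternant n ?z (?c n) (shifted \<kappa> n) = 0"
      by (simp only: mult_zero_left)
    then show ?thesis using eq V0 False by (simp add: n dschur_poly_eq_0)
  next
    case pm: True
    have sh: "shifted \<kappa> n j = Suc (shifted \<kappa> m j)" if "j \<in> {1..m}" for j
      using that by (auto simp: shifted_def n)
    have shn: "shifted \<kappa> n n = 0"
      using pm by (simp add: shifted_def part_eq_0[OF pm] n)
    let ?A = "\<lambda>i j. npow (?c n) (?z i) (shifted \<kappa> n j)"
    have A0: "?A (Suc m) j = 0" if "j \<in> {1..m}" for j
      by (simp only: n[symmetric] row) (simp add: sh[OF that])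
    have A1: "?A (Suc m) (Suc m) = 1"
      by (simp only: n[symmetric] row) (simp add: shn)
    have "alternant n ?z (?c n) (shifted \<kappa> n) = det_fun (Suc m) ?A"
      by (simp only: alternant_def n)
    also have "\<dots> = ?A (Suc m) (Suc m) * det_fun m ?A"
      by (rule det_fun_last_row) (rule A0)
    also have "\<dots> = det_fun m ?A"
      unfolding A1 by simp
    also have "\<dots> = det_fun m (\<lambda>i j. (xv i - xconst (av (int n))) * npow (?c m) (xv i) (shifted \<kappa> m j))"
      by (rule det_fun_cong) (simp add: sh npow_Suc', simp add: n)
    also have "\<dots> = (\<Prod>i=1..m. xv i - xconst (av (int n))) * alternant m xv (?c m) (shifted \<kappa> m)"
      unfolding det_fun_scale_rows alternant_def ..
    also have "\<dots> = dschur_poly \<kappa> m * vandermonde ?z n"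
      unfolding V dschur_poly_vandermonde[OF pm, symmetric] by (simp add: mult_ac)
    finally have "xsubst ?z (dschur_poly \<kappa> n) * vandermonde ?z n = dschur_poly \<kappa> m * vandermonde ?z n"
      unfolding eq .
    then have "xsubst ?z (dschur_poly \<kappa> n) = dschur_poly \<kappa> m"
      using V0 mult_right_cancel by blast
    then show ?thesis by (simp only: n diff_Suc_1)
  qed
qed

lemma dschur_poly_symmetric:
  assumes \<sigma>: "\<sigma> permutes {1..n}"
  shows "xsubst (\<lambda>i. xv (\<sigma> i)) (dschur_poly \<kappa> n) = dschur_poly \<kappa> n"
proof (cases "plength \<kappa> \<le> n")
  case True
  let ?c = "\<lambda>t. xconst (nodes n t)"
  let ?\<sigma> = "xsubst (\<lambda>i. xv (\<sigma> i))"
  have "?\<sigma> (dschur_poly \<kappa> n) * vandermonde (\<lambda>i. xv (\<sigma> i)) n =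
      alternant n (\<lambda>i. xv (\<sigma> i)) ?c (shifted \<kappa> n)"
    by (simp add: dschur_poly_eq_fschur[OF True] hom_fschur[OF comm_ring_hom_xsubst]
        fschur_vandermonde shifted_def[abs_def])
  then have "?\<sigma> (dschur_poly \<kappa> n) * vandermonde xv n = dschur_poly \<kappa> n * vandermonde xv n"
    unfolding vandermonde_permute[OF \<sigma>] alternant_permute[OF \<sigma>] dschur_poly_vandermonde[OF True]
    by (cases "evenperm \<sigma>") (simp_all add: sign_def)
  then show ?thesis using vandermonde_xv by simp
qed (simp add: dschur_poly_eq_0)

lemma xbound_dschur_poly: "xbound {1..n} (psize \<kappa>) (dschur_poly \<kappa> n)"
proof (cases "plength \<kappa> \<le> n")
  case True
  then show ?thesis
    using xbound_fschur[of n "\<lambda>i. i" "{1..n}" "part \<kappa>" "nodes n"]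
    by (simp add: dschur_poly_eq_fschur psize_eq)
qed (simp add: dschur_poly_eq_0)

lemma dsym_seqs_xboundI:
  assumes "\<And>n. xbound {1..n} d (P n)"
    and "\<And>n \<sigma>. \<sigma> permutes {1..n} \<Longrightarrow> xsubst (\<lambda>i. xv (\<sigma> i)) (P n) = P n"
    and "\<And>n. n \<ge> 1 \<Longrightarrow> xsubst (xv(n := xconst (av (int n)))) (P n) = P (n - 1)"
  shows "P \<in> dsym_seqs"
  by (rule dsym_seqsI[where d = d]) (use assms in \<open>auto simp: xbound_def xin_def\<close>)

lemma Rep_dschur: "Rep_dsym (dschur \<kappa>) = dschur_poly \<kappa>"
  unfolding dschur_def
  by (rule Abs_dsym_inverse, rule dsym_seqs_xboundI)
    (rule xbound_dschur_poly dschur_poly_symmetric dschur_poly_stable; assumption)+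

lemma Rep_dsym_symmetric:
  "\<sigma> permutes {1..n} \<Longrightarrow> xsubst (\<lambda>i. xv (\<sigma> i)) (Rep_dsym P n) = Rep_dsym P n"
  and Rep_dsym_stable:
  "n \<ge> 1 \<Longrightarrow> xsubst (xv(n := xconst (av (int n)))) (Rep_dsym P n) = Rep_dsym P (n - 1)"
  and Rep_dsym_xbound: "\<exists>d. \<forall>n. xbound {1..n} d (Rep_dsym P n)"
  using Rep_dsym[of P] unfolding dsym_seqs_def xbound_def xin_def by blast+

lemma Rep_dsym_xin: "xin {1..n} (Rep_dsym P n)"
  using Rep_dsym_xbound[of P] by (auto simp: xbound_def)

lemma dsym_eqI: "(\<And>n. Rep_dsym P n = Rep_dsym Q n) \<Longrightarrow> P = Q"
  by (metis Rep_dsym_inject ext)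

lemma Rep_dsym_simps [simp]:
  "Rep_dsym 0 n = 0" "Rep_dsym 1 n = 1" "Rep_dsym (dconst c) n = xconst c"
  "Rep_dsym (P + Q) n = Rep_dsym P n + Rep_dsym Q n"
  "Rep_dsym (P - Q) n = Rep_dsym P n - Rep_dsym Q n"
  "Rep_dsym (P * Q) n = Rep_dsym P n * Rep_dsym Q n"
  "Rep_dsym (- P) n = - Rep_dsym P n"
  "Rep_dsym (dscale c P) n = xconst c * Rep_dsym P n"
  by (simp_all add: zero_dsym.rep_eq one_dsym.rep_eq dconst.rep_eq plus_dsym.rep_eq
      minus_dsym.rep_eq times_dsym.rep_eq uminus_dsym.rep_eq dscale_def)

lemma Rep_dsym_sum: "Rep_dsym (\<Sum>i\<in>A. f i) n = (\<Sum>i\<in>A. Rep_dsym (f i) n)"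
  by (induction A rule: infinite_finite_induct) auto

lemma Rep_dsym_prod: "Rep_dsym (\<Prod>i\<in>A. f i) n = (\<Prod>i\<in>A. Rep_dsym (f i) n)"
  by (induction A rule: infinite_finite_induct) auto

lemma Rep_dpow: "Rep_dsym (dpow k) n = (\<Sum>i=1..n. xv i ^ k - xconst (av (int i)) ^ k)"
proof -
  let ?P = "\<lambda>n. \<Sum>i=1..n. xv i ^ k - xconst (av (int i)) ^ k"
  have "?P \<in> dsym_seqs"
  proof (rule dsym_seqs_xboundI[where d = k])
    fix n
    have "xbound {1..n} k (xv i ^ k)" if "i \<in> {1..n}" for i
      using xbound_power[of "{1..n}" 1 "xv i" k] xbound_xv[OF that, of 1] by simp
    moreover have "xbound {1..n} k (xconst (av (int i)) ^ k)" for i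
      using xbound_const[of "{1..n}" k "av (int i) ^ k"] by (simp add: xconst.hom_power)
    ultimately show "xbound {1..n} k (?P n)"
      by (intro xbound_sum xbound_diff) auto
  next
    fix n :: nat and \<sigma> assume \<sigma>: "\<sigma> permutes {1..n}"
    have "(\<Sum>i=1..n. xv (\<sigma> i) ^ k) = (\<Sum>i=1..n. xv i ^ k)"
      using sum.permute[OF \<sigma>, of "\<lambda>i. xv i ^ k"] by (simp add: o_def)
    then show "xsubst (\<lambda>i. xv (\<sigma> i)) (?P n) = ?P n"
      by (simp add: xsubst.hom_sum xsubst.hom_minus xsubst.hom_power sum_subtractf)
  next
    fix n :: nat assume "n \<ge> 1"
    then obtain m where n: "n = Suc m" by (metis Suc_pred' less_eq_Suc_le One_nat_def)
    show "xsubst (xv(n := xconst (av (int n)))) (?P n) = ?P (n - 1)"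
      by (simp add: n xsubst.hom_sum xsubst.hom_minus xsubst.hom_power atLeastAtMostSuc_conv)
  qed
  then show ?thesis unfolding dpow_def by (simp add: Abs_dsym_inverse)
qed

subsection \<open>Schur expansions\<close>

definition xspan :: "'i set \<Rightarrow> ('i \<Rightarrow> xpoly) \<Rightarrow> xpoly \<Rightarrow> bool" where
  "xspan I b p \<longleftrightarrow> (\<exists>F d. finite F \<and> F \<subseteq> I \<and> p = (\<Sum>i\<in>F. xconst (d i) * b i))"

lemma xspan_basis: "i \<in> I \<Longrightarrow> xspan I b (b i)"
  unfolding xspan_def by (intro exI[of _ "{i}"] exI[of _ "\<lambda>_. 1"]) simp

lemma xspan_0: "xspan I b 0"
  unfolding xspan_def by (intro exI[of _ "{}"]) simp

lemma xspan_scale: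
  assumes "xspan I b p"
  shows "xspan I b (xconst c * p)"
proof -
  from assms obtain F d where F: "finite F" "F \<subseteq> I" "p = (\<Sum>i\<in>F. xconst (d i) * b i)"
    unfolding xspan_def by blast
  have "xconst c * p = (\<Sum>i\<in>F. xconst (c * d i) * b i)"
    unfolding F(3) sum_distrib_left by (simp add: mult.assoc)
  with F(1,2) show ?thesis
    unfolding xspan_def by (intro exI[of _ F] exI[of _ "\<lambda>i. c * d i"] conjI)
qed

lemma xspan_add:
  assumes "xspan I b p" "xspan I b q"
  shows "xspan I b (p + q)"
proof -
  from assms obtain F d G e where F: "finite F" "F \<subseteq> I" "p = (\<Sum>i\<in>F. xconst (d i) * b i)"
    and G: "finite G" "G \<subseteq> I" "q = (\<Sum>i\<in>G. xconst (e i) * b i)"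
    unfolding xspan_def by blast
  let ?d = "\<lambda>i. if i \<in> F then d i else 0" and ?e = "\<lambda>i. if i \<in> G then e i else 0"
  have "p = (\<Sum>i\<in>F \<union> G. xconst (?d i) * b i)"
    unfolding F(3) by (rule sum.mono_neutral_cong_left) (use F G in auto)
  moreover have "q = (\<Sum>i\<in>F \<union> G. xconst (?e i) * b i)"
    unfolding G(3) by (rule sum.mono_neutral_cong_left) (use F G in auto)
  ultimately have "p + q = (\<Sum>i\<in>F \<union> G. xconst (?d i + ?e i) * b i)"
    by (simp only: sum.distrib[symmetric] distrib_right xconst_hom)
  with F G show ?thesis
    unfolding xspan_def by (intro exI[of _ "F \<union> G"] exI[of _ "\<lambda>i. ?d i + ?e i"] conjI) auto
qed

lemma xspan_sum: "(\<And>j. j \<in> A \<Longrightarrow> xspan I b (f j)) \<Longrightarrow> xspan I b (\<Sum>j\<in>A. f j)"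
  by (induction A rule: infinite_finite_induct) (simp_all add: xspan_0 xspan_add)

text \<open>Distinct exponents are a permutation of strictly decreasing ones, and subtracting n - i
  from the i-th of these leaves a partition.\<close>

lemma alternant_sorted:
  fixes z :: "nat \<Rightarrow> 'a::comm_ring_1"
  assumes f: "inj_on f {1..n}"
  shows "\<exists>\<kappa> s. plength \<kappa> \<le> n \<and> alternant n z c f = of_int s * alternant n z c (shifted \<kappa> n)"
proof -
  have card: "card (f ` {1..n}) = n" using card_image[OF f] by simp
  obtain h where h: "bij_betw h {..<n} (f ` {1..n})" "strict_mono_on {..<n} h"
    using ex_bij_betw_strict_mono_card[of "f ` {1..n}"] unfolding card by blast
  have h_less: "h k < h l" if "k < l" "l < n" for k l
    using strict_mono_onD[OF h(2)] that by simp
  have h_ge: "k \<le> h k" if "k < n" for k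
    using that
  proof (induction k)
    case (Suc k)
    then show ?case using h_less[of k "Suc k"] by simp
  qed simp
  \<comment> \<open>The increasing enumeration h read backwards. From h k \<ge> k it follows that g
    i - (n - i) is an untruncated difference.\<close>
  define g where "g i = h (n - i)" for i
  have g_less: "g j < g i" if "1 \<le> i" "i < j" "j \<le> n" for i j
    unfolding g_def by (rule h_less) (use that in auto)
  have g_ge: "n - i \<le> g i" if "1 \<le> i" "i \<le> n" for i
    unfolding g_def by (rule h_ge) (use that in auto)
  have "bij_betw (\<lambda>i. n - i) {1..n} {..<n}"
    by (rule bij_betwI[where g = "\<lambda>i. n - i"]) auto
  then have g: "bij_betw g {1..n} (f ` {1..n})"
    unfolding g_def using bij_betw_trans[OF _ h(1)] by (simp add: o_def)
  \<comment> \<open>The sorting map, extended by the identity so that it is a permutation of all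
    natural numbers supported on {1..n}.\<close>
  define \<sigma> where "\<sigma> i = (if i \<in> {1..n} then inv_into {1..n} f (g i) else i)" for i
  have f': "bij_betw f {1..n} (f ` {1..n})" using f by (rule inj_on_imp_bij_betw)
  have "bij_betw (inv_into {1..n} f \<circ> g) {1..n} {1..n}"
    by (rule bij_betw_trans[OF g bij_betw_inv_into[OF f']])
  then have "bij_betw \<sigma> {1..n} {1..n}"
    by (subst bij_betw_cong[where g = "inv_into {1..n} f \<circ> g"]) (simp_all add: \<sigma>_def)
  then have \<sigma>: "\<sigma> permutes {1..n}"
    by (rule bij_imp_permutes) (simp only: \<sigma>_def if_False)
  have f\<sigma>: "f (\<sigma> i) = g i" if "i \<in> {1..n}" for i
  proof -
    have "g i \<in> f ` {1..n}" using bij_betwE[OF g] that by blast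
    then show ?thesis by (simp only: \<sigma>_def that if_True f_inv_into_f)
  qed
  have "g (Suc i) - (n - Suc i) \<le> g i - (n - i)" if "1 \<le> i" "i < n" for i
    using g_less[of i "Suc i"] that by simp
  from ex_partition[of n "\<lambda>i. g i - (n - i)", OF this]
  obtain \<kappa> where \<kappa>: "plength \<kappa> \<le> n" "\<And>i. i \<in> {1..n} \<Longrightarrow> part \<kappa> i = g i - (n - i)" by blast
  have sh: "shifted \<kappa> n i = g i" if "i \<in> {1..n}" for i
    using \<kappa>(2)[OF that] g_ge[of i] that by (simp add: shifted_def)
  have "alternant n z c (shifted \<kappa> n) = det_fun n (\<lambda>i j. npow c (z i) (f (\<sigma> j)))"
    unfolding alternant_def by (rule det_fun_cong) (simp only: sh f\<sigma>)
  also have "\<dots> = of_int (sign \<sigma>) * alternant n z c f"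
    unfolding alternant_def by (rule det_fun_permute_cols[OF \<sigma>])
  finally have "of_int (sign \<sigma>) * alternant n z c (shifted \<kappa> n) = alternant n z c f"
    by (cases "evenperm \<sigma>") (simp_all add: sign_def)
  with \<kappa>(1) show ?thesis by metis
qed

lemma alternant_not_inj:
  assumes "\<not> inj_on f {1..n}"
  shows "alternant n z c f = 0"
proof -
  obtain i j where "i \<in> {1..n}" "j \<in> {1..n}" "i \<noteq> j" "f i = f j"
    using assms by (auto simp: inj_on_def)
  then show ?thesis
    unfolding alternant_def by (intro det_fun_identical_cols[of i n j]) auto
qed

text \<open>Antisymmetrizing \<open>P\<^sub>n V\<close> multiplies it by \<open>n!\<close>, and turns products of Newton
  polynomials into alternants.\<close>

lemma dschur_poly_spanning: "xspan {\<kappa>. plength \<kappa> \<le> n} (\<lambda>\<kappa>. dschur_poly \<kappa> n) (Rep_dsym P n)"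
proof -
  let ?V = "vandermonde xv n" and ?c = "\<lambda>t. xconst (nodes n t)"
  let ?I = "{\<kappa>. plength \<kappa> \<le> n}" and ?A = "\<lambda>\<kappa>. alternant n xv (\<lambda>t. xconst (nodes n t)) (shifted \<kappa> n)"
  define G where "G = Rep_dsym P n * ?V"
  have "xin {1..n} G"
    unfolding G_def using xin_vandermonde[of n "\<lambda>i. i" "{1..n}"] by (intro xin_mult Rep_dsym_xin) auto
  then obtain F d where F: "finite F" "G = (\<Sum>\<alpha>\<in>F. xconst (d \<alpha>) * (\<Prod>i=1..n. npow ?c (xv i) (\<alpha> i)))"
    using npow_prod_spanning[of "{1..n}" G "nodes n"] by auto
  have "xsubst (\<lambda>i. xv (\<sigma> i)) ?V = of_int (sign \<sigma>) * ?V" if "\<sigma> permutes {1..n}" for \<sigma>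
    by (simp add: hom_vandermonde[OF comm_ring_hom_xsubst] vandermonde_permute[OF that])
  then have "of_int (sign \<sigma>) * xsubst (\<lambda>i. xv (\<sigma> i)) G = G" if "\<sigma> permutes {1..n}" for \<sigma>
    using that by (cases "evenperm \<sigma>") (simp_all add: G_def Rep_dsym_symmetric sign_def)
  then have "(\<Sum>\<sigma> | \<sigma> permutes {1..n}. of_int (sign \<sigma>) * xsubst (\<lambda>i. xv (\<sigma> i)) G) =
      of_nat (fact n) * G"
    by (simp add: card_permutations)
  moreover have "(\<Sum>\<sigma> | \<sigma> permutes {1..n}. of_int (sign \<sigma>) * xsubst (\<lambda>i. xv (\<sigma> i)) G) =
      (\<Sum>\<alpha>\<in>F. xconst (d \<alpha>) * alternant n xv ?c \<alpha>)"
  proof -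
    have "(\<Sum>\<sigma> | \<sigma> permutes {1..n}. of_int (sign \<sigma>) * xsubst (\<lambda>i. xv (\<sigma> i)) G) =
        (\<Sum>\<sigma> | \<sigma> permutes {1..n}. \<Sum>\<alpha>\<in>F. xconst (d \<alpha>) *
          (of_int (sign \<sigma>) * (\<Prod>i=1..n. npow ?c (xv (\<sigma> i)) (\<alpha> i))))"
      unfolding F(2) by (intro sum.cong refl)
        (simp add: xsubst.hom_sum xsubst.hom_prod hom_npow[OF comm_ring_hom_xsubst] sum_distrib_left
          mult.left_commute)
    also have "\<dots> = (\<Sum>\<alpha>\<in>F. xconst (d \<alpha>) * alternant n xv ?c \<alpha>)"
      unfolding alternant_def det_fun_leibniz_col sum_distrib_left by (rule sum.swap)
    finally show ?thesis .
  qed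
  ultimately have fact: "of_nat (fact n) * G = (\<Sum>\<alpha>\<in>F. xconst (d \<alpha>) * alternant n xv ?c \<alpha>)"
    by simp
  have "xspan ?I ?A (alternant n xv ?c \<alpha>)" for \<alpha>
  proof (cases "inj_on \<alpha> {1..n}")
    case True
    then obtain \<kappa> s where "plength \<kappa> \<le> n" "alternant n xv ?c \<alpha> = of_int s * ?A \<kappa>"
      using alternant_sorted by blast
    then show ?thesis
      using xspan_scale[OF xspan_basis[of \<kappa> ?I ?A], of "of_int s"] by (simp add: xconst.hom_of_int)
  qed (simp add: alternant_not_inj xspan_0)
  then have "xspan ?I ?A (of_nat (fact n) * G)"
    unfolding fact by (intro xspan_sum xspan_scale)
  then have "xspan ?I ?A (xconst (Poly_Mapping.single 0 (1 / fact n)) * (of_nat (fact n) * G))"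
    by (rule xspan_scale)
  \<comment> \<open>The coefficients contain the rationals, so the factor n! from antisymmetrization
    can be inverted.\<close>
  moreover have "xconst (Poly_Mapping.single 0 (1 / fact n)) * of_nat (fact n) = 1"
  proof -
    have "Poly_Mapping.single 0 (1 / fact n :: rat) * of_nat (fact n) = (1 :: qa)"
      unfolding single_of_nat[symmetric] mult_single by simp
    then show ?thesis by (metis xconst.hom_mult xconst.hom_of_nat xconst.hom_one)
  qed
  ultimately have "xspan ?I ?A G" by (simp add: mult.assoc[symmetric])
  then obtain E e where E: "finite E" "E \<subseteq> ?I" "G = (\<Sum>\<kappa>\<in>E. xconst (e \<kappa>) * ?A \<kappa>)"
    unfolding xspan_def by blast
  have "Rep_dsym P n * ?V = (\<Sum>\<kappa>\<in>E. xconst (e \<kappa>) * (dschur_poly \<kappa> n * ?V))"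
    unfolding G_def[symmetric] E(3) by (rule sum.cong) (use E(2) in \<open>auto simp: dschur_poly_vandermonde\<close>)
  also have "\<dots> = (\<Sum>\<kappa>\<in>E. xconst (e \<kappa>) * dschur_poly \<kappa> n) * ?V"
    by (simp add: sum_distrib_right mult.assoc)
  finally have "Rep_dsym P n = (\<Sum>\<kappa>\<in>E. xconst (e \<kappa>) * dschur_poly \<kappa> n)"
    using vandermonde_xv[of n] by simp
  with E(1,2) show ?thesis unfolding xspan_def by blast
qed

text \<open>An explicit candidate for the coefficient of s_\<kappa>, computed in n variables. It
  turns out not to depend on n as long as n is at least the length of \<kappa>.\<close>

definition schur_coeff_at :: "nat \<Rightarrow> dsym \<Rightarrow> partition \<Rightarrow> qa" where
  "schur_coeff_at n P \<kappa> =
     ncoeff id (\<lambda>_. 0) (nodes n) {1..n} (shifted \<kappa> n) (Rep_dsym P n * vandermonde xv n)"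

lemma ncoeff_dschur_poly:
  assumes "comm_ring_hom \<phi>" "plength \<kappa> \<le> n"
  shows "ncoeff \<phi> h (nodes n) {1..n} (shifted \<kappa> n) (dschur_poly \<mu> n * vandermonde xv n) =
    (if \<mu> = \<kappa> then 1 else 0)"
proof (cases "plength \<mu> \<le> n")
  case True
  then show ?thesis
    using ncoeff_alternant[OF assms(1), of "\<lambda>i. i" n "shifted \<kappa> n" "shifted \<mu> n" h "nodes n"]
      shifted_inject[OF assms(2) True]
    by (simp add: dschur_poly_vandermonde shifted_strict eq_commute[of \<kappa> \<mu>])
next
  case False
  then show ?thesis using assms by (auto simp: dschur_poly_eq_0 ncoeff_0[OF assms(1)])
qed

lemma schur_coeff_at_sum:
  assumes "Rep_dsym P n = (\<Sum>\<mu>\<in>F. xconst (d \<mu>) * dschur_poly \<mu> n)" "finite F" "plength \<kappa> \<le> n"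
  shows "schur_coeff_at n P \<kappa> = (if \<kappa> \<in> F then d \<kappa> else 0)"
proof -
  note nc = comm_ring_hom_id finite_atLeastAtMost[of 1 n]
  have "schur_coeff_at n P \<kappa> = (\<Sum>\<mu>\<in>F. d \<mu> * (if \<mu> = \<kappa> then 1 else 0))"
    unfolding schur_coeff_at_def assms(1) sum_distrib_right mult.assoc ncoeff_sum[OF nc]
      ncoeff_const_mult[OF nc] ncoeff_dschur_poly[OF comm_ring_hom_id assms(3)] by simp
  also have "\<dots> = (\<Sum>\<mu>\<in>F. if \<mu> = \<kappa> then d \<mu> else 0)"
    by (rule sum.cong) auto
  also have "\<dots> = (if \<kappa> \<in> F then d \<kappa> else 0)"
    using assms(2) by (rule sum.delta)
  finally show ?thesis .
qed

text \<open>Setting the last variable to its a-value maps an expansion in n + 1 variables to one in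
  n variables with the same coefficients; the partitions with n + 1 parts just disappear.\<close>

lemma schur_coeff_at_Suc:
  assumes "plength \<kappa> \<le> n"
  shows "schur_coeff_at (Suc n) P \<kappa> = schur_coeff_at n P \<kappa>"
proof -
  obtain F d where F: "finite F" "Rep_dsym P (Suc n) = (\<Sum>\<mu>\<in>F. xconst (d \<mu>) * dschur_poly \<mu> (Suc n))"
    using dschur_poly_spanning[of "Suc n" P] unfolding xspan_def by blast
  have "Rep_dsym P n = (\<Sum>\<mu>\<in>F. xconst (d \<mu>) * dschur_poly \<mu> n)"
    using Rep_dsym_stable[of "Suc n" P] dschur_poly_stable[of "Suc n"]
    by (simp add: F(2) xsubst.hom_sum)
  from schur_coeff_at_sum[OF this F(1) assms] schur_coeff_at_sum[OF F(2,1)] assms show ?thesis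
    by simp
qed

lemma schur_coeff_at_plength:
  "plength \<kappa> \<le> n \<Longrightarrow> schur_coeff_at n P \<kappa> = schur_coeff_at (plength \<kappa>) P \<kappa>"
  by (induction n rule: dec_induct) (simp_all add: schur_coeff_at_Suc)

text \<open>The Vandermonde product contributes the sum of n - i to the degree, which is exactly the
  excess of the exponent sum of the alternant over |\<kappa>|.\<close>

lemma schur_coeff_at_degree:
  assumes "xbound {1..n} d (Rep_dsym P n)" "plength \<kappa> \<le> n" "d < psize \<kappa>"
  shows "schur_coeff_at n P \<kappa> = 0"
  unfolding schur_coeff_at_def
proof (rule ncoeff_degree[OF comm_ring_hom_id])
  have "xbound {1..n} (\<Sum>i=1..n. \<Sum>j\<in>{i<..n}. 1) (vandermonde xv n)"
    unfolding vandermonde_def by (intro xbound_prod xbound_diff xbound_xv) auto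
  then show "xbound {1..n} (d + (\<Sum>i=1..n. n - i)) (Rep_dsym P n * vandermonde xv n)"
    by (intro xbound_mult assms(1)) simp
  have "(\<Sum>i=1..n. shifted \<kappa> n i) = (\<Sum>i=1..n. part \<kappa> i + (n - i))"
    by (rule sum.cong) (auto simp: shifted_def)
  then show "d + (\<Sum>i=1..n. n - i) < (\<Sum>i=1..n. shifted \<kappa> n i)"
    using assms(3) unfolding sum.distrib psize_eq[OF assms(2)] by simp
qed simp

text \<open>The degree bound is uniform in n, so the expansions of all components fit one finite
  index set with common coefficients. Partitions longer than n may be included because their
  polynomial is 0.\<close>

lemma schur_expansion_bounded:
  assumes d: "\<And>n. xbound {1..n} d (Rep_dsym P n)"
  shows "P = (\<Sum>\<kappa> | psize \<kappa> \<le> d. dscale (schur_coeff_at (plength \<kappa>) P \<kappa>) (dschur \<kappa>))"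
proof (rule dsym_eqI)
  fix n
  let ?D = "{\<kappa>. psize \<kappa> \<le> d}" and ?c = "\<lambda>\<kappa>. schur_coeff_at (plength \<kappa>) P \<kappa>"
  obtain F e where F: "finite F" "F \<subseteq> {\<kappa>. plength \<kappa> \<le> n}"
      "Rep_dsym P n = (\<Sum>\<mu>\<in>F. xconst (e \<mu>) * dschur_poly \<mu> n)"
    using dschur_poly_spanning[of n P] unfolding xspan_def by blast
  have c: "?c \<kappa> = (if \<kappa> \<in> F then e \<kappa> else 0)" if "plength \<kappa> \<le> n" for \<kappa>
    using schur_coeff_at_sum[OF F(3,1) that] schur_coeff_at_plength[OF that] by simp
  have "Rep_dsym P n = (\<Sum>\<mu>\<in>F. xconst (?c \<mu>) * dschur_poly \<mu> n)"
    unfolding F(3) by (rule sum.cong) (use F(2) c in auto)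
  also have "\<dots> = (\<Sum>\<mu>\<in>F \<union> ?D. xconst (?c \<mu>) * dschur_poly \<mu> n)"
  proof (rule sum.mono_neutral_left)
    show "\<forall>\<mu>\<in>F \<union> ?D - F. xconst (?c \<mu>) * dschur_poly \<mu> n = 0"
    proof
      fix \<mu> assume \<mu>: "\<mu> \<in> F \<union> ?D - F"
      show "xconst (?c \<mu>) * dschur_poly \<mu> n = 0"
        using \<mu> c[of \<mu>] dschur_poly_eq_0[of n \<mu>] by (cases "plength \<mu> \<le> n") simp_all
    qed
  qed (use F(1) finite_psize_le in auto)
  also have "\<dots> = (\<Sum>\<mu>\<in>?D. xconst (?c \<mu>) * dschur_poly \<mu> n)"
  proof (rule sum.mono_neutral_right)
    show "\<forall>\<mu>\<in>F \<union> ?D - ?D. xconst (?c \<mu>) * dschur_poly \<mu> n = 0"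
    proof
      fix \<mu> assume "\<mu> \<in> F \<union> ?D - ?D"
      then have "?c \<mu> = 0" by (intro schur_coeff_at_degree[OF d]) auto
      then show "xconst (?c \<mu>) * dschur_poly \<mu> n = 0" by simp
    qed
  qed (use F(1) finite_psize_le in auto)
  finally show "Rep_dsym P n = Rep_dsym (\<Sum>\<kappa>\<in>?D. dscale (?c \<kappa>) (dschur \<kappa>)) n"
    by (simp add: Rep_dsym_sum Rep_dschur)
qed

lemma schur_coeffs_eq_at_plength: "schur_coeffs P \<kappa> = schur_coeff_at (plength \<kappa>) P \<kappa>"
proof -
  let ?c = "\<lambda>\<kappa>. schur_coeff_at (plength \<kappa>) P \<kappa>"
  obtain d where d: "\<And>n. xbound {1..n} d (Rep_dsym P n)" using Rep_dsym_xbound by blast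
  have sub: "{\<kappa>. ?c \<kappa> \<noteq> 0} \<subseteq> {\<kappa>. psize \<kappa> \<le> d}"
    using schur_coeff_at_degree[OF d] by (auto simp: not_le[symmetric])
  have "schur_coeffs P = ?c"
    unfolding schur_coeffs_def
  proof (rule the_equality)
    have "P = (\<Sum>\<kappa> | ?c \<kappa> \<noteq> 0. dscale (?c \<kappa>) (dschur \<kappa>))"
      by (subst schur_expansion_bounded[OF d], rule sum.mono_neutral_right)
        (use finite_psize_le sub in \<open>auto intro: dsym_eqI\<close>)
    then show "finite {\<kappa>. ?c \<kappa> \<noteq> 0} \<and> P = (\<Sum>\<kappa> | ?c \<kappa> \<noteq> 0. dscale (?c \<kappa>) (dschur \<kappa>))"
      using finite_subset[OF sub finite_psize_le] by blast
  next
    fix c assume c: "finite {\<kappa>. c \<kappa> \<noteq> 0} \<and> P = (\<Sum>\<kappa> | c \<kappa> \<noteq> 0. dscale (c \<kappa>) (dschur \<kappa>))"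
    show "c = ?c"
    proof
      fix \<kappa>
      have "Rep_dsym P (plength \<kappa>) = (\<Sum>\<mu> | c \<mu> \<noteq> 0. xconst (c \<mu>) * dschur_poly \<mu> (plength \<kappa>))"
        by (subst conjunct2[OF c]) (simp add: Rep_dsym_sum Rep_dschur)
      from schur_coeff_at_sum[OF this] c show "c \<kappa> = ?c \<kappa>" by simp
    qed
  qed
  then show ?thesis by simp
qed

lemma schur_coeffs_eq: "plength \<kappa> \<le> n \<Longrightarrow> schur_coeffs P \<kappa> = schur_coeff_at n P \<kappa>"
  by (metis schur_coeffs_eq_at_plength schur_coeff_at_plength)

lemma schur_expansion:
  obtains F where "finite F" "P = (\<Sum>\<kappa>\<in>F. dscale (schur_coeffs P \<kappa>) (dschur \<kappa>))"
    "\<And>\<kappa>. \<kappa> \<notin> F \<Longrightarrow> schur_coeffs P \<kappa> = 0"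
proof -
  obtain d where d: "\<And>n. xbound {1..n} d (Rep_dsym P n)" using Rep_dsym_xbound by blast
  show ?thesis
  proof (rule that[of "{\<kappa>. psize \<kappa> \<le> d}"])
    show "P = (\<Sum>\<kappa> | psize \<kappa> \<le> d. dscale (schur_coeffs P \<kappa>) (dschur \<kappa>))"
      using schur_expansion_bounded[OF d] by (simp only: schur_coeffs_eq_at_plength)
  qed (use finite_psize_le schur_coeff_at_degree[OF d] in \<open>auto simp: schur_coeffs_eq_at_plength\<close>)
qed

lemma schur_coeffs_add: "schur_coeffs (P + Q) \<kappa> = schur_coeffs P \<kappa> + schur_coeffs Q \<kappa>"
  unfolding schur_coeffs_eq_at_plength schur_coeff_at_def
  by (simp add: distrib_right ncoeff_add[OF comm_ring_hom_id])

lemma schur_coeffs_dscale: "schur_coeffs (dscale c P) \<kappa> = c * schur_coeffs P \<kappa>"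
  unfolding schur_coeffs_eq_at_plength schur_coeff_at_def
  by (simp add: mult.assoc ncoeff_const_mult[OF comm_ring_hom_id])

lemma schur_coeffs_0 [simp]: "schur_coeffs 0 \<kappa> = 0"
  using schur_coeffs_add[of 0 0 \<kappa>] by simp

lemma schur_coeffs_sum: "schur_coeffs (\<Sum>i\<in>A. f i) \<kappa> = (\<Sum>i\<in>A. schur_coeffs (f i) \<kappa>)"
  by (induction A rule: infinite_finite_induct) (simp_all add: schur_coeffs_add)

lemma schur_coeffs_dschur: "schur_coeffs (dschur \<mu>) \<kappa> = (if \<mu> = \<kappa> then 1 else 0)"
  unfolding schur_coeffs_eq_at_plength schur_coeff_at_def Rep_dschur
  by (rule ncoeff_dschur_poly[OF comm_ring_hom_id order_refl])

lemma dschur_empty: "dschur empty_part = 1"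
proof (rule dsym_eqI)
  fix n
  have "part empty_part = (\<lambda>_. 0)" by (simp add: empty_part.rep_eq)
  moreover have "plength empty_part = 0" by (simp add: plength_def empty_part.rep_eq)
  ultimately show "Rep_dsym (dschur empty_part) n = Rep_dsym 1 n"
    by (simp add: Rep_dschur dschur_poly_eq_fschur fschur_empty)
qed

section \<open>Triangularity of multiplication on Schur functions\<close>

lemma part_le_iff: "part_le \<mu> \<nu> \<longleftrightarrow> (\<forall>i. part \<mu> i \<le> part \<nu> i)"
proof
  assume *: "part_le \<mu> \<nu>"
  show "\<forall>i. part \<mu> i \<le> part \<nu> i"
  proof
    fix i
    show "part \<mu> i \<le> part \<nu> i"
    proof (cases "part \<mu> i = 0")
      case False
      then have "(i, part \<mu> i) \<in> diagram \<mu>"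
        using part_pos_iff[of \<mu> i] by (auto simp: diagram_def One_nat_def)
      with * show ?thesis by (auto simp: part_le_def diagram_def)
    qed simp
  qed
qed (auto simp: part_le_def diagram_def intro: le_trans)

lemma Rep_mult_dschur_vandermonde:
  assumes "plength \<mu> \<le> n"
  shows "Rep_dsym (P * dschur \<mu>) n * vandermonde xv n =
    Rep_dsym P n * alternant n xv (\<lambda>t. xconst (nodes n t)) (shifted \<mu> n)"
  by (simp add: Rep_dschur mult.assoc dschur_poly_vandermonde[OF assms])

text \<open>The diagonal entry of the triangular matrix: the node with number \<mu>_i + n - i is
  a_(i - \<mu>_i), the i-th entry of a_\<mu>.\<close>

lemma schur_coeffs_mult_same: "schur_coeffs (P * dschur \<mu>) \<mu> = dval P \<mu>"
proof -
  let ?n = "plength \<mu>"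
  have "schur_coeffs (P * dschur \<mu>) \<mu> =
      poly_subst id (\<lambda>i. nodes ?n (shifted \<mu> ?n i)) (Rep_dsym P ?n)"
    unfolding schur_coeffs_eq_at_plength schur_coeff_at_def Rep_mult_dschur_vandermonde[OF order_refl]
    by (rule ncoeff_mult_alternant(1)[OF Rep_dsym_xin shifted_strict])
  also have "\<dots> = dval P \<mu>"
    unfolding dval_def
    by (rule poly_subst_cong[OF comm_ring_hom_id Rep_dsym_xin]) (auto simp: shifted_def of_nat_diff)
  finally show ?thesis .
qed

text \<open>Dominance of the shifted exponents in sufficiently many variables is containment of the
  diagrams.\<close>

lemma schur_coeffs_mult_nonzero:
  assumes "schur_coeffs (P * dschur \<mu>) \<nu> \<noteq> 0"
  shows "part_le \<mu> \<nu>"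
  unfolding part_le_iff
proof
  fix i
  let ?n = "max (plength \<mu>) (plength \<nu>)"
  have "ncoeff id (\<lambda>_. 0) (nodes ?n) {1..?n} (shifted \<nu> ?n)
      (Rep_dsym P ?n * alternant ?n xv (\<lambda>t. xconst (nodes ?n t)) (shifted \<mu> ?n)) \<noteq> 0"
    using assms unfolding schur_coeffs_eq[OF max.cobounded2[of "plength \<nu>" "plength \<mu>"]]
      schur_coeff_at_def Rep_mult_dschur_vandermonde[OF max.cobounded1[of "plength \<mu>" "plength \<nu>"]] .
  then have le: "shifted \<mu> ?n i \<le> shifted \<nu> ?n i" if "i \<in> {1..?n}"
    by (rule ncoeff_mult_alternant(2)[OF Rep_dsym_xin, rotated 2])
      (simp_all only: shifted_strict shifted_antimono that)
  show "part \<mu> i \<le> part \<nu> i"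
  proof (cases "i \<in> {1..?n}")
    case True
    then have "i \<le> ?n" by simp
    moreover have "part \<mu> i + ?n - i \<le> part \<nu> i + ?n - i"
      using le[OF True] unfolding shifted_def .
    ultimately show ?thesis by linarith
  next
    case False
    then show ?thesis by (cases "i = 0") (auto simp: part_eq_0[OF order_refl])
  qed
qed


subsection \<open>The Pieri rule\<close>

lemma add_box_iff: "add_box \<mu> \<nu> \<longleftrightarrow> (\<exists>j\<ge>1. part \<nu> = (part \<mu>)(j := Suc (part \<mu> j)))"
proof
  assume "add_box \<mu> \<nu>"
  then obtain j k where jk: "(j, k) \<notin> diagram \<mu>" "diagram \<nu> = insert (j, k) (diagram \<mu>)"
    by (auto simp: add_box_def)
  have row: "{l. (i, l) \<in> diagram \<kappa>} = {1..part \<kappa> i}" if "i \<ge> 1" for i \<kappa>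
    using that by (auto simp: diagram_def)
  have "(j, k) \<in> diagram \<nu>" using jk by simp
  then have j: "j \<ge> 1" by (simp add: diagram_def)
  have "part \<nu> i = ((part \<mu>)(j := Suc (part \<mu> j))) i" for i
  proof (cases "i = 0")
    case False
    then have i: "i \<ge> 1" by simp
    have "{1..part \<nu> i} = (if i = j then insert k {1..part \<mu> i} else {1..part \<mu> i})"
      unfolding row[OF i, symmetric] jk(2) by auto
    then have "card {1..part \<nu> i} = card (if i = j then insert k {1..part \<mu> i} else {1..part \<mu> i})"
      by (rule arg_cong)
    moreover have "k \<notin> {1..part \<mu> j}"
      using jk(1) j by (auto simp: diagram_def)
    ultimately show ?thesis
      by (cases "i = j") simp_all
  qed (use j in simp)
  then show "\<exists>j\<ge>1. part \<nu> = (part \<mu>)(j := Suc (part \<mu> j))" using j by blast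
next
  assume "\<exists>j\<ge>1. part \<nu> = (part \<mu>)(j := Suc (part \<mu> j))"
  then obtain j where j: "j \<ge> 1" "part \<nu> = (part \<mu>)(j := Suc (part \<mu> j))" by blast
  have "diagram \<nu> = insert (j, Suc (part \<mu> j)) (diagram \<mu>)"
    unfolding diagram_def j(2) using j(1) by (auto split: if_splits)
  moreover have "(j, Suc (part \<mu> j)) \<notin> diagram \<mu>" by (simp add: diagram_def)
  ultimately show "add_box \<mu> \<nu>" unfolding add_box_def by blast
qed

lemma add_box_bounds:
  assumes "add_box \<mu> \<nu>"
  shows "plength \<nu> \<le> Suc (plength \<mu>)" "plength \<mu> \<le> plength \<nu>" "psize \<nu> = Suc (psize \<mu>)"
proof -
  obtain j where j: "j \<ge> 1" "part \<nu> = (part \<mu>)(j := Suc (part \<mu> j))"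
    using assms add_box_iff by blast
  have "j \<le> Suc (plength \<mu>)"
  proof (rule ccontr)
    assume "\<not> ?thesis"
    then have "part \<mu> (j - 1) = 0" "j - 1 \<ge> 1" "j - 1 \<noteq> j" "part \<mu> j = 0"
      by (auto intro!: part_eq_0[OF order_refl])
    then have "part \<nu> (j - 1) = 0" "part \<nu> j = 1" by (simp_all add: j(2) One_nat_def)
    moreover have "part \<nu> j \<le> part \<nu> (j - 1)"
      using \<open>j - 1 \<ge> 1\<close> by (intro part_antimono) auto
    ultimately show False by simp
  qed
  then show len: "plength \<nu> \<le> Suc (plength \<mu>)"
    unfolding plength_le_iff by (auto simp: j(2) part_eq_0[OF order_refl])
  show "plength \<mu> \<le> plength \<nu>"
    unfolding plength_le_iff
  proof (intro allI impI)
    fix i assume "plength \<nu> < i"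
    then have "part \<nu> i = 0" by (rule part_eq_0[OF order_refl])
    then show "part \<mu> i = 0" by (simp add: j(2) split: if_splits)
  qed
  let ?n = "Suc (plength \<mu>)"
  have "(\<Sum>i=1..?n. part \<nu> i) = (\<Sum>i=1..?n. part \<mu> i + (if i = j then 1 else 0))"
    by (rule sum.cong) (auto simp: j(2))
  also have "\<dots> = Suc (\<Sum>i=1..?n. part \<mu> i)"
    unfolding sum.distrib sum.delta[OF finite_atLeastAtMost] using \<open>j \<le> ?n\<close> j(1) by simp
  finally show "psize \<nu> = Suc (psize \<mu>)"
    by (simp only: psize_eq[OF len] psize_eq[of \<mu> ?n, OF le_SucI[OF order_refl]])
qed

lemma finite_add_box_above: "finite {\<nu>. add_box \<mu> \<nu>}"
  by (rule finite_subset[OF _ finite_psize_le[of "Suc (psize \<mu>)"]]) (auto simp: add_box_bounds(3))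

lemma finite_add_box_below: "finite {\<mu>. add_box \<mu> \<nu>}"
  by (rule finite_subset[OF _ finite_psize_le[of "psize \<nu>"]]) (auto dest: add_box_bounds(3))

section \<open>Differences |a_\<rho>| - |a_\<sigma>|\<close>

lemma adiff_eq_sum:
  assumes "plength \<rho> \<le> n" "plength \<sigma> \<le> n"
  shows "adiff \<rho> \<sigma> = (\<Sum>i=1..n. av (int i - int (part \<rho> i)) - av (int i - int (part \<sigma> i)))"
  unfolding adiff_def
proof (rule sum.mono_neutral_left)
  show "{i. part \<rho> i \<noteq> part \<sigma> i} \<subseteq> {1..n}"
  proof
    fix i assume "i \<in> {i. part \<rho> i \<noteq> part \<sigma> i}"
    moreover from this have "i \<noteq> 0" by (auto intro: gr0I)
    moreover have "i \<le> n"
      using calculation(1) part_eq_0[OF assms(1), of i] part_eq_0[OF assms(2), of i]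
      by (cases "i \<le> n") simp_all
    ultimately show "i \<in> {1..n}" by simp
  qed
qed auto

text \<open>Normalizing at the empty partition turns the formal difference of two infinite sums into
  a genuine difference of values of one function, as divided differences require.\<close>

lemma adiff_empty: "adiff \<rho> \<sigma> = adiff \<rho> empty_part - adiff \<sigma> empty_part"
proof -
  let ?n = "max (plength \<rho>) (plength \<sigma>)"
  have "plength empty_part = 0" by (simp add: plength_def empty_part.rep_eq)
  then show ?thesis
    by (simp add: adiff_eq_sum[where n = ?n] sum_subtractf[symmetric])
qed

text \<open>In the first row i where the partitions differ, with \<rho> the longer, the variable
  a_(i - \<rho>_i) occurs only once in a_\<rho> because k - \<rho>_k increases strictly with k. It
  does not occur in a_\<sigma>: earlier entries are those of \<rho>, and later ones have index at
  least i - \<sigma>_i, which is larger. So its coefficient is 1.\<close>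

lemma adiff_nonzero_aux:
  assumes eq: "\<And>k. k < i \<Longrightarrow> part \<rho> k = part \<sigma> k" and i: "part \<sigma> i < part \<rho> i"
  shows "adiff \<rho> \<sigma> \<noteq> 0"
proof -
  let ?n = "max (plength \<rho>) (plength \<sigma>)"
  let ?v = "Poly_Mapping.single (int i - int (part \<rho> i)) 1"
  have "i \<noteq> 0" using i by (intro notI) simp
  moreover have "i \<le> plength \<rho>"
    using i part_pos_iff[of \<rho> i] by simp
  ultimately have i_in: "i \<in> {1..?n}" by simp
  have lookup: "Poly_Mapping.lookup (av k) ?v = (if k = int i - int (part \<rho> i) then 1 else 0)" for k
  proof -
    have "Poly_Mapping.single k (1::nat) = ?v \<longleftrightarrow> k = int i - int (part \<rho> i)"
      by (metis inj_onD lookup_single_eq lookup_single_not_eq zero_neq_one)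
    then show ?thesis by (simp add: av_def lookup_single when_def)
  qed
  have \<rho>: "int k - int (part \<rho> k) = int i - int (part \<rho> i) \<longleftrightarrow> k = i" if "k \<in> {1..?n}" for k
  proof -
    consider "k < i" | "k = i" | "i < k" by linarith
    then show ?thesis
    proof cases
      case 1
      then show ?thesis using part_antimono[of k i \<rho>] that by simp
    next
      case 3
      then show ?thesis using part_antimono[of i k \<rho>] i_in by simp
    qed simp
  qed
  have \<sigma>: "int k - int (part \<sigma> k) \<noteq> int i - int (part \<rho> i)" if "k \<in> {1..?n}" for k
  proof (cases "k < i")
    case True
    then show ?thesis using part_antimono[of k i \<rho>] that eq[OF True] by simp
  next
    case False
    then show ?thesis using part_antimono[of i k \<sigma>] i_in i by simp
  qed
  have "Poly_Mapping.lookup (adiff \<rho> \<sigma>) ?v = (\<Sum>k=1..?n. if k = i then 1 else 0)"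
    by (simp only: adiff_eq_sum[OF max.cobounded1 max.cobounded2] lookup_sum lookup_minus lookup
        \<rho> \<sigma> if_False diff_0_right cong: sum.cong)
  also have "\<dots> = 1" using i_in by simp
  finally show ?thesis by auto
qed

lemma adiff_nonzero:
  assumes "\<rho> \<noteq> \<sigma>"
  shows "adiff \<rho> \<sigma> \<noteq> 0"
proof -
  have "\<exists>i. part \<rho> i \<noteq> part \<sigma> i" using assms partition_eqI by blast
  define i where "i = (LEAST i. part \<rho> i \<noteq> part \<sigma> i)"
  have i: "part \<rho> i \<noteq> part \<sigma> i"
    unfolding i_def by (rule LeastI_ex) fact
  have eq: "part \<rho> k = part \<sigma> k" if "k < i" for k
    using not_less_Least[OF that[unfolded i_def]] by blast
  show ?thesis
  proof (cases "part \<sigma> i < part \<rho> i")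
    case True
    then show ?thesis using adiff_nonzero_aux eq by blast
  next
    case False
    then have "adiff \<sigma> \<rho> \<noteq> 0" using i eq by (intro adiff_nonzero_aux[of i]) auto
    then show ?thesis using adiff_empty[of \<rho> \<sigma>] adiff_empty[of \<sigma> \<rho>] by simp
  qed
qed

lemma dsym_eqI_large:
  assumes "\<And>n. n \<ge> N \<Longrightarrow> Rep_dsym P n = Rep_dsym Q n"
  shows "P = Q"
proof (rule dsym_eqI)
  have down: "Rep_dsym P (N - k) = Rep_dsym Q (N - k)" for k
  proof (induction k)
    case (Suc k)
    show ?case
    proof (cases "N - k \<ge> 1")
      case True
      have eq: "N - Suc k = N - k - 1" by simp
      show ?thesis
        unfolding eq Rep_dsym_stable[OF True, symmetric] Suc ..
    qed (use Suc in simp)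
  qed (use assms in simp)
  fix n
  show "Rep_dsym P n = Rep_dsym Q n"
    using assms[of n] down[of "N - n"] by (cases "n \<ge> N") simp_all
qed

lemma det_fun_col_add_scaled:
  assumes "j \<in> {1..n}"
  shows "det_fun n (\<lambda>i k. if k = j then B i + d * A i k else A i k) =
    det_fun n (\<lambda>i k. if k = j then B i else A i k) + d * det_fun n A"
proof -
  have "(\<Prod>k=1..n. if k = j then B (p k) + d * A (p k) k else A (p k) k) =
      (\<Prod>k=1..n. if k = j then B (p k) else A (p k) k) + d * (\<Prod>k=1..n. A (p k) k)"
    for p :: "nat \<Rightarrow> nat"
  proof -
    have "(\<Prod>k\<in>{1..n} - {j}. if k = j then F k else A (p k) k) = (\<Prod>k\<in>{1..n} - {j}. A (p k) k)"
      for F by (rule prod.cong) auto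
    then show ?thesis
      using assms by (simp add: prod.remove[of "{1..n}" j] distrib_right mult.assoc)
  qed
  then show ?thesis
    unfolding det_fun_leibniz_col by (simp add: sum.distrib distrib_left sum_distrib_left mult.left_commute)
qed

text \<open>Apply \<open>det_fun_derivation\<close> and expand x times a Newton polynomial in the
  Newton basis, one column at a time: the exponent is raised by 1, or the node comes out as a
  scalar.\<close>

lemma pieri_alternant:
  "(\<Sum>i=1..n. z i) * alternant n z c \<alpha> =
    (\<Sum>j=1..n. alternant n z c (\<alpha>(j := Suc (\<alpha> j)))) + (\<Sum>j=1..n. c (\<alpha> j)) * alternant n z c \<alpha>"
proof -
  have "det_fun n (\<lambda>i k. if k = j then z i * npow c (z i) (\<alpha> k) else npow c (z i) (\<alpha> k)) =
      alternant n z c (\<alpha>(j := Suc (\<alpha> j))) + c (\<alpha> j) * alternant n z c \<alpha>" if j: "j \<in> {1..n}" for j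
  proof -
    have "det_fun n (\<lambda>i k. if k = j then z i * npow c (z i) (\<alpha> k) else npow c (z i) (\<alpha> k)) =
        det_fun n (\<lambda>i k. if k = j then npow c (z i) (Suc (\<alpha> j)) + c (\<alpha> j) * npow c (z i) (\<alpha> k)
          else npow c (z i) (\<alpha> k))"
      by (rule det_fun_cong) (simp add: npow_Suc algebra_simps)
    also have "\<dots> = det_fun n (\<lambda>i k. if k = j then npow c (z i) (Suc (\<alpha> j)) else npow c (z i) (\<alpha> k))
        + c (\<alpha> j) * alternant n z c \<alpha>"
      unfolding alternant_def by (rule det_fun_col_add_scaled[OF j])
    also have "det_fun n (\<lambda>i k. if k = j then npow c (z i) (Suc (\<alpha> j)) else npow c (z i) (\<alpha> k)) =
        alternant n z c (\<alpha>(j := Suc (\<alpha> j)))"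
      unfolding alternant_def by (rule det_fun_cong) simp
    finally show ?thesis .
  qed
  then have "(\<Sum>j=1..n. det_fun n (\<lambda>i k. if k = j then z i * npow c (z i) (\<alpha> k) else npow c (z i) (\<alpha> k))) =
      (\<Sum>j=1..n. alternant n z c (\<alpha>(j := Suc (\<alpha> j))) + c (\<alpha> j) * alternant n z c \<alpha>)"
    by (rule sum.cong[OF refl])
  moreover have "(\<Sum>i=1..n. z i) * alternant n z c \<alpha> =
      (\<Sum>j=1..n. det_fun n (\<lambda>i k. if k = j then z i * npow c (z i) (\<alpha> k) else npow c (z i) (\<alpha> k)))"
    unfolding alternant_def by (rule det_fun_derivation)
  ultimately show ?thesis
    by (simp only: sum.distrib sum_distrib_right)
qed

text \<open>Raising exponent j either adds a box in row j or makes it equal to exponent j - 1, and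
  then two columns coincide. One variable beyond the length of \<mu> leaves room for a box in a new
  row.\<close>

lemma sum_add_box_alternant:
  assumes n: "n \<ge> Suc (plength \<mu>)"
  shows "(\<Sum>j=1..n. alternant n z c ((shifted \<mu> n)(j := Suc (shifted \<mu> n j)))) =
    (\<Sum>\<nu> | add_box \<mu> \<nu>. alternant n z c (shifted \<nu> n))"
proof -
  let ?up = "\<lambda>j. (part \<mu>)(j := Suc (part \<mu> j))"
  let ?J = "{j\<in>{1..n}. \<exists>\<nu>. part \<nu> = ?up j}"
  let ?a = "\<lambda>j. alternant n z c ((shifted \<mu> n)(j := Suc (shifted \<mu> n j)))"
  define \<nu> where "\<nu> j = (SOME \<nu>. part \<nu> = ?up j)" for j
  have \<nu>: "part (\<nu> j) = ?up j" if "j \<in> ?J" for j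
    unfolding \<nu>_def using that by (intro someI_ex[of "\<lambda>\<nu>. part \<nu> = ?up j"]) blast
  have zero: "?a j = 0" if j: "j \<in> {1..n}" "\<nexists>\<nu>. part \<nu> = ?up j" for j
  proof -
    have "j \<noteq> 1 \<and> part \<mu> (j - 1) = part \<mu> j"
    proof (rule ccontr)
      assume *: "\<not> ?thesis"
      have "?up j (Suc i) \<le> ?up j i" if i: "1 \<le> i" for i
      proof (cases "Suc i = j")
        case True
        then have "part \<mu> i \<noteq> part \<mu> (Suc i)" using * i by auto
        then show ?thesis using part_Suc_le[OF i, of \<mu>] True by auto
      next
        case False
        then show ?thesis using part_Suc_le[OF i, of \<mu>] by auto
      qed
      moreover have "{i. ?up j i \<noteq> 0} \<subseteq> insert j {i. part \<mu> i \<noteq> 0}" by auto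
      then have "finite {i. ?up j i \<noteq> 0}" by (rule finite_subset) (simp only: finite_insert finite_part)
      moreover have "?up j 0 = 0" using j by auto
      ultimately have "part (Abs_partition (?up j)) = ?up j"
        by (intro Abs_partition_inverse) blast
      with j(2) show False by blast
    qed
    then have "j - 1 \<in> {1..n}" "j - 1 \<noteq> j" "shifted \<mu> n (j - 1) = Suc (shifted \<mu> n j)"
      using j(1) by (auto simp: shifted_def)
    then show ?thesis
      unfolding alternant_def using j(1)
      by (intro det_fun_identical_cols[of "j - 1" n j]) simp_all
  qed
  have "(\<Sum>j=1..n. ?a j) = (\<Sum>j\<in>?J. ?a j)"
    by (rule sum.mono_neutral_right) (use zero in blast)+
  also have "\<dots> = (\<Sum>j\<in>?J. alternant n z c (shifted (\<nu> j) n))"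
  proof (rule sum.cong[OF refl], rule alternant_cong)
    fix j i assume "j \<in> ?J" "i \<in> {1..n}"
    then show "((shifted \<mu> n)(j := Suc (shifted \<mu> n j))) i = shifted (\<nu> j) n i"
      using \<nu>[of j] by (auto simp: shifted_def)
  qed simp
  also have "\<dots> = (\<Sum>\<nu> | add_box \<mu> \<nu>. alternant n z c (shifted \<nu> n))"
  proof (rule sum.reindex_bij_betw)
    show "bij_betw \<nu> ?J {\<nu>. add_box \<mu> \<nu>}"
      unfolding bij_betw_def
    proof (intro conjI inj_onI equalityI subsetI)
      fix j k assume jk: "j \<in> ?J" "k \<in> ?J" "\<nu> j = \<nu> k"
      have "?up j = ?up k"
        unfolding \<nu>[OF jk(1), symmetric] \<nu>[OF jk(2), symmetric] jk(3) ..
      then have "?up j j = ?up k j" by (rule fun_cong)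
      then show "j = k" by (simp split: if_splits)
    next
      fix \<kappa> assume "\<kappa> \<in> \<nu> ` ?J"
      then obtain j where j: "j \<in> ?J" "\<kappa> = \<nu> j" by blast
      then show "\<kappa> \<in> {\<nu>. add_box \<mu> \<nu>}"
        using \<nu>[OF j(1)] by (auto simp: add_box_iff)
    next
      fix \<kappa> assume "\<kappa> \<in> {\<nu>. add_box \<mu> \<nu>}"
      then have ab: "add_box \<mu> \<kappa>" by simp
      then obtain j where j: "j \<ge> 1" "part \<kappa> = ?up j" using add_box_iff by blast
      have "part \<kappa> j > 0" by (simp add: j(2))
      then have "j \<le> n"
        using part_pos_iff[of \<kappa> j] add_box_bounds(1)[OF ab] n by simp
      with j have "j \<in> ?J" by auto
      moreover have "\<nu> j = \<kappa>"
        by (rule part_inject[THEN iffD1]) (simp only: \<nu>[OF \<open>j \<in> ?J\<close>] j(2))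
      ultimately show "\<kappa> \<in> \<nu> ` ?J" by blast
    qed
  qed
  finally show ?thesis .
qed

lemma pieri:
  "dpow 1 * dschur \<mu> = dscale (adiff \<mu> empty_part) (dschur \<mu>) + (\<Sum>\<nu> | add_box \<mu> \<nu>. dschur \<nu>)"
proof (rule dsym_eqI_large[of "Suc (plength \<mu>)"])
  fix n assume n: "n \<ge> Suc (plength \<mu>)"
  let ?V = "vandermonde xv n" and ?A = "\<lambda>\<kappa>. alternant n xv (\<lambda>t. xconst (nodes n t)) (shifted \<kappa> n)"
  have \<mu>: "plength \<mu> \<le> n" using n by simp
  have \<nu>: "plength \<nu> \<le> n" if "add_box \<mu> \<nu>" for \<nu>
    using add_box_bounds(1)[OF that] n by simp
  have e: "plength empty_part \<le> n" by (simp add: plength_def empty_part.rep_eq)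
  \<comment> \<open>The scalar from the Pieri rule is the sum of the nodes at the exponents of
    \<mu>, that is of the a_(i - \<mu>_i); p_1 subtracts the a_i.\<close>
  have adiff: "(\<Sum>j=1..n. xconst (nodes n (shifted \<mu> n j))) - (\<Sum>i=1..n. xconst (av (int i))) =
      xconst (adiff \<mu> empty_part)"
    unfolding adiff_eq_sum[OF \<mu> e] xconst.hom_sum sum_subtractf[symmetric]
    by (rule sum.cong) (auto simp: shifted_def of_nat_diff empty_part.rep_eq xconst.hom_minus)
  have "Rep_dsym (dpow 1 * dschur \<mu>) n * ?V =
      (\<Sum>i=1..n. xv i) * ?A \<mu> - (\<Sum>i=1..n. xconst (av (int i))) * ?A \<mu>"
    by (simp add: Rep_dpow Rep_dschur mult.assoc dschur_poly_vandermonde[OF \<mu>] sum_subtractf left_diff_distrib)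
  also have "\<dots> = xconst (adiff \<mu> empty_part) * ?A \<mu> + (\<Sum>\<nu> | add_box \<mu> \<nu>. ?A \<nu>)"
    unfolding pieri_alternant sum_add_box_alternant[OF n] adiff[symmetric] by (simp add: algebra_simps)
  also have "\<dots> = Rep_dsym (dscale (adiff \<mu> empty_part) (dschur \<mu>) + (\<Sum>\<nu> | add_box \<mu> \<nu>. dschur \<nu>)) n * ?V"
    using dschur_poly_vandermonde[OF \<nu>]
    by (simp add: Rep_dsym_sum Rep_dschur distrib_right sum_distrib_right mult.assoc
        dschur_poly_vandermonde[OF \<mu>])
  finally show "Rep_dsym (dpow 1 * dschur \<mu>) n =
      Rep_dsym (dscale (adiff \<mu> empty_part) (dschur \<mu>) + (\<Sum>\<nu> | add_box \<mu> \<nu>. dschur \<nu>)) n"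
    using vandermonde_xv[of n] by (simp only: mult_right_cancel simp_thms)
qed

text \<open>Expand \<open>p\<^sub>1 P s\<^sub>\<mu>\<close> in two ways.\<close>

lemma schur_coeffs_recursion:
  fixes P :: dsym
  defines "c \<equiv> \<lambda>\<mu> \<nu>. schur_coeffs (P * dschur \<mu>) \<nu>"
  shows "adiff \<nu> \<mu> * c \<mu> \<nu> =
    (\<Sum>\<mu>' | add_box \<mu> \<mu>'. c \<mu>' \<nu>) - (\<Sum>\<nu>' | add_box \<nu>' \<nu>. c \<mu> \<nu>')"
proof -
  let ?d = "\<lambda>\<mu>. adiff \<mu> empty_part"
  have "dpow 1 * (P * dschur \<mu>) = P * (dpow 1 * dschur \<mu>)" by (simp add: mult_ac)
  also have "\<dots> = dscale (?d \<mu>) (P * dschur \<mu>) + (\<Sum>\<mu>' | add_box \<mu> \<mu>'. P * dschur \<mu>')"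
    unfolding pieri dscale_def by (simp add: distrib_left sum_distrib_left mult_ac)
  finally have 1: "schur_coeffs (dpow 1 * (P * dschur \<mu>)) \<nu> = ?d \<mu> * c \<mu> \<nu> + (\<Sum>\<mu>' | add_box \<mu> \<mu>'. c \<mu>' \<nu>)"
    by (simp add: schur_coeffs_add schur_coeffs_dscale schur_coeffs_sum c_def)
  obtain F where F: "finite F" "P * dschur \<mu> = (\<Sum>\<kappa>\<in>F. dscale (c \<mu> \<kappa>) (dschur \<kappa>))"
    "\<And>\<kappa>. \<kappa> \<notin> F \<Longrightarrow> c \<mu> \<kappa> = 0"
    unfolding c_def using schur_expansion[of "P * dschur \<mu>"] by metis
  have "dpow 1 * (P * dschur \<mu>) = (\<Sum>\<kappa>\<in>F. dscale (c \<mu> \<kappa>) (dpow 1 * dschur \<kappa>))"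
    unfolding F(2) sum_distrib_left dscale_def by (simp add: mult_ac)
  also have "schur_coeffs \<dots> \<nu> = (\<Sum>\<kappa>\<in>F. c \<mu> \<kappa> * schur_coeffs (dpow 1 * dschur \<kappa>) \<nu>)"
    by (simp add: schur_coeffs_sum schur_coeffs_dscale)
  also have "\<dots> = (\<Sum>\<kappa>\<in>F. (if \<kappa> = \<nu> then c \<mu> \<kappa> * ?d \<kappa> else 0) + (if add_box \<kappa> \<nu> then c \<mu> \<kappa> else 0))"
  proof (rule sum.cong[OF refl])
    fix \<kappa>
    have "(\<Sum>\<kappa>' | add_box \<kappa> \<kappa>'. schur_coeffs (dschur \<kappa>') \<nu>) = (if add_box \<kappa> \<nu> then 1 else 0)"
      unfolding schur_coeffs_dschur by (subst sum.delta[OF finite_add_box_above]) simp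
    then have "schur_coeffs (dpow 1 * dschur \<kappa>) \<nu> =
        (if \<kappa> = \<nu> then ?d \<kappa> else 0) + (if add_box \<kappa> \<nu> then 1 else 0)"
      unfolding pieri schur_coeffs_add schur_coeffs_dscale schur_coeffs_sum
      by (simp add: schur_coeffs_dschur)
    then show "c \<mu> \<kappa> * schur_coeffs (dpow 1 * dschur \<kappa>) \<nu> =
        (if \<kappa> = \<nu> then c \<mu> \<kappa> * ?d \<kappa> else 0) + (if add_box \<kappa> \<nu> then c \<mu> \<kappa> else 0)"
      by (simp add: distrib_left)
  qed
  also have "\<dots> = c \<mu> \<nu> * ?d \<nu> + (\<Sum>\<nu>' | add_box \<nu>' \<nu>. c \<mu> \<nu>')"
  proof -
    have "(\<Sum>\<kappa>\<in>F. if \<kappa> = \<nu> then c \<mu> \<kappa> * ?d \<kappa> else 0) = c \<mu> \<nu> * ?d \<nu>"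
      using F(3)[of \<nu>] by (subst sum.delta[OF F(1)]) simp
    moreover have "(\<Sum>\<kappa>\<in>F. if add_box \<kappa> \<nu> then c \<mu> \<kappa> else 0) = (\<Sum>\<kappa>\<in>F \<inter> {\<kappa>. add_box \<kappa> \<nu>}. c \<mu> \<kappa>)"
      by (simp add: sum.inter_restrict[OF F(1)])
    moreover have "\<dots> = (\<Sum>\<nu>' | add_box \<nu>' \<nu>. c \<mu> \<nu>')"
      by (rule sum.mono_neutral_left) (use finite_add_box_below F(3) in blast)+
    ultimately show ?thesis by (simp add: sum.distrib)
  qed
  finally have "schur_coeffs (dpow 1 * (P * dschur \<mu>)) \<nu> = c \<mu> \<nu> * ?d \<nu> + (\<Sum>\<nu>' | add_box \<nu>' \<nu>. c \<mu> \<nu>')" .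
  \<comment> \<open>The diagonal terms of the two expansions carry the eigenvalues of p_1 at \<mu>
    and at \<nu>; their difference moves to the left side.\<close>
  with 1 show ?thesis
    unfolding adiff_empty[of \<nu> \<mu>] by (simp add: algebra_simps)
qed


subsection \<open>Sums over chains\<close>

definition divided_difference :: "(nat \<Rightarrow> 'a::field) \<Rightarrow> (nat \<Rightarrow> 'a) \<Rightarrow> nat set \<Rightarrow> 'a" where
  "divided_difference x g A = (\<Sum>k\<in>A. g k / (\<Prod>j\<in>A - {k}. x k - x j))"

lemma divided_difference_step:
  assumes A: "finite A" and x: "inj_on x A" and ab: "a \<in> A" "b \<in> A" "a \<noteq> b"
  shows "(x b - x a) * divided_difference x g A =
    divided_difference x g (A - {a}) - divided_difference x g (A - {b})"
proof -
  let ?P = "\<lambda>k. \<Prod>j\<in>A - {k}. x k - x j"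
  \<comment> \<open>Deleting the node c multiplies the summand of k by x k - x c. The summand of c
    itself gets the factor 0 and may stay, so both deletions become sums over the same set
    A.\<close>
  have remove: "divided_difference x g (A - {c}) = (\<Sum>k\<in>A. g k * (x k - x c) / ?P k)" if c: "c \<in> A" for c
  proof -
    have "g k / (\<Prod>j\<in>A - {c} - {k}. x k - x j) = g k * (x k - x c) / ?P k" if k: "k \<in> A - {c}" for k
    proof -
      have "?P k = (x k - x c) * (\<Prod>j\<in>A - {k} - {c}. x k - x j)"
        using A c k by (intro prod.remove) auto
      moreover have "A - {k} - {c} = A - {c} - {k}" by blast
      moreover have "x k - x c \<noteq> 0" using x c k by (auto simp: inj_on_def)
      ultimately show ?thesis by simp
    qed
    then have "divided_difference x g (A - {c}) = (\<Sum>k\<in>A - {c}. g k * (x k - x c) / ?P k)"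
      unfolding divided_difference_def by (rule sum.cong[OF refl])
    also have "\<dots> = (\<Sum>k\<in>A. g k * (x k - x c) / ?P k)"
      by (rule sum.mono_neutral_left) (use A in auto)
    finally show ?thesis .
  qed
  show ?thesis
    unfolding remove[OF ab(1)] remove[OF ab(2)] sum_subtractf[symmetric]
    unfolding divided_difference_def sum_distrib_left
    by (rule sum.cong[OF refl]) (simp add: diff_divide_distrib[symmetric] algebra_simps)
qed

lemma divided_difference_reindex:
  assumes "inj_on f A"
  shows "divided_difference x g (f ` A) = divided_difference (\<lambda>k. x (f k)) (\<lambda>k. g (f k)) A"
proof -
  have "(\<Prod>j\<in>f ` A - {f k}. x (f k) - x j) = (\<Prod>j\<in>A - {k}. x (f k) - x (f j))" if "k \<in> A" for k
  proof -
    have "f ` A - {f k} = f ` (A - {k})"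
      using assms that by (auto simp: inj_on_def)
    then show ?thesis
      using assms by (simp add: prod.reindex inj_on_diff)
  qed
  then show ?thesis
    unfolding divided_difference_def by (simp add: sum.reindex[OF assms])
qed

section \<open>Chains of partitions and their end points\<close>

lemma chains_iff:
  "R \<in> chains \<mu> \<kappa> \<longleftrightarrow> R \<noteq> [] \<and> hd R = \<mu> \<and> last R = \<kappa> \<and> successively add_box R"
  by (simp add: chains_def successively_conv_nth)

lemma chains_Cons:
  "R' \<noteq> [] \<Longrightarrow> \<rho> # R' \<in> chains \<mu> \<kappa> \<longleftrightarrow> \<rho> = \<mu> \<and> add_box \<mu> (hd R') \<and> R' \<in> chains (hd R') \<kappa>"
  by (auto simp: chains_iff successively_Cons)

lemma chains_snoc:
  "R' \<noteq> [] \<Longrightarrow> R' @ [\<rho>] \<in> chains \<mu> \<kappa> \<longleftrightarrow> \<rho> = \<kappa> \<and> add_box (last R') \<kappa> \<and> R' \<in> chains \<mu> (last R')"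
  by (auto simp: chains_iff successively_append_iff)

lemma chain_psize:
  assumes "R \<in> chains \<mu> \<kappa>" "i < length R"
  shows "psize (R ! i) = psize \<mu> + i"
  using assms(2)
proof (induction i)
  case 0
  then show ?case using assms(1) by (simp add: chains_def hd_conv_nth)
next
  case (Suc i)
  then have "add_box (R ! i) (R ! Suc i)" using assms(1) by (simp add: chains_def)
  from add_box_bounds(3)[OF this] show ?case using Suc by simp
qed

lemma chain_psize_last:
  assumes "R \<in> chains \<mu> \<kappa>"
  shows "psize \<kappa> = psize \<mu> + (length R - 1)"
proof -
  have "R \<noteq> []" "last R = \<kappa>" using assms by (simp_all add: chains_iff)
  then show ?thesis
    using chain_psize[OF assms, of "length R - 1"] by (cases R) (auto simp: last_conv_nth One_nat_def)
qed

lemma finite_chains: "finite (chains \<mu> \<kappa>)"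
proof (rule finite_subset)
  show "chains \<mu> \<kappa> \<subseteq> {R. set R \<subseteq> {\<rho>. psize \<rho> \<le> psize \<kappa>} \<and> length R \<le> Suc (psize \<kappa>)}"
  proof
    fix R assume R: "R \<in> chains \<mu> \<kappa>"
    then have len: "length R \<le> Suc (psize \<kappa>)" using chain_psize_last[OF R] by simp
    have "psize (R ! i) \<le> psize \<kappa>" if "i < length R" for i
      using chain_psize[OF R that] chain_psize_last[OF R] that by linarith
    with len show "R \<in> {R. set R \<subseteq> {\<rho>. psize \<rho> \<le> psize \<kappa>} \<and> length R \<le> Suc (psize \<kappa>)}"
      by (auto simp: in_set_conv_nth)
  qed
  show "finite {R. set R \<subseteq> {\<rho>. psize \<rho> \<le> psize \<kappa>} \<and> length R \<le> Suc (psize \<kappa>)}"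
    by (rule finite_lists_length_le[OF finite_psize_le])
qed

lemma chains_same: "chains \<mu> \<mu> = {[\<mu>]}"
proof (intro equalityI subsetI)
  fix R assume R: "R \<in> chains \<mu> \<mu>"
  then obtain R' where R': "R = \<mu> # R'" by (cases R) (auto simp: chains_iff)
  then have "R' = []" using chain_psize_last[OF R] by simp
  with R' show "R \<in> {[\<mu>]}" by simp
qed (simp add: chains_def)

lemma part_le_refl [simp]: "part_le \<mu> \<mu>"
  and part_le_trans: "part_le \<mu> \<rho> \<Longrightarrow> part_le \<rho> \<nu> \<Longrightarrow> part_le \<mu> \<nu>"
  and add_box_part_le: "add_box \<mu> \<nu> \<Longrightarrow> part_le \<mu> \<nu>"
  by (auto simp: part_le_def add_box_def)

lemma chains_part_le: "R \<in> chains \<mu> \<kappa> \<Longrightarrow> part_le \<mu> \<kappa>"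
proof (induction R arbitrary: \<mu>)
  case (Cons \<rho> R)
  show ?case
  proof (cases "R = []")
    case True
    then show ?thesis using Cons.prems by (auto simp: chains_iff)
  next
    case False
    then show ?thesis
      using Cons by (metis add_box_part_le chains_Cons part_le_trans)
  qed
qed (simp add: chains_def)

lemma part_le_psize_less:
  assumes "part_le \<mu> \<kappa>" "\<mu> \<noteq> \<kappa>"
  shows "psize \<mu> < psize \<kappa>"
proof -
  let ?n = "max (plength \<mu>) (plength \<kappa>)"
  obtain i where i: "i \<ge> 1" "part \<mu> i \<noteq> part \<kappa> i" using partition_eqI assms(2) by blast
  have "i \<le> ?n"
  proof (rule ccontr)
    assume "\<not> i \<le> ?n"
    then have "?n < i" by (simp only: not_le)
    then have "part \<mu> i = 0" "part \<kappa> i = 0"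
      by (rule part_eq_0[OF max.cobounded1], rule part_eq_0[OF max.cobounded2])
    with i show False by simp
  qed
  with i have "i \<in> {1..?n}" by simp
  moreover have "part \<mu> i < part \<kappa> i"
    using i(2) assms(1) by (simp add: part_le_iff le_neq_implies_less)
  ultimately have "(\<Sum>i=1..?n. part \<mu> i) < (\<Sum>i=1..?n. part \<kappa> i)"
    using assms(1) by (intro sum_strict_mono_ex1) (auto simp: part_le_iff)
  then show ?thesis by (simp add: psize_eq[of \<mu> ?n] psize_eq[of \<kappa> ?n])
qed

definition chain_term :: "dsym \<Rightarrow> partition list \<Rightarrow> qa fract" where
  "chain_term P R = divided_difference (\<lambda>k. to_fract (adiff (R ! k) empty_part))
     (\<lambda>k. to_fract (dval P (R ! k))) {..<length R}"

lemma chain_sum_eq: "chain_sum P \<mu> \<kappa> = (\<Sum>R\<in>chains \<mu> \<kappa>. chain_term P R)"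
  unfolding chain_sum_def chain_term_def divided_difference_def
  by (simp add: adiff_empty[of "_ ! _" "_ ! _"])

lemma chain_term_step:
  assumes R: "R \<in> chains \<mu> \<kappa>" and ne: "\<mu> \<noteq> \<kappa>"
  shows "to_fract (adiff \<kappa> \<mu>) * chain_term P R = chain_term P (tl R) - chain_term P (butlast R)"
proof -
  let ?x = "\<lambda>k. to_fract (adiff (R ! k) empty_part)" and ?g = "\<lambda>k. to_fract (dval P (R ! k))"
  have "R \<noteq> []" "length R \<noteq> 1"
    using R ne by (auto simp: chains_iff length_Suc_conv One_nat_def)
  from \<open>R \<noteq> []\<close> have "length R \<noteq> 0" by simp
  with \<open>length R \<noteq> 1\<close> have len: "2 \<le> length R" by linarith
  \<comment> \<open>Distinct partitions have distinct |a_\<rho>|, and the members of a chain are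
    distinct because their sizes increase by 1.\<close>
  have inj: "inj_on ?x {..<length R}"
  proof (rule inj_onI)
    fix i j assume ij: "i \<in> {..<length R}" "j \<in> {..<length R}" "?x i = ?x j"
    then have "adiff (R ! i) (R ! j) = 0" by (simp add: adiff_empty[of "R ! i" "R ! j"])
    then have "R ! i = R ! j" using adiff_nonzero by blast
    then have "psize \<mu> + i = psize \<mu> + j"
      using chain_psize[OF R, of i] chain_psize[OF R, of j] ij(1,2) by (simp only: lessThan_iff)
    then show "i = j" by simp
  qed
  have "hd R = \<mu>" "last R = \<kappa>" using R by (simp_all add: chains_iff)
  then have ends: "R ! 0 = \<mu>" "R ! (length R - 1) = \<kappa>"
    unfolding hd_conv_nth[OF \<open>R \<noteq> []\<close>] last_conv_nth[OF \<open>R \<noteq> []\<close>] .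
  have "(?x (length R - 1) - ?x 0) * chain_term P R =
      divided_difference ?x ?g ({..<length R} - {0}) - divided_difference ?x ?g ({..<length R} - {length R - 1})"
    unfolding chain_term_def
  proof (rule divided_difference_step[OF finite_lessThan inj])
    show "0 \<in> {..<length R}" "length R - 1 \<in> {..<length R}" "0 \<noteq> length R - 1"
      using len \<open>R \<noteq> []\<close> by auto
  qed
  moreover have "divided_difference ?x ?g ({..<length R} - {0}) = chain_term P (tl R)"
  proof -
    have "{..<length R} - {0} = Suc ` {..<length (tl R)}"
    proof -
      have "length R = Suc (length (tl R))" using len by simp
      then have "{..<length R} = insert 0 (Suc ` {..<length (tl R)})"
        by (simp only: lessThan_Suc_eq_insert_0)
      then show ?thesis by (simp only:) blast
    qed
    then show ?thesis
      by (simp add: divided_difference_reindex chain_term_def nth_tl[symmetric])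
        (simp add: divided_difference_def nth_tl)
  qed
  moreover have "divided_difference ?x ?g ({..<length R} - {length R - 1}) = chain_term P (butlast R)"
  proof -
    have "{..<length R} - {length R - 1} = {..<length (butlast R)}" by auto
    then show ?thesis
      unfolding chain_term_def divided_difference_def
      by (intro sum.cong arg_cong2[where f = "(/)"] prod.cong) (auto simp: nth_butlast)
  qed
  ultimately show ?thesis
    by (simp add: ends adiff_empty[of \<kappa> \<mu>])
qed

text \<open>As the ends differ, a chain has at least one step, so its tail is again a chain,
  starting at some partition one box above \<mu>.\<close>

lemma chains_tl_sum:
  assumes "\<mu> \<noteq> \<kappa>"
  shows "(\<Sum>R\<in>chains \<mu> \<kappa>. f (tl R)) = (\<Sum>\<mu>' | add_box \<mu> \<mu>'. \<Sum>R\<in>chains \<mu>' \<kappa>. f R)"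
proof -
  have "(\<Sum>\<mu>' | add_box \<mu> \<mu>'. \<Sum>R\<in>chains \<mu>' \<kappa>. f R) =
      (\<Sum>(\<mu>', R)\<in>(SIGMA \<mu>':{\<mu>'. add_box \<mu> \<mu>'}. chains \<mu>' \<kappa>). f R)"
    by (rule sum.Sigma) (auto simp: finite_add_box_above finite_chains)
  also have "\<dots> = (\<Sum>R\<in>chains \<mu> \<kappa>. f (tl R))"
  proof (rule sum.reindex_bij_witness[of _ "\<lambda>R. (hd (tl R), tl R)" "\<lambda>(\<mu>', R). \<mu> # R"])
    fix R assume R: "R \<in> chains \<mu> \<kappa>"
    then obtain R' where R': "R = \<mu> # R'" by (cases R) (auto simp: chains_iff)
    then have "R' \<noteq> []" using R assms by (auto simp: chains_iff)
    with R R' show "(hd (tl R), tl R) \<in> (SIGMA \<mu>':{\<mu>'. add_box \<mu> \<mu>'}. chains \<mu>' \<kappa>)"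
      by (simp add: chains_Cons)
    show "(case (hd (tl R), tl R) of (\<mu>', R) \<Rightarrow> \<mu> # R) = R" by (simp add: R')
  next
    fix q assume q: "q \<in> (SIGMA \<mu>':{\<mu>'. add_box \<mu> \<mu>'}. chains \<mu>' \<kappa>)"
    obtain \<mu>' R where qq: "q = (\<mu>', R)" by (cases q)
    then have *: "add_box \<mu> \<mu>'" "R \<in> chains \<mu>' \<kappa>" using q by auto
    then have "R \<noteq> []" "hd R = \<mu>'" by (auto simp: chains_iff)
    with * qq show "(case q of (\<mu>', R) \<Rightarrow> \<mu> # R) \<in> chains \<mu> \<kappa>"
      "(hd (tl (case q of (\<mu>', R) \<Rightarrow> \<mu> # R)), tl (case q of (\<mu>', R) \<Rightarrow> \<mu> # R)) = q"
      "f (tl (case q of (\<mu>', R) \<Rightarrow> \<mu> # R)) = (case q of (\<mu>', R) \<Rightarrow> f R)"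
      by (auto simp: chains_Cons)
  qed
  finally show ?thesis ..
qed

lemma chains_butlast_sum:
  assumes "\<mu> \<noteq> \<kappa>"
  shows "(\<Sum>R\<in>chains \<mu> \<kappa>. f (butlast R)) = (\<Sum>\<kappa>' | add_box \<kappa>' \<kappa>. \<Sum>R\<in>chains \<mu> \<kappa>'. f R)"
proof -
  have "(\<Sum>\<kappa>' | add_box \<kappa>' \<kappa>. \<Sum>R\<in>chains \<mu> \<kappa>'. f R) =
      (\<Sum>(\<kappa>', R)\<in>(SIGMA \<kappa>':{\<kappa>'. add_box \<kappa>' \<kappa>}. chains \<mu> \<kappa>'). f R)"
    by (rule sum.Sigma) (auto simp: finite_add_box_below finite_chains)
  also have "\<dots> = (\<Sum>R\<in>chains \<mu> \<kappa>. f (butlast R))"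
  proof (rule sum.reindex_bij_witness[of _ "\<lambda>R. (last (butlast R), butlast R)" "\<lambda>(\<kappa>', R). R @ [\<kappa>]"])
    fix R assume R: "R \<in> chains \<mu> \<kappa>"
    then obtain R' where R': "R = R' @ [\<kappa>]" by (metis append_butlast_last_id chains_iff)
    then have "R' \<noteq> []" using R assms by (auto simp: chains_iff)
    with R R' show "(last (butlast R), butlast R) \<in> (SIGMA \<kappa>':{\<kappa>'. add_box \<kappa>' \<kappa>}. chains \<mu> \<kappa>')"
      by (simp add: chains_snoc)
    show "(case (last (butlast R), butlast R) of (\<kappa>', R) \<Rightarrow> R @ [\<kappa>]) = R" by (simp add: R')
  next
    fix q assume q: "q \<in> (SIGMA \<kappa>':{\<kappa>'. add_box \<kappa>' \<kappa>}. chains \<mu> \<kappa>')"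
    obtain \<kappa>' R where qq: "q = (\<kappa>', R)" by (cases q)
    then have *: "add_box \<kappa>' \<kappa>" "R \<in> chains \<mu> \<kappa>'" using q by auto
    then have "R \<noteq> []" "last R = \<kappa>'" by (auto simp: chains_iff)
    with * qq show "(case q of (\<kappa>', R) \<Rightarrow> R @ [\<kappa>]) \<in> chains \<mu> \<kappa>"
      "(last (butlast (case q of (\<kappa>', R) \<Rightarrow> R @ [\<kappa>])), butlast (case q of (\<kappa>', R) \<Rightarrow> R @ [\<kappa>])) = q"
      "f (butlast (case q of (\<kappa>', R) \<Rightarrow> R @ [\<kappa>])) = (case q of (\<kappa>', R) \<Rightarrow> f R)"
      by (auto simp: chains_snoc)
  qed
  finally show ?thesis ..
qed

lemma chain_sum_recursion:
  assumes "\<mu> \<noteq> \<kappa>"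
  shows "to_fract (adiff \<kappa> \<mu>) * chain_sum P \<mu> \<kappa> =
    (\<Sum>\<mu>' | add_box \<mu> \<mu>'. chain_sum P \<mu>' \<kappa>) - (\<Sum>\<kappa>' | add_box \<kappa>' \<kappa>. chain_sum P \<mu> \<kappa>')"
proof -
  have "to_fract (adiff \<kappa> \<mu>) * chain_sum P \<mu> \<kappa> =
      (\<Sum>R\<in>chains \<mu> \<kappa>. chain_term P (tl R) - chain_term P (butlast R))"
    unfolding chain_sum_eq sum_distrib_left
    by (rule sum.cong[OF refl]) (rule chain_term_step[OF _ assms])
  then show ?thesis
    by (simp only: sum_subtractf chains_tl_sum[OF assms] chains_butlast_sum[OF assms] chain_sum_eq)
qed

text \<open>Both sides satisfy the same recursion, whose right side involves only pairs of smaller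
  size difference, and |a_\<kappa>| - |a_\<mu>| can be cancelled. Both vanish unless \<mu> lies in
  \<kappa>, and for \<mu> = \<kappa> both are P(a_\<mu>), the only chain having one member.\<close>

theorem schur_coeffs_eq_chain_sum: "to_fract (schur_coeffs (P * dschur \<mu>) \<kappa>) = chain_sum P \<mu> \<kappa>"
proof (induction "psize \<kappa> - psize \<mu>" arbitrary: \<mu> \<kappa> rule: less_induct)
  case less
  show ?case
  proof (cases "part_le \<mu> \<kappa>")
    case False
    then have "chains \<mu> \<kappa> = {}" using chains_part_le by blast
    moreover have "schur_coeffs (P * dschur \<mu>) \<kappa> = 0"
      using False schur_coeffs_mult_nonzero by blast
    ultimately show ?thesis by (simp add: chain_sum_def)
  next
    case le: True
    show ?thesis
    proof (cases "\<mu> = \<kappa>")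
      case True
      have "{..<Suc 0} - {0::nat} = {}" by auto
      then show ?thesis
        by (simp add: True chain_sum_def chains_same schur_coeffs_mult_same)
    next
      case False
      have size: "psize \<mu> < psize \<kappa>" using part_le_psize_less[OF le False] .
      have up: "to_fract (schur_coeffs (P * dschur \<mu>') \<kappa>) = chain_sum P \<mu>' \<kappa>" if "add_box \<mu> \<mu>'" for \<mu>'
        by (rule less) (use size add_box_bounds(3)[OF that] in linarith)
      have down: "to_fract (schur_coeffs (P * dschur \<mu>) \<kappa>') = chain_sum P \<mu> \<kappa>'" if "add_box \<kappa>' \<kappa>" for \<kappa>'
        by (rule less) (use size add_box_bounds(3)[OF that] in linarith)
      have "to_fract (adiff \<kappa> \<mu>) * to_fract (schur_coeffs (P * dschur \<mu>) \<kappa>) =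
          (\<Sum>\<mu>' | add_box \<mu> \<mu>'. to_fract (schur_coeffs (P * dschur \<mu>') \<kappa>)) -
          (\<Sum>\<kappa>' | add_box \<kappa>' \<kappa>. to_fract (schur_coeffs (P * dschur \<mu>) \<kappa>'))"
        by (simp only: schur_coeffs_recursion to_fract_mult[symmetric] to_fract_diff to_fract_sum)
      also have "\<dots> = to_fract (adiff \<kappa> \<mu>) * chain_sum P \<mu> \<kappa>"
        unfolding chain_sum_recursion[OF False]
        by (intro arg_cong2[where f = minus] sum.cong) (auto simp: up down)
      finally show ?thesis
        using adiff_nonzero[of \<kappa> \<mu>] False by simp
    qed
  qed
qed

corollary schur_coeffs_eq_chain_sum_empty:
  "to_fract (schur_coeffs P \<kappa>) = chain_sum P empty_part \<kappa>"
  using schur_coeffs_eq_chain_sum[of P empty_part \<kappa>] by (simp add: dschur_empty)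

lemma dchar_eq_chain_sum: "to_fract (dchar \<kappa> \<mu>) = chain_sum (dpow_part \<mu>) empty_part \<kappa>"
  unfolding dchar_def by (rule schur_coeffs_eq_chain_sum_empty)

lemma lr_coeff_eq_chain_sum: "to_fract (lr_coeff \<kappa> \<mu> \<nu>) = chain_sum (dschur \<kappa>) \<mu> \<nu>"
  unfolding lr_coeff_def by (rule schur_coeffs_eq_chain_sum)


subsection \<open>Power series\<close>

text \<open>Infinite expansions are handled by truncation: series are compared modulo terms of total
  degree at least D, for all large D, and only finite sums occur.\<close>

definition ylow :: "nat \<Rightarrow> 'a::comm_ring_1 yseries \<Rightarrow> bool" where
  "ylow D F \<longleftrightarrow> (\<forall>u. mdeg u < D \<longrightarrow> ycoeff F u = 0)"

definition ycong :: "nat \<Rightarrow> 'a::comm_ring_1 yseries \<Rightarrow> 'a yseries \<Rightarrow> bool" where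
  "ycong D F G \<longleftrightarrow> ylow D (F - G)"

lemma ycoeff_simps [simp]:
  "ycoeff (F + G) u = ycoeff F u + ycoeff G u" "ycoeff (F - G) u = ycoeff F u - ycoeff G u"
  "ycoeff (- F) u = - ycoeff F u" "ycoeff 0 u = 0" "ycoeff 1 u = (if u = 0 then 1 else 0)"
  by (simp_all add: plus_yseries.rep_eq minus_yseries.rep_eq uminus_yseries.rep_eq
      zero_yseries.rep_eq one_yseries.rep_eq)

lemma ycoeff_sum: "ycoeff (\<Sum>i\<in>A. f i) u = (\<Sum>i\<in>A. ycoeff (f i) u)"
  by (induction A rule: infinite_finite_induct) simp_all

lemma ylow_mult:
  assumes "ylow d F" "ylow e G"
  shows "ylow (d + e) (F * G)"
  unfolding ylow_def
proof (intro allI impI)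
  fix w assume w: "mdeg w < d + e"
  have "ycoeff F u * ycoeff G v = 0" if "(u, v) \<in> splits w" for u v
  proof -
    have "mdeg u + mdeg v = mdeg w" using that by (auto simp: splits_def mdeg_add)
    then have "mdeg u < d \<or> mdeg v < e" using w by linarith
    then show ?thesis using assms unfolding ylow_def by (metis mult_zero_left mult_zero_right)
  qed
  then show "ycoeff (F * G) w = 0"
    unfolding times_yseries.rep_eq by (intro sum.neutral ballI) (simp add: case_prod_unfold)
qed

lemma ylow_0: "ylow 0 F"
  by (simp add: ylow_def)

lemma ylow_mult_left: "ylow d F \<Longrightarrow> ylow d (F * G)"
  and ylow_mult_right: "ylow d G \<Longrightarrow> ylow d (F * G)"
  using ylow_mult[of d F 0 G] ylow_mult[of 0 F d G] by (simp_all add: ylow_0)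

lemma ylow_zero: "ylow D 0"
  by (simp add: ylow_def)

lemma ylow_add: "ylow D F \<Longrightarrow> ylow D G \<Longrightarrow> ylow D (F + G)"
  by (simp add: ylow_def)

lemma ylow_uminus: "ylow D F \<Longrightarrow> ylow D (- F)"
  by (simp add: ylow_def)

lemma ylow_sum: "(\<And>i. i \<in> A \<Longrightarrow> ylow D (f i)) \<Longrightarrow> ylow D (\<Sum>i\<in>A. f i)"
  by (induction A rule: infinite_finite_induct) (simp_all add: ylow_add ylow_zero)

lemma ylow_prod: "(\<And>i. i \<in> A \<Longrightarrow> ylow (d i) (f i)) \<Longrightarrow> ylow (\<Sum>i\<in>A. d i) (\<Prod>i\<in>A. f i)"
  by (induction A rule: infinite_finite_induct) (simp_all add: ylow_mult ylow_0)

lemma ylow_yv_power: "ylow k (yv i ^ k :: 'a::comm_ring_1 yseries)"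
proof (induction k)
  case (Suc k)
  have "ycoeff (yv i :: 'a yseries) u = 0" if "mdeg u = 0" for u
    using that by (auto simp: yv.rep_eq mdeg_def)
  then have "ylow 1 (yv i :: 'a yseries)" by (simp add: ylow_def)
  from ylow_mult[OF this Suc] show ?case by (simp add: plus_1_eq_Suc)
qed (simp add: ylow_0)

lemma ycong_refl [simp]: "ycong D F F"
  by (simp add: ycong_def ylow_zero)

lemma ycong_sym: "ycong D F G \<Longrightarrow> ycong D G F"
  unfolding ycong_def using ylow_uminus by fastforce

lemma ycong_trans: "ycong D F G \<Longrightarrow> ycong D G H \<Longrightarrow> ycong D F H"
  unfolding ycong_def using ylow_add[of D "F - G" "G - H"] by simp

lemma ycong_mult:
  assumes "ycong D F F'" "ycong D G G'"
  shows "ycong D (F * G) (F' * G')"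
proof -
  have "F * G - F' * G' = (F - F') * G + F' * (G - G')" by (simp add: algebra_simps)
  then show ?thesis
    using assms unfolding ycong_def by (simp only:) (intro ylow_add ylow_mult_left ylow_mult_right)
qed

lemma ycong_sum: "(\<And>i. i \<in> A \<Longrightarrow> ycong D (f i) (g i)) \<Longrightarrow> ycong D (\<Sum>i\<in>A. f i) (\<Sum>i\<in>A. g i)"
  unfolding ycong_def sum_subtractf[symmetric] by (rule ylow_sum)

lemma ycong_prod: "(\<And>i. i \<in> A \<Longrightarrow> ycong D (f i) (g i)) \<Longrightarrow> ycong D (\<Prod>i\<in>A. f i) (\<Prod>i\<in>A. g i)"
  by (induction A rule: infinite_finite_induct) (simp_all add: ycong_mult)

lemma ycong_eqI: "(\<And>D. D \<ge> N \<Longrightarrow> ycong D F G) \<Longrightarrow> F = G"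
proof (rule yseries_eqI)
  fix u assume "\<And>D. D \<ge> N \<Longrightarrow> ycong D F G"
  from this[of "max N (Suc (mdeg u))"] have "ylow (max N (Suc (mdeg u))) (F - G)"
    by (simp add: ycong_def)
  then have "ycoeff (F - G) u = 0" unfolding ylow_def by (simp add: less_max_iff_disj)
  then show "ycoeff F u = ycoeff G u" by simp
qed

lemma ycoeff_yconst_mult [simp]: "ycoeff (yconst c * F) u = c * ycoeff F u"
  using ycoeff_mult_monom(1)[where m = 0 and M = "yconst c" and F = F and v = u]
  by (simp add: yconst.rep_eq)

lemma comm_ring_hom_yconst: "comm_ring_hom (yconst :: 'a::comm_ring_1 \<Rightarrow> 'a yseries)"
  by unfold_locales (auto intro!: yseries_eqI simp: yconst.rep_eq)

interpretation yconst: comm_ring_hom "yconst :: 'a::comm_ring_1 \<Rightarrow> 'a yseries"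
  by (rule comm_ring_hom_yconst)

lemma
  fixes F :: "'a::comm_ring_1 yseries"
  shows ycoeff_yv_mult: "ycoeff (yv i * F) (Poly_Mapping.single i 1 + v) = ycoeff F v"
    and ycoeff_yv_mult_0: "Poly_Mapping.lookup w i = 0 \<Longrightarrow> ycoeff (yv i * F) w = 0"
proof -
  have M: "ycoeff (yv i) u = (0::'a)" if "u \<noteq> Poly_Mapping.single i 1" for u
    using that by (simp add: yv.rep_eq)
  show "ycoeff (yv i * F) (Poly_Mapping.single i 1 + v) = ycoeff F v"
    by (subst ycoeff_mult_monom(1)[OF M]) (simp_all add: yv.rep_eq)
  assume "Poly_Mapping.lookup w i = 0"
  then have "w \<noteq> Poly_Mapping.single i 1 + v" for v by (auto simp: lookup_add)
  then show "ycoeff (yv i * F) w = 0"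
    by (intro ycoeff_mult_monom(2)[where m = "Poly_Mapping.single i 1"]) (simp_all add: M)
qed

lemma poly_mapping_split_single:
  fixes w :: "nat \<Rightarrow>\<^sub>0 nat"
  assumes "Poly_Mapping.lookup w i \<noteq> 0"
  obtains v where "w = Poly_Mapping.single i 1 + v"
proof
  show "w = Poly_Mapping.single i 1 + (w - Poly_Mapping.single i 1)"
    using assms by (intro poly_mapping_eqI) (auto simp: lookup_add lookup_minus lookup_single when_def)
qed

lemma ylow_cancel_yv:
  assumes "ylow (Suc D) (yv i * F)"
  shows "ylow D F"
  unfolding ylow_def
proof (intro allI impI)
  fix v assume "mdeg v < D"
  moreover have "mdeg (Poly_Mapping.single i 1 :: nat \<Rightarrow>\<^sub>0 nat) = 1" by (simp add: mdeg_def)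
  ultimately have "mdeg (Poly_Mapping.single i 1 + v) < Suc D" by (simp add: mdeg_add)
  then show "ycoeff F v = 0" using assms unfolding ylow_def by (metis ycoeff_yv_mult)
qed

lemma ycong_cancel_yv_power: "ycong (k + D) (yv i ^ k * F) (yv i ^ k * G) \<Longrightarrow> ycong D F G"
proof (induction k)
  case (Suc k)
  have "yv i ^ Suc k * F - yv i ^ Suc k * G = yv i * (yv i ^ k * F - yv i ^ k * G)"
    by (simp add: algebra_simps)
  then have "ylow (Suc (k + D)) (yv i * (yv i ^ k * F - yv i ^ k * G))"
    using Suc.prems unfolding ycong_def by simp
  then have "ycong (k + D) (yv i ^ k * F) (yv i ^ k * G)"
    unfolding ycong_def by (rule ylow_cancel_yv)
  then show ?case by (rule Suc.IH)
qed simp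

text \<open>The coefficient of (y_i - y_j) F at w times y_i says that F has the same coefficient at
  w and at w with one y_j replaced by y_i. Repeating this removes all y_j, where the coefficient is
  0. The set S of exponents must be stable under the moves used.\<close>

lemma ycoeff_cancel_diff:
  assumes ij: "i \<noteq> j"
    and closed: "\<And>w. w \<in> S \<Longrightarrow> Poly_Mapping.single i 1 + w \<in> S"
      "\<And>w. Poly_Mapping.single j 1 + w \<in> S \<Longrightarrow> Poly_Mapping.single i 1 + w \<in> S"
    and zero: "\<And>w. w \<in> S \<Longrightarrow> ycoeff ((yv i - yv j) * F) w = 0"
    and w: "w \<in> S"
  shows "ycoeff F w = 0"
  using w
proof (induction "Poly_Mapping.lookup w j" arbitrary: w)
  case 0
  have "Poly_Mapping.lookup (Poly_Mapping.single i 1 + w) j = 0"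
    using 0 ij by (simp add: lookup_add lookup_single)
  then have "ycoeff (yv j * F) (Poly_Mapping.single i 1 + w) = 0" by (rule ycoeff_yv_mult_0)
  with zero[OF closed(1)[OF \<open>w \<in> S\<close>]] show ?case
    by (simp add: left_diff_distrib ycoeff_yv_mult)
next
  case (Suc k)
  then obtain v where v: "w = Poly_Mapping.single j 1 + v"
    by (metis poly_mapping_split_single nat.distinct(1))
  let ?v = "Poly_Mapping.single i 1 + v"
  have "Poly_Mapping.lookup ?v j = k"
    using Suc.hyps(2) ij by (simp add: v lookup_add lookup_single)
  moreover have "?v \<in> S" using Suc.prems closed(2) by (simp only: v)
  ultimately have "ycoeff F ?v = 0" using Suc.hyps(1) by blast
  moreover have "Poly_Mapping.single i 1 + w = Poly_Mapping.single j 1 + ?v"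
    by (simp add: v add.left_commute)
  then have "ycoeff (yv j * F) (Poly_Mapping.single i 1 + w) = ycoeff F ?v"
    by (simp only: ycoeff_yv_mult)
  ultimately show ?case
    using zero[OF closed(1)[OF Suc.prems]] by (simp add: left_diff_distrib ycoeff_yv_mult)
qed

text \<open>Taking all exponents for S shows that the Vandermonde product is cancellable. Taking
  those without y_n shows that a factor y_n of the product passes to F.\<close>

lemma ycoeff_cancel_vandermonde:
  assumes closed: "\<And>i j w. 1 \<le> i \<Longrightarrow> i < j \<Longrightarrow> j \<le> n \<Longrightarrow> w \<in> S \<Longrightarrow> Poly_Mapping.single i 1 + w \<in> S"
      "\<And>i j w. 1 \<le> i \<Longrightarrow> i < j \<Longrightarrow> j \<le> n \<Longrightarrow> Poly_Mapping.single j 1 + w \<in> S \<Longrightarrow>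
        Poly_Mapping.single i 1 + w \<in> S"
    and zero: "\<And>w. w \<in> S \<Longrightarrow> ycoeff (vandermonde yv n * F) w = 0"
    and w: "w \<in> S"
  shows "ycoeff F w = 0"
proof -
  define I where "I = (SIGMA i:{1..n}. {i<..n})"
  have I: "(i, j) \<in> I \<Longrightarrow> 1 \<le> i \<and> i < j \<and> j \<le> n" for i j by (auto simp: I_def)
  have V: "vandermonde yv n = (\<Prod>(i, j)\<in>I. yv i - yv j)"
    unfolding vandermonde_def I_def by (rule prod.Sigma) auto
  have "(\<And>w. w \<in> S \<Longrightarrow> ycoeff ((\<Prod>(i, j)\<in>J. yv i - yv j) * F) w = 0) \<Longrightarrow>
      w \<in> S \<Longrightarrow> ycoeff F w = 0" if "finite J" "J \<subseteq> I" for J F w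
    using that
  proof (induction J arbitrary: F w rule: finite_induct)
    case (insert p J)
    obtain i j where p: "p = (i, j)" by (cases p)
    then have ij: "1 \<le> i" "i < j" "j \<le> n" using I[of i j] insert.prems by auto
    show ?case
    proof (rule insert.IH[OF _ insert.prems(2)])
      show "J \<subseteq> I" using insert.prems by blast
      fix v assume "v \<in> S"
      then show "ycoeff ((\<Prod>(i, j)\<in>J. yv i - yv j) * F) v = 0"
      proof (rule ycoeff_cancel_diff[where i = i and j = j, rotated 4])
        fix w assume "w \<in> S"
        from insert.prems(1)[OF this]
        show "ycoeff ((yv i - yv j) * ((\<Prod>(i, j)\<in>J. yv i - yv j) * F)) w = 0"
          using insert.hyps by (simp add: p mult.assoc)
      qed (use ij closed in \<open>simp; blast\<close>)+
    qed
  qed simp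
  from this[of I F w] zero w show ?thesis unfolding V I_def by simp
qed

lemma vandermonde_yv_cancel:
  assumes "vandermonde yv n * F = vandermonde yv n * G"
  shows "F = G"
proof (rule yseries_eqI)
  fix u
  have "ycoeff (F - G) u = 0"
  proof (rule ycoeff_cancel_vandermonde[where S = UNIV])
    fix w show "ycoeff (vandermonde yv n * (F - G)) w = 0" by (simp add: right_diff_distrib assms)
  qed simp_all
  then show "ycoeff F u = ycoeff G u" by simp
qed

section \<open>Coefficientwise maps of power series\<close>

lift_definition ymap :: "('a \<Rightarrow> 'b) \<Rightarrow> 'a yseries \<Rightarrow> 'b yseries" is "\<lambda>\<phi> F u. \<phi> (F u)" .

lemma ymap_yconst: "\<phi> 0 = 0 \<Longrightarrow> ymap \<phi> (yconst c) = yconst (\<phi> c)"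
  by (rule yseries_eqI) (simp add: ymap.rep_eq yconst.rep_eq)

lemma comm_ring_hom_ymap:
  assumes "comm_ring_hom \<phi>"
  shows "comm_ring_hom (ymap \<phi>)"
proof -
  interpret comm_ring_hom \<phi> by (rule assms)
  show ?thesis
    by unfold_locales (auto intro!: yseries_eqI
        simp: ymap.rep_eq hom_add times_yseries.rep_eq hom_sum hom_mult case_prod_unfold)
qed

lemma ymap_yv:
  assumes "comm_ring_hom \<phi>"
  shows "ymap \<phi> (yv i) = yv i"
proof -
  interpret comm_ring_hom \<phi> by (rule assms)
  show ?thesis by (rule yseries_eqI) (simp add: ymap.rep_eq yv.rep_eq)
qed

lemma ymap_ygeom:
  assumes "comm_ring_hom \<phi>"
  shows "ymap \<phi> (ygeom c i) = ygeom (\<phi> c) i"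
proof -
  interpret comm_ring_hom \<phi> by (rule assms)
  show ?thesis by (rule yseries_eqI) (simp add: ymap.rep_eq ygeom.rep_eq hom_power)
qed

text \<open>L need not be multiplicative: linearity over the constants suffices, because the
  coefficients of the left factor are constants. L will be a Schur coefficient functional.\<close>

lemma ymap_linear_mult:
  fixes L :: "xpoly \<Rightarrow> qa"
  assumes add: "\<And>p q. L (p + q) = L p + L q" and scale: "\<And>c p. L (xconst c * p) = c * L p"
  shows "ymap L (ymap xconst A * F) = A * ymap L F"
proof (rule yseries_eqI)
  fix w
  have "L 0 = 0" using scale[of 0 0] by simp
  then have "L (\<Sum>i\<in>B. f i) = (\<Sum>i\<in>B. L (f i))" for B :: "((nat \<Rightarrow>\<^sub>0 nat) \<times> (nat \<Rightarrow>\<^sub>0 nat)) set" and f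
    by (induction B rule: infinite_finite_induct) (simp_all add: add)
  then show "ycoeff (ymap L (ymap xconst A * F)) w = ycoeff (A * ymap L F) w"
    by (simp add: ymap.rep_eq times_yseries.rep_eq case_prod_unfold scale)
qed

lemma ymap_sum:
  assumes "\<phi> 0 = 0" "\<And>p q. \<phi> (p + q) = \<phi> p + \<phi> q"
  shows "ymap \<phi> (\<Sum>i\<in>A. f i) = (\<Sum>i\<in>A. ymap \<phi> (f i))"
proof (rule yseries_eqI)
  fix u
  have "\<phi> (\<Sum>i\<in>A. ycoeff (f i) u) = (\<Sum>i\<in>A. \<phi> (ycoeff (f i) u))"
    by (induction A rule: infinite_finite_induct) (simp_all add: assms)
  then show "ycoeff (ymap \<phi> (\<Sum>i\<in>A. f i)) u = ycoeff (\<Sum>i\<in>A. ymap \<phi> (f i)) u"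
    by (simp add: ymap.rep_eq ycoeff_sum)
qed

lemma ymap_ycong:
  assumes "\<phi> 0 = 0" "\<And>p q. \<phi> (p - q) = \<phi> p - \<phi> q" "ycong D F G"
  shows "ycong D (ymap \<phi> F) (ymap \<phi> G)"
  using assms(3) by (simp add: ycong_def ylow_def ymap.rep_eq assms(2)[symmetric] assms(1))


subsection \<open>Generating series\<close>

text \<open>The series dual to the Newton polynomials: the sum over r of
  \<open>npow c x r * yweight c j r\<close> is 1 / (1 - x y_j).\<close>

definition yweight :: "(nat \<Rightarrow> 'a::comm_ring_1) \<Rightarrow> nat \<Rightarrow> nat \<Rightarrow> 'a yseries" where
  "yweight c j r = yv j ^ r * (\<Prod>t<Suc r. ygeom (c t) j)"

lemma ygeom_cancel: "ygeom c i * ((1 - yconst c * yv i) * F) = F"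
  using ygeom_inverse[of c i] by (simp only: mult.assoc[symmetric] mult_1)

text \<open>Split 1 - z_k y as (1 - c_r y) - (z_k - c_r) y. The first part cancels the last
  denominator of the weight, the second matches the recursion of \<open>newt\<close>, and what is
  left telescopes to a boundary term divisible by y^D.\<close>

lemma newt_series_telescope:
  assumes "k \<le> n"
  shows "(1 - yconst (z k) * yv j) * (\<Sum>r<D. yconst (newt n z c r k) * yweight c j r) =
    (if k = n then 1 else 0) +
    (if k < n then yv j * (\<Sum>r<D. yconst (newt n z c r (Suc k)) * yweight c j r) else 0) -
    yconst (newt n z c D k) * (yv j ^ D * (\<Prod>t<D. ygeom (c t) j))"
proof -
  define T where "T r = yconst (newt n z c r k) * (yv j ^ r * (\<Prod>t<r. ygeom (c t) j))" for r
  define b where "b r = (if k < n then newt n z c r (Suc k) else 0)" for r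
  have T: "(1 - yconst (z k) * yv j) * (yconst (newt n z c r k) * yweight c j r) - yv j * (yconst (b r) * yweight c j r) =
      T r - T (Suc r)" for r
  proof -
    have alg: "(1 - zz * Y) * (a * (p * g)) - Y * (e * (p * g)) =
        a * (p * (g * (1 - cc * Y))) - (e + (zz - cc) * a) * (Y * p * g)"
      for zz Y a p g e cc :: "'a yseries"
      by (simp add: algebra_simps)
    have "T r = yconst (newt n z c r k) * (yv j ^ r * ((\<Prod>t<Suc r. ygeom (c t) j) * (1 - yconst (c r) * yv j)))"
      unfolding T_def using ygeom_inverse[of "c r" j] by (simp add: mult.assoc)
    moreover have "T (Suc r) = (yconst (b r) + (yconst (z k) - yconst (c r)) * yconst (newt n z c r k)) *
        (yv j * yv j ^ r * (\<Prod>t<Suc r. ygeom (c t) j))"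
      unfolding T_def b_def newt.simps yconst.hom_add yconst.hom_mult yconst.hom_minus power_Suc
      by (simp only: mult.assoc)
    ultimately show ?thesis
      unfolding yweight_def by (simp only: alg)
  qed
  have "T 0 - T D = (\<Sum>r<D. T r - T (Suc r))"
    by (rule sum_lessThan_telescope'[symmetric])
  also have "\<dots> = (1 - yconst (z k) * yv j) * (\<Sum>r<D. yconst (newt n z c r k) * yweight c j r) -
      yv j * (\<Sum>r<D. yconst (b r) * yweight c j r)"
    unfolding T[symmetric] sum_subtractf sum_distrib_left ..
  finally have "(1 - yconst (z k) * yv j) * (\<Sum>r<D. yconst (newt n z c r k) * yweight c j r) =
      T 0 + yv j * (\<Sum>r<D. yconst (b r) * yweight c j r) - T D"
    by (simp add: algebra_simps)
  moreover have "T 0 = (if k = n then 1 else 0)" by (simp add: T_def)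
  moreover have "yv j * (\<Sum>r<D. yconst (b r) * yweight c j r) =
      (if k < n then yv j * (\<Sum>r<D. yconst (newt n z c r (Suc k)) * yweight c j r) else 0)"
    by (cases "k < n") (simp_all add: b_def)
  ultimately show ?thesis unfolding T_def by (simp only:)
qed

text \<open>These are the divided differences of 1 / (1 - x y) in x. Dividing the telescoped
  identity by 1 - z_k y and descending from k = n adds one node at a time, and the boundary term is
  invisible below degree D.\<close>

lemma newt_series:
  assumes "1 \<le> k" "k \<le> n"
  shows "ycong D (\<Sum>r<D. yconst (newt n z c r k) * yweight c j r)
    (yv j ^ (n - k) * (\<Prod>i=k..n. ygeom (z i) j))"
proof -
  let ?S = "\<lambda>k. \<Sum>r<D. yconst (newt n z c r k) * yweight c j r"
  let ?T = "\<lambda>k. yconst (newt n z c D k) * (yv j ^ D * (\<Prod>t<D. ygeom (c t) j))"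
  have drop: "ycong D (ygeom (z k) j * (F - ?T k)) (ygeom (z k) j * F)" for k F
  proof -
    have "ylow D (?T k)" by (rule ylow_mult_right, rule ylow_mult_left, rule ylow_yv_power)
    from ylow_mult_right[OF ylow_uminus[OF this]] have "ylow D (ygeom (z k) j * - ?T k)" .
    then show ?thesis unfolding ycong_def by (simp add: algebra_simps)
  qed
  show ?thesis
    using assms(2)
  proof (induction k rule: inc_induct)
    case base
    have "?S n = ygeom (z n) j * (1 - ?T n)"
      using ygeom_cancel[of "z n" j "?S n"] unfolding newt_series_telescope[OF order_refl] by simp
    then show ?case using drop[of n 1] by simp
  next
    case (step k)
    then have k: "k \<le> n" "k < n" "k \<noteq> n" by simp_all
    have "?S k = ygeom (z k) j * (yv j * ?S (Suc k) - ?T k)"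
      using ygeom_cancel[of "z k" j "?S k"] unfolding newt_series_telescope[OF k(1)] by (simp add: k)
    then have 1: "ycong D (?S k) (ygeom (z k) j * (yv j * ?S (Suc k)))"
      by (simp only: drop)
    have 2: "ycong D (ygeom (z k) j * (yv j * ?S (Suc k)))
        (ygeom (z k) j * (yv j * (yv j ^ (n - Suc k) * (\<Prod>i=Suc k..n. ygeom (z i) j))))"
      by (intro ycong_mult ycong_refl step.IH)
    have 3: "ygeom (z k) j * (yv j * (yv j ^ (n - Suc k) * (\<Prod>i=Suc k..n. ygeom (z i) j))) =
        yv j ^ (n - k) * (\<Prod>i=k..n. ygeom (z i) j)"
    proof -
      have "n - k = Suc (n - Suc k)" using k by simp
      then show ?thesis
        by (simp only: prod.atLeast_Suc_atMost[OF k(1)] power_Suc mult_ac)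
    qed
    show ?case using ycong_trans[OF 1 2] unfolding 3 .
  qed
qed

lemma kernel_series: "ycong D (\<Sum>r<D. yconst (npow c x r) * yweight c j r) (ygeom x j)"
proof -
  have "npow c x r = newt 1 (\<lambda>_. x) c r 1" for r
    using newt_interpolation[of 1 1 c "\<lambda>_. x" r] by simp
  then show ?thesis using newt_series[of 1 1 D "\<lambda>_. x" c j] by simp
qed

text \<open>The coefficients are chosen before Y, so the same ones serve all y_j and form a single
  triangular matrix, with diagonal 1 because a 0 = 1.\<close>

lemma prod_one_minus_expansion:
  fixes w :: "nat \<Rightarrow> 'a::comm_ring_1"
  assumes "1 \<le> k"
  shows "\<exists>a. a 0 = 1 \<and> (\<forall>Y. (\<Prod>l\<in>{1..<k}. 1 - w l * Y) = (\<Sum>s<k. a s * Y ^ s))"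
  using assms
proof (induction k rule: dec_induct)
  case base
  show ?case by (intro exI[of _ "\<lambda>_. 1"]) (simp add: One_nat_def)
next
  case (step k)
  then obtain a where a: "a 0 = 1" "\<And>Y. (\<Prod>l\<in>{1..<k}. 1 - w l * Y) = (\<Sum>s<k. a s * Y ^ s)" by blast
  define b where "b s = (if s < k then a s else 0) - (if s = 0 then 0 else w k * a (s - 1))" for s
  have "(\<Prod>l\<in>{1..<Suc k}. 1 - w l * Y) = (\<Sum>s<Suc k. b s * Y ^ s)" for Y
  proof -
    have "(\<Sum>s<Suc k. b s * Y ^ s) = (\<Sum>s<Suc k. (if s < k then a s else 0) * Y ^ s) -
        (\<Sum>s<Suc k. (if s = 0 then 0 else w k * a (s - 1)) * Y ^ s)"
      unfolding b_def by (simp only: left_diff_distrib sum_subtractf)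
    also have "(\<Sum>s<Suc k. (if s < k then a s else 0) * Y ^ s) = (\<Sum>s<k. a s * Y ^ s)"
      by simp
    also have "(\<Sum>s<Suc k. (if s = 0 then 0 else w k * a (s - 1)) * Y ^ s) = w k * Y * (\<Sum>s<k. a s * Y ^ s)"
      unfolding sum.lessThan_Suc_shift by (simp add: sum_distrib_left mult_ac)
    finally have "(\<Sum>s<Suc k. b s * Y ^ s) = (\<Sum>s<k. a s * Y ^ s) * (1 - w k * Y)"
      by (simp add: algebra_simps)
    moreover have "(\<Prod>l\<in>{1..<Suc k}. 1 - w l * Y) = (\<Prod>l\<in>{1..<k}. 1 - w l * Y) * (1 - w k * Y)"
      using step.hyps by (simp add: prod.atLeastLessThan_Suc)
    ultimately show ?thesis by (simp only: a(2))
  qed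
  moreover have "b 0 = 1" using a(1) step.hyps by (simp add: b_def)
  ultimately show ?case by blast
qed

text \<open>Cauchy's determinant: Newton interpolation of \<open>x \<mapsto> 1 / (1 - x y\<^sub>j)\<close> at the nodes \<open>x\<^sub>i\<close>.\<close>

lemma cauchy_determinant:
  fixes x :: "nat \<Rightarrow> 'a::comm_ring_1"
  shows "det_fun n (\<lambda>i j. ygeom (x i) j) =
    yconst (vandermonde x n) * (vandermonde yv n * (\<Prod>j=1..n. \<Prod>i=1..n. ygeom (x i) j))"
proof -
  let ?z = "\<lambda>i. yconst (x i)" and ?D = "\<lambda>k j. yv j ^ (n - k) * (\<Prod>l=k..n. ygeom (x l) j)"
  let ?E = "\<lambda>k j. yv j ^ (n - k) * (\<Prod>l\<in>{1..<k}. 1 - ?z l * yv j)"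
  have "det_fun n (\<lambda>i j. ygeom (x i) j) = vandermonde ?z n * det_fun n ?D"
  proof (rule det_fun_newton)
    fix i j assume i: "i \<in> {1..n}"
    let ?g = "\<lambda>l. ygeom (x l) j" and ?q = "1 - ?z i * yv j"
    \<comment> \<open>Summand k of the interpolation formula, without its last factor 1 / (1 - z_k
      y_j). Because (z_i - z_k) y g_k = 1 - (1 - z_i y) g_k, multiplying by 1 - z_i y makes the sum
      telescope from U n = 1 down to U 0 = 0.\<close>
    define U where "U k = (\<Prod>m\<in>{k<..n}. (?z i - ?z m) * (yv j * ?g m))" for k
    have summand: "(\<Prod>m\<in>{k<..n}. ?z i - ?z m) * ?D k j = U k * ?g k" if "k \<in> {1..n}" for k
    proof -
      have "{k..n} = insert k {k<..n}" using that by auto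
      then have "(\<Prod>l=k..n. ?g l) = ?g k * (\<Prod>l\<in>{k<..n}. ?g l)" by simp
      then show ?thesis by (simp add: U_def prod.distrib mult_ac)
    qed
    have U: "?q * (U k * ?g k) = U k - U (k - 1)" if "k \<in> {1..n}" for k
    proof -
      have "{k - 1<..n} = insert k {k<..n}" using that by auto
      then have Uk: "U (k - 1) = (?z i - ?z k) * (yv j * ?g k) * U k" by (simp add: U_def)
      have alg: "(zi - zk) * (Y * g) = g * (1 - zk * Y) - (1 - zi * Y) * g" for zi zk Y g :: "'a yseries"
        by (simp add: algebra_simps)
      show ?thesis unfolding Uk alg ygeom_inverse by (simp add: algebra_simps)
    qed
    have "?q * (\<Sum>k=1..n. U k * ?g k) = (\<Sum>k=1..n. U k - U (k - 1))"
      unfolding sum_distrib_left by (rule sum.cong[OF refl]) (rule U)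
    also have "\<dots> = U n - U 0"
      unfolding sum_from_1 lessThan_atLeast0[symmetric] diff_Suc_1 by (rule sum_lessThan_telescope)
    also have "U n = 1" by (simp add: U_def)
    also have "U 0 = 0" unfolding U_def using i by (intro prod_zero bexI[of _ i]) auto
    finally have "?g i = (\<Sum>k=1..n. U k * ?g k)"
      using ygeom_cancel[of "x i" j "\<Sum>k=1..n. U k * ?g k"] by simp
    also have "\<dots> = (\<Sum>k=1..n. (\<Prod>m\<in>{k<..n}. ?z i - ?z m) * ?D k j)"
      by (rule sum.cong[OF refl]) (rule summand[symmetric])
    finally show "?g i = (\<Sum>k=1..n. (\<Prod>m\<in>{k<..n}. ?z i - ?z m) * ?D k j)" .
  qed
  \<comment> \<open>Extend each partial product over l \<ge> k to the full one, compensating by the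
    polynomial factors with l < k. The full product depends only on the column and comes out of the
    determinant.\<close>
  also have "det_fun n ?D = det_fun n (\<lambda>k j. (\<Prod>i=1..n. ygeom (x i) j) * ?E k j)"
  proof (rule det_fun_cong)
    fix k j assume k: "k \<in> {1..n}"
    have "{1..n} = {1..<k} \<union> {k..n}" using k by auto
    then have pp: "(\<Prod>i=1..n. ygeom (x i) j) = (\<Prod>i\<in>{1..<k}. ygeom (x i) j) * (\<Prod>i=k..n. ygeom (x i) j)"
      by (simp only:) (rule prod.union_disjoint; auto)
    have qq: "(\<Prod>i\<in>{1..<k}. ygeom (x i) j) * (\<Prod>l\<in>{1..<k}. 1 - ?z l * yv j) = 1"
      unfolding prod.distrib[symmetric] by (simp add: ygeom_inverse)
    have alg: "A * B * (Y * Q) = A * Q * (Y * B)" for A B Y Q :: "'a yseries"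
      by (simp add: mult_ac)
    show "?D k j = (\<Prod>i=1..n. ygeom (x i) j) * ?E k j"
      unfolding pp by (subst alg) (simp only: qq mult_1)
  qed
  also have "\<dots> = (\<Prod>j=1..n. \<Prod>i=1..n. ygeom (x i) j) * det_fun n ?E"
    by (rule det_fun_scale_cols)
  \<comment> \<open>Row k consists of y_j^(n - k) times a polynomial of degree below k in y_j with
    constant term 1, so it is a unitriangular combination of the rows y_j^(n - m) with m \<le>
    k.\<close>
  also have "det_fun n ?E = vandermonde yv n"
  proof -
    obtain a where a: "\<And>k. 1 \<le> k \<Longrightarrow> a k 0 = 1 \<and> (\<forall>Y. (\<Prod>l\<in>{1..<k}. 1 - ?z l * Y) = (\<Sum>s<k. a k s * Y ^ s))"
      using prod_one_minus_expansion[of _ ?z] by metis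
    let ?T = "\<lambda>k m. if m \<le> k then a k (k - m) else 0"
    have "?E k j = (\<Sum>m=1..n. ?T k m * yv j ^ (n - m))" if k: "k \<in> {1..n}" for k j
    proof -
      have "?E k j = yv j ^ (n - k) * (\<Sum>s<k. a k s * yv j ^ s)"
        using a[of k] k by simp
      also have "\<dots> = (\<Sum>s<k. a k s * yv j ^ (n - k + s))"
        unfolding sum_distrib_left power_add by (simp only: mult_ac)
      also have "\<dots> = (\<Sum>m=1..k. a k (k - m) * yv j ^ (n - m))"
        by (rule sum.reindex_bij_witness[of _ "\<lambda>m. k - m" "\<lambda>s. k - s"]) (use k in \<open>auto simp: Suc_le_eq One_nat_def\<close>)
      also have "\<dots> = (\<Sum>m=1..n. ?T k m * yv j ^ (n - m))"
        by (rule sum.mono_neutral_cong_left) (use k in auto)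
      finally show ?thesis .
    qed
    then have "det_fun n ?E = det_fun n (\<lambda>k j. \<Sum>m=1..n. ?T k m * yv j ^ (n - m))"
      by (intro det_fun_cong)
    also have "\<dots> = det_fun n ?T * det_fun n (\<lambda>m j. yv j ^ (n - m))"
      by (rule det_fun_mult)
    also have "det_fun n ?T = 1"
    proof (subst det_fun_lower_triangular)
      show "(\<Prod>i=1..n. ?T i i) = 1" by (intro prod.neutral ballI) (use a in simp)
    qed simp
    also have "det_fun n (\<lambda>m j. yv j ^ (n - m)) = alternant n yv (\<lambda>_. 0) (\<lambda>j. n - j)"
      unfolding alternant_def by (subst det_fun_transpose[symmetric]) (simp add: npow_def)
    finally show ?thesis by (simp add: alternant_empty)
  qed
  finally show ?thesis
    by (simp add: hom_vandermonde[OF comm_ring_hom_yconst] mult_ac)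
qed


subsection \<open>Multisets of parts\<close>

definition parts_mset :: "partition \<Rightarrow> nat multiset" where
  "parts_mset \<mu> = image_mset (part \<mu>) (mset_set {i. part \<mu> i \<noteq> 0})"

definition exps_mset :: "(nat \<Rightarrow>\<^sub>0 nat) \<Rightarrow> nat multiset" where
  "exps_mset u = image_mset (Poly_Mapping.lookup u) (mset_set (Poly_Mapping.keys u))"

lemma monomials_eq: "monomials \<mu> n = {u. Poly_Mapping.keys u \<subseteq> {1..n} \<and> exps_mset u = parts_mset \<mu>}"
  by (simp add: monomials_def exps_mset_def parts_mset_def)

lemma psize_eq_sum_mset: "psize \<mu> = sum_mset (parts_mset \<mu>)"
  by (simp only: psize_def parts_mset_def sum_unfold_sum_mset)

lemma mdeg_eq_sum_mset: "mdeg u = sum_mset (exps_mset u)"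
  by (simp only: mdeg_def exps_mset_def sum_unfold_sum_mset)

lemma size_parts_mset: "size (parts_mset \<mu>) = plength \<mu>"
  by (simp add: parts_mset_def plength_def)

lemma size_exps_mset: "size (exps_mset u) = card (Poly_Mapping.keys u)"
  by (simp add: exps_mset_def)

lemma parts_mset_list: "parts_mset \<mu> = mset (map (part \<mu>) [1..<Suc (plength \<mu>)])"
proof -
  have "mset_set {1..plength \<mu>} = mset [1..<Suc (plength \<mu>)]"
    by (metis atLeastLessThanSuc_atLeastAtMost mset_upt)
  then show ?thesis unfolding parts_mset_def part_support by (simp only: mset_map)
qed

lemma parts_mset_inject:
  assumes "parts_mset \<mu> = parts_mset \<nu>"
  shows "\<mu> = \<nu>"
proof -
  have len: "plength \<mu> = plength \<nu>" using assms size_parts_mset by metis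
  let ?l = "\<lambda>\<mu>. map (part \<mu>) [1..<Suc (plength \<mu>)]"
  have sorted: "sorted (rev (?l \<mu>))" for \<mu>
  proof -
    have "sorted_wrt (\<ge>) (?l \<mu>)"
      unfolding sorted_wrt_iff_nth_less
    proof (intro allI impI)
      fix i j assume "i < j" "j < length (?l \<mu>)"
      then show "?l \<mu> ! j \<le> ?l \<mu> ! i"
        using part_antimono[of "Suc i" "Suc j" \<mu>] by (simp add: plus_1_eq_Suc del: upt_Suc)
    qed
    then show ?thesis by (simp add: sorted_wrt_rev del: upt_Suc)
  qed
  have "mset (rev (?l \<mu>)) = mset (rev (?l \<nu>))"
    using assms by (simp only: mset_rev parts_mset_list)
  then have "rev (?l \<mu>) = rev (?l \<nu>)"
    using properties_for_sort[of "rev (?l \<mu>)" "rev (?l \<nu>)"] properties_for_sort[of "rev (?l \<nu>)" "rev (?l \<nu>)"]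
      sorted by metis
  then have eq: "?l \<mu> = ?l \<nu>" by (simp only: rev_is_rev_conv)
  show ?thesis
  proof (rule partition_eqI)
    fix i :: nat assume i: "1 \<le> i"
    show "part \<mu> i = part \<nu> i"
    proof (cases "i \<le> plength \<mu>")
      case True
      have "?l \<mu> ! (i - 1) = ?l \<nu> ! (i - 1)" by (simp only: eq)
      then show ?thesis using i True len by (simp add: plus_1_eq_Suc del: upt_Suc)
    next
      case False
      then show ?thesis using len by (simp add: part_eq_0[OF order_refl])
    qed
  qed
qed

lemma parts_mset_surj:
  assumes "\<And>x. x \<in># M \<Longrightarrow> x > 0"
  shows "\<exists>\<mu>. parts_mset \<mu> = M"
proof -
  define xs where "xs = rev (sorted_list_of_multiset M)"
  have mset: "mset xs = M" by (simp add: xs_def)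
  have "sorted_wrt (\<ge>) xs" by (simp add: xs_def sorted_wrt_rev)
  then have dec: "xs ! j \<le> xs ! i" if "i < j" "j < length xs" for i j
    using that by (simp add: sorted_wrt_iff_nth_less)
  from ex_partition[of "length xs" "\<lambda>i. xs ! (i - 1)"] dec
  obtain \<mu> where \<mu>: "plength \<mu> \<le> length xs" "\<And>i. i \<in> {1..length xs} \<Longrightarrow> part \<mu> i = xs ! (i - 1)"
    by (metis (no_types, lifting) One_nat_def Suc_diff_1 diff_Suc_1 diff_less less_eq_Suc_le lessI less_le_trans)
  have "plength \<mu> = length xs"
  proof (rule antisym[OF \<mu>(1)], rule ccontr)
    assume *: "\<not> length xs \<le> plength \<mu>"
    then have "length xs \<ge> 1" by simp
    then have "part \<mu> (length xs) = xs ! (length xs - 1)" using \<mu>(2) by simp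
    moreover have "xs ! (length xs - 1) > 0"
    proof -
      have "length xs - 1 < length xs" using \<open>length xs \<ge> 1\<close> by linarith
      from nth_mem[OF this] have "xs ! (length xs - 1) \<in># M" by (simp only: mset[symmetric] set_mset_mset)
      then show ?thesis by (rule assms)
    qed
    ultimately show False using * part_pos_iff[of \<mu> "length xs"] by simp
  qed
  then have "map (part \<mu>) [1..<Suc (plength \<mu>)] = xs"
    by (intro nth_equalityI) (simp_all add: \<mu>(2) plus_1_eq_Suc del: upt_Suc)
  then have "parts_mset \<mu> = M" by (simp only: parts_mset_list mset)
  then show ?thesis by blast
qed

lemma ex1_partition_monomials:
  assumes "Poly_Mapping.keys u \<subseteq> {1..n}"
  shows "\<exists>\<mu>. u \<in> monomials \<mu> n"
proof -
  have "\<exists>\<mu>. parts_mset \<mu> = exps_mset u"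
    by (rule parts_mset_surj) (auto simp: exps_mset_def in_keys_iff)
  then obtain \<mu> where "parts_mset \<mu> = exps_mset u" by blast
  with assms have "u \<in> monomials \<mu> n" by (simp add: monomials_eq)
  then show ?thesis by blast
qed

lemma monomials_psize: "u \<in> monomials \<mu> n \<Longrightarrow> mdeg u = psize \<mu>"
  and monomials_plength: "u \<in> monomials \<mu> n \<Longrightarrow> card (Poly_Mapping.keys u) = plength \<mu>"
  and monomials_keys: "u \<in> monomials \<mu> n \<Longrightarrow> Poly_Mapping.keys u \<subseteq> {1..n}"
  by (simp_all add: monomials_eq mdeg_eq_sum_mset psize_eq_sum_mset
      size_parts_mset[symmetric] size_exps_mset[symmetric])

lemma monomials_unique: "u \<in> monomials \<mu> n \<Longrightarrow> u \<in> monomials \<nu> n \<Longrightarrow> \<mu> = \<nu>"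
  by (rule parts_mset_inject) (simp add: monomials_eq)

lemma lookup_le_mdeg: "Poly_Mapping.lookup u i \<le> mdeg u"
proof (cases "i \<in> Poly_Mapping.keys u")
  case True
  then show ?thesis unfolding mdeg_def by (intro member_le_sum) auto
qed (simp add: in_keys_iff)

lemma finite_mdeg_less: "finite {u. Poly_Mapping.keys u \<subseteq> {1..n} \<and> mdeg u < D}"
proof (rule inj_on_finite)
  let ?r = "\<lambda>u. restrict (Poly_Mapping.lookup u) {1..n}"
  show "inj_on ?r {u. Poly_Mapping.keys u \<subseteq> {1..n} \<and> mdeg u < D}"
  proof (rule inj_onI, rule poly_mapping_eqI)
    fix u v i assume *: "u \<in> {u. Poly_Mapping.keys u \<subseteq> {1..n} \<and> mdeg u < D}"
      "v \<in> {u. Poly_Mapping.keys u \<subseteq> {1..n} \<and> mdeg u < D}" "?r u = ?r v"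
    show "Poly_Mapping.lookup u i = Poly_Mapping.lookup v i"
    proof (cases "i \<in> {1..n}")
      case True
      then show ?thesis using fun_cong[OF *(3), of i] by simp
    next
      case False
      then have "i \<notin> Poly_Mapping.keys u" "i \<notin> Poly_Mapping.keys v" using * by blast+
      then show ?thesis by (simp add: in_keys_iff)
    qed
  qed
  show "?r ` {u. Poly_Mapping.keys u \<subseteq> {1..n} \<and> mdeg u < D} \<subseteq> PiE {1..n} (\<lambda>_. {..<D})"
    by (auto intro: le_less_trans[OF lookup_le_mdeg])
qed (auto intro: finite_PiE)

lemma finite_monomials: "finite (monomials \<mu> n)"
  by (rule finite_subset[OF _ finite_mdeg_less[of n "Suc (psize \<mu>)"]])
    (auto dest: monomials_psize monomials_keys)

lemma dcomplete_0: "dcomplete 0 = 1"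
proof -
  have "row_part 0 = empty_part"
    by (rule partition_eqI) (simp add: row_part.rep_eq empty_part.rep_eq)
  then show ?thesis by (simp add: dcomplete_def dschur_empty)
qed

text \<open>The product depends only on the multiset of exponents, and variables with exponent 0
  contribute h_0 = 1.\<close>

lemma dcomplete_part_monomials:
  assumes "u \<in> monomials \<mu> n"
  shows "(\<Prod>j=1..n. dcomplete (Poly_Mapping.lookup u j)) = dcomplete_part \<mu>"
proof -
  have "dcomplete_part \<mu> = prod_mset (image_mset dcomplete (parts_mset \<mu>))"
    by (simp add: dcomplete_part_def parts_mset_def prod_unfold_prod_mset multiset.map_comp comp_def)
  also have "\<dots> = prod_mset (image_mset dcomplete (exps_mset u))"
    using assms by (simp add: monomials_eq)
  also have "\<dots> = (\<Prod>j\<in>Poly_Mapping.keys u. dcomplete (Poly_Mapping.lookup u j))"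
    by (simp add: exps_mset_def prod_unfold_prod_mset multiset.map_comp comp_def)
  also have "\<dots> = (\<Prod>j=1..n. dcomplete (Poly_Mapping.lookup u j))"
    by (rule prod.mono_neutral_left) (use monomials_keys[OF assms] in \<open>auto simp: in_keys_iff dcomplete_0\<close>)
  finally show ?thesis ..
qed


subsection \<open>Coefficients of dual monomial symmetric functions\<close>

lemma ycoeff_yv_power_mult: "ycoeff (yv i ^ k * F) (Poly_Mapping.single i k + v) = ycoeff F v"
proof (induction k)
  case (Suc k)
  have "Poly_Mapping.single i (Suc k) = Poly_Mapping.single i 1 + Poly_Mapping.single i k"
    by (simp add: single_add[symmetric] plus_1_eq_Suc)
  then show ?case
    using Suc by (simp only: power_Suc mult.assoc add.assoc ycoeff_yv_mult)
qed simp

lemma ycoeff_yv_power_mult_0: "Poly_Mapping.lookup w i < k \<Longrightarrow> ycoeff (yv i ^ k * F) w = 0"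
proof (induction k arbitrary: w)
  case (Suc k)
  show ?case
  proof (cases "Poly_Mapping.lookup w i = 0")
    case True
    then show ?thesis by (simp only: power_Suc mult.assoc ycoeff_yv_mult_0)
  next
    case False
    then obtain v where v: "w = Poly_Mapping.single i 1 + v" by (rule poly_mapping_split_single)
    then have "Poly_Mapping.lookup v i < k" using Suc.prems by (simp add: lookup_add)
    then show ?thesis unfolding v power_Suc mult.assoc ycoeff_yv_mult by (rule Suc.IH)
  qed
qed simp

lemma ycoeff_monom_mult:
  assumes "finite S"
  shows "ycoeff ((\<Prod>i\<in>S. yv i ^ g i) * F) ((\<Sum>i\<in>S. Poly_Mapping.single i (g i)) + v) = ycoeff F v"
    and "i \<in> S \<Longrightarrow> Poly_Mapping.lookup w i < g i \<Longrightarrow> ycoeff ((\<Prod>i\<in>S. yv i ^ g i) * F) w = 0"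
  using assms
proof (induction S arbitrary: v w rule: finite_induct)
  case (insert a S)
  case 1
  show ?case
    unfolding sum.insert[OF insert.hyps] prod.insert[OF insert.hyps] mult.assoc add.assoc
      ycoeff_yv_power_mult insert.IH(1) ..
next
  case (insert a S)
  case 2
  show ?case
  proof (cases "Poly_Mapping.lookup w a < g a")
    case True
    then show ?thesis
      unfolding prod.insert[OF insert.hyps] mult.assoc by (rule ycoeff_yv_power_mult_0)
  next
    case False
    define v where "v = w - Poly_Mapping.single a (g a)"
    have w: "w = Poly_Mapping.single a (g a) + v"
      using False by (intro poly_mapping_eqI) (auto simp: v_def lookup_add lookup_minus lookup_single when_def)
    have "i \<in> S" "Poly_Mapping.lookup v i < g i"
      using 2 False by (auto simp: v_def lookup_minus)
    then show ?thesis
      unfolding w prod.insert[OF insert.hyps] mult.assoc ycoeff_yv_power_mult by (rule insert.IH(2))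
  qed
qed simp_all

lemma ycoeff_mult_at_0: "ycoeff (F * G) 0 = ycoeff F 0 * ycoeff G 0"
proof -
  have "splits 0 = {(0, 0)}" by (auto simp: splits_def) (metis lookup_zero add_eq_0_iff_both_eq_0 lookup_add poly_mapping_eqI)+
  then show ?thesis by (simp add: times_yseries.rep_eq)
qed

lemma ycoeff_prod_at_0: "ycoeff (\<Prod>i\<in>A. f i) 0 = (\<Prod>i\<in>A. ycoeff (f i) 0)"
  by (induction A rule: infinite_finite_induct) (simp_all add: ycoeff_mult_at_0)

abbreviation ypow_monom :: "(nat \<Rightarrow>\<^sub>0 nat) \<Rightarrow> qa yseries" where
  "ypow_monom u \<equiv> \<Prod>i\<in>Poly_Mapping.keys u. ypow i (Poly_Mapping.lookup u i)"

lemma ypow_monom_eq: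
  "ypow_monom u = (\<Prod>i\<in>Poly_Mapping.keys u. yv i ^ Poly_Mapping.lookup u i) *
    (\<Prod>i\<in>Poly_Mapping.keys u. \<Prod>k\<in>{1 - int (Poly_Mapping.lookup u i)..0}. ygeom (av k) i)"
  by (simp add: ypow_def prod.distrib)

lemma ycoeff_ypow_monom_self: "ycoeff (ypow_monom u) u = 1"
proof -
  have u: "u = (\<Sum>i\<in>Poly_Mapping.keys u. Poly_Mapping.single i (Poly_Mapping.lookup u i)) + 0"
    using poly_sum_single[of u] by simp
  have "ycoeff (ypow_monom u) u = ycoeff (\<Prod>i\<in>Poly_Mapping.keys u.
      \<Prod>k\<in>{1 - int (Poly_Mapping.lookup u i)..0}. ygeom (av k) i) 0"
    unfolding ypow_monom_eq by (subst (4) u) (rule ycoeff_monom_mult(1)[OF finite_keys])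
  then show ?thesis by (simp add: ycoeff_prod_at_0 ygeom.rep_eq)
qed

lemma ycoeff_ypow_monom_le:
  assumes "ycoeff (ypow_monom u) w \<noteq> 0"
  shows "Poly_Mapping.lookup u i \<le> Poly_Mapping.lookup w i"
proof (rule ccontr)
  assume *: "\<not> ?thesis"
  then have "i \<in> Poly_Mapping.keys u" by (simp add: in_keys_iff)
  with * have "ycoeff (ypow_monom u) w = 0"
    unfolding ypow_monom_eq by (intro ycoeff_monom_mult(2)[of _ i]) simp_all
  with assms show False by simp
qed

lemma mdeg_mono:
  assumes "\<And>i. Poly_Mapping.lookup u i \<le> Poly_Mapping.lookup w i"
  shows "mdeg u \<le> mdeg w" "mdeg u = mdeg w \<Longrightarrow> u = w"
proof -
  have "w = u + (w - u)"
    using assms by (intro poly_mapping_eqI) (simp add: lookup_add lookup_minus)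
  then have m: "mdeg w = mdeg u + mdeg (w - u)" by (metis mdeg_add)
  then show "mdeg u \<le> mdeg w" by simp
  assume "mdeg u = mdeg w"
  then have "mdeg (w - u) = 0" using m by simp
  then have "Poly_Mapping.lookup (w - u) i = 0" for i using lookup_le_mdeg[of "w - u" i] by simp
  then have "w - u = 0" by (intro poly_mapping_eqI) simp
  with \<open>w = u + (w - u)\<close> show "u = w" by simp
qed

lemma ycoeff_dual_monomial_nonzero:
  assumes "ycoeff (dual_monomial \<mu> n) w \<noteq> 0"
  obtains u where "u \<in> monomials \<mu> n" "\<And>i. Poly_Mapping.lookup u i \<le> Poly_Mapping.lookup w i"
proof -
  have "\<exists>u\<in>monomials \<mu> n. ycoeff (ypow_monom u) w \<noteq> 0"
    using assms unfolding dual_monomial_def ycoeff_sum by (metis (no_types, lifting) sum.neutral)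
  then show ?thesis using that ycoeff_ypow_monom_le by blast
qed

lemma ycoeff_dual_monomial_psize: "ycoeff (dual_monomial \<mu> n) w \<noteq> 0 \<Longrightarrow> psize \<mu> \<le> mdeg w"
  by (metis ycoeff_dual_monomial_nonzero mdeg_mono(1) monomials_psize)

text \<open>The part of lowest degree of a dual monomial function is the ordinary monomial function,
  because (y,a)^r begins with y^r. This unitriangularity by size makes expansions unique.\<close>

lemma ycoeff_dual_monomial_top:
  assumes w: "w \<in> monomials \<mu> n" and "psize \<nu> = psize \<mu>"
  shows "ycoeff (dual_monomial \<nu> n) w = (if \<nu> = \<mu> then 1 else 0)"
proof -
  have eq: "u = w" if u: "u \<in> monomials \<nu> n" "ycoeff (ypow_monom u) w \<noteq> 0" for u
    by (rule mdeg_mono(2)[OF ycoeff_ypow_monom_le[OF u(2)]])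
      (simp only: monomials_psize[OF u(1)] monomials_psize[OF w] assms(2))
  show ?thesis
  proof (cases "\<nu> = \<mu>")
    case True
    have "ycoeff (dual_monomial \<nu> n) w = (\<Sum>u\<in>{w}. ycoeff (ypow_monom u) w)"
      unfolding dual_monomial_def ycoeff_sum True
    proof (rule sum.mono_neutral_right[OF finite_monomials])
      show "{w} \<subseteq> monomials \<mu> n" using w by blast
      show "\<forall>u\<in>monomials \<mu> n - {w}. ycoeff (ypow_monom u) w = 0" using eq True by blast
    qed
    then show ?thesis using True by (simp add: ycoeff_ypow_monom_self)
  next
    case False
    have "ycoeff (dual_monomial \<nu> n) w = 0"
      unfolding dual_monomial_def ycoeff_sum
    proof (rule sum.neutral, rule ballI, rule ccontr)
      fix u assume u: "u \<in> monomials \<nu> n" "ycoeff (ypow_monom u) w \<noteq> 0"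
      then have "w \<in> monomials \<nu> n" using eq by blast
      then show False using monomials_unique[OF w] False by blast
    qed
    then show ?thesis using False by simp
  qed
qed

lemma ex_monomial:
  assumes "plength \<mu> \<le> n"
  obtains u where "u \<in> monomials \<mu> n" "\<And>i. Poly_Mapping.lookup u i = part \<mu> i"
proof
  let ?u = "Abs_poly_mapping (part \<mu>)"
  show l: "Poly_Mapping.lookup ?u i = part \<mu> i" for i
    by (subst lookup_Abs_poly_mapping) (use finite_part in auto)
  have keys: "Poly_Mapping.keys ?u = {i. part \<mu> i \<noteq> 0}"
    unfolding set_eq_iff in_keys_iff l by simp
  have "exps_mset ?u = parts_mset \<mu>"
    unfolding exps_mset_def parts_mset_def keys by (intro image_mset_cong l)
  moreover have "Poly_Mapping.keys ?u \<subseteq> {1..n}"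
    unfolding keys part_support using assms by auto
  ultimately show "?u \<in> monomials \<mu> n" by (simp add: monomials_eq)
qed

text \<open>Only partitions of size at most the degree of u reach the exponent u, so every
  coefficient of the formal sum is a sum over one fixed finite set.\<close>

lemma formal_sums_dual_monomials_iff:
  "formal_sums (\<lambda>\<mu>. yconst (K \<mu>) * dual_monomial \<mu> n) F \<longleftrightarrow>
    (\<forall>u. ycoeff F u = (\<Sum>\<mu> | psize \<mu> \<le> mdeg u. K \<mu> * ycoeff (dual_monomial \<mu> n) u))"
proof -
  let ?f = "\<lambda>u \<mu>. K \<mu> * ycoeff (dual_monomial \<mu> n) u"
  have sub: "{\<mu>. ?f u \<mu> \<noteq> 0} \<subseteq> {\<mu>. psize \<mu> \<le> mdeg u}" for u
    using ycoeff_dual_monomial_psize by auto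
  have "(\<Sum>\<mu> | ?f u \<mu> \<noteq> 0. ?f u \<mu>) = (\<Sum>\<mu> | psize \<mu> \<le> mdeg u. ?f u \<mu>)" for u
    by (rule sum.mono_neutral_left[OF finite_psize_le sub]) blast
  moreover have "finite {\<mu>. ?f u \<mu> \<noteq> 0}" for u
    by (rule finite_subset[OF sub finite_psize_le])
  ultimately show ?thesis by (simp only: formal_sums_def ycoeff_yconst_mult simp_thms)
qed

text \<open>Look at an exponent of type \<mu>: smaller partitions agree by induction, and others of
  the same size do not contribute. Using as many variables as \<mu> has parts guarantees that such
  an exponent exists.\<close>

lemma dual_monomial_expansion_unique:
  assumes "\<And>n. formal_sums (\<lambda>\<mu>. yconst (K \<mu>) * dual_monomial \<mu> n) (F n)"
    and "\<And>n. formal_sums (\<lambda>\<mu>. yconst (K' \<mu>) * dual_monomial \<mu> n) (F n)"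
  shows "K = K'"
proof
  fix \<mu>
  show "K \<mu> = K' \<mu>"
  proof (induction "psize \<mu>" arbitrary: \<mu> rule: less_induct)
    case less
    obtain u where u: "u \<in> monomials \<mu> (plength \<mu>)" using ex_monomial[OF order_refl] by blast
    let ?n = "plength \<mu>"
    have "(\<Sum>\<nu> | psize \<nu> \<le> mdeg u. K \<nu> * ycoeff (dual_monomial \<nu> ?n) u) =
        (\<Sum>\<nu> | psize \<nu> \<le> mdeg u. K' \<nu> * ycoeff (dual_monomial \<nu> ?n) u)"
      using assms[of ?n] unfolding formal_sums_dual_monomials_iff by metis
    then have "(\<Sum>\<nu> | psize \<nu> \<le> mdeg u. (K \<nu> - K' \<nu>) * ycoeff (dual_monomial \<nu> ?n) u) = 0"
      by (simp add: left_diff_distrib sum_subtractf)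
    also have "(\<Sum>\<nu> | psize \<nu> \<le> mdeg u. (K \<nu> - K' \<nu>) * ycoeff (dual_monomial \<nu> ?n) u) =
        (\<Sum>\<nu>\<in>{\<mu>}. (K \<nu> - K' \<nu>) * ycoeff (dual_monomial \<nu> ?n) u)"
    proof (rule sum.mono_neutral_right[OF finite_psize_le])
      show "{\<mu>} \<subseteq> {\<nu>. psize \<nu> \<le> mdeg u}" using monomials_psize[OF u] by simp
      show "\<forall>\<nu>\<in>{\<nu>. psize \<nu> \<le> mdeg u} - {\<mu>}. (K \<nu> - K' \<nu>) * ycoeff (dual_monomial \<nu> ?n) u = 0"
      proof
        fix \<nu> assume \<nu>: "\<nu> \<in> {\<nu>. psize \<nu> \<le> mdeg u} - {\<mu>}"
        show "(K \<nu> - K' \<nu>) * ycoeff (dual_monomial \<nu> ?n) u = 0"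
        proof (cases "psize \<nu> = psize \<mu>")
          case True
          then show ?thesis using \<nu> ycoeff_dual_monomial_top[OF u True] by simp
        next
          case False
          then have "psize \<nu> < psize \<mu>" using \<nu> monomials_psize[OF u] by simp
          then show ?thesis using less by simp
        qed
      qed
    qed
    finally show ?case by (simp add: ycoeff_dual_monomial_top[OF u refl])
  qed
qed


subsection \<open>Dual Schur functions\<close>

lemma sum_split_add: "(\<Sum>r<a + b. g r) = (\<Sum>r<a. g r) + (\<Sum>r<b. g (a + r))" for a b :: nat
  by (induction b) (simp_all add: add.assoc)

abbreviation yembed :: "qa yseries \<Rightarrow> xpoly yseries" where
  "yembed \<equiv> ymap xconst"

interpretation yembed: comm_ring_hom yembed
  by (rule comm_ring_hom_ymap[OF comm_ring_hom_xconst])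

lemma yembed_simps [simp]:
  "yembed (yv i) = yv i" "yembed (ygeom c i) = ygeom (xconst c) i" "yembed (yconst c) = yconst (xconst c)"
  by (simp_all add: ymap_yv[OF comm_ring_hom_xconst] ymap_ygeom[OF comm_ring_hom_xconst] ymap_yconst)

lemma part_row_part: "part (row_part k) i = (if i = 1 then k else 0)"
  by (simp add: row_part.rep_eq)

text \<open>Columns beyond the first carry the exponents n - j of the empty partition, so the matrix
  is triangular and only its first diagonal entry differs from 1.\<close>

lemma dschur_poly_row:
  assumes "n \<ge> 1"
  shows "dschur_poly (row_part k) n = newt n xv (\<lambda>t. xconst (nodes n t)) (k + n - 1) 1"
proof -
  have "plength (row_part k) \<le> n"
    unfolding plength_le_iff using assms by (auto simp: part_row_part)
  then have "dschur_poly (row_part k) n = fschur n xv (\<lambda>t. xconst (nodes n t)) (part (row_part k))"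
    by (rule dschur_poly_eq_fschur)
  also have "\<dots> = (\<Prod>i=1..n. newt n xv (\<lambda>t. xconst (nodes n t)) (part (row_part k) i + n - i) i)"
    unfolding fschur_def
    by (rule det_fun_lower_triangular) (auto simp: part_row_part intro!: newt_eq_0)
  also have "\<dots> = (\<Prod>i=1..n. if i = 1 then newt n xv (\<lambda>t. xconst (nodes n t)) (k + n - 1) 1 else 1)"
    by (rule prod.cong) (auto simp: part_row_part newt_eq_1)
  also have "\<dots> = newt n xv (\<lambda>t. xconst (nodes n t)) (k + n - 1) 1"
    using assms by simp
  finally show ?thesis .
qed

lemma prod_ygeom_nodes:
  "(\<Prod>t<k. ygeom (nodes n t) j) = (\<Prod>s\<in>{int n + 1 - int k..int n}. ygeom (av s) j)"
  by (rule prod.reindex_bij_witness[of _ "\<lambda>s. nat (int n - s)" "\<lambda>t. int n - int t"]) auto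

text \<open>The numerator in y_j of the Cauchy kernel: it removes from the weights the denominators
  with index 1, ..., n, which are absent from (y,a)^r.\<close>

abbreviation ynum :: "nat \<Rightarrow> nat \<Rightarrow> qa yseries" where
  "ynum n j \<equiv> \<Prod>s\<in>{1..int n}. 1 - yconst (av s) * yv j"

lemma ygeom_inverse_prod: "(\<Prod>s\<in>A. ygeom (c s) j) * (\<Prod>s\<in>A. 1 - yconst (c s) * yv j) = 1"
  unfolding prod.distrib[symmetric] by (simp add: ygeom_inverse)

lemma yweight_row:
  assumes "n \<ge> 1"
  shows "yweight (nodes n) j (k + n - 1) =
    yv j ^ (n - 1) * ((\<Prod>s\<in>{1..int n}. ygeom (av s) j) * ypow j k)"
proof -
  have k: "Suc (k + n - 1) = n + k" "k + n - 1 = (n - 1) + k" using assms by simp_all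
  have "{int n + 1 - int (n + k)..int n} = {1..int n} \<union> {1 - int k..0}" by auto
  then have "(\<Prod>t<n + k. ygeom (nodes n t) j) =
      (\<Prod>s\<in>{1..int n}. ygeom (av s) j) * (\<Prod>s\<in>{1 - int k..0}. ygeom (av s) j)"
    unfolding prod_ygeom_nodes by (simp only:) (rule prod.union_disjoint; auto)
  then show ?thesis
    unfolding yweight_def k(1) unfolding k(2) power_add ypow_def by (simp only: mult_ac)
qed

text \<open>The generating function of the complete functions is \<open>newt_series\<close> at k =
  1, where all nodes enter; the weights reduce to (y,a)^k after multiplication by
  \<open>ynum\<close>.\<close>

lemma complete_series:
  assumes n: "n \<ge> 1"
  shows "ycong D (\<Sum>k<D. yconst (dschur_poly (row_part k) n) * yembed (ypow j k))
    (yembed (ynum n j) * (\<Prod>i=1..n. ygeom (xv i) j))"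
proof -
  let ?C = "\<lambda>t. xconst (nodes n t)" and ?B = "yembed (ynum n j)"
  let ?A = "yembed (\<Prod>s\<in>{1..int n}. ygeom (av s) j)"
  let ?H = "\<Sum>k<D. yconst (dschur_poly (row_part k) n) * yembed (ypow j k)"
  have AB: "?A * ?B = 1"
    by (simp only: yembed.hom_mult[symmetric] ygeom_inverse_prod yembed.hom_one)
  have W: "yweight ?C j r = yembed (yweight (nodes n) j r)" for r
    by (simp add: yweight_def yembed.hom_mult yembed.hom_power yembed.hom_prod)
  \<comment> \<open>The first n - 1 terms vanish by degree. The extra n - 1 in the truncation pays
    for cancelling the common factor \<open>yv j ^ (n - 1)\<close> afterwards.\<close>
  have "(\<Sum>r<n - 1 + D. yconst (newt n xv ?C r 1) * yweight ?C j r) =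
      (\<Sum>k<D. yconst (newt n xv ?C (n - 1 + k) 1) * yweight ?C j (n - 1 + k))"
    unfolding sum_split_add by (simp add: newt_eq_0)
  also have "\<dots> = yv j ^ (n - 1) * (?A * ?H)"
    unfolding sum_distrib_left
  proof (rule sum.cong[OF refl])
    fix k
    have "n - 1 + k = k + n - 1" using n by simp
    then show "yconst (newt n xv ?C (n - 1 + k) 1) * yweight ?C j (n - 1 + k) =
        yv j ^ (n - 1) * (?A * (yconst (dschur_poly (row_part k) n) * yembed (ypow j k)))"
      by (simp only: W yweight_row[OF n] dschur_poly_row[OF n] yembed.hom_mult yembed.hom_power
          yembed_simps mult_ac)
  qed
  finally have "ycong (n - 1 + D) (yv j ^ (n - 1) * (?A * ?H)) (yv j ^ (n - 1) * (\<Prod>i=1..n. ygeom (xv i) j))"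
    using newt_series[of 1 n "n - 1 + D" xv ?C j] n by simp
  then have "ycong D (?A * ?H) (\<Prod>i=1..n. ygeom (xv i) j)"
    by (rule ycong_cancel_yv_power)
  then have "ycong D (?B * (?A * ?H)) (?B * (\<Prod>i=1..n. ygeom (xv i) j))"
    by (intro ycong_mult ycong_refl)
  moreover have "?B * (?A * ?H) = ?A * ?B * ?H" by (simp only: mult_ac)
  ultimately show ?thesis by (simp only: AB mult_1)
qed

section \<open>Schur coefficients of the Cauchy kernel\<close>

abbreviation lcoeff :: "nat \<Rightarrow> partition \<Rightarrow> xpoly \<Rightarrow> qa" where
  "lcoeff n \<kappa> \<equiv> ncoeff id (\<lambda>_. 0) (nodes n) {1..n} (shifted \<kappa> n)"

lemmas lcoeff_rules = comm_ring_hom_id finite_atLeastAtMost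

lemma lcoeff_linear:
  "lcoeff n \<kappa> (p + q) = lcoeff n \<kappa> p + lcoeff n \<kappa> q"
  "lcoeff n \<kappa> (p - q) = lcoeff n \<kappa> p - lcoeff n \<kappa> q"
  "lcoeff n \<kappa> (xconst c * p) = c * lcoeff n \<kappa> p"
  "lcoeff n \<kappa> 0 = 0"
  by (simp_all add: ncoeff_add[OF lcoeff_rules] ncoeff_diff[OF lcoeff_rules]
      ncoeff_const_mult[OF lcoeff_rules] ncoeff_0[OF lcoeff_rules])

lemma ymap_lcoeff_mult: "ymap (lcoeff n \<kappa>) (yembed A * F) = A * ymap (lcoeff n \<kappa>) F"
  by (rule ymap_linear_mult) (rule lcoeff_linear)+

lemma ymap_lcoeff_sum: "ymap (lcoeff n \<kappa>) (\<Sum>i\<in>A. f i) = (\<Sum>i\<in>A. ymap (lcoeff n \<kappa>) (f i))"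
  by (rule ymap_sum) (rule lcoeff_linear)+

lemma ymap_lcoeff_yconst: "ymap (lcoeff n \<kappa>) (yconst p) = yconst (lcoeff n \<kappa> p)"
  by (rule ymap_yconst) (rule lcoeff_linear)

text \<open>Expand each 1 / (1 - x_i y_j) in the Newton basis of x_i. The coefficient at the
  exponents of \<kappa> selects in row i the weight with exponent
  \<open>shifted \<kappa> n i\<close>.\<close>

lemma ymap_lcoeff_cauchy:
  "ymap (lcoeff n \<kappa>) (det_fun n (\<lambda>i j. ygeom (xv i) j)) =
    det_fun n (\<lambda>i j. yweight (nodes n) j (shifted \<kappa> n i))"
proof (rule ycong_eqI[of "Suc (\<Sum>i=1..n. shifted \<kappa> n i)"])
  \<comment> \<open>So large that the truncated expansions still contain every exponent of
    \<kappa>.\<close>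
  fix D assume D: "D \<ge> Suc (\<Sum>i=1..n. shifted \<kappa> n i)"
  let ?C = "\<lambda>t. xconst (nodes n t)" and ?\<alpha> = "shifted \<kappa> n" and ?P = "PiE {1..n} (\<lambda>_. {..<D})"
  have \<alpha>: "?\<alpha> i < D" if "i \<in> {1..n}" for i
    using member_le_sum[OF that, of ?\<alpha>] D by simp
  have W: "yweight ?C j r = yembed (yweight (nodes n) j r)" for j r
    by (simp add: yweight_def yembed.hom_mult yembed.hom_power yembed.hom_prod)
  let ?S = "\<lambda>p. \<Sum>f\<in>?P. yembed (\<Prod>i=1..n. yweight (nodes n) (p i) (f i)) *
      yconst (\<Prod>i=1..n. npow ?C (xv i) (f i))"
  have S: "ycong D (\<Prod>i=1..n. ygeom (xv i) (p i)) (?S p)" for p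
  proof -
    have "ycong D (\<Prod>i=1..n. \<Sum>r<D. yconst (npow ?C (xv i) r) * yweight ?C (p i) r)
        (\<Prod>i=1..n. ygeom (xv i) (p i))"
      by (intro ycong_prod kernel_series)
    moreover have "(\<Prod>i=1..n. \<Sum>r<D. yconst (npow ?C (xv i) r) * yweight ?C (p i) r) =
        (\<Sum>f\<in>?P. \<Prod>i=1..n. yconst (npow ?C (xv i) (f i)) * yweight ?C (p i) (f i))"
      by (rule prod_sum_PiE) simp_all
    moreover have "\<dots> = ?S p"
      by (simp only: prod.distrib W yembed.hom_prod yconst.hom_prod mult.commute)
    ultimately show ?thesis by (simp only: ycong_sym)
  qed
  have L: "ymap (lcoeff n \<kappa>) (?S p) = (\<Prod>i=1..n. yweight (nodes n) (p i) (?\<alpha> i))" for p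
  proof -
    have "ymap (lcoeff n \<kappa>) (?S p) = (\<Sum>f\<in>?P. (\<Prod>i=1..n. yweight (nodes n) (p i) (f i)) *
        yconst (if \<forall>i\<in>{1..n}. ?\<alpha> i = f i then 1 else 0))"
      by (simp only: ymap_lcoeff_sum ymap_lcoeff_mult ymap_lcoeff_yconst ncoeff_npow_prod[OF lcoeff_rules])
    also have "\<dots> = (\<Sum>f\<in>{restrict ?\<alpha> {1..n}}. (\<Prod>i=1..n. yweight (nodes n) (p i) (f i)) *
        yconst (if \<forall>i\<in>{1..n}. ?\<alpha> i = f i then 1 else 0))"
    proof (rule sum.mono_neutral_right)
      show "finite ?P" by (rule finite_PiE) simp_all
      show "{restrict ?\<alpha> {1..n}} \<subseteq> ?P" using \<alpha> by simp
      show "\<forall>f\<in>?P - {restrict ?\<alpha> {1..n}}. (\<Prod>i=1..n. yweight (nodes n) (p i) (f i)) *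
          yconst (if \<forall>i\<in>{1..n}. ?\<alpha> i = f i then 1 else 0) = 0"
      proof
        fix f assume f: "f \<in> ?P - {restrict ?\<alpha> {1..n}}"
        have "\<not> (\<forall>i\<in>{1..n}. ?\<alpha> i = f i)"
        proof
          assume *: "\<forall>i\<in>{1..n}. ?\<alpha> i = f i"
          have "f = restrict ?\<alpha> {1..n}"
            by (rule extensionalityI[of _ "{1..n}"]) (use f * in \<open>simp_all add: PiE_def\<close>)
          with f show False by blast
        qed
        then show "(\<Prod>i=1..n. yweight (nodes n) (p i) (f i)) *
          yconst (if \<forall>i\<in>{1..n}. ?\<alpha> i = f i then 1 else 0) = 0"
          by (simp only: if_False yconst.hom_zero mult_zero_right)
      qed
    qed
    finally show ?thesis by simp
  qed
  have "ycong D (det_fun n (\<lambda>i j. ygeom (xv i) j))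
      (\<Sum>p | p permutes {1..n}. yembed (of_int (sign p)) * ?S p)"
    unfolding det_fun_leibniz yembed.hom_of_int by (intro ycong_sum ycong_mult ycong_refl S)
  then have "ycong D (ymap (lcoeff n \<kappa>) (det_fun n (\<lambda>i j. ygeom (xv i) j)))
      (ymap (lcoeff n \<kappa>) (\<Sum>p | p permutes {1..n}. yembed (of_int (sign p)) * ?S p))"
    by (rule ymap_ycong[rotated 2]) (rule lcoeff_linear)+
  then show "ycong D (ymap (lcoeff n \<kappa>) (det_fun n (\<lambda>i j. ygeom (xv i) j)))
      (det_fun n (\<lambda>i j. yweight (nodes n) j (?\<alpha> i)))"
    by (simp only: ymap_lcoeff_sum[of n \<kappa> _ "{p. p permutes {1..n}}"] ymap_lcoeff_mult L
        det_fun_leibniz[of n "\<lambda>i j. yweight (nodes n) j (?\<alpha> i)"])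
qed

abbreviation dual_entry :: "partition \<Rightarrow> nat \<Rightarrow> nat \<Rightarrow> nat \<Rightarrow> qa yseries" where
  "dual_entry \<kappa> n \<equiv> \<lambda>i j. if j \<le> diag_len \<kappa>
    then yv i ^ (part \<kappa> j + n - j) * (\<Prod>k\<in>{int j - int (part \<kappa> j)..0}. ygeom (av k) i)
    else yv i ^ (part \<kappa> j + n - j) *
      (\<Prod>k\<in>{1..int j - int (part \<kappa> j) - 1}. 1 - yconst (av k) * yv i)"

lemma le_diag_len_iff:
  assumes "1 \<le> j"
  shows "j \<le> diag_len \<kappa> \<longleftrightarrow> j \<le> part \<kappa> j"
proof -
  let ?A = "{i. (i, i) \<in> diagram \<kappa>}"
  have A: "i \<in> ?A \<longleftrightarrow> 1 \<le> i \<and> i \<le> part \<kappa> i" for i by (auto simp: diagram_def)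
  have down: "i \<in> ?A" if "k \<in> ?A" "1 \<le> i" "i \<le> k" for i k
    using that part_antimono[of i k \<kappa>] unfolding A by linarith
  have fin: "finite ?A"
  proof (rule finite_subset)
    show "?A \<subseteq> {..psize \<kappa>}"
    proof
      fix i assume "i \<in> ?A"
      then have "i \<le> part \<kappa> i" using A by blast
      then show "i \<in> {..psize \<kappa>}" using part_le_psize[of \<kappa> i] by simp
    qed
  qed simp
  show ?thesis
  proof
    assume "j \<le> part \<kappa> j"
    then have "j \<in> ?A" using assms A by blast
    then have "{1..j} \<subseteq> ?A" using down by auto
    from card_mono[OF fin this] show "j \<le> diag_len \<kappa>" by (simp add: diag_len_def)
  next
    assume *: "j \<le> diag_len \<kappa>"
    show "j \<le> part \<kappa> j"
    proof (rule ccontr)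
      assume "\<not> j \<le> part \<kappa> j"
      then have "j \<notin> ?A" using A by blast
      then have "?A \<subseteq> {1..<j}" using down assms A by (meson atLeastLessThan_iff not_le subsetI)
      from card_mono[OF _ this] have "diag_len \<kappa> < j" using assms by (simp add: diag_len_def)
      with * show False by simp
    qed
  qed
qed

text \<open>The weight has denominators with indices from j - \<kappa>_j to n, and
  \<open>ynum\<close> numerators from 1 to n. For j up to the diagonal length the lower end is at
  most 0, so all numerators cancel and denominators remain; otherwise all denominators cancel and
  the numerators 1, ..., j - \<kappa>_j - 1 remain. This explains the two cases in the definition of
  the dual Schur function.\<close>

lemma dual_entry_eq:
  assumes "j \<in> {1..n}"
  shows "ynum n i * yweight (nodes n) i (shifted \<kappa> n j) = dual_entry \<kappa> n i j"
proof -
  let ?s = "int j - int (part \<kappa> j)" and ?y = "yv i ^ (part \<kappa> j + n - j) :: qa yseries"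
  let ?g = "\<lambda>A. \<Prod>k\<in>A. ygeom (av k) i" and ?h = "\<lambda>A. \<Prod>k\<in>A. 1 - yconst (av k) * yv i"
  have "int n + 1 - int (Suc (shifted \<kappa> n j)) = ?s"
    using assms by (simp add: shifted_def of_nat_diff)
  then have w: "yweight (nodes n) i (shifted \<kappa> n j) = ?y * ?g {?s..int n}"
    unfolding yweight_def prod_ygeom_nodes by (simp add: shifted_def)
  have gh: "?g A * ?h A = 1" for A by (rule ygeom_inverse_prod)
  show ?thesis
  proof (cases "j \<le> diag_len \<kappa>")
    case True
    then have "?s \<le> 0" using le_diag_len_iff[of j \<kappa>] assms by simp
    then have "{?s..int n} = {?s..0} \<union> {1..int n}" by auto
    then have "?g {?s..int n} = ?g {?s..0} * ?g {1..int n}"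
      by (simp only:) (rule prod.union_disjoint; auto)
    then have "ynum n i * yweight (nodes n) i (shifted \<kappa> n j) = ?y * ?g {?s..0} * (?g {1..int n} * ?h {1..int n})"
      unfolding w by (simp only: mult_ac)
    then show ?thesis using True by (simp only: gh mult_1_right if_True)
  next
    case False
    then have "?s \<ge> 1" using le_diag_len_iff[of j \<kappa>] assms by simp
    then have "{1..int n} = {1..?s - 1} \<union> {?s..int n}" using assms by auto
    then have "?h {1..int n} = ?h {1..?s - 1} * ?h {?s..int n}"
      by (simp only:) (rule prod.union_disjoint; auto)
    then have "ynum n i * yweight (nodes n) i (shifted \<kappa> n j) =
        ?y * ?h {1..?s - 1} * (?g {?s..int n} * ?h {?s..int n})"
      unfolding w by (simp only: mult_ac)
    then show ?thesis using False by (simp only: gh mult_1_right if_False)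
  qed
qed

text \<open>Apply \<open>lcoeff\<close> to the Cauchy identity
  \<open>V(x) V(y) \<Prod>\<^sub>i\<^sub>,\<^sub>j (1 - a\<^sub>i y\<^sub>j) / (1 - x\<^sub>i y\<^sub>j) = \<Prod>\<^sub>i\<^sub>,\<^sub>j (1 - a\<^sub>i y\<^sub>j) det (1 / (1 - x\<^sub>i y\<^sub>j))\<close>.\<close>

lemma dual_cauchy:
  assumes \<kappa>: "plength \<kappa> \<le> n"
  shows "ycong D (vandermonde yv n * (\<Sum>f\<in>PiE {1..n} (\<lambda>_. {..<D}).
      yconst (schur_coeffs (\<Prod>j=1..n. dcomplete (f j)) \<kappa>) * (\<Prod>j=1..n. ypow j (f j))))
    (det_fun n (dual_entry \<kappa> n))"
proof (cases "n \<ge> 1")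
  \<comment> \<open>The generating function of complete functions requires a variable, so n = 0,
    where \<kappa> is empty, is settled directly.\<close>
  case False
  then have n: "n = 0" by simp
  have "\<kappa> = empty_part"
    by (rule partition_eqI) (use \<kappa> in \<open>simp add: n part_eq_0[of \<kappa> 0] empty_part.rep_eq\<close>)
  then have "schur_coeffs 1 \<kappa> = 1"
    using schur_coeffs_dschur[of empty_part \<kappa>] by (simp add: dschur_empty)
  then show ?thesis
    by (simp add: n vandermonde_def det_fun_leibniz PiE_def permutes_empty)
next
  case n: True
  let ?h = "\<lambda>k. dschur_poly (row_part k) n" and ?P = "PiE {1..n} (\<lambda>_. {..<D})"
  let ?V = "vandermonde xv n" and ?Vy = "vandermonde yv n :: qa yseries"
  let ?G = "\<Prod>j=1..n. \<Prod>i=1..n. ygeom (xv i) j"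
  have "ycong D (\<Prod>j=1..n. \<Sum>k<D. yconst (?h k) * yembed (ypow j k))
      (\<Prod>j=1..n. yembed (ynum n j) * (\<Prod>i=1..n. ygeom (xv i) j))"
    by (intro ycong_prod complete_series n)
  moreover have "(\<Prod>j=1..n. \<Sum>k<D. yconst (?h k) * yembed (ypow j k)) =
      (\<Sum>f\<in>?P. \<Prod>j=1..n. yconst (?h (f j)) * yembed (ypow j (f j)))"
    by (rule prod_sum_PiE) simp_all
  ultimately have "ycong D (\<Sum>f\<in>?P. \<Prod>j=1..n. yconst (?h (f j)) * yembed (ypow j (f j)))
      (yembed (\<Prod>j=1..n. ynum n j) * ?G)"
    by (simp only: prod.distrib yembed.hom_prod)
  then have "ycong D (yembed ?Vy * yconst ?V * (\<Sum>f\<in>?P. \<Prod>j=1..n. yconst (?h (f j)) * yembed (ypow j (f j))))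
      (yembed ?Vy * yconst ?V * (yembed (\<Prod>j=1..n. ynum n j) * ?G))"
    by (intro ycong_mult ycong_refl)
  moreover have "yembed ?Vy * yconst ?V * (yembed (\<Prod>j=1..n. ynum n j) * ?G) =
      yembed (\<Prod>j=1..n. ynum n j) * det_fun n (\<lambda>i j. ygeom (xv i) j)"
    unfolding cauchy_determinant hom_vandermonde[OF yembed.comm_ring_hom_axioms] yembed_simps
    by (simp only: mult_ac)
  moreover have "yembed ?Vy * yconst ?V * (\<Sum>f\<in>?P. \<Prod>j=1..n. yconst (?h (f j)) * yembed (ypow j (f j))) =
      yembed ?Vy * (\<Sum>f\<in>?P. yembed (\<Prod>j=1..n. ypow j (f j)) * yconst ((\<Prod>j=1..n. ?h (f j)) * ?V))"
    unfolding mult.assoc sum_distrib_left prod.distrib yembed.hom_prod yconst.hom_mult yconst.hom_prod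
    by (simp only: mult_ac)
  ultimately have "ycong D
      (yembed ?Vy * (\<Sum>f\<in>?P. yembed (\<Prod>j=1..n. ypow j (f j)) * yconst ((\<Prod>j=1..n. ?h (f j)) * ?V)))
      (yembed (\<Prod>j=1..n. ynum n j) * det_fun n (\<lambda>i j. ygeom (xv i) j))"
    by (simp only:)
  then have "ycong D
      (ymap (lcoeff n \<kappa>) (yembed ?Vy * (\<Sum>f\<in>?P. yembed (\<Prod>j=1..n. ypow j (f j)) * yconst ((\<Prod>j=1..n. ?h (f j)) * ?V))))
      (ymap (lcoeff n \<kappa>) (yembed (\<Prod>j=1..n. ynum n j) * det_fun n (\<lambda>i j. ygeom (xv i) j)))"
    by (rule ymap_ycong[rotated 2]) (rule lcoeff_linear)+
  then have "ycong D (?Vy * (\<Sum>f\<in>?P. (\<Prod>j=1..n. ypow j (f j)) * yconst (lcoeff n \<kappa> ((\<Prod>j=1..n. ?h (f j)) * ?V))))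
      ((\<Prod>j=1..n. ynum n j) * det_fun n (\<lambda>i j. yweight (nodes n) j (shifted \<kappa> n i)))"
    by (simp only: ymap_lcoeff_mult ymap_lcoeff_sum ymap_lcoeff_yconst ymap_lcoeff_cauchy)
  moreover have "lcoeff n \<kappa> ((\<Prod>j=1..n. ?h (f j)) * ?V) = schur_coeffs (\<Prod>j=1..n. dcomplete (f j)) \<kappa>" for f
    unfolding schur_coeffs_eq[OF \<kappa>] schur_coeff_at_def Rep_dsym_prod dcomplete_def Rep_dschur ..
  moreover have "(\<Prod>j=1..n. ynum n j) * det_fun n (\<lambda>i j. yweight (nodes n) j (shifted \<kappa> n i)) =
      det_fun n (dual_entry \<kappa> n)"
  proof -
    have "det_fun n (\<lambda>i j. yweight (nodes n) j (shifted \<kappa> n i)) =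
        det_fun n (\<lambda>i j. yweight (nodes n) i (shifted \<kappa> n j))"
      by (rule det_fun_transpose)
    then show ?thesis
      by (simp only: det_fun_scale_rows[symmetric]) (rule det_fun_cong, rule dual_entry_eq)
  qed
  ultimately show ?thesis by (simp only: mult.commute)
qed

lemma ylow_ypow: "ylow r (ypow i r)"
  unfolding ypow_def by (rule ylow_mult_left[OF ylow_yv_power])

lemma ypow_0 [simp]: "ypow i 0 = 1"
  by (simp add: ypow_def)

text \<open>The Schur coefficient of a product of complete functions depends only on the type of the
  exponent, so the exponents can be collected into dual monomial functions.\<close>

lemma dual_monomials_regroup:
  "ycong D (\<Sum>f\<in>PiE {1..n} (\<lambda>_. {..<D}).
      yconst (schur_coeffs (\<Prod>j=1..n. dcomplete (f j)) \<kappa>) * (\<Prod>j=1..n. ypow j (f j)))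
    (\<Sum>\<mu> | psize \<mu> < D. yconst (schur_coeffs (dcomplete_part \<mu>) \<kappa>) * dual_monomial \<mu> n)"
proof -
  let ?P = "PiE {1..n} (\<lambda>_. {..<D})"
  let ?U = "{u. Poly_Mapping.keys u \<subseteq> {1..n} \<and> mdeg u < D}"
  let ?t = "\<lambda>f. yconst (schur_coeffs (\<Prod>j=1..n. dcomplete (f j)) \<kappa>) * (\<Prod>j=1..n. ypow j (f j))"
  \<comment> \<open>Exponents in the box whose total degree is below D. The rest of the box is
    negligible because (y,a)^r starts in degree r.\<close>
  let ?Q = "{f\<in>?P. (\<Sum>j=1..n. f j) < D}"
  have finP: "finite ?P" by (rule finite_PiE) simp_all
  have mdeg: "mdeg u = (\<Sum>j=1..n. Poly_Mapping.lookup u j)" if "Poly_Mapping.keys u \<subseteq> {1..n}" for u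
    unfolding mdeg_def by (rule sum.mono_neutral_left) (use that in \<open>auto simp: in_keys_iff\<close>)
  have "ylow D (\<Sum>f\<in>?P - ?Q. ?t f)"
  proof (rule ylow_sum, rule ylow_mult_right)
    fix f assume "f \<in> ?P - ?Q"
    then have "D \<le> (\<Sum>j=1..n. f j)" by (auto simp: not_less)
    moreover have "ylow (\<Sum>j=1..n. f j) (\<Prod>j=1..n. ypow j (f j))" by (intro ylow_prod ylow_ypow)
    ultimately show "ylow D (\<Prod>j=1..n. ypow j (f j))" by (simp add: ylow_def)
  qed
  moreover have "(\<Sum>f\<in>?P. ?t f) - (\<Sum>f\<in>?Q. ?t f) = (\<Sum>f\<in>?P - ?Q. ?t f)"
    by (rule sum_diff[symmetric]) (use finP in auto)
  ultimately have "ycong D (\<Sum>f\<in>?P. ?t f) (\<Sum>f\<in>?Q. ?t f)"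
    unfolding ycong_def by (simp only:)
  also have "(\<Sum>f\<in>?Q. ?t f) = (\<Sum>u\<in>?U. ?t (Poly_Mapping.lookup u))"
  proof (rule sum.reindex_bij_witness[of _ "\<lambda>u. restrict (Poly_Mapping.lookup u) {1..n}"
        "\<lambda>f. Abs_poly_mapping (\<lambda>i. if i \<in> {1..n} then f i else 0)"])
    fix f assume f: "f \<in> ?Q"
    let ?u = "Abs_poly_mapping (\<lambda>i. if i \<in> {1..n} then f i else 0)"
    have l: "Poly_Mapping.lookup ?u i = (if i \<in> {1..n} then f i else 0)" for i
      by (subst lookup_Abs_poly_mapping) (auto intro: finite_subset[of _ "{1..n}"] split: if_splits)
    show "restrict (Poly_Mapping.lookup ?u) {1..n} = f"
      by (rule extensionalityI[of _ "{1..n}"]) (use f in \<open>simp_all add: l PiE_def\<close>)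
    have keys: "Poly_Mapping.keys ?u \<subseteq> {1..n}"
      by (auto simp: in_keys_iff l split: if_splits)
    have "mdeg ?u = (\<Sum>j=1..n. f j)" unfolding mdeg[OF keys] by (rule sum.cong) (simp_all only: l if_True)
    with f keys show "?u \<in> ?U" by simp
    have c: "(\<Prod>j=1..n. dcomplete (Poly_Mapping.lookup ?u j)) = (\<Prod>j=1..n. dcomplete (f j))"
      "(\<Prod>j=1..n. ypow j (Poly_Mapping.lookup ?u j)) = (\<Prod>j=1..n. ypow j (f j))"
      by (rule prod.cong; simp only: l if_True)+
    show "?t (Poly_Mapping.lookup ?u) = ?t f" by (simp only: c)
  next
    fix u assume u: "u \<in> ?U"
    let ?f = "restrict (Poly_Mapping.lookup u) {1..n}"
    have "(\<Sum>j=1..n. ?f j) = mdeg u" using u mdeg by simp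
    moreover have "Poly_Mapping.lookup u i < D" for i using lookup_le_mdeg[of u i] u by simp
    ultimately show "?f \<in> ?Q" using u by simp
    have "(\<lambda>i. if i \<in> {1..n} then ?f i else 0) = Poly_Mapping.lookup u"
    proof
      fix i
      show "(if i \<in> {1..n} then ?f i else 0) = Poly_Mapping.lookup u i"
      proof (cases "i \<in> {1..n}")
        case False
        then have "i \<notin> Poly_Mapping.keys u" using u by blast
        then show ?thesis using False by (simp add: in_keys_iff)
      qed simp
    qed
    then show "Abs_poly_mapping (\<lambda>i. if i \<in> {1..n} then ?f i else 0) = u"
      by (simp only: lookup_inverse)
  qed
  also have "?U = (\<Union>\<mu>\<in>{\<mu>. psize \<mu> < D}. monomials \<mu> n)"
  proof (intro equalityI subsetI)
    fix u assume u: "u \<in> ?U"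
    then obtain \<mu> where "u \<in> monomials \<mu> n" using ex1_partition_monomials by blast
    moreover have "psize \<mu> < D" using u monomials_psize[OF \<open>u \<in> monomials \<mu> n\<close>] by simp
    ultimately show "u \<in> (\<Union>\<mu>\<in>{\<mu>. psize \<mu> < D}. monomials \<mu> n)" by blast
  next
    fix u assume "u \<in> (\<Union>\<mu>\<in>{\<mu>. psize \<mu> < D}. monomials \<mu> n)"
    then obtain \<mu> where \<mu>: "psize \<mu> < D" "u \<in> monomials \<mu> n" by blast
    then show "u \<in> ?U" using monomials_psize[OF \<mu>(2)] monomials_keys[OF \<mu>(2)] by simp
  qed
  also have "(\<Sum>u\<in>(\<Union>\<mu>\<in>{\<mu>. psize \<mu> < D}. monomials \<mu> n). ?t (Poly_Mapping.lookup u)) =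
      (\<Sum>\<mu> | psize \<mu> < D. \<Sum>u\<in>monomials \<mu> n. ?t (Poly_Mapping.lookup u))"
  proof (rule sum.UNION_disjoint)
    show "finite {\<mu>. psize \<mu> < D}"
      by (rule finite_subset[OF _ finite_psize_le[of D]]) (simp add: Collect_mono less_imp_le)
    show "\<forall>\<mu>\<in>{\<mu>. psize \<mu> < D}. \<forall>\<nu>\<in>{\<mu>. psize \<mu> < D}. \<mu> \<noteq> \<nu> \<longrightarrow> monomials \<mu> n \<inter> monomials \<nu> n = {}"
      using monomials_unique by blast
  qed (simp add: finite_monomials)
  also have "\<dots> = (\<Sum>\<mu> | psize \<mu> < D. yconst (schur_coeffs (dcomplete_part \<mu>) \<kappa>) * dual_monomial \<mu> n)"
    unfolding dual_monomial_def sum_distrib_left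
  proof (intro sum.cong refl)
    fix \<mu> u assume u: "u \<in> monomials \<mu> n"
    have "(\<Prod>j=1..n. ypow j (Poly_Mapping.lookup u j)) = ypow_monom u"
      by (rule prod.mono_neutral_right) (use monomials_keys[OF u] in \<open>auto simp: in_keys_iff\<close>)
    then show "?t (Poly_Mapping.lookup u) = yconst (schur_coeffs (dcomplete_part \<mu>) \<kappa>) * ypow_monom u"
      by (simp only: dcomplete_part_monomials[OF u])
  qed
  finally show ?thesis .
qed

text \<open>The series having the desired expansion by construction. It is given coefficient by
  coefficient because the sum over \<mu> is infinite, and it is later shown to satisfy the
  determinant equation of the dual Schur function.\<close>

definition dual_schur_series :: "partition \<Rightarrow> nat \<Rightarrow> qa yseries" where
  "dual_schur_series \<kappa> n = Abs_yseries (\<lambda>u. \<Sum>\<mu> | psize \<mu> \<le> mdeg u.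
     schur_coeffs (dcomplete_part \<mu>) \<kappa> * ycoeff (dual_monomial \<mu> n) u)"

lemma ycoeff_dual_schur_series: "ycoeff (dual_schur_series \<kappa> n) u =
    (\<Sum>\<mu> | psize \<mu> \<le> mdeg u. schur_coeffs (dcomplete_part \<mu>) \<kappa> * ycoeff (dual_monomial \<mu> n) u)"
  by (simp add: dual_schur_series_def Abs_yseries_inverse)

lemma dual_schur_series_vandermonde:
  assumes "plength \<kappa> \<le> n"
  shows "vandermonde yv n * dual_schur_series \<kappa> n = det_fun n (dual_entry \<kappa> n)"
proof (rule ycong_eqI[of 0])
  fix D
  let ?K = "\<lambda>\<mu>. schur_coeffs (dcomplete_part \<mu>) \<kappa>"
  let ?S = "\<Sum>\<mu> | psize \<mu> < D. yconst (?K \<mu>) * dual_monomial \<mu> n"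
  have "ycong D (dual_schur_series \<kappa> n) ?S"
    unfolding ycong_def ylow_def
  proof (intro allI impI)
    fix u assume u: "mdeg u < D"
    have "(\<Sum>\<mu> | psize \<mu> \<le> mdeg u. ?K \<mu> * ycoeff (dual_monomial \<mu> n) u) =
        (\<Sum>\<mu> | psize \<mu> < D. ?K \<mu> * ycoeff (dual_monomial \<mu> n) u)"
    proof (rule sum.mono_neutral_left)
      show "finite {\<mu>. psize \<mu> < D}"
        by (rule finite_subset[OF _ finite_psize_le[of D]]) (simp add: Collect_mono less_imp_le)
      show "{\<mu>. psize \<mu> \<le> mdeg u} \<subseteq> {\<mu>. psize \<mu> < D}" using u by auto
      show "\<forall>\<mu>\<in>{\<mu>. psize \<mu> < D} - {\<mu>. psize \<mu> \<le> mdeg u}. ?K \<mu> * ycoeff (dual_monomial \<mu> n) u = 0"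
        using ycoeff_dual_monomial_psize by auto
    qed
    then show "ycoeff (dual_schur_series \<kappa> n - ?S) u = 0"
      by (simp add: ycoeff_dual_schur_series ycoeff_sum)
  qed
  then have "ycong D (vandermonde yv n * dual_schur_series \<kappa> n) (vandermonde yv n * ?S)"
    by (intro ycong_mult ycong_refl)
  moreover have "ycong D (vandermonde yv n * ?S) (det_fun n (dual_entry \<kappa> n))"
    by (rule ycong_trans[OF ycong_mult[OF ycong_refl ycong_sym[OF dual_monomials_regroup]] dual_cauchy[OF assms]])
  ultimately show "ycong D (vandermonde yv n * dual_schur_series \<kappa> n) (det_fun n (dual_entry \<kappa> n))"
    by (rule ycong_trans)
qed

text \<open>If \<open>n\<close> is the length of \<open>\<kappa>\<close> then the last row of the determinant is divisible by \<open>y\<^sub>n\<close>.\<close>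

lemma ycoeff_dual_schur_series_0:
  fixes w :: "nat \<Rightarrow>\<^sub>0 nat"
  assumes n: "plength \<kappa> = n" "n \<ge> 1" and w: "Poly_Mapping.lookup w n = 0"
  shows "ycoeff (dual_schur_series \<kappa> n) w = 0"
\<comment> \<open>The moves replace some y_j by y_i with i < j \<le> n, and so never introduce
  y_n.\<close>
proof (rule ycoeff_cancel_vandermonde[where S = "{w. Poly_Mapping.lookup w n = 0}"])
  fix w :: "nat \<Rightarrow>\<^sub>0 nat" assume w: "w \<in> {w. Poly_Mapping.lookup w n = 0}"
  have row: "\<exists>F. dual_entry \<kappa> n n j = yv n * F" if j: "j \<in> {1..n}" for j
  proof -
    have "part \<kappa> j > 0" using j n by (simp add: part_pos_iff)
    then have "0 < part \<kappa> j + n - j" using j by simp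
    then have "part \<kappa> j + n - j = Suc (part \<kappa> j + n - j - 1)" by linarith
    then have "yv n ^ (part \<kappa> j + n - j) = yv n * (yv n ^ (part \<kappa> j + n - j - 1) :: qa yseries)"
      by (metis power_Suc)
    then show ?thesis
      by (cases "j \<le> diag_len \<kappa>") (simp_all only: if_True if_False mult.assoc, blast+)
  qed
  have "ycoeff (det_fun n (dual_entry \<kappa> n)) w = 0"
    unfolding det_fun_leibniz ycoeff_sum
  proof (rule sum.neutral, rule ballI)
    fix p assume "p \<in> {p. p permutes {1..n}}"
    then have "p n \<in> {1..n}" using permutes_in_image[of p "{1..n}" n] n(2) by simp
    then obtain F where F: "dual_entry \<kappa> n n (p n) = yv n * F" using row by blast
    have "(\<Prod>i=1..n. dual_entry \<kappa> n i (p i)) =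
        dual_entry \<kappa> n n (p n) * (\<Prod>i\<in>{1..n} - {n}. dual_entry \<kappa> n i (p i))"
      by (rule prod.remove) (use n(2) in simp_all)
    then have "of_int (sign p) * (\<Prod>i=1..n. dual_entry \<kappa> n i (p i)) =
        yv n * (F * (\<Prod>i\<in>{1..n} - {n}. dual_entry \<kappa> n i (p i)) * of_int (sign p))"
      unfolding F by (simp only: mult_ac)
    then show "ycoeff (of_int (sign p) * (\<Prod>i=1..n. dual_entry \<kappa> n i (p i))) w = 0"
      using w by (simp only: ycoeff_yv_mult_0 mem_Collect_eq)
  qed
  then show "ycoeff (vandermonde yv n * dual_schur_series \<kappa> n) w = 0"
    using n by (simp only: dual_schur_series_vandermonde order_refl)
qed (use w in \<open>auto simp: lookup_add lookup_single when_def split: if_splits\<close>)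

text \<open>Let n be the length of \<kappa> and compare coefficients at the exponent with parts
  \<mu>, which does not involve y_n: the series has coefficient 0 there. Any other contributing
  \<nu> is smaller than \<mu> and, by induction, has at least n parts; but one of its monomials
  would have to divide a monomial in fewer than n variables. So only the coefficient of \<mu>
  remains.\<close>

lemma schur_coeffs_dcomplete_part_eq_0:
  assumes "plength \<mu> < plength \<kappa>"
  shows "schur_coeffs (dcomplete_part \<mu>) \<kappa> = 0"
  using assms
proof (induction "psize \<mu>" arbitrary: \<mu> rule: less_induct)
  case less
  let ?n = "plength \<kappa>" and ?K = "\<lambda>\<mu>. schur_coeffs (dcomplete_part \<mu>) \<kappa>"
  obtain u where u: "u \<in> monomials \<mu> ?n" "\<And>i. Poly_Mapping.lookup u i = part \<mu> i"
    using ex_monomial[of \<mu> ?n] less.prems by (metis less_imp_le)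
  have n: "?n \<ge> 1" using less.prems by linarith
  have "Poly_Mapping.lookup u ?n = 0"
    unfolding u(2) using less.prems by (simp add: part_eq_0[OF order_refl])
  then have "0 = ycoeff (dual_schur_series \<kappa> ?n) u"
    by (simp only: ycoeff_dual_schur_series_0[OF refl n])
  also have "\<dots> = (\<Sum>\<nu>\<in>{\<mu>}. ?K \<nu> * ycoeff (dual_monomial \<nu> ?n) u)"
    unfolding ycoeff_dual_schur_series
  proof (rule sum.mono_neutral_right[OF finite_psize_le])
    show "{\<mu>} \<subseteq> {\<nu>. psize \<nu> \<le> mdeg u}" using monomials_psize[OF u(1)] by simp
    show "\<forall>\<nu>\<in>{\<nu>. psize \<nu> \<le> mdeg u} - {\<mu>}. ?K \<nu> * ycoeff (dual_monomial \<nu> ?n) u = 0"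
    proof (rule ballI, rule ccontr)
      fix \<nu> assume \<nu>: "\<nu> \<in> {\<nu>. psize \<nu> \<le> mdeg u} - {\<mu>}" and nz: "?K \<nu> * ycoeff (dual_monomial \<nu> ?n) u \<noteq> 0"
      then have "?K \<nu> \<noteq> 0" and c: "ycoeff (dual_monomial \<nu> ?n) u \<noteq> 0" by auto
      have "psize \<nu> \<noteq> psize \<mu>"
        using ycoeff_dual_monomial_top[OF u(1), of \<nu>] \<nu> c by auto
      then have "psize \<nu> < psize \<mu>" using \<nu> monomials_psize[OF u(1)] by simp
      with \<open>?K \<nu> \<noteq> 0\<close> less.hyps have "?n \<le> plength \<nu>" by (meson not_le)
      obtain v where v: "v \<in> monomials \<nu> ?n" "\<And>i. Poly_Mapping.lookup v i \<le> Poly_Mapping.lookup u i"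
        using ycoeff_dual_monomial_nonzero[OF c] by blast
      have "Poly_Mapping.keys v \<subseteq> Poly_Mapping.keys u"
      proof
        fix i assume "i \<in> Poly_Mapping.keys v"
        then show "i \<in> Poly_Mapping.keys u" using v(2)[of i] by (simp add: in_keys_iff)
      qed
      then have "card (Poly_Mapping.keys v) \<le> card (Poly_Mapping.keys u)" by (intro card_mono) simp_all
      then have "plength \<nu> \<le> plength \<mu>"
        using monomials_plength[OF v(1)] monomials_plength[OF u(1)] by simp
      with \<open>?n \<le> plength \<nu>\<close> less.prems show False by simp
    qed
  qed
  also have "\<dots> = ?K \<mu>" by (simp add: ycoeff_dual_monomial_top[OF u(1) refl])
  finally show ?case by simp
qed

lemma dual_schur_expansion:
  "formal_sums (\<lambda>\<mu>. yconst (schur_coeffs (dcomplete_part \<mu>) \<kappa>) * dual_monomial \<mu> n) (dual_schur \<kappa> n)"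
proof -
  have "dual_schur \<kappa> n = dual_schur_series \<kappa> n"
  proof (cases "plength \<kappa> \<le> n")
    case True
    have "(THE F. F * vandermonde yv n = det_fun n (dual_entry \<kappa> n)) = dual_schur_series \<kappa> n"
    proof (rule the_equality)
      show eq: "dual_schur_series \<kappa> n * vandermonde yv n = det_fun n (dual_entry \<kappa> n)"
        by (rule trans[OF mult.commute dual_schur_series_vandermonde[OF True]])
      fix F assume "F * vandermonde yv n = det_fun n (dual_entry \<kappa> n)"
      then have "F * vandermonde yv n = dual_schur_series \<kappa> n * vandermonde yv n"
        by (rule trans[OF _ eq[symmetric]])
      from trans[OF mult.commute trans[OF this mult.commute]]
      show "F = dual_schur_series \<kappa> n" by (rule vandermonde_yv_cancel)
    qed
    then show ?thesis using True by (simp add: dual_schur_def)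
  next
    \<comment> \<open>The dual Schur function is 0 here by definition. On the other side, every
      \<mu> with at most n parts has coefficient 0, and longer ones have no monomials in n
      variables.\<close>
    case False
    have "dual_schur_series \<kappa> n = 0"
    proof (rule yseries_eqI)
      fix u
      have Z: "schur_coeffs (dcomplete_part \<mu>) \<kappa> * ycoeff (dual_monomial \<mu> n) u = 0" for \<mu>
      proof (cases "plength \<mu> \<le> n")
        case True
        then show ?thesis using False by (simp add: schur_coeffs_dcomplete_part_eq_0)
      next
        case longer: False
        have "monomials \<mu> n = {}"
        proof (rule ccontr)
          assume "monomials \<mu> n \<noteq> {}"
          then obtain v where v: "v \<in> monomials \<mu> n" by blast
          from card_mono[OF _ monomials_keys[OF v]] show False
            using longer monomials_plength[OF v] by simp
        qed
        then show ?thesis by (simp add: dual_monomial_def)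
      qed
      then show "ycoeff (dual_schur_series \<kappa> n) u = ycoeff 0 u"
        unfolding ycoeff_dual_schur_series zero_yseries.rep_eq by (intro sum.neutral ballI) (rule Z)
    qed
    then show ?thesis using False by (simp add: dual_schur_def)
  qed
  then show ?thesis
    unfolding formal_sums_dual_monomials_iff by (simp only: ycoeff_dual_schur_series simp_thms)
qed

lemma dual_kostka_eq: "dual_kostka \<kappa> \<mu> = schur_coeffs (dcomplete_part \<mu>) \<kappa>"
proof -
  have "dual_kostka \<kappa> = (\<lambda>\<mu>. schur_coeffs (dcomplete_part \<mu>) \<kappa>)"
    unfolding dual_kostka_def
  proof (rule the_equality)
    fix K assume "\<forall>n. formal_sums (\<lambda>\<mu>. yconst (K \<mu>) * dual_monomial \<mu> n) (dual_schur \<kappa> n)"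
    then show "K = (\<lambda>\<mu>. schur_coeffs (dcomplete_part \<mu>) \<kappa>)"
      using dual_schur_expansion by (intro dual_monomial_expansion_unique) blast+
  qed (use dual_schur_expansion in blast)
  then show ?thesis by simp
qed

lemma dual_kostka_eq_chain_sum:
  "to_fract (dual_kostka \<kappa> \<mu>) = chain_sum (dcomplete_part \<mu>) empty_part \<kappa>"
  unfolding dual_kostka_eq by (rule schur_coeffs_eq_chain_sum_empty)


subsection \<open>Strips\<close>

lemma diagram_inject: "diagram \<mu> = diagram \<nu> \<Longrightarrow> \<mu> = \<nu>"
proof -
  assume "diagram \<mu> = diagram \<nu>"
  then have "part_le \<mu> \<nu>" "part_le \<nu> \<mu>" by (simp_all add: part_le_def)
  then show "\<mu> = \<nu>"
    unfolding part_le_iff by (intro partition_eqI antisym) blast+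
qed

lemma part_le_antisym: "part_le \<mu> \<nu> \<Longrightarrow> part_le \<nu> \<mu> \<Longrightarrow> \<mu> = \<nu>"
  by (rule diagram_inject) (simp add: part_le_def)

lemma mem_diagram: "(i, j) \<in> diagram \<kappa> \<longleftrightarrow> 1 \<le> i \<and> 1 \<le> j \<and> j \<le> part \<kappa> i"
  by (simp add: diagram_def)

lemma diagram_down:
  assumes "(i, j) \<in> diagram \<kappa>" "1 \<le> i'" "i' \<le> i" "1 \<le> j'" "j' \<le> j"
  shows "(i', j') \<in> diagram \<kappa>"
  using assms part_antimono[of i' i \<kappa>] unfolding mem_diagram by linarith

lemma finite_diagram: "finite (diagram \<kappa>)"
proof (rule finite_subset)
  show "diagram \<kappa> \<subseteq> {1..plength \<kappa>} \<times> {1..psize \<kappa>}"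
  proof
    fix \<alpha> assume "\<alpha> \<in> diagram \<kappa>"
    moreover obtain i j where "\<alpha> = (i, j)" by (cases \<alpha>)
    ultimately have ij: "\<alpha> = (i, j)" "1 \<le> i" "1 \<le> j" "j \<le> part \<kappa> i" by (simp_all add: mem_diagram)
    have "i \<le> plength \<kappa>" using ij part_pos_iff[of \<kappa> i] by linarith
    moreover have "j \<le> psize \<kappa>" using ij part_le_psize[of \<kappa> i] by linarith
    ultimately show "\<alpha> \<in> {1..plength \<kappa>} \<times> {1..psize \<kappa>}" using ij by simp
  qed
qed simp

text \<open>The rows of a finite order ideal are initial segments of weakly decreasing length. The
  lemma recognizes the intermediate shapes cut out of a tableau.\<close>

lemma ex_diagram:
  assumes fin: "finite S" and pos: "\<And>i j. (i, j) \<in> S \<Longrightarrow> 1 \<le> i \<and> 1 \<le> j"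
    and down: "\<And>i j i' j'. (i, j) \<in> S \<Longrightarrow> 1 \<le> i' \<Longrightarrow> i' \<le> i \<Longrightarrow> 1 \<le> j' \<Longrightarrow> j' \<le> j \<Longrightarrow> (i', j') \<in> S"
  shows "\<exists>\<sigma>. diagram \<sigma> = S"
proof -
  let ?r = "\<lambda>i. {j. (i, j) \<in> S}"
  have finr: "finite (?r i)" for i
    by (rule finite_subset[of _ "snd ` S"]) (use fin in \<open>force+\<close>)
  have mem: "(i, j) \<in> S \<longleftrightarrow> 1 \<le> j \<and> j \<le> card (?r i)" if i: "1 \<le> i" for i j
  proof
    assume ij: "(i, j) \<in> S"
    then have "{1..j} \<subseteq> ?r i" using down[OF ij i order_refl] by auto
    from card_mono[OF finr this] show "1 \<le> j \<and> j \<le> card (?r i)" using pos[OF ij] by simp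
  next
    assume j: "1 \<le> j \<and> j \<le> card (?r i)"
    show "(i, j) \<in> S"
    proof (rule ccontr)
      assume *: "(i, j) \<notin> S"
      have "?r i \<subseteq> {1..<j}"
      proof
        fix k assume "k \<in> ?r i"
        then have k: "(i, k) \<in> S" by simp
        have "\<not> j \<le> k" using down[OF k i order_refl, of j] j * by blast
        with pos[OF k] show "k \<in> {1..<j}" by simp
      qed
      from card_mono[OF _ this] have "card (?r i) \<le> j - 1" by simp
      then show False using j by linarith
    qed
  qed
  define n where "n = Max (fst ` S)"
  have n: "i \<le> n" if "i \<in> fst ` S" for i
    unfolding n_def using that fin by (intro Max_ge) simp_all
  have "card (?r (Suc i)) \<le> card (?r i)" if "1 \<le> i" for i
  proof (rule card_mono[OF finr])
    show "?r (Suc i) \<subseteq> ?r i"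
    proof
      fix j assume "j \<in> ?r (Suc i)"
      then have j: "(Suc i, j) \<in> S" by simp
      then show "j \<in> ?r i" using down[OF j that _ _ order_refl] pos[OF j] by simp
    qed
  qed
  then obtain \<sigma> where \<sigma>: "plength \<sigma> \<le> n" "\<And>i. i \<in> {1..n} \<Longrightarrow> part \<sigma> i = card (?r i)"
    using ex_partition[of n "\<lambda>i. card (?r i)"] by blast
  have part: "part \<sigma> i = card (?r i)" if i: "1 \<le> i" for i
  proof (cases "i \<le> n")
    case False
    have "(i, j) \<notin> S" for j
    proof
      assume "(i, j) \<in> S"
      then have "i \<in> fst ` S" by (rule image_eqI[rotated]) simp
      from n[OF this] False show False by blast
    qed
    then have "?r i = {}" by blast
    then show ?thesis using False \<sigma>(1) by (simp add: part_eq_0)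
  qed (use \<sigma> i in simp)
  have "(i, j) \<in> diagram \<sigma> \<longleftrightarrow> (i, j) \<in> S" for i j
  proof (cases "1 \<le> i")
    case True
    show ?thesis unfolding mem_diagram part[OF True] using mem[OF True, of j] True by blast
  next
    case False
    then show ?thesis using pos[of i j] unfolding mem_diagram by blast
  qed
  then show ?thesis by (intro exI[of _ \<sigma>]) auto
qed

definition hstrip :: "partition \<Rightarrow> partition \<Rightarrow> bool" where
  "hstrip \<mu> \<nu> \<longleftrightarrow> (\<forall>i\<ge>1. part \<nu> (Suc i) \<le> part \<mu> i \<and> part \<mu> i \<le> part \<nu> i)"

definition vstrip :: "partition \<Rightarrow> partition \<Rightarrow> bool" where
  "vstrip \<mu> \<nu> \<longleftrightarrow> (\<forall>i\<ge>1. part \<mu> i \<le> part \<nu> i \<and> part \<nu> i \<le> Suc (part \<mu> i))"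

lemma hstrip_part_le: "hstrip \<mu> \<nu> \<Longrightarrow> part_le \<mu> \<nu>"
  and vstrip_part_le: "vstrip \<mu> \<nu> \<Longrightarrow> part_le \<mu> \<nu>"
  unfolding hstrip_def vstrip_def part_le_iff
  by (metis le0 less_one not_le part_0)+

lemma hstrip_iff_columns:
  assumes "part_le \<mu> \<nu>"
  shows "hstrip \<mu> \<nu> \<longleftrightarrow> (\<forall>i i' j. i < i' \<longrightarrow> (i, j) \<in> diagram \<nu> - diagram \<mu> \<longrightarrow> (i', j) \<notin> diagram \<nu> - diagram \<mu>)"
proof
  assume h: "hstrip \<mu> \<nu>"
  show "\<forall>i i' j. i < i' \<longrightarrow> (i, j) \<in> diagram \<nu> - diagram \<mu> \<longrightarrow> (i', j) \<notin> diagram \<nu> - diagram \<mu>"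
  proof (intro allI impI notI)
    fix i i' j assume *: "i < i'" "(i, j) \<in> diagram \<nu> - diagram \<mu>" "(i', j) \<in> diagram \<nu> - diagram \<mu>"
    then have i: "1 \<le> i" "part \<mu> i < j" "j \<le> part \<nu> i'" by (auto simp: mem_diagram)
    have "part \<nu> i' \<le> part \<nu> (Suc i)" using * by (intro part_antimono) simp_all
    also have "\<dots> \<le> part \<mu> i" using h i unfolding hstrip_def by blast
    finally show False using i by simp
  qed
next
  assume *: "\<forall>i i' j. i < i' \<longrightarrow> (i, j) \<in> diagram \<nu> - diagram \<mu> \<longrightarrow> (i', j) \<notin> diagram \<nu> - diagram \<mu>"
  show "hstrip \<mu> \<nu>"
    unfolding hstrip_def
  proof (intro allI impI conjI)
    fix i :: nat assume i: "1 \<le> i"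
    show "part \<mu> i \<le> part \<nu> i" using assms part_le_iff by blast
    show "part \<nu> (Suc i) \<le> part \<mu> i"
    proof (rule ccontr)
      assume n: "\<not> part \<nu> (Suc i) \<le> part \<mu> i"
      let ?j = "part \<nu> (Suc i)"
      have "?j \<le> part \<nu> i" using part_Suc_le[OF i] .
      then have "(i, ?j) \<in> diagram \<nu> - diagram \<mu>" using n i by (auto simp: mem_diagram)
      moreover have "part \<mu> (Suc i) \<le> part \<mu> i" using part_Suc_le[OF i] .
      then have "(Suc i, ?j) \<in> diagram \<nu> - diagram \<mu>" using n i by (auto simp: mem_diagram)
      ultimately show False using * lessI by blast
    qed
  qed
qed

lemma part_conj: "1 \<le> j \<Longrightarrow> part (conj_part \<kappa>) j = card {i. 1 \<le> i \<and> j \<le> part \<kappa> i}"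
  by (simp add: conj_part.rep_eq)

lemma mem_diagram_conj: "(j, i) \<in> diagram (conj_part \<kappa>) \<longleftrightarrow> (i, j) \<in> diagram \<kappa>"
proof (cases "1 \<le> i \<and> 1 \<le> j")
  case True
  let ?A = "{i. 1 \<le> i \<and> j \<le> part \<kappa> i}"
  have A: "k \<in> ?A \<longleftrightarrow> 1 \<le> k \<and> j \<le> part \<kappa> k" for k by simp
  have fin: "finite ?A"
    by (rule finite_subset[OF _ finite_part[of \<kappa>]]) (use True in auto)
  have down: "k' \<in> ?A" if "k \<in> ?A" "1 \<le> k'" "k' \<le> k" for k k'
    using that part_antimono[of k' k \<kappa>] unfolding A by linarith
  have "i \<le> card ?A \<longleftrightarrow> i \<in> ?A"
  proof
    assume "i \<in> ?A"
    then have "{1..i} \<subseteq> ?A" using down by (meson atLeastAtMost_iff subsetI)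
    from card_mono[OF fin this] show "i \<le> card ?A" by simp
  next
    assume *: "i \<le> card ?A"
    show "i \<in> ?A"
    proof (rule ccontr)
      assume "i \<notin> ?A"
      then have "?A \<subseteq> {1..<i}" using down True A by (meson atLeastLessThan_iff not_le subsetI)
      from card_mono[OF _ this] have "card ?A \<le> i - 1" by simp
      then show False using * True by linarith
    qed
  qed
  then show ?thesis using True by (simp add: mem_diagram part_conj)
qed (auto simp: mem_diagram)

lemma diagram_conj: "diagram (conj_part \<kappa>) = prod.swap ` diagram \<kappa>"
proof -
  have "(j, i) \<in> prod.swap ` diagram \<kappa> \<longleftrightarrow> (i, j) \<in> diagram \<kappa>" for i j by force
  then show ?thesis using mem_diagram_conj by auto
qed

lemma conj_conj [simp]: "conj_part (conj_part \<kappa>) = \<kappa>"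
  by (rule diagram_inject) (simp add: diagram_conj image_image)

lemma part_le_conj: "part_le (conj_part \<mu>) (conj_part \<nu>) \<longleftrightarrow> part_le \<mu> \<nu>"
  unfolding part_le_def diagram_conj by (rule inj_image_subset_iff) simp

lemma diagram_conj_diff: "diagram (conj_part \<nu>) - diagram (conj_part \<mu>) = prod.swap ` (diagram \<nu> - diagram \<mu>)"
  unfolding diagram_conj by (rule image_set_diff[symmetric]) simp

lemma vstrip_conj: "hstrip (conj_part \<mu>) (conj_part \<nu>) \<longleftrightarrow> vstrip \<mu> \<nu>"
proof
  assume h: "hstrip (conj_part \<mu>) (conj_part \<nu>)"
  then have le: "part_le \<mu> \<nu>" using hstrip_part_le part_le_conj by blast
  note cols = h[unfolded hstrip_iff_columns[OF part_le_conj[THEN iffD2, OF le]]]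
  show "vstrip \<mu> \<nu>"
    unfolding vstrip_def
  proof (intro allI impI conjI)
    fix i :: nat assume i: "1 \<le> i"
    show "part \<mu> i \<le> part \<nu> i" using le part_le_iff by blast
    show "part \<nu> i \<le> Suc (part \<mu> i)"
    proof (rule ccontr)
      assume "\<not> part \<nu> i \<le> Suc (part \<mu> i)"
      then have "(Suc (part \<mu> i), i) \<in> diagram (conj_part \<nu>) - diagram (conj_part \<mu>)"
        "(Suc (Suc (part \<mu> i)), i) \<in> diagram (conj_part \<nu>) - diagram (conj_part \<mu>)"
        using i unfolding Diff_iff mem_diagram_conj unfolding mem_diagram by simp_all
      then show False using cols lessI by blast
    qed
  qed
next
  assume v: "vstrip \<mu> \<nu>"
  then have le: "part_le (conj_part \<mu>) (conj_part \<nu>)" using vstrip_part_le part_le_conj by blast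
  show "hstrip (conj_part \<mu>) (conj_part \<nu>)"
    unfolding hstrip_iff_columns[OF le]
  proof (intro allI impI notI)
    fix j j' i assume *: "j < j'" "(j, i) \<in> diagram (conj_part \<nu>) - diagram (conj_part \<mu>)"
      "(j', i) \<in> diagram (conj_part \<nu>) - diagram (conj_part \<mu>)"
    then have "1 \<le> i" "part \<mu> i < j" "j' \<le> part \<nu> i"
      unfolding Diff_iff mem_diagram_conj unfolding mem_diagram by linarith+
    moreover have "part \<nu> i \<le> Suc (part \<mu> i)" using v \<open>1 \<le> i\<close> unfolding vstrip_def by blast
    ultimately show False using *(1) by linarith
  qed
qed


subsection \<open>Peeling tableaux\<close>

lemma rev_tableauxD:
  assumes "T \<in> rev_tableaux \<theta> n"
  shows "\<alpha> \<in> \<theta> \<Longrightarrow> 1 \<le> T \<alpha> \<and> T \<alpha> \<le> n" "\<alpha> \<notin> \<theta> \<Longrightarrow> T \<alpha> = undefined"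
    "(i, j) \<in> \<theta> \<Longrightarrow> (i, j') \<in> \<theta> \<Longrightarrow> j \<le> j' \<Longrightarrow> T (i, j') \<le> T (i, j)"
    "(i, j) \<in> \<theta> \<Longrightarrow> (i', j) \<in> \<theta> \<Longrightarrow> i < i' \<Longrightarrow> T (i', j) < T (i, j)"
proof -
  have T: "T \<in> \<theta> \<rightarrow>\<^sub>E {1..n}"
    "\<forall>i j j'. (i, j) \<in> \<theta> \<and> (i, j') \<in> \<theta> \<and> j < j' \<longrightarrow> T (i, j) \<ge> T (i, j')"
    "\<forall>i i' j. (i, j) \<in> \<theta> \<and> (i', j) \<in> \<theta> \<and> i < i' \<longrightarrow> T (i, j) > T (i', j)"
    using assms[unfolded rev_tableaux_def mem_Collect_eq] by - (elim conjE; assumption)+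
  show "\<alpha> \<in> \<theta> \<Longrightarrow> 1 \<le> T \<alpha> \<and> T \<alpha> \<le> n" using PiE_mem[OF T(1)] by simp
  show "\<alpha> \<notin> \<theta> \<Longrightarrow> T \<alpha> = undefined" using PiE_arb[OF T(1)] .
  show "(i, j) \<in> \<theta> \<Longrightarrow> (i, j') \<in> \<theta> \<Longrightarrow> j \<le> j' \<Longrightarrow> T (i, j') \<le> T (i, j)"
    using T(2) by (cases "j = j'") (simp, meson le_neq_implies_less)
  show "(i, j) \<in> \<theta> \<Longrightarrow> (i', j) \<in> \<theta> \<Longrightarrow> i < i' \<Longrightarrow> T (i', j) < T (i, j)"
    using T(3) by blast
qed

lemma tableauxD:
  assumes "T \<in> tableaux \<theta> n"
  shows "\<alpha> \<in> \<theta> \<Longrightarrow> 1 \<le> T \<alpha> \<and> T \<alpha> \<le> n" "\<alpha> \<notin> \<theta> \<Longrightarrow> T \<alpha> = undefined"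
    "(i, j) \<in> \<theta> \<Longrightarrow> (i, j') \<in> \<theta> \<Longrightarrow> j \<le> j' \<Longrightarrow> T (i, j) \<le> T (i, j')"
    "(i, j) \<in> \<theta> \<Longrightarrow> (i', j) \<in> \<theta> \<Longrightarrow> i < i' \<Longrightarrow> T (i, j) < T (i', j)"
proof -
  have T: "T \<in> \<theta> \<rightarrow>\<^sub>E {1..n}"
    "\<forall>i j j'. (i, j) \<in> \<theta> \<and> (i, j') \<in> \<theta> \<and> j < j' \<longrightarrow> T (i, j) \<le> T (i, j')"
    "\<forall>i i' j. (i, j) \<in> \<theta> \<and> (i', j) \<in> \<theta> \<and> i < i' \<longrightarrow> T (i, j) < T (i', j)"
    using assms[unfolded tableaux_def mem_Collect_eq] by - (elim conjE; assumption)+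
  show "\<alpha> \<in> \<theta> \<Longrightarrow> 1 \<le> T \<alpha> \<and> T \<alpha> \<le> n" using PiE_mem[OF T(1)] by simp
  show "\<alpha> \<notin> \<theta> \<Longrightarrow> T \<alpha> = undefined" using PiE_arb[OF T(1)] .
  show "(i, j) \<in> \<theta> \<Longrightarrow> (i, j') \<in> \<theta> \<Longrightarrow> j \<le> j' \<Longrightarrow> T (i, j) \<le> T (i, j')"
    using T(2) by (cases "j = j'") (simp, meson le_neq_implies_less)
  show "(i, j) \<in> \<theta> \<Longrightarrow> (i', j) \<in> \<theta> \<Longrightarrow> i < i' \<Longrightarrow> T (i, j) < T (i', j)"
    using T(3) by blast
qed

lemma rev_tableauxI:
  assumes "\<And>\<alpha>. \<alpha> \<in> \<theta> \<Longrightarrow> 1 \<le> T \<alpha> \<and> T \<alpha> \<le> n" "\<And>\<alpha>. \<alpha> \<notin> \<theta> \<Longrightarrow> T \<alpha> = undefined"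
    "\<And>i j j'. (i, j) \<in> \<theta> \<Longrightarrow> (i, j') \<in> \<theta> \<Longrightarrow> j < j' \<Longrightarrow> T (i, j') \<le> T (i, j)"
    "\<And>i i' j. (i, j) \<in> \<theta> \<Longrightarrow> (i', j) \<in> \<theta> \<Longrightarrow> i < i' \<Longrightarrow> T (i', j) < T (i, j)"
  shows "T \<in> rev_tableaux \<theta> n"
proof -
  have "T \<in> \<theta> \<rightarrow>\<^sub>E {1..n}" by (rule PiE_I) (use assms(1,2) in simp_all)
  then show ?thesis unfolding rev_tableaux_def using assms(3,4) by blast
qed

lemma tableauxI:
  assumes "\<And>\<alpha>. \<alpha> \<in> \<theta> \<Longrightarrow> 1 \<le> T \<alpha> \<and> T \<alpha> \<le> n" "\<And>\<alpha>. \<alpha> \<notin> \<theta> \<Longrightarrow> T \<alpha> = undefined"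
    "\<And>i j j'. (i, j) \<in> \<theta> \<Longrightarrow> (i, j') \<in> \<theta> \<Longrightarrow> j < j' \<Longrightarrow> T (i, j) \<le> T (i, j')"
    "\<And>i i' j. (i, j) \<in> \<theta> \<Longrightarrow> (i', j) \<in> \<theta> \<Longrightarrow> i < i' \<Longrightarrow> T (i, j) < T (i', j)"
  shows "T \<in> tableaux \<theta> n"
proof -
  have "T \<in> \<theta> \<rightarrow>\<^sub>E {1..n}" by (rule PiE_I) (use assms(1,2) in simp_all)
  then show ?thesis unfolding tableaux_def using assms(3,4) by blast
qed

lemma finite_rev_tableaux: "finite \<theta> \<Longrightarrow> finite (rev_tableaux \<theta> n)"
  and finite_tableaux: "finite \<theta> \<Longrightarrow> finite (tableaux \<theta> n)"
  unfolding rev_tableaux_def tableaux_def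
  by (rule finite_subset[OF _ finite_PiE[of \<theta> "\<lambda>_. {1..n}"]]; auto)+

lemma finite_part_le: "finite {\<rho>. part_le \<rho> \<nu>}"
proof (rule finite_subset[OF _ finite_psize_le[of "psize \<nu>"]], rule subsetI)
  fix \<rho> assume "\<rho> \<in> {\<rho>. part_le \<rho> \<nu>}"
  then have "\<rho> = \<nu> \<or> psize \<rho> < psize \<nu>" using part_le_psize_less[of \<rho> \<nu>] by blast
  then show "\<rho> \<in> {\<kappa>. psize \<kappa> \<le> psize \<nu>}" by auto
qed

text \<open>In a reverse tableau with entries at most \<open>n + 1\<close> the boxes with entry \<open>n + 1\<close> form a
  horizontal strip along the inner border.\<close>

lemma rev_tableaux_peel:
  fixes w :: "nat \<Rightarrow> nat \<times> nat \<Rightarrow> 'a::comm_ring_1"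
  assumes le: "part_le \<rho> \<nu>"
  shows "(\<Sum>T\<in>rev_tableaux (diagram \<nu> - diagram \<rho>) (Suc n). \<Prod>\<alpha>\<in>diagram \<nu> - diagram \<rho>. w (T \<alpha>) \<alpha>) =
    (\<Sum>\<sigma> | hstrip \<rho> \<sigma> \<and> part_le \<sigma> \<nu>. (\<Prod>\<alpha>\<in>diagram \<sigma> - diagram \<rho>. w (Suc n) \<alpha>) *
      (\<Sum>T\<in>rev_tableaux (diagram \<nu> - diagram \<sigma>) n. \<Prod>\<alpha>\<in>diagram \<nu> - diagram \<sigma>. w (T \<alpha>) \<alpha>))"
proof -
  let ?D = diagram and ?\<theta> = "\<lambda>\<sigma>. diagram \<nu> - diagram \<sigma>"
  let ?I = "{\<sigma>. hstrip \<rho> \<sigma> \<and> part_le \<sigma> \<nu>}"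
  \<comment> \<open>The inner shape together with the boxes of maximal entry, which is to be the new
    inner shape.\<close>
  let ?S = "\<lambda>T. ?D \<rho> \<union> {\<alpha> \<in> ?\<theta> \<rho>. T \<alpha> = Suc n}"
  have sub: "?D \<rho> \<subseteq> ?D \<nu>" using le by (simp add: part_le_def)
  have ex: "\<exists>\<sigma>. ?D \<sigma> = ?S T" if T: "T \<in> rev_tableaux (?\<theta> \<rho>) (Suc n)" for T
  proof (rule ex_diagram)
    show "finite (?S T)" by (rule finite_subset[OF _ finite_diagram[of \<nu>]]) (use sub in blast)
    show "1 \<le> i \<and> 1 \<le> j" if "(i, j) \<in> ?S T" for i j
      using that by (auto simp: mem_diagram)
    fix i j i' j' assume *: "(i, j) \<in> ?S T" "1 \<le> i'" "i' \<le> i" "1 \<le> j'" "j' \<le> j"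
    show "(i', j') \<in> ?S T"
    proof (cases "(i', j') \<in> ?D \<rho>")
      case False
      then have nij: "(i, j) \<notin> ?D \<rho>" "(i', j) \<notin> ?D \<rho>"
        using diagram_down[of _ _ \<rho> i' j'] * by (meson order_refl order_trans)+
      then have ij: "(i, j) \<in> ?\<theta> \<rho>" "T (i, j) = Suc n" using * by blast+
      have "(i', j) \<in> ?D \<nu>" "(i', j') \<in> ?D \<nu>"
        using ij(1) diagram_down[of i j \<nu>] * by (meson DiffD1 order_refl order_trans)+
      then have mem: "(i', j) \<in> ?\<theta> \<rho>" "(i', j') \<in> ?\<theta> \<rho>" using nij False by blast+
      \<comment> \<open>Going up a column or left along a row never decreases the entries of a
        reverse tableau, so a maximal entry persists and the set is an order ideal.\<close>
      have "T (i, j) \<le> T (i', j)"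
        using rev_tableauxD(4)[OF T mem(1) ij(1)] *(3) by (cases "i' = i") (simp_all add: less_imp_le)
      also have "\<dots> \<le> T (i', j')" by (rule rev_tableauxD(3)[OF T mem(2,1) *(5)])
      finally have "T (i', j') = Suc n" using ij(2) rev_tableauxD(1)[OF T mem(2)] by linarith
      with mem show ?thesis by blast
    qed blast
  qed
  define \<sigma>f where "\<sigma>f T = (SOME \<sigma>. ?D \<sigma> = ?S T)" for T
  have \<sigma>f: "?D (\<sigma>f T) = ?S T" if "T \<in> rev_tableaux (?\<theta> \<rho>) (Suc n)" for T
    unfolding \<sigma>f_def using ex[OF that] by (rule someI_ex)
  let ?t = "\<lambda>\<sigma> T. (\<Prod>\<alpha>\<in>?D \<sigma> - ?D \<rho>. w (Suc n) \<alpha>) * (\<Prod>\<alpha>\<in>?\<theta> \<sigma>. w (T \<alpha>) \<alpha>)"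
  have "(\<Sum>T\<in>rev_tableaux (?\<theta> \<rho>) (Suc n). \<Prod>\<alpha>\<in>?\<theta> \<rho>. w (T \<alpha>) \<alpha>) =
      (\<Sum>(\<sigma>, T)\<in>(SIGMA \<sigma>:?I. rev_tableaux (?\<theta> \<sigma>) n). ?t \<sigma> T)"
  proof (rule sum.reindex_bij_witness[of _ "\<lambda>(\<sigma>, T') \<alpha>. if \<alpha> \<in> ?D \<sigma> - ?D \<rho> then Suc n else T' \<alpha>"
        "\<lambda>T. (\<sigma>f T, \<lambda>\<alpha>. if \<alpha> \<in> ?\<theta> (\<sigma>f T) then T \<alpha> else undefined)"])
    fix T assume T: "T \<in> rev_tableaux (?\<theta> \<rho>) (Suc n)"
    let ?\<sigma> = "\<sigma>f T" and ?T = "\<lambda>\<alpha>. if \<alpha> \<in> ?\<theta> (\<sigma>f T) then T \<alpha> else undefined"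
    note \<sigma> = \<sigma>f[OF T]
    have d: "?D ?\<sigma> - ?D \<rho> = {\<alpha> \<in> ?\<theta> \<rho>. T \<alpha> = Suc n}" "?\<theta> ?\<sigma> = {\<alpha> \<in> ?\<theta> \<rho>. T \<alpha> \<noteq> Suc n}"
      unfolding \<sigma> by blast+
    have le\<sigma>: "part_le \<rho> ?\<sigma>" "part_le ?\<sigma> \<nu>" unfolding part_le_def \<sigma> using sub by blast+
    have h: "hstrip \<rho> ?\<sigma>"
      unfolding hstrip_iff_columns[OF le\<sigma>(1)] d
    proof (intro allI impI notI)
      fix i i' j assume *: "i < i'" "(i, j) \<in> {\<alpha> \<in> ?\<theta> \<rho>. T \<alpha> = Suc n}" "(i', j) \<in> {\<alpha> \<in> ?\<theta> \<rho>. T \<alpha> = Suc n}"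
      from rev_tableauxD(4)[OF T _ _ *(1), of j] * show False by simp
    qed
    have rT: "?T \<in> rev_tableaux (?\<theta> ?\<sigma>) n"
    proof (rule rev_tableauxI)
      fix \<alpha> assume \<alpha>: "\<alpha> \<in> ?\<theta> ?\<sigma>"
      then have "\<alpha> \<in> ?\<theta> \<rho>" "T \<alpha> \<noteq> Suc n" unfolding d by blast+
      then have "1 \<le> T \<alpha> \<and> T \<alpha> \<le> n" using rev_tableauxD(1)[OF T, of \<alpha>] by simp
      then show "1 \<le> ?T \<alpha> \<and> ?T \<alpha> \<le> n" by (simp only: \<alpha> if_True)
    next
      fix i j j' assume *: "(i, j) \<in> ?\<theta> ?\<sigma>" "(i, j') \<in> ?\<theta> ?\<sigma>" "j < j'"
      have "(i, j) \<in> ?\<theta> \<rho>" "(i, j') \<in> ?\<theta> \<rho>" using * unfolding d by blast+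
      from rev_tableauxD(3)[OF T this] *(3) show "?T (i, j') \<le> ?T (i, j)"
        by (simp only: * if_True less_imp_le)
    next
      fix i i' j assume *: "(i, j) \<in> ?\<theta> ?\<sigma>" "(i', j) \<in> ?\<theta> ?\<sigma>" "i < i'"
      have "(i, j) \<in> ?\<theta> \<rho>" "(i', j) \<in> ?\<theta> \<rho>" using * unfolding d by blast+
      from rev_tableauxD(4)[OF T this *(3)] show "?T (i', j) < ?T (i, j)"
        by (simp only: * if_True)
    qed (simp only: if_False)
    show "(?\<sigma>, ?T) \<in> (SIGMA \<sigma>:?I. rev_tableaux (?\<theta> \<sigma>) n)" using h le\<sigma>(2) rT by blast
    have "(if \<alpha> \<in> ?D ?\<sigma> - ?D \<rho> then Suc n else ?T \<alpha>) = T \<alpha>" for \<alpha>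
    proof (cases "\<alpha> \<in> ?\<theta> \<rho>")
      case True
      then show ?thesis unfolding d by (cases "T \<alpha> = Suc n") simp_all
    next
      case False
      then show ?thesis unfolding d using rev_tableauxD(2)[OF T False] by simp
    qed
    then show "(case (?\<sigma>, ?T) of (\<sigma>, T') \<Rightarrow> \<lambda>\<alpha>. if \<alpha> \<in> ?D \<sigma> - ?D \<rho> then Suc n else T' \<alpha>) = T"
      by (simp only: case_prod_conv)
    have U: "?\<theta> \<rho> = (?D ?\<sigma> - ?D \<rho>) \<union> ?\<theta> ?\<sigma>" unfolding d by blast
    have "(\<Prod>\<alpha>\<in>?\<theta> \<rho>. w (T \<alpha>) \<alpha>) = (\<Prod>\<alpha>\<in>?D ?\<sigma> - ?D \<rho>. w (T \<alpha>) \<alpha>) * (\<Prod>\<alpha>\<in>?\<theta> ?\<sigma>. w (T \<alpha>) \<alpha>)"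
      by (subst U, rule prod.union_disjoint) (use finite_diagram in blast)+
    also have "(\<Prod>\<alpha>\<in>?D ?\<sigma> - ?D \<rho>. w (T \<alpha>) \<alpha>) = (\<Prod>\<alpha>\<in>?D ?\<sigma> - ?D \<rho>. w (Suc n) \<alpha>)"
      by (rule prod.cong[OF refl]) (simp only: d mem_Collect_eq)
    also have "(\<Prod>\<alpha>\<in>?\<theta> ?\<sigma>. w (T \<alpha>) \<alpha>) = (\<Prod>\<alpha>\<in>?\<theta> ?\<sigma>. w (?T \<alpha>) \<alpha>)"
      by (rule prod.cong[OF refl]) (simp only: if_True)
    finally show "(case (?\<sigma>, ?T) of (\<sigma>, T) \<Rightarrow> ?t \<sigma> T) = (\<Prod>\<alpha>\<in>?\<theta> \<rho>. w (T \<alpha>) \<alpha>)"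
      by (simp only: case_prod_conv)
  next
    fix q assume q: "q \<in> (SIGMA \<sigma>:?I. rev_tableaux (?\<theta> \<sigma>) n)"
    obtain \<sigma> T' where qq: "q = (\<sigma>, T')" by (cases q)
    then have h: "hstrip \<rho> \<sigma>" and le\<sigma>: "part_le \<sigma> \<nu>" and T': "T' \<in> rev_tableaux (?\<theta> \<sigma>) n"
      using q by blast+
    have sub\<sigma>: "?D \<rho> \<subseteq> ?D \<sigma>" "?D \<sigma> \<subseteq> ?D \<nu>"
      using hstrip_part_le[OF h] le\<sigma> by (simp_all add: part_le_def)
    note cols = h[unfolded hstrip_iff_columns[OF hstrip_part_le[OF h]]]
    let ?T = "\<lambda>\<alpha>. if \<alpha> \<in> ?D \<sigma> - ?D \<rho> then Suc n else T' \<alpha>"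
    have T_\<sigma>: "?T \<alpha> = T' \<alpha>" "?T \<alpha> \<le> n" "1 \<le> ?T \<alpha>" if "\<alpha> \<in> ?\<theta> \<sigma>" for \<alpha>
    proof -
      show eq: "?T \<alpha> = T' \<alpha>" using that by simp
      show "?T \<alpha> \<le> n" "1 \<le> ?T \<alpha>" unfolding eq using rev_tableauxD(1)[OF T' that] by blast+
    qed
    have cases: "\<alpha> \<in> ?D \<sigma> - ?D \<rho> \<or> \<alpha> \<in> ?\<theta> \<sigma>" if "\<alpha> \<in> ?\<theta> \<rho>" for \<alpha> using that by blast
    have T: "?T \<in> rev_tableaux (?\<theta> \<rho>) (Suc n)"
    proof (rule rev_tableauxI)
      fix \<alpha> assume "\<alpha> \<in> ?\<theta> \<rho>"
      from cases[OF this] show "1 \<le> ?T \<alpha> \<and> ?T \<alpha> \<le> Suc n"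
      proof
        assume "\<alpha> \<in> ?\<theta> \<sigma>"
        then show ?thesis using T_\<sigma>[of \<alpha>] by linarith
      qed simp
    next
      fix \<alpha> assume "\<alpha> \<notin> ?\<theta> \<rho>"
      then have "\<alpha> \<notin> ?D \<sigma> - ?D \<rho>" "\<alpha> \<notin> ?\<theta> \<sigma>" using sub\<sigma> by blast+
      then show "?T \<alpha> = undefined" using rev_tableauxD(2)[OF T', of \<alpha>] by (simp only: if_False not_False_eq_True simp_thms)
    next
      fix i j j' assume *: "(i, j) \<in> ?\<theta> \<rho>" "(i, j') \<in> ?\<theta> \<rho>" "j < j'"
      show "?T (i, j') \<le> ?T (i, j)"
      proof (cases "(i, j) \<in> ?D \<sigma> - ?D \<rho>")
        case True
        have "?T (i, j') \<le> Suc n" 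
          using cases[OF *(2)]
        proof
          assume "(i, j') \<in> ?D \<sigma> - ?D \<rho>"
          then show "?T (i, j') \<le> Suc n" by (simp only: if_True order_refl)
        next
          assume "(i, j') \<in> ?\<theta> \<sigma>"
          from T_\<sigma>(2)[OF this] show "?T (i, j') \<le> Suc n" by (rule le_SucI)
        qed
        then show ?thesis by (simp only: True if_True)
      next
        case False
        then have ij: "(i, j) \<in> ?\<theta> \<sigma>" using cases[OF *(1)] by blast
        have "(i, j') \<notin> ?D \<sigma>"
        proof
          assume "(i, j') \<in> ?D \<sigma>"
          then have "(i, j) \<in> ?D \<sigma>"
            using *(1,3) by - (rule diagram_down[of i j'], simp_all add: mem_diagram)
          then show False using ij by blast
        qed
        then have ij': "(i, j') \<in> ?\<theta> \<sigma>" using *(2) by blast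
        show ?thesis unfolding T_\<sigma>(1)[OF ij] T_\<sigma>(1)[OF ij']
          using rev_tableauxD(3)[OF T' ij ij'] *(3) by simp
      qed
    next
      fix i i' j assume *: "(i, j) \<in> ?\<theta> \<rho>" "(i', j) \<in> ?\<theta> \<rho>" "i < i'"
      have "(i', j) \<notin> ?D \<sigma>"
      proof
        assume i': "(i', j) \<in> ?D \<sigma>"
        then have "(i, j) \<in> ?D \<sigma>"
          using *(1,3) by - (rule diagram_down[of i' j], simp_all add: mem_diagram)
        then show False using cols *(1,2,3) i' by blast
      qed
      then have ij': "(i', j) \<in> ?\<theta> \<sigma>" using *(2) by blast
      show "?T (i', j) < ?T (i, j)"
      proof (cases "(i, j) \<in> ?D \<sigma> - ?D \<rho>")
        case True
        then show ?thesis using T_\<sigma>(2)[OF ij'] by simp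
      next
        case False
        then have ij: "(i, j) \<in> ?\<theta> \<sigma>" using cases[OF *(1)] by blast
        show ?thesis unfolding T_\<sigma>(1)[OF ij] T_\<sigma>(1)[OF ij']
          by (rule rev_tableauxD(4)[OF T' ij ij' *(3)])
      qed
    qed
    show "(case q of (\<sigma>, T') \<Rightarrow> \<lambda>\<alpha>. if \<alpha> \<in> ?D \<sigma> - ?D \<rho> then Suc n else T' \<alpha>) \<in> rev_tableaux (?\<theta> \<rho>) (Suc n)"
      unfolding qq case_prod_conv by (rule T)
    have "{\<alpha> \<in> ?\<theta> \<rho>. ?T \<alpha> = Suc n} = ?D \<sigma> - ?D \<rho>"
    proof (intro equalityI subsetI)
      fix \<alpha> assume \<alpha>: "\<alpha> \<in> {\<alpha> \<in> ?\<theta> \<rho>. ?T \<alpha> = Suc n}"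
      then have "\<alpha> \<in> ?\<theta> \<rho>" "?T \<alpha> = Suc n" by blast+
      from cases[OF this(1)] show "\<alpha> \<in> ?D \<sigma> - ?D \<rho>"
      proof
        assume "\<alpha> \<in> ?\<theta> \<sigma>"
        from T_\<sigma>(2)[OF this] have "?T \<alpha> \<noteq> Suc n" by linarith
        then show ?thesis using \<open>?T \<alpha> = Suc n\<close> by (rule notE)
      qed
    next
      fix \<alpha> assume "\<alpha> \<in> ?D \<sigma> - ?D \<rho>"
      moreover from this have "?T \<alpha> = Suc n" by (rule if_P)
      moreover have "\<alpha> \<in> ?\<theta> \<rho>" using sub\<sigma> \<open>\<alpha> \<in> ?D \<sigma> - ?D \<rho>\<close> by blast
      ultimately show "\<alpha> \<in> {\<alpha> \<in> ?\<theta> \<rho>. ?T \<alpha> = Suc n}" by (intro CollectI conjI)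
    qed
    then have "?D (\<sigma>f ?T) = ?D \<sigma>" unfolding \<sigma>f[OF T] using sub\<sigma>(1) by blast
    then have eq: "\<sigma>f ?T = \<sigma>" by (rule diagram_inject)
    have "(if \<alpha> \<in> ?\<theta> \<sigma> then ?T \<alpha> else undefined) = T' \<alpha>" for \<alpha>
      using T_\<sigma>(1)[of \<alpha>] rev_tableauxD(2)[OF T', of \<alpha>] by (cases "\<alpha> \<in> ?\<theta> \<sigma>") simp_all
    then show "(\<sigma>f (case q of (\<sigma>, T') \<Rightarrow> \<lambda>\<alpha>. if \<alpha> \<in> ?D \<sigma> - ?D \<rho> then Suc n else T' \<alpha>),
        \<lambda>\<alpha>. if \<alpha> \<in> ?\<theta> (\<sigma>f (case q of (\<sigma>, T') \<Rightarrow> \<lambda>\<alpha>. if \<alpha> \<in> ?D \<sigma> - ?D \<rho> then Suc n else T' \<alpha>))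
          then (case q of (\<sigma>, T') \<Rightarrow> \<lambda>\<alpha>. if \<alpha> \<in> ?D \<sigma> - ?D \<rho> then Suc n else T' \<alpha>) \<alpha> else undefined) = q"
      unfolding qq case_prod_conv eq by (simp only: Pair_inject simp_thms)
  qed
  also have "\<dots> = (\<Sum>\<sigma>\<in>?I. \<Sum>T\<in>rev_tableaux (?\<theta> \<sigma>) n. ?t \<sigma> T)"
    by (rule sum.Sigma[symmetric])
      (auto intro: finite_subset[OF _ finite_part_le[of \<nu>]] finite_rev_tableaux finite_diagram)
  finally show ?thesis by (simp only: sum_distrib_left)
qed

text \<open>In a tableau with entries at most \<open>n + 1\<close> the boxes with entry \<open>n + 1\<close> form a
  horizontal strip along the outer border.\<close>

lemma tableaux_peel:
  fixes w :: "nat \<Rightarrow> nat \<times> nat \<Rightarrow> 'a::comm_ring_1"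
  assumes le: "part_le \<mu> \<kappa>"
  shows "(\<Sum>T\<in>tableaux (diagram \<kappa> - diagram \<mu>) (Suc n). \<Prod>\<alpha>\<in>diagram \<kappa> - diagram \<mu>. w (T \<alpha>) \<alpha>) =
    (\<Sum>\<sigma> | part_le \<mu> \<sigma> \<and> hstrip \<sigma> \<kappa>.
      (\<Sum>T\<in>tableaux (diagram \<sigma> - diagram \<mu>) n. \<Prod>\<alpha>\<in>diagram \<sigma> - diagram \<mu>. w (T \<alpha>) \<alpha>) *
      (\<Prod>\<alpha>\<in>diagram \<kappa> - diagram \<sigma>. w (Suc n) \<alpha>))"
proof -
  let ?D = diagram and ?\<theta> = "\<lambda>\<sigma>. diagram \<sigma> - diagram \<mu>"
  let ?I = "{\<sigma>. part_le \<mu> \<sigma> \<and> hstrip \<sigma> \<kappa>}"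
  \<comment> \<open>Here the boxes without the maximal entry form the order ideal, since entries
    increase away from the corner.\<close>
  let ?S = "\<lambda>T. ?D \<mu> \<union> {\<alpha> \<in> ?\<theta> \<kappa>. T \<alpha> \<noteq> Suc n}"
  have sub: "?D \<mu> \<subseteq> ?D \<kappa>" using le by (simp add: part_le_def)
  have ex: "\<exists>\<sigma>. ?D \<sigma> = ?S T" if T: "T \<in> tableaux (?\<theta> \<kappa>) (Suc n)" for T
  proof (rule ex_diagram)
    show "finite (?S T)" by (rule finite_subset[OF _ finite_diagram[of \<kappa>]]) (use sub in blast)
    show "1 \<le> i \<and> 1 \<le> j" if "(i, j) \<in> ?S T" for i j
      using that by (auto simp: mem_diagram)
    fix i j i' j' assume *: "(i, j) \<in> ?S T" "1 \<le> i'" "i' \<le> i" "1 \<le> j'" "j' \<le> j"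
    show "(i', j') \<in> ?S T"
    proof (cases "(i', j') \<in> ?D \<mu>")
      case False
      then have nij: "(i, j) \<notin> ?D \<mu>" "(i', j) \<notin> ?D \<mu>"
        using diagram_down[of _ _ \<mu> i' j'] * by (meson order_refl order_trans)+
      then have ij: "(i, j) \<in> ?\<theta> \<kappa>" "T (i, j) \<noteq> Suc n" using * by blast+
      have "(i', j) \<in> ?D \<kappa>" "(i', j') \<in> ?D \<kappa>"
        using ij(1) diagram_down[of i j \<kappa>] * by (meson DiffD1 order_refl order_trans)+
      then have mem: "(i', j) \<in> ?\<theta> \<kappa>" "(i', j') \<in> ?\<theta> \<kappa>" using nij False by blast+
      have "T (i', j') \<le> T (i', j)" by (rule tableauxD(3)[OF T mem(2,1) *(5)])
      also have "\<dots> \<le> T (i, j)"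
        using tableauxD(4)[OF T mem(1) ij(1)] *(3) by (cases "i' = i") (simp_all add: less_imp_le)
      finally have "T (i', j') \<noteq> Suc n" using ij(2) tableauxD(1)[OF T ij(1)] by linarith
      with mem show ?thesis by blast
    qed blast
  qed
  define \<sigma>f where "\<sigma>f T = (SOME \<sigma>. ?D \<sigma> = ?S T)" for T
  have \<sigma>f: "?D (\<sigma>f T) = ?S T" if "T \<in> tableaux (?\<theta> \<kappa>) (Suc n)" for T
    unfolding \<sigma>f_def using ex[OF that] by (rule someI_ex)
  let ?t = "\<lambda>\<sigma> T. (\<Prod>\<alpha>\<in>?\<theta> \<sigma>. w (T \<alpha>) \<alpha>) * (\<Prod>\<alpha>\<in>?D \<kappa> - ?D \<sigma>. w (Suc n) \<alpha>)"
  have "(\<Sum>T\<in>tableaux (?\<theta> \<kappa>) (Suc n). \<Prod>\<alpha>\<in>?\<theta> \<kappa>. w (T \<alpha>) \<alpha>) =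
      (\<Sum>(\<sigma>, T)\<in>(SIGMA \<sigma>:?I. tableaux (?\<theta> \<sigma>) n). ?t \<sigma> T)"
  proof (rule sum.reindex_bij_witness[of _ "\<lambda>(\<sigma>, T') \<alpha>. if \<alpha> \<in> ?D \<kappa> - ?D \<sigma> then Suc n else T' \<alpha>"
        "\<lambda>T. (\<sigma>f T, \<lambda>\<alpha>. if \<alpha> \<in> ?\<theta> (\<sigma>f T) then T \<alpha> else undefined)"])
    fix T assume T: "T \<in> tableaux (?\<theta> \<kappa>) (Suc n)"
    let ?\<sigma> = "\<sigma>f T" and ?T = "\<lambda>\<alpha>. if \<alpha> \<in> ?\<theta> (\<sigma>f T) then T \<alpha> else undefined"
    note \<sigma> = \<sigma>f[OF T]
    have d: "?D \<kappa> - ?D ?\<sigma> = {\<alpha> \<in> ?\<theta> \<kappa>. T \<alpha> = Suc n}" "?\<theta> ?\<sigma> = {\<alpha> \<in> ?\<theta> \<kappa>. T \<alpha> \<noteq> Suc n}"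
      unfolding \<sigma> using sub by blast+
    have le\<sigma>: "part_le \<mu> ?\<sigma>" "part_le ?\<sigma> \<kappa>" unfolding part_le_def \<sigma> using sub by blast+
    have h: "hstrip ?\<sigma> \<kappa>"
      unfolding hstrip_iff_columns[OF le\<sigma>(2)] d
    proof (intro allI impI notI)
      fix i i' j assume *: "i < i'" "(i, j) \<in> {\<alpha> \<in> ?\<theta> \<kappa>. T \<alpha> = Suc n}" "(i', j) \<in> {\<alpha> \<in> ?\<theta> \<kappa>. T \<alpha> = Suc n}"
      from tableauxD(4)[OF T _ _ *(1), of j] * show False by simp
    qed
    have rT: "?T \<in> tableaux (?\<theta> ?\<sigma>) n"
    proof (rule tableauxI)
      fix \<alpha> assume \<alpha>: "\<alpha> \<in> ?\<theta> ?\<sigma>"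
      then have "\<alpha> \<in> ?\<theta> \<kappa>" "T \<alpha> \<noteq> Suc n" unfolding d by blast+
      then have "1 \<le> T \<alpha> \<and> T \<alpha> \<le> n" using tableauxD(1)[OF T, of \<alpha>] by simp
      then show "1 \<le> ?T \<alpha> \<and> ?T \<alpha> \<le> n" by (simp only: \<alpha> if_True)
    next
      fix i j j' assume *: "(i, j) \<in> ?\<theta> ?\<sigma>" "(i, j') \<in> ?\<theta> ?\<sigma>" "j < j'"
      have "(i, j) \<in> ?\<theta> \<kappa>" "(i, j') \<in> ?\<theta> \<kappa>" using * unfolding d by blast+
      from tableauxD(3)[OF T this] *(3) show "?T (i, j) \<le> ?T (i, j')"
        by (simp only: * if_True less_imp_le)
    next
      fix i i' j assume *: "(i, j) \<in> ?\<theta> ?\<sigma>" "(i', j) \<in> ?\<theta> ?\<sigma>" "i < i'"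
      have "(i, j) \<in> ?\<theta> \<kappa>" "(i', j) \<in> ?\<theta> \<kappa>" using * unfolding d by blast+
      from tableauxD(4)[OF T this *(3)] show "?T (i, j) < ?T (i', j)"
        by (simp only: * if_True)
    qed (simp only: if_False)
    show "(?\<sigma>, ?T) \<in> (SIGMA \<sigma>:?I. tableaux (?\<theta> \<sigma>) n)" using h le\<sigma>(1) rT by blast
    have "(if \<alpha> \<in> ?D \<kappa> - ?D ?\<sigma> then Suc n else ?T \<alpha>) = T \<alpha>" for \<alpha>
    proof (cases "\<alpha> \<in> ?\<theta> \<kappa>")
      case True
      then show ?thesis unfolding d by (cases "T \<alpha> = Suc n") simp_all
    next
      case False
      then show ?thesis unfolding d using tableauxD(2)[OF T False] by simp
    qed
    then show "(case (?\<sigma>, ?T) of (\<sigma>, T') \<Rightarrow> \<lambda>\<alpha>. if \<alpha> \<in> ?D \<kappa> - ?D \<sigma> then Suc n else T' \<alpha>) = T"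
      by (simp only: case_prod_conv)
    have U: "?\<theta> \<kappa> = ?\<theta> ?\<sigma> \<union> (?D \<kappa> - ?D ?\<sigma>)" unfolding d by blast
    have "(\<Prod>\<alpha>\<in>?\<theta> \<kappa>. w (T \<alpha>) \<alpha>) = (\<Prod>\<alpha>\<in>?\<theta> ?\<sigma>. w (T \<alpha>) \<alpha>) * (\<Prod>\<alpha>\<in>?D \<kappa> - ?D ?\<sigma>. w (T \<alpha>) \<alpha>)"
      by (subst U, rule prod.union_disjoint) (use finite_diagram in blast)+
    also have "(\<Prod>\<alpha>\<in>?D \<kappa> - ?D ?\<sigma>. w (T \<alpha>) \<alpha>) = (\<Prod>\<alpha>\<in>?D \<kappa> - ?D ?\<sigma>. w (Suc n) \<alpha>)"
      by (rule prod.cong[OF refl]) (simp only: d mem_Collect_eq)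
    also have "(\<Prod>\<alpha>\<in>?\<theta> ?\<sigma>. w (T \<alpha>) \<alpha>) = (\<Prod>\<alpha>\<in>?\<theta> ?\<sigma>. w (?T \<alpha>) \<alpha>)"
      by (rule prod.cong[OF refl]) (simp only: if_True)
    finally show "(case (?\<sigma>, ?T) of (\<sigma>, T) \<Rightarrow> ?t \<sigma> T) = (\<Prod>\<alpha>\<in>?\<theta> \<kappa>. w (T \<alpha>) \<alpha>)"
      by (simp only: case_prod_conv)
  next
    fix q assume q: "q \<in> (SIGMA \<sigma>:?I. tableaux (?\<theta> \<sigma>) n)"
    obtain \<sigma> T' where qq: "q = (\<sigma>, T')" by (cases q)
    then have h: "hstrip \<sigma> \<kappa>" and le\<sigma>: "part_le \<mu> \<sigma>" and T': "T' \<in> tableaux (?\<theta> \<sigma>) n"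
      using q by blast+
    have sub\<sigma>: "?D \<mu> \<subseteq> ?D \<sigma>" "?D \<sigma> \<subseteq> ?D \<kappa>"
      using hstrip_part_le[OF h] le\<sigma> by (simp_all add: part_le_def)
    note cols = h[unfolded hstrip_iff_columns[OF hstrip_part_le[OF h]]]
    let ?T = "\<lambda>\<alpha>. if \<alpha> \<in> ?D \<kappa> - ?D \<sigma> then Suc n else T' \<alpha>"
    have T_\<sigma>: "?T \<alpha> = T' \<alpha>" "?T \<alpha> \<le> n" "1 \<le> ?T \<alpha>" if "\<alpha> \<in> ?\<theta> \<sigma>" for \<alpha>
    proof -
      show eq: "?T \<alpha> = T' \<alpha>" using that by simp
      show "?T \<alpha> \<le> n" "1 \<le> ?T \<alpha>" unfolding eq using tableauxD(1)[OF T' that] by blast+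
    qed
    have cases: "\<alpha> \<in> ?D \<kappa> - ?D \<sigma> \<or> \<alpha> \<in> ?\<theta> \<sigma>" if "\<alpha> \<in> ?\<theta> \<kappa>" for \<alpha> using that by blast
    have T: "?T \<in> tableaux (?\<theta> \<kappa>) (Suc n)"
    proof (rule tableauxI)
      fix \<alpha> assume "\<alpha> \<in> ?\<theta> \<kappa>"
      from cases[OF this] show "1 \<le> ?T \<alpha> \<and> ?T \<alpha> \<le> Suc n"
      proof
        assume "\<alpha> \<in> ?\<theta> \<sigma>"
        then show ?thesis using T_\<sigma>[of \<alpha>] by linarith
      qed simp
    next
      fix \<alpha> assume "\<alpha> \<notin> ?\<theta> \<kappa>"
      then have "\<alpha> \<notin> ?D \<kappa> - ?D \<sigma>" "\<alpha> \<notin> ?\<theta> \<sigma>" using sub\<sigma> by blast+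
      then show "?T \<alpha> = undefined" using tableauxD(2)[OF T', of \<alpha>] by (simp only: if_False not_False_eq_True simp_thms)
    next
      fix i j j' assume *: "(i, j) \<in> ?\<theta> \<kappa>" "(i, j') \<in> ?\<theta> \<kappa>" "j < j'"
      show "?T (i, j) \<le> ?T (i, j')"
      proof (cases "(i, j') \<in> ?D \<kappa> - ?D \<sigma>")
        case True
        have "?T (i, j) \<le> Suc n" 
          using cases[OF *(1)]
        proof
          assume "(i, j) \<in> ?D \<kappa> - ?D \<sigma>"
          then show "?T (i, j) \<le> Suc n" by (simp only: if_True order_refl)
        next
          assume "(i, j) \<in> ?\<theta> \<sigma>"
          from T_\<sigma>(2)[OF this] show "?T (i, j) \<le> Suc n" by (rule le_SucI)
        qed
        then show ?thesis by (simp only: True if_True)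
      next
        case False
        then have ij': "(i, j') \<in> ?\<theta> \<sigma>" using cases[OF *(2)] by blast
        then have "(i, j) \<in> ?D \<sigma>"
          using *(1,3) by - (rule diagram_down[of i j'], simp_all add: mem_diagram)
        then have ij: "(i, j) \<in> ?\<theta> \<sigma>" using *(1) by blast
        show ?thesis unfolding T_\<sigma>(1)[OF ij] T_\<sigma>(1)[OF ij']
          using tableauxD(3)[OF T' ij ij'] *(3) by simp
      qed
    next
      fix i i' j assume *: "(i, j) \<in> ?\<theta> \<kappa>" "(i', j) \<in> ?\<theta> \<kappa>" "i < i'"
      have "(i, j) \<in> ?D \<sigma>"
      proof (rule ccontr)
        assume i: "(i, j) \<notin> ?D \<sigma>"
        then have "(i', j) \<notin> ?D \<sigma>"
          using diagram_down[of i' j \<sigma> i j] *(1,3) by (auto simp: mem_diagram)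
        then show False using cols *(1,2,3) i by blast
      qed
      then have ij: "(i, j) \<in> ?\<theta> \<sigma>" using *(1) by blast
      show "?T (i, j) < ?T (i', j)"
      proof (cases "(i', j) \<in> ?D \<kappa> - ?D \<sigma>")
        case True
        then show ?thesis using T_\<sigma>(2)[OF ij] by simp
      next
        case False
        then have ij': "(i', j) \<in> ?\<theta> \<sigma>" using cases[OF *(2)] by blast
        show ?thesis unfolding T_\<sigma>(1)[OF ij] T_\<sigma>(1)[OF ij']
          by (rule tableauxD(4)[OF T' ij ij' *(3)])
      qed
    qed
    show "(case q of (\<sigma>, T') \<Rightarrow> \<lambda>\<alpha>. if \<alpha> \<in> ?D \<kappa> - ?D \<sigma> then Suc n else T' \<alpha>) \<in> tableaux (?\<theta> \<kappa>) (Suc n)"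
      unfolding qq case_prod_conv by (rule T)
    have "{\<alpha> \<in> ?\<theta> \<kappa>. ?T \<alpha> \<noteq> Suc n} = ?\<theta> \<sigma>"
    proof (intro equalityI subsetI)
      fix \<alpha> assume \<alpha>: "\<alpha> \<in> {\<alpha> \<in> ?\<theta> \<kappa>. ?T \<alpha> \<noteq> Suc n}"
      then have "\<alpha> \<in> ?\<theta> \<kappa>" "?T \<alpha> \<noteq> Suc n" by blast+
      from cases[OF this(1)] show "\<alpha> \<in> ?\<theta> \<sigma>"
      proof
        assume "\<alpha> \<in> ?D \<kappa> - ?D \<sigma>"
        then have "?T \<alpha> = Suc n" by (rule if_P)
        with \<open>?T \<alpha> \<noteq> Suc n\<close> show ?thesis by (rule notE)
      qed
    next
      fix \<alpha> assume "\<alpha> \<in> ?\<theta> \<sigma>"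
      from T_\<sigma>(2)[OF this] have "?T \<alpha> \<noteq> Suc n" by linarith
      moreover have "\<alpha> \<in> ?\<theta> \<kappa>" using sub\<sigma>(2) \<open>\<alpha> \<in> ?\<theta> \<sigma>\<close> by blast
      ultimately show "\<alpha> \<in> {\<alpha> \<in> ?\<theta> \<kappa>. ?T \<alpha> \<noteq> Suc n}" by (intro CollectI conjI)
    qed
    then have "?D (\<sigma>f ?T) = ?D \<sigma>" unfolding \<sigma>f[OF T] using sub\<sigma>(1) by blast
    then have eq: "\<sigma>f ?T = \<sigma>" by (rule diagram_inject)
    have "(if \<alpha> \<in> ?\<theta> \<sigma> then ?T \<alpha> else undefined) = T' \<alpha>" for \<alpha>
      using T_\<sigma>(1)[of \<alpha>] tableauxD(2)[OF T', of \<alpha>] by (cases "\<alpha> \<in> ?\<theta> \<sigma>") simp_all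
    then show "(\<sigma>f (case q of (\<sigma>, T') \<Rightarrow> \<lambda>\<alpha>. if \<alpha> \<in> ?D \<kappa> - ?D \<sigma> then Suc n else T' \<alpha>),
        \<lambda>\<alpha>. if \<alpha> \<in> ?\<theta> (\<sigma>f (case q of (\<sigma>, T') \<Rightarrow> \<lambda>\<alpha>. if \<alpha> \<in> ?D \<kappa> - ?D \<sigma> then Suc n else T' \<alpha>))
          then (case q of (\<sigma>, T') \<Rightarrow> \<lambda>\<alpha>. if \<alpha> \<in> ?D \<kappa> - ?D \<sigma> then Suc n else T' \<alpha>) \<alpha> else undefined) = q"
      unfolding qq case_prod_conv eq by (simp only: Pair_inject simp_thms)
  qed
  also have "\<dots> = (\<Sum>\<sigma>\<in>?I. \<Sum>T\<in>tableaux (?\<theta> \<sigma>) n. ?t \<sigma> T)"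
    by (rule sum.Sigma[symmetric])
      (auto intro: finite_subset[OF _ finite_part_le[of \<kappa>]] finite_tableaux finite_diagram hstrip_part_le)
  finally show ?thesis by (simp only: sum_distrib_right)
qed


subsection \<open>Matrices indexed by partitions\<close>

type_synonym 'a pmat = "partition \<Rightarrow> partition \<Rightarrow> 'a"

definition interval :: "partition \<Rightarrow> partition \<Rightarrow> partition set" where
  "interval \<mu> \<nu> = {\<rho>. part_le \<mu> \<rho> \<and> part_le \<rho> \<nu>}"

text \<open>The product in the incidence algebra of the containment order, where all intervals are
  finite. A row vector is treated as a matrix that ignores its first index.\<close>

definition conv :: "'a::comm_ring_1 pmat \<Rightarrow> 'a pmat \<Rightarrow> 'a pmat" where
  "conv F G \<mu> \<nu> = (\<Sum>\<rho>\<in>interval \<mu> \<nu>. F \<mu> \<rho> * G \<rho> \<nu>)"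

definition pdelta :: "'a::comm_ring_1 pmat" where
  "pdelta \<mu> \<nu> = (if \<mu> = \<nu> then 1 else 0)"

definition psupp :: "'a::comm_ring_1 pmat \<Rightarrow> bool" where
  "psupp F \<longleftrightarrow> (\<forall>\<mu> \<nu>. F \<mu> \<nu> \<noteq> 0 \<longrightarrow> part_le \<mu> \<nu>)"

lemma finite_interval [simp]: "finite (interval \<mu> \<nu>)"
  unfolding interval_def by (rule finite_subset[OF _ finite_part_le[of \<nu>]]) blast

lemma conv_assoc: "conv (conv F G) H = conv F (conv G H)"
proof (intro ext)
  fix \<mu> \<nu>
  have "conv (conv F G) H \<mu> \<nu> =
      (\<Sum>(\<rho>, \<sigma>)\<in>(SIGMA \<rho>:interval \<mu> \<nu>. interval \<mu> \<rho>). F \<mu> \<sigma> * G \<sigma> \<rho> * H \<rho> \<nu>)"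
    unfolding conv_def sum_distrib_right by (rule sum.Sigma) simp_all
  also have "\<dots> = (\<Sum>(\<sigma>, \<rho>)\<in>(SIGMA \<sigma>:interval \<mu> \<nu>. interval \<sigma> \<nu>). F \<mu> \<sigma> * (G \<sigma> \<rho> * H \<rho> \<nu>))"
  proof (rule sum.reindex_bij_witness[of _ prod.swap prod.swap])
    fix q :: "partition \<times> partition"
    obtain a b where q: "q = (a, b)" by (cases q)
    assume "q \<in> (SIGMA \<rho>:interval \<mu> \<nu>. interval \<mu> \<rho>)"
    then have "part_le \<mu> b" "part_le b a" "part_le a \<nu>" by (simp_all add: q interval_def)
    then show "prod.swap q \<in> (SIGMA \<sigma>:interval \<mu> \<nu>. interval \<sigma> \<nu>)"
      using part_le_trans[of b a \<nu>] by (simp add: q interval_def)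
  next
    fix q :: "partition \<times> partition"
    obtain a b where q: "q = (a, b)" by (cases q)
    assume "q \<in> (SIGMA \<sigma>:interval \<mu> \<nu>. interval \<sigma> \<nu>)"
    then have "part_le \<mu> a" "part_le a b" "part_le b \<nu>" by (simp_all add: q interval_def)
    then show "prod.swap q \<in> (SIGMA \<rho>:interval \<mu> \<nu>. interval \<mu> \<rho>)"
      using part_le_trans[of \<mu> a b] by (simp add: q interval_def)
  qed (simp_all add: case_prod_unfold mult.assoc)
  also have "\<dots> = conv F (conv G H) \<mu> \<nu>"
    unfolding conv_def sum_distrib_left by (rule sum.Sigma[symmetric]) simp_all
  finally show "conv (conv F G) H \<mu> \<nu> = conv F (conv G H) \<mu> \<nu>" .
qed

lemma conv_delta_right: "part_le \<mu> \<nu> \<Longrightarrow> conv F pdelta \<mu> \<nu> = F \<mu> \<nu>"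
proof -
  assume le: "part_le \<mu> \<nu>"
  have "conv F pdelta \<mu> \<nu> = (\<Sum>\<rho>\<in>{\<nu>}. F \<mu> \<rho> * pdelta \<rho> \<nu>)"
    unfolding conv_def
    by (rule sum.mono_neutral_right[OF finite_interval]) (use le part_le_refl in \<open>simp_all add: interval_def pdelta_def\<close>)
  then show ?thesis by (simp add: pdelta_def)
qed

lemma conv_delta_left: "part_le \<mu> \<nu> \<Longrightarrow> conv pdelta F \<mu> \<nu> = F \<mu> \<nu>"
proof -
  assume le: "part_le \<mu> \<nu>"
  have "conv pdelta F \<mu> \<nu> = (\<Sum>\<rho>\<in>{\<mu>}. pdelta \<mu> \<rho> * F \<rho> \<nu>)"
    unfolding conv_def
    by (rule sum.mono_neutral_right[OF finite_interval]) (use le part_le_refl in \<open>simp_all add: interval_def pdelta_def\<close>)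
  then show ?thesis by (simp add: pdelta_def)
qed

lemma conv_eq_0: "\<not> part_le \<mu> \<nu> \<Longrightarrow> conv F G \<mu> \<nu> = 0"
  unfolding conv_def interval_def by (rule sum.neutral) (use part_le_trans in blast)

lemma psupp_conv: "psupp (conv F G)"
  unfolding psupp_def using conv_eq_0 by blast

lemma psupp_delta: "psupp pdelta"
  unfolding psupp_def pdelta_def by (simp add: part_le_refl)

lemma conv_delta_left': "psupp F \<Longrightarrow> conv pdelta F = F"
proof (intro ext)
  fix \<mu> \<nu> assume "psupp F"
  then show "conv pdelta F \<mu> \<nu> = F \<mu> \<nu>"
    by (cases "part_le \<mu> \<nu>") (simp add: conv_delta_left, metis conv_eq_0 psupp_def)
qed

text \<open>Conjugation is an automorphism of the containment order, so it commutes with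
  convolution.\<close>

lemma conv_transpose:
  "conv (\<lambda>\<mu> \<nu>. F (conj_part \<mu>) (conj_part \<nu>)) (\<lambda>\<mu> \<nu>. G (conj_part \<mu>) (conj_part \<nu>)) \<mu> \<nu> =
    conv F G (conj_part \<mu>) (conj_part \<nu>)"
  unfolding conv_def
proof (rule sum.reindex_bij_witness[of _ conj_part conj_part])
  fix \<rho> assume "\<rho> \<in> interval (conj_part \<mu>) (conj_part \<nu>)"
  then have "part_le (conj_part \<mu>) (conj_part (conj_part \<rho>))" "part_le (conj_part (conj_part \<rho>)) (conj_part \<nu>)"
    by (simp_all add: interval_def)
  then show "conj_part \<rho> \<in> interval \<mu> \<nu>" unfolding part_le_conj interval_def by simp
next
  fix \<rho> assume "\<rho> \<in> interval \<mu> \<nu>"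
  then show "conj_part \<rho> \<in> interval (conj_part \<mu>) (conj_part \<nu>)"
    by (simp add: interval_def part_le_conj)
qed simp_all

lemma hom_conv:
  assumes "comm_ring_hom \<phi>"
  shows "\<phi> (conv F G \<mu> \<nu>) = conv (\<lambda>\<mu> \<nu>. \<phi> (F \<mu> \<nu>)) (\<lambda>\<mu> \<nu>. \<phi> (G \<mu> \<nu>)) \<mu> \<nu>"
proof -
  interpret comm_ring_hom \<phi> by fact
  show ?thesis unfolding conv_def hom_sum hom_mult ..
qed

section \<open>Strip matrices with weights depending on contents\<close>

definition hmat :: "(int \<Rightarrow> 'a::comm_ring_1) \<Rightarrow> 'a pmat" where
  "hmat w \<rho> \<nu> = (if hstrip \<rho> \<nu> then \<Prod>\<alpha>\<in>diagram \<nu> - diagram \<rho>. w (content \<alpha>) else 0)"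

text \<open>The sign makes this the inverse of \<open>hmat\<close>: a weighted form of the relation
  between elementary and complete symmetric functions.\<close>

definition vmat :: "(int \<Rightarrow> 'a::comm_ring_1) \<Rightarrow> 'a pmat" where
  "vmat w \<rho> \<nu> = (if vstrip \<rho> \<nu> then \<Prod>\<alpha>\<in>diagram \<nu> - diagram \<rho>. - w (content \<alpha>) else 0)"

lemma psupp_vmat: "psupp (vmat w)"
  unfolding psupp_def vmat_def using vstrip_part_le by meson

lemma hom_hmat:
  assumes "comm_ring_hom \<phi>"
  shows "\<phi> (hmat w \<rho> \<nu>) = hmat (\<lambda>c. \<phi> (w c)) \<rho> \<nu>"
proof -
  interpret comm_ring_hom \<phi> by fact
  show ?thesis by (simp add: hmat_def hom_prod)
qed

lemma hom_vmat:
  assumes "comm_ring_hom \<phi>"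
  shows "\<phi> (vmat w \<rho> \<nu>) = vmat (\<lambda>c. \<phi> (w c)) \<rho> \<nu>"
proof -
  interpret comm_ring_hom \<phi> by fact
  show ?thesis by (simp add: vmat_def hom_prod hom_uminus)
qed

lemma content_swap [simp]: "content (prod.swap \<alpha>) = - content \<alpha>"
  by (simp add: content_def)

lemma hmat_conj: "hmat w (conj_part \<mu>) (conj_part \<nu>) = vmat (\<lambda>c. - w (- c)) \<mu> \<nu>"
  unfolding hmat_def vmat_def vstrip_conj diagram_conj_diff
  by (subst prod.reindex) simp_all

lemma vmat_conj: "vmat w (conj_part \<mu>) (conj_part \<nu>) = hmat (\<lambda>c. - w (- c)) \<mu> \<nu>"
  using hmat_conj[of "\<lambda>c. - w (- c)" "conj_part \<mu>" "conj_part \<nu>"] by simp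

lemma ex_update_part:
  assumes "i \<ge> 1" "part \<rho> (Suc i) \<le> k" "i = 1 \<or> k \<le> part \<rho> (i - 1)"
  shows "\<exists>\<rho>'. part \<rho>' = (part \<rho>)(i := k)"
proof -
  let ?f = "(part \<rho>)(i := k)"
  have "?f (Suc j) \<le> ?f j" if "j \<ge> 1" for j
    using assms part_Suc_le[OF that, of \<rho>] that by (cases "j = i"; cases "Suc j = i") auto
  moreover have "finite {j. ?f j \<noteq> 0}"
    by (rule finite_subset[of _ "insert i {j. part \<rho> j \<noteq> 0}"]) (use finite_part[of \<rho>] in auto)
  moreover have "?f 0 = 0" using assms(1) by simp
  ultimately have "?f \<in> {f. f 0 = 0 \<and> (\<forall>i\<ge>1. f (Suc i) \<le> f i) \<and> finite {i. f i \<noteq> 0}}" by blast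
  from Abs_partition_inverse[OF this] show ?thesis by blast
qed

lemma diagram_update:
  assumes "i \<ge> 1" "part \<rho>' = (part \<rho>)(i := Suc (part \<rho> i))"
  shows "diagram \<rho>' = insert (i, Suc (part \<rho> i)) (diagram \<rho>)" "(i, Suc (part \<rho> i)) \<notin> diagram \<rho>"
proof -
  have "(a, b) \<in> diagram \<rho>' \<longleftrightarrow> (a, b) \<in> insert (i, Suc (part \<rho> i)) (diagram \<rho>)" for a b
    unfolding mem_diagram insert_iff assms(2) using assms(1) by (cases "a = i") auto
  then show "diagram \<rho>' = insert (i, Suc (part \<rho> i)) (diagram \<rho>)" by auto
qed (simp add: mem_diagram)

text \<open>If \<open>\<tau> \<noteq> \<sigma>\<close>, toggling the first box that \<open>\<sigma>\<close> has beyond \<open>\<tau>\<close> in the last row where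
  they differ is a sign-reversing involution on the terms of the product.\<close>

lemma conv_vmat_hmat: "conv (vmat w) (hmat w) = pdelta"
proof (intro ext)
  fix \<tau> \<sigma>
  let ?D = diagram
  show "conv (vmat w) (hmat w) \<tau> \<sigma> = pdelta \<tau> \<sigma>"
  proof (cases "part_le \<tau> \<sigma> \<and> \<tau> \<noteq> \<sigma>")
    case False
    show ?thesis
    proof (cases "\<tau> = \<sigma>")
      case True
      have "interval \<tau> \<sigma> = {\<tau>}" unfolding True interval_def using part_le_antisym part_le_refl by blast
      moreover have "hstrip \<tau> \<tau>" "vstrip \<tau> \<tau>" unfolding hstrip_def vstrip_def by (simp_all add: part_Suc_le)
      ultimately show ?thesis by (simp add: conv_def True hmat_def vmat_def pdelta_def)
    next
      case ne: False
      with False show ?thesis by (simp add: conv_eq_0 pdelta_def)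
    qed
  next
    case True
    let ?R = "{i. part \<tau> i < part \<sigma> i}"
    have le: "part \<tau> i \<le> part \<sigma> i" for i using True part_le_iff by blast
    have finR: "finite ?R" by (rule finite_subset[OF _ finite_part[of \<sigma>]]) auto
    have "?R \<noteq> {}"
    proof
      assume "?R = {}"
      then have "part \<tau> i = part \<sigma> i" for i using le[of i] by (metis (mono_tags) empty_Collect_eq le_less)
      then show False using True partition_eqI by blast
    qed
    \<comment> \<open>In all later rows \<tau> and \<sigma> agree, which pins \<rho> down there and
      leaves the box in row i unobstructed from below.\<close>
    define i where "i = Max ?R"
    have i: "part \<tau> i < part \<sigma> i" using Max_in[OF finR \<open>?R \<noteq> {}\<close>] by (simp add: i_def)
    then have i1: "i \<ge> 1" using part_pos_iff[of \<sigma> i] by linarith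
    have below: "part \<tau> j = part \<sigma> j" if "i < j" for j
    proof -
      have "j \<notin> ?R" using Max_ge[OF finR, of j] that unfolding i_def by (meson leD)
      then show ?thesis using le[of j] by simp
    qed
    define A where "A = {\<rho>. vstrip \<tau> \<rho> \<and> hstrip \<rho> \<sigma>}"
    define t where "t \<rho> = vmat w \<tau> \<rho> * hmat w \<rho> \<sigma>" for \<rho>
    have AI: "A \<subseteq> interval \<tau> \<sigma>"
      unfolding A_def interval_def using hstrip_part_le vstrip_part_le by blast
    then have finA: "finite A" using finite_interval by (rule finite_subset)
    define A0 where "A0 = {\<rho>\<in>A. part \<rho> i = part \<tau> i}"
    define A1 where "A1 = {\<rho>\<in>A. part \<rho> i = Suc (part \<tau> i)}"
    have A: "part \<tau> j \<le> part \<rho> j" "part \<rho> j \<le> Suc (part \<tau> j)" "part \<sigma> (Suc j) \<le> part \<rho> j" "part \<rho> j \<le> part \<sigma> j"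
      if "\<rho> \<in> A" "j \<ge> 1" for \<rho> j
      using that unfolding A_def vstrip_def hstrip_def by blast+
    have A_iff: "\<rho> \<in> A \<longleftrightarrow> (\<forall>j\<ge>1. part \<tau> j \<le> part \<rho> j \<and> part \<rho> j \<le> Suc (part \<tau> j) \<and>
        part \<sigma> (Suc j) \<le> part \<rho> j \<and> part \<rho> j \<le> part \<sigma> j)" for \<rho>
      unfolding A_def vstrip_def hstrip_def by blast
    have \<rho>_below: "part \<rho> (Suc i) = part \<tau> (Suc i)" if "\<rho> \<in> A" for \<rho>
      using A(1,4)[OF that, of "Suc i"] below[of "Suc i"] by simp
    \<comment> \<open>Interlacing with \<sigma> makes the row above at least as long as
      \<open>part \<sigma> i\<close>, which exceeds \<open>part \<tau> i\<close>, so the box in row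
      i always fits.\<close>
    have \<rho>_above: "i = 1 \<or> Suc (part \<tau> i) \<le> part \<rho> (i - 1)" if "\<rho> \<in> A" for \<rho>
    proof (cases "i = 1")
      case False
      then have "i - 1 \<ge> 1" "Suc (i - 1) = i" using i1 by linarith+
      then show ?thesis using A(3)[OF that, of "i - 1"] i by simp
    qed simp
    have upd: "\<exists>\<rho>'. part \<rho>' = (part \<rho>)(i := k) \<and> \<rho>' \<in> A"
      if \<rho>: "\<rho> \<in> A" and k: "k = part \<tau> i \<or> k = Suc (part \<tau> i)" for \<rho> k
    proof -
      have "part \<tau> (Suc i) \<le> part \<tau> i" by (rule part_Suc_le[OF i1])
      then have "part \<rho> (Suc i) \<le> k" "part \<tau> i \<le> k" "k \<le> Suc (part \<tau> i)" "k \<le> part \<sigma> i" "part \<sigma> (Suc i) \<le> k"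
        using \<rho>_below[OF \<rho>] k i below[of "Suc i"] by linarith+
      moreover have "i = 1 \<or> k \<le> part \<rho> (i - 1)" using \<rho>_above[OF \<rho>] k by linarith
      ultimately obtain \<rho>' where \<rho>': "part \<rho>' = (part \<rho>)(i := k)" using ex_update_part[OF i1] by blast
      have "\<rho>' \<in> A"
        unfolding A_iff
      proof (intro allI impI)
        fix j :: nat assume j: "1 \<le> j"
        show "part \<tau> j \<le> part \<rho>' j \<and> part \<rho>' j \<le> Suc (part \<tau> j) \<and> part \<sigma> (Suc j) \<le> part \<rho>' j \<and> part \<rho>' j \<le> part \<sigma> j"
          unfolding \<rho>' using A[OF \<rho> j] \<open>part \<tau> i \<le> k\<close> \<open>k \<le> Suc (part \<tau> i)\<close> \<open>k \<le> part \<sigma> i\<close> \<open>part \<sigma> (Suc i) \<le> k\<close>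
          by (cases "j = i") simp_all
      qed
      with \<rho>' show ?thesis by blast
    qed
    define f where "f \<rho> = (SOME \<rho>'. part \<rho>' = (part \<rho>)(i := Suc (part \<tau> i)) \<and> \<rho>' \<in> A)" for \<rho>
    have f: "part (f \<rho>) = (part \<rho>)(i := Suc (part \<tau> i))" "f \<rho> \<in> A" if "\<rho> \<in> A" for \<rho>
      using someI_ex[OF upd[OF that, of "Suc (part \<tau> i)"]] unfolding f_def by simp_all
    have "bij_betw f A0 A1"
      unfolding bij_betw_def
    proof (intro conjI inj_onI equalityI subsetI)
      fix \<rho> \<rho>' assume *: "\<rho> \<in> A0" "\<rho>' \<in> A0" "f \<rho> = f \<rho>'"
      then have "(part \<rho>)(i := Suc (part \<tau> i)) = (part \<rho>')(i := Suc (part \<tau> i))" "part \<rho> i = part \<rho>' i"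
        using f(1)[of \<rho>] f(1)[of \<rho>'] by (simp_all add: A0_def)
      then have "part \<rho> j = part \<rho>' j" for j by (metis fun_upd_other)
      then show "\<rho> = \<rho>'" by (rule partition_eqI)
    next
      fix \<rho> assume "\<rho> \<in> f ` A0"
      then show "\<rho> \<in> A1" using f by (auto simp: A0_def A1_def)
    next
      fix \<rho> assume \<rho>: "\<rho> \<in> A1"
      then obtain \<rho>' where \<rho>': "part \<rho>' = (part \<rho>)(i := part \<tau> i)" "\<rho>' \<in> A"
        using upd[of \<rho> "part \<tau> i"] by (auto simp: A1_def)
      then have "part (f \<rho>') j = part \<rho> j" for j using f(1)[OF \<rho>'(2)] \<rho> by (simp add: A1_def)
      then have "f \<rho>' = \<rho>" by (rule partition_eqI)
      then show "\<rho> \<in> f ` A0" using \<rho>' by (auto simp: A0_def intro!: image_eqI[of _ f \<rho>'])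
    qed
    then have "(\<Sum>\<rho>\<in>A1. t \<rho>) = (\<Sum>\<rho>\<in>A0. t (f \<rho>))" by (rule sum.reindex_bij_betw[symmetric])
    also have "\<dots> = (\<Sum>\<rho>\<in>A0. - t \<rho>)"
    proof (rule sum.cong[OF refl])
      fix \<rho> assume "\<rho> \<in> A0"
      then have \<rho>: "\<rho> \<in> A" "part \<rho> i = part \<tau> i" by (simp_all add: A0_def)
      let ?\<alpha> = "(i, Suc (part \<rho> i))"
      have d: "?D (f \<rho>) = insert ?\<alpha> (?D \<rho>)" "?\<alpha> \<notin> ?D \<rho>"
        using diagram_update[OF i1, of "f \<rho>" \<rho>] f(1)[OF \<rho>(1)] \<rho>(2) by simp_all
      have sub: "?D \<tau> \<subseteq> ?D \<rho>" "?D (f \<rho>) \<subseteq> ?D \<sigma>"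
        using AI \<rho>(1) f(2)[OF \<rho>(1)] by (auto simp: interval_def part_le_def)
      \<comment> \<open>The toggled box leaves the horizontal strip and enters the vertical one,
        where the same weight counts with the opposite sign.\<close>
      have e: "?D (f \<rho>) - ?D \<tau> = insert ?\<alpha> (?D \<rho> - ?D \<tau>)" "?D \<sigma> - ?D \<rho> = insert ?\<alpha> (?D \<sigma> - ?D (f \<rho>))"
        using d sub by blast+
      have "t (f \<rho>) = (\<Prod>\<alpha>\<in>?D (f \<rho>) - ?D \<tau>. - w (content \<alpha>)) * (\<Prod>\<alpha>\<in>?D \<sigma> - ?D (f \<rho>). w (content \<alpha>))"
        using f(2)[OF \<rho>(1)] by (simp add: t_def vmat_def hmat_def A_def)
      also have "\<dots> = - ((\<Prod>\<alpha>\<in>?D \<rho> - ?D \<tau>. - w (content \<alpha>)) * (\<Prod>\<alpha>\<in>?D \<sigma> - ?D \<rho>. w (content \<alpha>)))"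
        unfolding e using d by (simp add: finite_diagram mult_ac)
      also have "\<dots> = - t \<rho>"
        using \<rho>(1) by (simp add: t_def vmat_def hmat_def A_def)
      finally show "t (f \<rho>) = - t \<rho>" .
    qed
    finally have "(\<Sum>\<rho>\<in>A0. t \<rho>) + (\<Sum>\<rho>\<in>A1. t \<rho>) = 0" by (simp add: sum_negf)
    moreover have "A = A0 \<union> A1"
    proof (intro equalityI subsetI)
      fix \<rho> assume \<rho>: "\<rho> \<in> A"
      then have "part \<rho> i = part \<tau> i \<or> part \<rho> i = Suc (part \<tau> i)" using A(1,2)[OF \<rho> i1] by linarith
      then show "\<rho> \<in> A0 \<union> A1" using \<rho> by (auto simp: A0_def A1_def)
    qed (auto simp: A0_def A1_def)
    moreover have "A0 \<inter> A1 = {}" by (auto simp: A0_def A1_def)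
    moreover have "conv (vmat w) (hmat w) \<tau> \<sigma> = (\<Sum>\<rho>\<in>A. t \<rho>)"
      unfolding conv_def t_def
      by (rule sum.mono_neutral_right[OF finite_interval AI]) (auto simp: A_def vmat_def hmat_def)
    ultimately show ?thesis
      using True finA by (simp add: pdelta_def sum.union_disjoint)
  qed
qed

text \<open>Conjugation exchanges the two kinds of strips and negates contents, so the product in
  the other order reduces to the one already computed.\<close>

lemma conv_hmat_vmat: "conv (hmat w) (vmat w) = pdelta"
proof (intro ext)
  fix \<mu> \<nu>
  let ?w = "\<lambda>c. - w (- c)"
  have "conv (hmat w) (vmat w) \<mu> \<nu> =
      conv (\<lambda>\<mu> \<nu>. vmat ?w (conj_part \<mu>) (conj_part \<nu>)) (\<lambda>\<mu> \<nu>. hmat ?w (conj_part \<mu>) (conj_part \<nu>)) \<mu> \<nu>"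
    by (simp add: hmat_conj vmat_conj)
  also have "\<dots> = pdelta (conj_part \<mu>) (conj_part \<nu>)"
    unfolding conv_transpose conv_vmat_hmat ..
  also have "\<dots> = pdelta \<mu> \<nu>" unfolding pdelta_def by (metis conj_conj)
  finally show "conv (hmat w) (vmat w) \<mu> \<nu> = pdelta \<mu> \<nu>" .
qed

text \<open>In a reverse tableau the largest entry lies at the inner border, so its factor stands on
  the left. \<open>viter\<close> multiplies the inverse factors in the opposite order, and the
  product of the two collapses from the middle.\<close>

primrec hiter :: "(nat \<Rightarrow> int \<Rightarrow> 'a::comm_ring_1) \<Rightarrow> nat \<Rightarrow> 'a pmat" where
  "hiter w 0 = pdelta"
| "hiter w (Suc n) = conv (hmat (w (Suc n))) (hiter w n)"

primrec viter :: "(nat \<Rightarrow> int \<Rightarrow> 'a::comm_ring_1) \<Rightarrow> nat \<Rightarrow> 'a pmat" where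
  "viter w 0 = pdelta"
| "viter w (Suc n) = conv (viter w n) (vmat (w (Suc n)))"

lemma psupp_hiter: "psupp (hiter w n)" and psupp_viter: "psupp (viter w n)"
  by (cases n; simp add: psupp_delta psupp_conv)+

lemma conv_hiter_viter: "conv (hiter w n) (viter w n) = pdelta"
proof (induction n)
  case (Suc n)
  have "conv (hiter w (Suc n)) (viter w (Suc n)) =
      conv (hmat (w (Suc n))) (conv (conv (hiter w n) (viter w n)) (vmat (w (Suc n))))"
    by (simp add: conv_assoc)
  then show ?case by (simp only: Suc conv_delta_left'[OF psupp_vmat] conv_hmat_vmat)
qed (simp add: conv_delta_left' psupp_delta)

lemma hom_hiter:
  assumes "comm_ring_hom \<phi>"
  shows "\<phi> (hiter w n \<mu> \<nu>) = hiter (\<lambda>k c. \<phi> (w k c)) n \<mu> \<nu>"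
proof (induction n arbitrary: \<mu> \<nu>)
  case 0
  interpret comm_ring_hom \<phi> by fact
  show ?case by (simp add: pdelta_def)
qed (simp add: hom_conv[OF assms] hom_hmat[OF assms])

lemma hom_viter:
  assumes "comm_ring_hom \<phi>"
  shows "\<phi> (viter w n \<mu> \<nu>) = viter (\<lambda>k c. \<phi> (w k c)) n \<mu> \<nu>"
proof (induction n arbitrary: \<mu> \<nu>)
  case 0
  interpret comm_ring_hom \<phi> by fact
  show ?case by (simp add: pdelta_def)
qed (simp add: hom_conv[OF assms] hom_vmat[OF assms])

lemma hiter_cong: "(\<And>k. 1 \<le> k \<Longrightarrow> k \<le> n \<Longrightarrow> w k = w' k) \<Longrightarrow> hiter w n = hiter w' n"
  by (induction n) simp_all

section \<open>Tableau sums as products of strip matrices\<close>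

lemma tableaux_0:
  "rev_tableaux \<theta> 0 = (if \<theta> = {} then {\<lambda>_. undefined} else {})"
  "tableaux \<theta> 0 = (if \<theta> = {} then {\<lambda>_. undefined} else {})"
  by (auto simp: rev_tableaux_def tableaux_def PiE_eq_empty_iff) 

lemma sum_rev_tableaux:
  assumes "part_le \<rho> \<nu>"
  shows "(\<Sum>T\<in>rev_tableaux (diagram \<nu> - diagram \<rho>) n. \<Prod>\<alpha>\<in>diagram \<nu> - diagram \<rho>. w (T \<alpha>) (content \<alpha>)) =
    hiter w n \<rho> \<nu>"
  using assms
proof (induction n arbitrary: \<rho>)
  case 0
  have "diagram \<nu> - diagram \<rho> = {} \<longleftrightarrow> \<rho> = \<nu>"
    using 0 part_le_antisym[of \<rho> \<nu>] unfolding part_le_def by blast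
  then show ?case by (simp add: tableaux_0 pdelta_def)
next
  case (Suc n)
  have "(\<Sum>T\<in>rev_tableaux (diagram \<nu> - diagram \<rho>) (Suc n). \<Prod>\<alpha>\<in>diagram \<nu> - diagram \<rho>. w (T \<alpha>) (content \<alpha>)) =
      (\<Sum>\<sigma> | hstrip \<rho> \<sigma> \<and> part_le \<sigma> \<nu>. (\<Prod>\<alpha>\<in>diagram \<sigma> - diagram \<rho>. w (Suc n) (content \<alpha>)) * hiter w n \<sigma> \<nu>)"
    unfolding rev_tableaux_peel[OF Suc.prems, of "\<lambda>k \<alpha>. w k (content \<alpha>)"]
    by (rule sum.cong[OF refl]) (simp add: Suc.IH)
  also have "\<dots> = conv (hmat (w (Suc n))) (hiter w n) \<rho> \<nu>"
    unfolding conv_def interval_def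
  proof (rule sum.mono_neutral_cong_left)
    show "finite {\<sigma>. part_le \<rho> \<sigma> \<and> part_le \<sigma> \<nu>}" using finite_interval unfolding interval_def .
    show "{\<sigma>. hstrip \<rho> \<sigma> \<and> part_le \<sigma> \<nu>} \<subseteq> {\<sigma>. part_le \<rho> \<sigma> \<and> part_le \<sigma> \<nu>}"
      using hstrip_part_le by blast
  qed (auto simp: hmat_def)
  finally show ?case by simp
qed

text \<open>Conjugating the shape turns the horizontal strips of a tableau into vertical ones and
  negates the contents; the minus sign of the weight is the one in \<open>vmat\<close>.\<close>

lemma sum_tableaux:
  assumes "part_le \<mu> \<kappa>"
  shows "(\<Sum>T\<in>tableaux (diagram \<kappa> - diagram \<mu>) n. \<Prod>\<alpha>\<in>diagram \<kappa> - diagram \<mu>. - w (T \<alpha>) (- content \<alpha>)) =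
    viter w n (conj_part \<mu>) (conj_part \<kappa>)"
  using assms
proof (induction n arbitrary: \<kappa>)
  case 0
  have "diagram \<kappa> - diagram \<mu> = {} \<longleftrightarrow> \<mu> = \<kappa>"
    using 0 part_le_antisym[of \<mu> \<kappa>] unfolding part_le_def by blast
  moreover have "conj_part \<mu> = conj_part \<kappa> \<longleftrightarrow> \<mu> = \<kappa>" by (metis conj_conj)
  ultimately show ?case by (simp add: tableaux_0 pdelta_def)
next
  case (Suc n)
  let ?v = "\<lambda>\<mu> \<nu>. viter w n (conj_part \<mu>) (conj_part \<nu>)"
  have "(\<Sum>T\<in>tableaux (diagram \<kappa> - diagram \<mu>) (Suc n). \<Prod>\<alpha>\<in>diagram \<kappa> - diagram \<mu>. - w (T \<alpha>) (- content \<alpha>)) =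
      (\<Sum>\<sigma> | part_le \<mu> \<sigma> \<and> hstrip \<sigma> \<kappa>. ?v \<mu> \<sigma> * (\<Prod>\<alpha>\<in>diagram \<kappa> - diagram \<sigma>. - w (Suc n) (- content \<alpha>)))"
    unfolding tableaux_peel[OF Suc.prems, of "\<lambda>k \<alpha>. - w k (- content \<alpha>)"]
    by (rule sum.cong[OF refl]) (simp add: Suc.IH)
  also have "\<dots> = conv ?v (hmat (\<lambda>c. - w (Suc n) (- c))) \<mu> \<kappa>"
    unfolding conv_def interval_def
  proof (rule sum.mono_neutral_cong_left)
    show "finite {\<sigma>. part_le \<mu> \<sigma> \<and> part_le \<sigma> \<kappa>}" using finite_interval unfolding interval_def .
    show "{\<sigma>. part_le \<mu> \<sigma> \<and> hstrip \<sigma> \<kappa>} \<subseteq> {\<sigma>. part_le \<mu> \<sigma> \<and> part_le \<sigma> \<kappa>}"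
      using hstrip_part_le by blast
  qed (simp_all add: hmat_def)
  also have "\<dots> = conv ?v (\<lambda>\<mu> \<nu>. vmat (w (Suc n)) (conj_part \<mu>) (conj_part \<nu>)) \<mu> \<kappa>"
    by (simp add: vmat_conj)
  finally show ?case by (simp add: conv_transpose)
qed

definition xweight :: "nat \<Rightarrow> int \<Rightarrow> xpoly" where
  "xweight k c = xv k - xconst (av (int k - c))"

text \<open>The value of \<open>xweight\<close> at x_k = a_k.\<close>

definition aweight :: "nat \<Rightarrow> int \<Rightarrow> xpoly" where
  "aweight k c = xconst (av (int k)) - xconst (av (int k - c))"

text \<open>In matrix form, the skew polynomials are the inverse of the product of strip matrices at
  x = a, times the same product at x.\<close>

lemma dskew_poly_eq: "dskew_poly \<nu> \<mu> n = conv (viter aweight n) (hiter xweight n) \<mu> \<nu>"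
  unfolding dskew_poly_def conv_def interval_def
proof (rule sum.cong[OF refl])
  fix \<rho> assume "\<rho> \<in> {\<rho>. part_le \<mu> \<rho> \<and> part_le \<rho> \<nu>}"
  then have le: "part_le \<mu> \<rho>" "part_le \<rho> \<nu>" by simp_all
  let ?w = "\<lambda>k c. av (int k) - av (int k - c)"
  have "stilde (diagram \<nu> - diagram \<rho>) n = hiter xweight n \<rho> \<nu>"
    unfolding stilde_def sum_rev_tableaux[OF le(2), symmetric] xweight_def ..
  moreover have "sneg (diagram (conj_part \<rho>) - diagram (conj_part \<mu>)) n =
      viter ?w n (conj_part (conj_part \<mu>)) (conj_part (conj_part \<rho>))"
    unfolding sneg_def sum_tableaux[OF part_le_conj[THEN iffD2, OF le(1)], symmetric]
    by (simp add: algebra_simps)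
  moreover have "xconst (viter ?w n \<mu> \<rho>) = viter aweight n \<mu> \<rho>"
    unfolding hom_viter[OF xconst.comm_ring_hom_axioms]
    by (simp add: aweight_def[abs_def] xconst.hom_minus)
  ultimately show "stilde (diagram \<nu> - diagram \<rho>) n * xconst (sneg (diagram (conj_part \<rho>) - diagram (conj_part \<mu>)) n) =
      viter aweight n \<mu> \<rho> * hiter xweight n \<rho> \<nu>"
    by (simp add: mult.commute)
qed

lemma xsubst_hiter: "xsubst f (hiter xweight n \<mu> \<nu>) = hiter (\<lambda>k c. f k - xconst (av (int k - c))) n \<mu> \<nu>"
  unfolding hom_hiter[OF xsubst.comm_ring_hom_axioms] by (simp add: xweight_def xsubst.hom_minus)

lemma xsubst_viter: "xsubst f (viter aweight n \<mu> \<nu>) = viter aweight n \<mu> \<nu>"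
  unfolding hom_viter[OF xsubst.comm_ring_hom_axioms] by (simp add: aweight_def[abs_def] xsubst.hom_minus)

text \<open>At x_(n+1) = a_(n+1) the two innermost factors of the matrix product are the inverse
  pair \<open>vmat\<close> and \<open>hmat\<close> with equal weights, and cancel.\<close>

lemma dskew_poly_stable:
  "xsubst (xv(Suc n := xconst (av (int (Suc n))))) (dskew_poly \<nu> \<mu> (Suc n)) = dskew_poly \<nu> \<mu> n"
proof -
  let ?f = "xv(Suc n := xconst (av (int (Suc n))))"
  have "(\<lambda>\<mu> \<nu>. xsubst ?f (hiter xweight (Suc n) \<mu> \<nu>)) = conv (hmat (aweight (Suc n))) (hiter xweight n)"
  proof -
    have "hiter (\<lambda>k c. ?f k - xconst (av (int k - c))) n = hiter xweight n"
      by (rule hiter_cong) (auto simp: xweight_def)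
    moreover have "(\<lambda>c. ?f (Suc n) - xconst (av (int (Suc n) - c))) = aweight (Suc n)"
      by (simp add: aweight_def fun_eq_iff)
    ultimately show ?thesis unfolding xsubst_hiter by simp
  qed
  then have "xsubst ?f (dskew_poly \<nu> \<mu> (Suc n)) =
      conv (conv (viter aweight n) (vmat (aweight (Suc n)))) (conv (hmat (aweight (Suc n))) (hiter xweight n)) \<mu> \<nu>"
    unfolding dskew_poly_eq hom_conv[OF xsubst.comm_ring_hom_axioms] xsubst_viter by simp
  also have "\<dots> = conv (viter aweight n) (conv (conv (vmat (aweight (Suc n))) (hmat (aweight (Suc n)))) (hiter xweight n)) \<mu> \<nu>"
    by (simp only: conv_assoc)
  also have "\<dots> = dskew_poly \<nu> \<mu> n"
    unfolding conv_vmat_hmat conv_delta_left'[OF psupp_hiter] dskew_poly_eq ..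
  finally show ?thesis .
qed


subsection \<open>Branching of alternants\<close>

text \<open>The multiple of \<open>npow c y b\<close> is chosen so that the left side vanishes at y
  = x. The right side is the explicit quotient by y - x.\<close>

lemma npow_telescope:
  assumes "b \<le> a"
  shows "npow c y a - (\<Prod>s\<in>{b..<a}. x - c s) * npow c y b =
    (y - x) * (\<Sum>r\<in>{b..<a}. npow c y r * (\<Prod>s\<in>{r<..<a}. x - c s))"
  using assms
proof (induction a rule: dec_induct)
  case (step a)
  let ?Q = "\<Prod>s\<in>{b..<a}. x - c s" and ?S = "\<Sum>r\<in>{b..<a}. npow c y r * (\<Prod>s\<in>{r<..<a}. x - c s)"
  have "(\<Sum>r\<in>{b..<Suc a}. npow c y r * (\<Prod>s\<in>{r<..<Suc a}. x - c s)) =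
      (\<Sum>r\<in>{b..<a}. npow c y r * (\<Prod>s\<in>{r<..<Suc a}. x - c s)) + npow c y a"
  proof -
    have "{a<..<Suc a} = {}" by auto
    then show ?thesis using step(1) by (simp add: sum.atLeastLessThan_Suc)
  qed
  also have "(\<Sum>r\<in>{b..<a}. npow c y r * (\<Prod>s\<in>{r<..<Suc a}. x - c s)) = ?S * (x - c a)"
    unfolding sum_distrib_right
  proof (rule sum.cong[OF refl])
    fix r assume "r \<in> {b..<a}"
    then have "{r<..<Suc a} = insert a {r<..<a}" by auto
    then show "npow c y r * (\<Prod>s\<in>{r<..<Suc a}. x - c s) = npow c y r * (\<Prod>s\<in>{r<..<a}. x - c s) * (x - c a)"
      by (simp add: mult_ac)
  qed
  finally have S: "(\<Sum>r\<in>{b..<Suc a}. npow c y r * (\<Prod>s\<in>{r<..<Suc a}. x - c s)) = ?S * (x - c a) + npow c y a" .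
  have "npow c y (Suc a) - (\<Prod>s\<in>{b..<Suc a}. x - c s) * npow c y b =
      (npow c y a - ?Q * npow c y b) * (x - c a) + (y - x) * npow c y a"
    using step(1) by (simp add: npow_Suc prod.atLeastLessThan_Suc algebra_simps)
  then show ?case unfolding step.IH S by (simp add: algebra_simps)
qed simp

text \<open>Subtracting from each column a multiple of the next one clears the last row.\<close>

lemma alternant_branch:
  fixes z :: "nat \<Rightarrow> 'a::comm_ring_1"
  assumes \<alpha>: "\<And>j. j \<in> {1..n} \<Longrightarrow> \<alpha> (Suc j) \<le> \<alpha> j"
  defines "x \<equiv> z (Suc n)"
  shows "alternant (Suc n) z c \<alpha> = (\<Prod>i=1..n. z i - x) *
    (\<Sum>\<beta>\<in>PiE {1..n} (\<lambda>j. {\<alpha> (Suc j)..<\<alpha> j}).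
      npow c x (\<alpha> (Suc n)) * (\<Prod>j=1..n. \<Prod>s\<in>{\<beta> j<..<\<alpha> j}. x - c s) * alternant n z c \<beta>)"
proof -
  define Q where "Q j = (\<Prod>s\<in>{\<alpha> (Suc j)..<\<alpha> j}. x - c s)" for j
  define A where "A i j = npow c (z i) (\<alpha> j)" for i j
  \<comment> \<open>Column operations: subtract from column j the multiple Q j of column j + 1. The
    matrix is unitriangular, and Q j is the ratio of the two entries in the row of x.\<close>
  define E where "E k j = (if k = j then 1 else 0) + (if k = Suc j then - Q j else 0)" for k j
  define B where "B i j = (\<Sum>k=1..Suc n. A i k * E k j)" for i j
  have "det_fun (Suc n) E = (\<Prod>i=1..Suc n. E i i)"
    by (rule det_fun_lower_triangular) (simp add: E_def)
  then have "det_fun (Suc n) E = 1" by (simp add: E_def)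
  then have det: "det_fun (Suc n) B = det_fun (Suc n) A"
    unfolding B_def det_fun_mult by simp
  have B: "B i j = A i j - A i (Suc j) * Q j" if "j \<in> {1..n}" for i j
  proof -
    have "B i j = (\<Sum>k=1..Suc n. A i k * (if k = j then 1 else 0)) + (\<Sum>k=1..Suc n. A i k * (if k = Suc j then - Q j else 0))"
      unfolding B_def E_def by (simp only: distrib_left sum.distrib)
    also have "(\<Sum>k=1..Suc n. A i k * (if k = j then 1 else 0)) = (\<Sum>k\<in>{j}. A i k * (if k = j then 1 else 0))"
      by (rule sum.mono_neutral_right) (use that in auto)
    also have "(\<Sum>k=1..Suc n. A i k * (if k = Suc j then - Q j else 0)) = (\<Sum>k\<in>{Suc j}. A i k * (if k = Suc j then - Q j else 0))"
      by (rule sum.mono_neutral_right) (use that in auto)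
    finally show ?thesis by simp
  qed
  let ?P = "\<lambda>j r. \<Prod>s\<in>{r<..<\<alpha> j}. x - c s"
  have B': "B i j = (z i - x) * (\<Sum>r\<in>{\<alpha> (Suc j)..<\<alpha> j}. npow c (z i) r * ?P j r)" if j: "j \<in> {1..n}" for i j
    unfolding B[OF j] A_def Q_def npow_telescope[OF \<alpha>[OF j], symmetric] by (simp add: mult.commute)
  have last: "B (Suc n) (Suc n) = npow c x (\<alpha> (Suc n))"
  proof -
    have "B (Suc n) (Suc n) = (\<Sum>k\<in>{Suc n}. A (Suc n) k * E k (Suc n))"
      unfolding B_def by (rule sum.mono_neutral_right) (auto simp: E_def)
    then show ?thesis by (simp add: A_def E_def x_def)
  qed
  have "alternant (Suc n) z c \<alpha> = det_fun (Suc n) B"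
    unfolding det A_def alternant_def ..
  also have "\<dots> = npow c x (\<alpha> (Suc n)) * det_fun n B"
    unfolding last[symmetric] by (rule det_fun_last_row) (simp add: B' x_def)
  also have "det_fun n B = det_fun n (\<lambda>i j. (z i - x) * (\<Sum>r\<in>{\<alpha> (Suc j)..<\<alpha> j}. npow c (z i) r * ?P j r))"
    by (rule det_fun_cong) (rule B')
  also have "\<dots> = (\<Prod>i=1..n. z i - x) *
      (\<Sum>\<beta>\<in>PiE {1..n} (\<lambda>j. {\<alpha> (Suc j)..<\<alpha> j}). det_fun n (\<lambda>i j. npow c (z i) (\<beta> j) * ?P j (\<beta> j)))"
    unfolding det_fun_scale_rows by (subst det_fun_sum_cols) simp_all
  also have "(\<Sum>\<beta>\<in>PiE {1..n} (\<lambda>j. {\<alpha> (Suc j)..<\<alpha> j}). det_fun n (\<lambda>i j. npow c (z i) (\<beta> j) * ?P j (\<beta> j))) =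
      (\<Sum>\<beta>\<in>PiE {1..n} (\<lambda>j. {\<alpha> (Suc j)..<\<alpha> j}). (\<Prod>j=1..n. ?P j (\<beta> j)) * alternant n z c \<beta>)"
    unfolding alternant_def by (simp only: mult.commute[of "npow _ _ _"] det_fun_scale_cols)
  finally show ?thesis by (simp add: sum_distrib_left mult_ac)
qed

text \<open>The double Schur polynomial in only the last k variables x_N, ..., x_(N-k+1), with the
  nodes a_N, a_(N-1), ... of all N variables. Reversing the variables makes x_(N-k) the one that
  separates when k grows by 1.\<close>

definition gsch :: "nat \<Rightarrow> nat \<Rightarrow> partition \<Rightarrow> xpoly" where
  "gsch N k \<nu> = (if plength \<nu> \<le> k
     then fschur k (\<lambda>i. xv (Suc N - i)) (\<lambda>t. xconst (nodes N t)) (part \<nu>) else 0)"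

lemma inj_reverse: "k \<le> N \<Longrightarrow> inj_on (\<lambda>i. Suc N - i) {1..k}"
  by (rule inj_onI) auto

lemma gsch_vandermonde:
  assumes "plength \<nu> \<le> k"
  shows "gsch N k \<nu> * vandermonde (\<lambda>i. xv (Suc N - i)) k =
    alternant k (\<lambda>i. xv (Suc N - i)) (\<lambda>t. xconst (nodes N t)) (shifted \<nu> k)"
  using assms by (simp add: gsch_def fschur_vandermonde shifted_def[abs_def])

lemma vandermonde_reverse: "k \<le> N \<Longrightarrow> vandermonde (\<lambda>i. xv (Suc N - i)) k \<noteq> 0"
  by (rule vandermonde_nonzero, rule inj_onI) (use inj_xv[of UNIV] in \<open>auto dest!: injD\<close>)

lemma xin_gsch:
  assumes "n \<le> N"
  shows "xin {n<..N} (gsch N (N - n) \<nu>)"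
proof -
  have "xbound {n<..N} (\<Sum>i=1..N - n. part \<nu> i) (fschur (N - n) (\<lambda>i. xv (Suc N - i)) (\<lambda>t. xconst (nodes N t)) (part \<nu>))"
    by (rule xbound_fschur) (use assms in auto)
  then show ?thesis by (simp add: gsch_def xbound_def)
qed

lemma part_le_empty: "part_le empty_part \<nu>"
  unfolding part_le_iff by (simp add: empty_part.rep_eq)

text \<open>The box (j, b) corresponds to the node with number b + k - j, which is a_(N - k - c) for
  its content c = b - j. This is the node in \<open>xweight (N - k)\<close>. Row k + 1 of \<rho> is
  empty, and its boxes give the separate factor \<open>npow\<close>.\<close>

lemma prod_hstrip_boxes:
  assumes k: "k < N" and \<nu>: "plength \<nu> \<le> Suc k" and h: "hstrip \<rho> \<nu>" and \<rho>: "plength \<rho> \<le> k"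
  defines "x \<equiv> xv (N - k)" and "c \<equiv> \<lambda>t. xconst (nodes N t)"
  shows "npow c x (shifted \<nu> (Suc k) (Suc k)) *
      (\<Prod>j=1..k. \<Prod>s\<in>{shifted \<rho> k j<..<shifted \<nu> (Suc k) j}. x - c s) = hmat (xweight (N - k)) \<rho> \<nu>"
proof -
  let ?S = "\<lambda>j. {s. part \<rho> j + k < s + j \<and> s + j < part \<nu> j + Suc k}"
  have box: "(\<Prod>b\<in>{part \<rho> j<..part \<nu> j}. xweight (N - k) (content (j, b))) = (\<Prod>s\<in>?S j. x - c s)"
    if j: "j \<in> {1..Suc k}" for j
  proof (rule prod.reindex_bij_witness[of _ "\<lambda>s. s + j - k" "\<lambda>b. b + k - j"])
    fix b assume b: "b \<in> {part \<rho> j<..part \<nu> j}"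
    then have "b + k \<ge> j" using j by simp
    then show "x - c (b + k - j) = xweight (N - k) (content (j, b))"
      using k by (simp add: x_def c_def xweight_def content_def of_nat_diff algebra_simps)
  qed (use j in auto)
  have last: "npow c x (shifted \<nu> (Suc k) (Suc k)) = (\<Prod>s\<in>?S (Suc k). x - c s)"
  proof -
    have "part \<rho> (Suc k) = 0" using \<rho> by (simp add: part_eq_0)
    then have "?S (Suc k) = {..<part \<nu> (Suc k)}" by auto
    then show ?thesis by (simp add: npow_def shifted_def)
  qed
  have front: "{shifted \<rho> k j<..<shifted \<nu> (Suc k) j} = ?S j" if "j \<in> {1..k}" for j
    using that by (auto simp: shifted_def)
  have "diagram \<nu> - diagram \<rho> = (SIGMA j:{1..Suc k}. {part \<rho> j<..part \<nu> j})"
  proof -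
    have m: "(j, b) \<in> diagram \<nu> - diagram \<rho> \<longleftrightarrow> j \<in> {1..Suc k} \<and> part \<rho> j < b \<and> b \<le> part \<nu> j" for j b
      unfolding Diff_iff mem_diagram using part_eq_0[OF \<nu>, of j] by (cases "j \<le> Suc k") auto
    show ?thesis
    proof (rule Set.set_eqI)
      fix q :: "nat \<times> nat"
      obtain j b where q: "q = (j, b)" by (cases q)
      show "q \<in> diagram \<nu> - diagram \<rho> \<longleftrightarrow> q \<in> (SIGMA j:{1..Suc k}. {part \<rho> j<..part \<nu> j})"
        unfolding q m by simp
    qed
  qed
  then have "hmat (xweight (N - k)) \<rho> \<nu> =
      (\<Prod>(j, b)\<in>(SIGMA j:{1..Suc k}. {part \<rho> j<..part \<nu> j}). xweight (N - k) (content (j, b)))"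
    using h by (simp only: hmat_def if_True case_prod_unfold prod.collapse)
  also have "\<dots> = (\<Prod>j=1..Suc k. \<Prod>b\<in>{part \<rho> j<..part \<nu> j}. xweight (N - k) (content (j, b)))"
    by (rule prod.Sigma[symmetric]) simp_all
  also have "\<dots> = (\<Prod>j=1..Suc k. \<Prod>s\<in>?S j. x - c s)" by (rule prod.cong[OF refl]) (rule box)
  also have "\<dots> = (\<Prod>j=1..k. \<Prod>s\<in>?S j. x - c s) * (\<Prod>s\<in>?S (Suc k). x - c s)"
    by (rule prod.cl_ivl_Suc[THEN trans]) simp
  also have "(\<Prod>j=1..k. \<Prod>s\<in>?S j. x - c s) = (\<Prod>j=1..k. \<Prod>s\<in>{shifted \<rho> k j<..<shifted \<nu> (Suc k) j}. x - c s)"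
    by (rule prod.cong[OF refl]) (simp only: front)
  finally show ?thesis by (simp add: last mult.commute)
qed

lemma gsch_Suc:
  assumes k: "k < N"
  shows "gsch N (Suc k) \<nu> = (\<Sum>\<rho>\<in>interval empty_part \<nu>. gsch N k \<rho> * hmat (xweight (N - k)) \<rho> \<nu>)"
proof (cases "plength \<nu> \<le> Suc k")
  case False
  have Z: "gsch N k \<rho> * hmat (xweight (N - k)) \<rho> \<nu> = 0" for \<rho>
  proof (cases "hstrip \<rho> \<nu> \<and> plength \<rho> \<le> k")
    case True
    then have "part \<nu> (Suc (Suc k)) \<le> part \<rho> (Suc k)" unfolding hstrip_def by simp
    also have "\<dots> = 0" by (rule part_eq_0[OF conjunct2[OF True]]) simp
    finally show ?thesis using False part_pos_iff[of \<nu> "Suc (Suc k)"] by simp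
  qed (auto simp: gsch_def hmat_def)
  have "gsch N (Suc k) \<nu> = 0" using False by (simp add: gsch_def)
  then show ?thesis by (simp only: Z sum.neutral_const)
next
  case \<nu>: True
  let ?z = "\<lambda>i. xv (Suc N - i)" and ?c = "\<lambda>t. xconst (nodes N t)" and ?\<alpha> = "shifted \<nu> (Suc k)"
  let ?H = "{\<rho>. hstrip \<rho> \<nu> \<and> plength \<rho> \<le> k}" and ?x = "xv (N - k)"
  let ?B = "PiE {1..k} (\<lambda>j. {?\<alpha> (Suc j)..<?\<alpha> j})"
  let ?V = "vandermonde ?z k" and ?W = "\<Prod>i=1..k. ?z i - ?x"
  let ?g = "\<lambda>\<rho>. restrict (shifted \<rho> k) {1..k}"
  let ?t = "\<lambda>\<beta>. npow ?c ?x (?\<alpha> (Suc k)) * (\<Prod>j=1..k. \<Prod>s\<in>{\<beta> j<..<?\<alpha> j}. ?x - ?c s) * alternant k ?z ?c \<beta>"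
  have H: "?H \<subseteq> interval empty_part \<nu>"
    unfolding interval_def using hstrip_part_le part_le_empty by blast
  \<comment> \<open>Passing from k + 1 to k variables shifts exponents by one, so the half-open
    intervals for \<beta> become the weak interlacing inequalities of a horizontal strip.\<close>
  have bij: "bij_betw ?g ?H ?B"
    unfolding bij_betw_def
  proof (intro conjI inj_onI equalityI subsetI)
    fix \<rho> \<rho>' assume *: "\<rho> \<in> ?H" "\<rho>' \<in> ?H" "?g \<rho> = ?g \<rho>'"
    have "shifted \<rho> k j = shifted \<rho>' k j" if "j \<in> {1..k}" for j
      using fun_cong[OF *(3), of j] that by simp
    then show "\<rho> = \<rho>'" using shifted_inject[of \<rho> k \<rho>'] * by blast
  next
    fix \<beta> assume "\<beta> \<in> ?g ` ?H"
    then obtain \<rho> where \<rho>: "\<beta> = ?g \<rho>" "hstrip \<rho> \<nu>" by blast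
    show "\<beta> \<in> ?B"
      unfolding \<rho>(1)
    proof (rule PiE_I)
      fix j assume j: "j \<in> {1..k}"
      then have "part \<nu> (Suc j) \<le> part \<rho> j" "part \<rho> j \<le> part \<nu> j" using \<rho>(2) unfolding hstrip_def by simp_all
      then show "?g \<rho> j \<in> {?\<alpha> (Suc j)..<?\<alpha> j}" using j by (auto simp: shifted_def)
    next
      fix j assume "j \<notin> {1..k}"
      then show "?g \<rho> j = undefined" unfolding restrict_def by (rule if_not_P)
    qed
  next
    fix \<beta> assume \<beta>: "\<beta> \<in> ?B"
    have b: "part \<nu> (Suc j) + k \<le> \<beta> j + j" "\<beta> j + j < part \<nu> j + Suc k" if "j \<in> {1..k}" for j
      using PiE_mem[OF \<beta> that] that by (auto simp: shifted_def)
    have "\<exists>\<rho>. plength \<rho> \<le> k \<and> (\<forall>i\<in>{1..k}. part \<rho> i = \<beta> i + i - k)"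
    proof (rule ex_partition)
      fix i assume i: "1 \<le> i" "i < k"
      show "\<beta> (Suc i) + Suc i - k \<le> \<beta> i + i - k" using b(1)[of i] b(2)[of "Suc i"] i by simp
    qed
    then obtain \<rho> where \<rho>: "plength \<rho> \<le> k" "\<And>i. i \<in> {1..k} \<Longrightarrow> part \<rho> i = \<beta> i + i - k" by blast
    have "hstrip \<rho> \<nu>"
      unfolding hstrip_def
    proof (intro allI impI)
      fix i :: nat assume i: "1 \<le> i"
      show "part \<nu> (Suc i) \<le> part \<rho> i \<and> part \<rho> i \<le> part \<nu> i"
      proof (cases "i \<le> k")
        case True
        then have i': "i \<in> {1..k}" using i by simp
        have "part \<rho> i + k = \<beta> i + i" using b(1)[OF i'] \<rho>(2)[OF i'] by linarith
        then show ?thesis using b[OF i'] by (intro conjI; linarith)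
      next
        case False
        then show ?thesis using \<rho>(1) \<nu> by (simp add: part_eq_0)
      qed
    qed
    moreover have "?g \<rho> = \<beta>"
    proof (rule ext)
      fix j
      show "?g \<rho> j = \<beta> j"
      proof (cases "j \<in> {1..k}")
        case True
        then show ?thesis using \<rho>(2)[OF True] b(1)[OF True] by (simp add: shifted_def)
      next
        case False
        then show ?thesis using PiE_arb[OF \<beta> False] by auto
      qed
    qed
    ultimately show "\<beta> \<in> ?g ` ?H" using \<rho>(1) by blast
  qed
  have z: "?z (Suc k) = ?x" by simp
  have "gsch N (Suc k) \<nu> * vandermonde ?z (Suc k) = ?W * (\<Sum>\<beta>\<in>?B. ?t \<beta>)"
    unfolding gsch_vandermonde[OF \<nu>] z[symmetric]
    by (rule alternant_branch) (simp add: shifted_antimono)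
  also have "(\<Sum>\<beta>\<in>?B. ?t \<beta>) = (\<Sum>\<rho>\<in>?H. ?t (?g \<rho>))" by (rule sum.reindex_bij_betw[OF bij, symmetric])
  also have "\<dots> = (\<Sum>\<rho>\<in>?H. gsch N k \<rho> * hmat (xweight (N - k)) \<rho> \<nu> * ?V)"
  proof (rule sum.cong[OF refl])
    fix \<rho> assume "\<rho> \<in> ?H"
    then have \<rho>: "hstrip \<rho> \<nu>" "plength \<rho> \<le> k" by simp_all
    have "alternant k ?z ?c (?g \<rho>) = gsch N k \<rho> * ?V"
      unfolding gsch_vandermonde[OF \<rho>(2)] by (rule alternant_cong) simp_all
    moreover have "(\<Prod>j=1..k. \<Prod>s\<in>{?g \<rho> j<..<?\<alpha> j}. ?x - ?c s) =
        (\<Prod>j=1..k. \<Prod>s\<in>{shifted \<rho> k j<..<?\<alpha> j}. ?x - ?c s)"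
      by (rule prod.cong[OF refl]) simp
    ultimately show "?t (?g \<rho>) = gsch N k \<rho> * hmat (xweight (N - k)) \<rho> \<nu> * ?V"
      unfolding prod_hstrip_boxes[OF k \<nu> \<rho>, symmetric] by (simp only: mult_ac)
  qed
  also have "?W * \<dots> = (\<Sum>\<rho>\<in>?H. gsch N k \<rho> * hmat (xweight (N - k)) \<rho> \<nu>) * vandermonde ?z (Suc k)"
    unfolding vandermonde_Suc z sum_distrib_right[symmetric] by (simp only: mult_ac)
  finally have E: "gsch N (Suc k) \<nu> * vandermonde ?z (Suc k) =
      (\<Sum>\<rho>\<in>?H. gsch N k \<rho> * hmat (xweight (N - k)) \<rho> \<nu>) * vandermonde ?z (Suc k)" .
  have "vandermonde ?z (Suc k) \<noteq> 0" using k by (intro vandermonde_reverse Suc_leI)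
  from iffD1[OF mult_right_cancel[OF this] E]
  have "gsch N (Suc k) \<nu> = (\<Sum>\<rho>\<in>?H. gsch N k \<rho> * hmat (xweight (N - k)) \<rho> \<nu>)" .
  also have "\<dots> = (\<Sum>\<rho>\<in>interval empty_part \<nu>. gsch N k \<rho> * hmat (xweight (N - k)) \<rho> \<nu>)"
    by (rule sum.mono_neutral_left[OF finite_interval H]) (auto simp: gsch_def hmat_def)
  finally show ?thesis .
qed

lemma gsch_full: "gsch N N \<nu> = dschur_poly \<nu> N"
proof (cases "plength \<nu> \<le> N")
  case True
  let ?c = "\<lambda>t. xconst (nodes N t)"
  define p where "p i = (if i \<in> {1..N} then Suc N - i else i)" for i
  have p: "p permutes {1..N}"
  proof (rule bij_imp_permutes)
    have "p (p i) = i" for i by (auto simp: p_def)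
    moreover have "p i \<in> {1..N}" if "i \<in> {1..N}" for i using that by (auto simp: p_def)
    ultimately show "bij_betw p {1..N} {1..N}" by (intro bij_betw_byWitness[of _ p]) auto
    fix i assume "i \<notin> {1..N}"
    then show "p i = i" unfolding p_def by (rule if_not_P)
  qed
  let ?V = "vandermonde (\<lambda>i. xv (p i)) N"
  have V: "?V = vandermonde (\<lambda>i. xv (Suc N - i)) N" by (rule vandermonde_cong) (simp add: p_def)
  have "gsch N N \<nu> * ?V = alternant N (\<lambda>i. xv (p i)) ?c (shifted \<nu> N)"
    unfolding V gsch_vandermonde[OF True] by (rule alternant_cong) (simp_all add: p_def)
  also have "\<dots> = dschur_poly \<nu> N * ?V"
    unfolding alternant_permute[OF p] vandermonde_permute[OF p] dschur_poly_vandermonde[OF True, symmetric]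
    by (simp only: mult_ac)
  finally show ?thesis using vandermonde_reverse[of N N] unfolding V by simp
qed (simp add: gsch_def dschur_poly_eq_0)

text \<open>Lowering the number of retained variables from N splits off x_1, ..., x_n in this order,
  one strip matrix for each. The function \<open>gsch\<close> enters as a row vector.\<close>

lemma dschur_poly_branch:
  assumes "n \<le> N"
  shows "dschur_poly \<nu> N = conv (\<lambda>_. gsch N (N - n)) (hiter xweight n) empty_part \<nu>"
  using assms
proof (induction n)
  case 0
  then show ?case by (simp add: conv_delta_right part_le_empty gsch_full)
next
  case (Suc n)
  have k: "N - n = Suc (N - Suc n)" "N - Suc n < N" "N - (N - Suc n) = Suc n" using Suc.prems by auto
  have g: "gsch N (N - n) \<rho> = conv (\<lambda>_. gsch N (N - Suc n)) (hmat (xweight (Suc n))) empty_part \<rho>" for \<rho>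
    unfolding k(1) gsch_Suc[OF k(2)] k(3) conv_def ..
  have "dschur_poly \<nu> N = conv (\<lambda>_. gsch N (N - n)) (hiter xweight n) empty_part \<nu>" using Suc by simp
  also have "\<dots> = conv (conv (\<lambda>_. gsch N (N - Suc n)) (hmat (xweight (Suc n)))) (hiter xweight n) empty_part \<nu>"
    unfolding conv_def[of _ "hiter xweight n"] g ..
  finally show ?case by (simp add: conv_assoc)
qed

text \<open>Multiply by the Vandermonde product of the last variables and take the Newton
  coefficient in them, keeping x_1, ..., x_n as parameters: the alternants are separated and p comes
  out as a scalar.\<close>

lemma gsch_independent:
  assumes n: "n \<le> N" and F: "finite F" "\<And>\<rho>. \<rho> \<in> F \<Longrightarrow> plength \<rho> \<le> N - n"
    and p: "\<And>\<rho>. \<rho> \<in> F \<Longrightarrow> xin {1..n} (p \<rho>)"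
    and eq: "(\<Sum>\<rho>\<in>F. gsch N (N - n) \<rho> * p \<rho>) = 0" and \<rho>\<^sub>0: "\<rho>\<^sub>0 \<in> F"
  shows "p \<rho>\<^sub>0 = 0"
proof -
  let ?k = "N - n" and ?z = "\<lambda>i. Suc N - i"
  let ?S = "?z ` {1..?k}" and ?A = "\<lambda>\<rho>. alternant ?k (\<lambda>i. xv (?z i)) (\<lambda>t. xconst (nodes N t)) (shifted \<rho> ?k)"
  let ?n = "ncoeff xconst xv (nodes N) ?S (\<lambda>m. shifted \<rho>\<^sub>0 ?k (Suc N - m))"
  have disj: "{1..n} \<inter> ?S = {}" using n by auto
  have z: "inj_on ?z {1..?k}" by (rule inj_reverse) simp
  have hom: "comm_ring_hom xconst" by (rule xconst.comm_ring_hom_axioms)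
  have c: "?n (?A \<rho>) = (if \<rho> = \<rho>\<^sub>0 then 1 else 0)" if "\<rho> \<in> F" for \<rho>
  proof -
    have zz: "Suc N - (Suc N - i) = i" if "i \<le> ?k" for i using that by simp
    have "?n (?A \<rho>) = (if \<forall>i\<in>{1..?k}. shifted \<rho>\<^sub>0 ?k (Suc N - ?z i) = shifted \<rho> ?k i then 1 else 0)"
      by (rule ncoeff_alternant[OF hom z]) (simp_all only: shifted_strict zz le_trans less_imp_le)
    also have "(\<forall>i\<in>{1..?k}. shifted \<rho>\<^sub>0 ?k (Suc N - ?z i) = shifted \<rho> ?k i) \<longleftrightarrow>
        (\<forall>i\<in>{1..?k}. shifted \<rho>\<^sub>0 ?k i = shifted \<rho> ?k i)"
      by (rule ball_cong[OF refl]) (simp only: atLeastAtMost_iff zz)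
    also have "\<dots> \<longleftrightarrow> \<rho> = \<rho>\<^sub>0"
      unfolding shifted_inject[OF F(2)[OF \<rho>\<^sub>0] F(2)[OF that]] by blast
    finally show ?thesis .
  qed
  have "0 = ?n ((\<Sum>\<rho>\<in>F. gsch N ?k \<rho> * p \<rho>) * vandermonde (\<lambda>i. xv (?z i)) ?k)" by (simp add: eq ncoeff_0[OF hom])
  also have "(\<Sum>\<rho>\<in>F. gsch N ?k \<rho> * p \<rho>) * vandermonde (\<lambda>i. xv (?z i)) ?k = (\<Sum>\<rho>\<in>F. p \<rho> * ?A \<rho>)"
    unfolding sum_distrib_right
  proof (rule sum.cong[OF refl])
    fix \<rho> assume "\<rho> \<in> F"
    show "gsch N ?k \<rho> * p \<rho> * vandermonde (\<lambda>i. xv (?z i)) ?k = p \<rho> * ?A \<rho>"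
      unfolding gsch_vandermonde[OF F(2)[OF \<open>\<rho> \<in> F\<close>], symmetric] by (simp only: mult_ac)
  qed
  also have "?n \<dots> = (\<Sum>\<rho>\<in>F. ?n (p \<rho> * ?A \<rho>))" by (rule ncoeff_sum[OF hom]) simp
  also have "\<dots> = (\<Sum>\<rho>\<in>F. p \<rho> * (if \<rho> = \<rho>\<^sub>0 then 1 else 0))"
  proof (rule sum.cong[OF refl])
    fix \<rho> assume \<rho>: "\<rho> \<in> F"
    have "?n (p \<rho> * ?A \<rho>) = poly_subst xconst xv (p \<rho>) * ?n (?A \<rho>)"
      by (rule ncoeff_mult_outside[OF hom _ p[OF \<rho>] disj]) simp
    then show "?n (p \<rho> * ?A \<rho>) = p \<rho> * (if \<rho> = \<rho>\<^sub>0 then 1 else 0)" by (simp only: xsubst_id c[OF \<rho>])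
  qed
  also have "\<dots> = (\<Sum>\<rho>\<in>{\<rho>\<^sub>0}. p \<rho> * (if \<rho> = \<rho>\<^sub>0 then 1 else 0))"
    by (rule sum.mono_neutral_right) (use F \<rho>\<^sub>0 in auto)
  finally show ?thesis by simp
qed

section \<open>Skew double Schur functions as elements of the ring\<close>

lemma part_le_plength: "part_le \<rho> \<nu> \<Longrightarrow> plength \<rho> \<le> plength \<nu>"
proof -
  assume "part_le \<rho> \<nu>"
  then have "part \<rho> i \<le> part \<nu> i" for i using part_le_iff by blast
  then have "part \<rho> i = 0" if "i > plength \<nu>" for i
    using part_eq_0[OF order_refl that] by (metis le_zero_eq)
  then show ?thesis unfolding plength_le_iff by blast
qed

lemma xbound_hiter: "xbound {1..n} (card (diagram \<nu>)) (hiter xweight n \<rho> \<nu>)"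
proof (cases "part_le \<rho> \<nu>")
  case True
  have "xbound {1..n} (card (diagram \<nu>)) (\<Prod>\<alpha>\<in>diagram \<nu> - diagram \<rho>. xweight (T \<alpha>) (content \<alpha>))"
    if T: "T \<in> rev_tableaux (diagram \<nu> - diagram \<rho>) n" for T
  proof (rule xbound_mono[OF xbound_prod[where d = "\<lambda>_. 1"]])
    fix \<alpha> assume "\<alpha> \<in> diagram \<nu> - diagram \<rho>"
    from rev_tableauxD(1)[OF T this] have "T \<alpha> \<in> {1..n}" by simp
    then show "xbound {1..n} 1 (xweight (T \<alpha>) (content \<alpha>))"
      unfolding xweight_def by (intro xbound_diff xbound_xv xbound_const) simp_all
  next
    have "card (diagram \<nu> - diagram \<rho>) \<le> card (diagram \<nu>)" by (rule card_mono[OF finite_diagram]) blast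
    then show "(\<Sum>\<alpha>\<in>diagram \<nu> - diagram \<rho>. 1) \<le> card (diagram \<nu>)" by simp
  qed
  then show ?thesis unfolding sum_rev_tableaux[OF True, symmetric] by (rule xbound_sum)
next
  case False
  then have "hiter xweight n \<rho> \<nu> = 0" using psupp_hiter unfolding psupp_def by blast
  then show ?thesis by simp
qed

text \<open>The factors for different variables need not commute visibly. But s_\<nu>(x_1, ..., x_N)
  is symmetric, a permutation of the first n variables fixes the \<open>gsch\<close> factors, and
  the coefficients of independent factors are unique.\<close>

lemma hiter_symmetric:
  assumes p: "p permutes {1..n}"
  shows "xsubst (\<lambda>i. xv (p i)) (hiter xweight n \<rho> \<nu>) = hiter xweight n \<rho> \<nu>"
proof (cases "part_le \<rho> \<nu>")
  case True
  \<comment> \<open>With this many further variables no partition inside \<nu> is too long, so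
    independence applies to all of them.\<close>
  define N where "N = n + plength \<nu>"
  have n: "n \<le> N" "N - n = plength \<nu>" by (simp_all add: N_def)
  let ?f = "\<lambda>i. xv (p i)" and ?h = "\<lambda>\<rho>. hiter xweight n \<rho> \<nu>" and ?I = "interval empty_part \<nu>"
  have xh: "xin {1..n} (?h \<rho>)" for \<rho> using xbound_hiter unfolding xbound_def by blast
  have g: "xsubst ?f (gsch N (N - n) \<rho>) = gsch N (N - n) \<rho>" for \<rho>
  proof (rule xsubst_fix[OF xin_gsch[OF n(1)]])
    fix i assume "i \<in> {n<..N}"
    then have "p i = i" using p by (intro permutes_not_in) auto
    then show "xv (p i) = xv i" by simp
  qed
  have br: "dschur_poly \<nu> N = (\<Sum>\<rho>\<in>?I. gsch N (N - n) \<rho> * ?h \<rho>)"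
    unfolding dschur_poly_branch[OF n(1)] conv_def ..
  have "p permutes {1..N}" by (rule permutes_subset[OF p]) (use n in auto)
  from dschur_poly_symmetric[OF this, of \<nu>]
  have "(\<Sum>\<rho>\<in>?I. gsch N (N - n) \<rho> * (xsubst ?f (?h \<rho>) - ?h \<rho>)) = 0"
    unfolding br by (simp add: xsubst.hom_sum xsubst.hom_mult g right_diff_distrib sum_subtractf)
  moreover have "xin {1..n} (xsubst ?f (?h \<rho>) - ?h \<rho>)" for \<rho>
  proof (intro xin_diff xin_xsubst[OF xh] xh xin_xv)
    fix i assume "i \<in> {1..n}"
    then show "p i \<in> {1..n}" using permutes_in_image[OF p] by blast
  qed
  moreover have "\<rho> \<in> ?I" using True part_le_empty by (simp add: interval_def)
  moreover have "plength \<rho> \<le> N - n" if "\<rho> \<in> ?I" for \<rho>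
    using that part_le_plength unfolding n(2) interval_def by blast
  ultimately have "xsubst ?f (?h \<rho>) - ?h \<rho> = 0"
    using gsch_independent[OF n(1) finite_interval, of empty_part \<nu> "\<lambda>\<rho>. xsubst ?f (?h \<rho>) - ?h \<rho>" \<rho>] by blast
  then show ?thesis by simp
next
  case False
  then have "hiter xweight n \<rho> \<nu> = 0" using psupp_hiter unfolding psupp_def by blast
  then show ?thesis by simp
qed

lemma viter_aweight:
  "viter aweight n \<mu> \<rho> = xconst (viter (\<lambda>k c. av (int k) - av (int k - c)) n \<mu> \<rho>)"
  unfolding hom_viter[OF xconst.comm_ring_hom_axioms] by (simp add: aweight_def[abs_def] xconst.hom_minus)

lemma Rep_dskew: "Rep_dsym (dskew \<nu> \<mu>) = dskew_poly \<nu> \<mu>"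
  unfolding dskew_def
proof (rule Abs_dsym_inverse, rule dsym_seqs_xboundI)
  fix n
  show "xbound {1..n} (card (diagram \<nu>)) (dskew_poly \<nu> \<mu> n)"
    unfolding dskew_poly_eq conv_def viter_aweight
    by (intro xbound_sum xbound_const_mult xbound_hiter)
next
  fix n and p :: "nat \<Rightarrow> nat" assume p: "p permutes {1..n}"
  show "xsubst (\<lambda>i. xv (p i)) (dskew_poly \<nu> \<mu> n) = dskew_poly \<nu> \<mu> n"
    unfolding dskew_poly_eq hom_conv[OF xsubst.comm_ring_hom_axioms] xsubst_viter hiter_symmetric[OF p] ..
next
  fix n :: nat assume "n \<ge> 1"
  then show "xsubst (xv(n := xconst (av (int n)))) (dskew_poly \<nu> \<mu> n) = dskew_poly \<nu> \<mu> (n - 1)"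
    using dskew_poly_stable[of "n - 1"] by simp
qed

abbreviation spec :: "nat \<Rightarrow> nat \<Rightarrow> xpoly" where
  "spec n \<equiv> \<lambda>i. if i \<le> n then xconst (av (int i)) else xv i"

lemma xsubst_spec_dschur_poly:
  assumes "n \<le> N"
  shows "xsubst (spec n) (dschur_poly \<mu> N) = conv (\<lambda>_. gsch N (N - n)) (hiter aweight n) empty_part \<mu>"
proof -
  have "xsubst (spec n) (gsch N (N - n) \<rho>) = gsch N (N - n) \<rho>" for \<rho>
    by (rule xsubst_fix[OF xin_gsch[OF assms]]) simp
  moreover have "xsubst (spec n) (hiter xweight n \<rho> \<sigma>) = hiter aweight n \<rho> \<sigma>" for \<rho> \<sigma>
    unfolding xsubst_hiter by (rule fun_cong[OF fun_cong[OF hiter_cong]]) (simp add: aweight_def fun_eq_iff)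
  ultimately show ?thesis
    unfolding dschur_poly_branch[OF assms] hom_conv[OF xsubst.comm_ring_hom_axioms] by simp
qed

text \<open>Insert the identity, written as the product of \<open>hiter aweight n\<close> and
  \<open>viter aweight n\<close>, into the branching rule. The left half is the value at x_i = a_i
  for i \<le> n, the right half the skew polynomial.\<close>

lemma dschur_poly_split:
  assumes "n \<le> N"
  shows "dschur_poly \<nu> N =
    (\<Sum>\<mu>\<in>interval empty_part \<nu>. dskew_poly \<nu> \<mu> n * xsubst (spec n) (dschur_poly \<mu> N))"
proof -
  let ?g = "\<lambda>_. gsch N (N - n)"
  have "(\<Sum>\<mu>\<in>interval empty_part \<nu>. dskew_poly \<nu> \<mu> n * xsubst (spec n) (dschur_poly \<mu> N)) =
      conv (conv ?g (hiter aweight n)) (conv (viter aweight n) (hiter xweight n)) empty_part \<nu>"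
    unfolding conv_def[of "conv ?g (hiter aweight n)"] xsubst_spec_dschur_poly[OF assms] dskew_poly_eq
    by (simp only: mult.commute)
  also have "\<dots> = conv ?g (conv (conv (hiter aweight n) (viter aweight n)) (hiter xweight n)) empty_part \<nu>"
    by (simp only: conv_assoc)
  also have "\<dots> = dschur_poly \<nu> N"
    unfolding conv_hiter_viter conv_delta_left'[OF psupp_hiter] dschur_poly_branch[OF assms] ..
  finally show ?thesis ..
qed


subsection \<open>Generation by power sums\<close>

definition injections :: "nat \<Rightarrow> nat \<Rightarrow> (nat \<Rightarrow> nat) set" where
  "injections m n = {f \<in> PiE {1..m} (\<lambda>_. {1..n}). inj_on f {1..m}}"

text \<open>Summing over injections rather than over distinct monomials gives a multiple of a
  monomial symmetric polynomial, without treating equal or zero exponents separately.\<close>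

definition msum :: "nat \<Rightarrow> nat \<Rightarrow> (nat \<Rightarrow> nat) \<Rightarrow> xpoly" where
  "msum n m u = (\<Sum>f\<in>injections m n. \<Prod>j=1..m. xv (f j) ^ u j)"

lemma finite_injections: "finite (injections m n)"
  unfolding injections_def by (rule finite_subset[OF _ finite_PiE[of "{1..m}" "\<lambda>_. {1..n}"]]) auto

lemma msum_0: "msum n 0 u = 1"
proof -
  have "injections 0 n = {\<lambda>_. undefined}" by (auto simp: injections_def)
  then show ?thesis by (simp add: msum_def)
qed

text \<open>Let the last index run freely and subtract the cases where it coincides with an earlier
  one, in which the two exponents merge. Iterating this expresses everything through power
  sums.\<close>

lemma msum_Suc:
  "msum n (Suc m) u = (\<Sum>i=1..n. xv i ^ u (Suc m)) * msum n m u -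
    (\<Sum>j=1..m. msum n m (u(j := u j + u (Suc m))))"
proof -
  let ?k = "u (Suc m)" and ?t = "\<lambda>u f. \<Prod>j=1..m. xv (f j) ^ u j"
  let ?P = "SIGMA f:injections m n. {1..n} - f ` {1..m}"
  have pw: "(\<Prod>j=1..m. xv (f j) ^ (u(j' := u j' + ?k)) j) = xv (f j') ^ ?k * ?t u f" if "j' \<in> {1..m}" for f j'
  proof -
    have "(\<Prod>j=1..m. xv (f j) ^ (u(j' := u j' + ?k)) j) =
        (\<Prod>j=1..m. (if j = j' then xv (f j') ^ ?k else 1) * xv (f j) ^ u j)"
      by (rule prod.cong[OF refl]) (simp add: power_add mult.commute)
    then show ?thesis using that by (simp add: prod.distrib)
  qed
  have "msum n (Suc m) u = (\<Sum>(f, i)\<in>?P. xv i ^ ?k * ?t u f)"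
    unfolding msum_def
  proof (rule sum.reindex_bij_witness[of _ "\<lambda>(f, i). f(Suc m := i)" "\<lambda>f. (restrict f {1..m}, f (Suc m))"])
    fix f assume f: "f \<in> injections (Suc m) n"
    have fP: "f \<in> PiE {1..Suc m} (\<lambda>_. {1..n})" and fi: "inj_on f {1..Suc m}"
      using f by (simp_all only: injections_def mem_Collect_eq)
    have undef: "f j = undefined" if "j \<notin> {1..Suc m}" for j
      using that by (rule PiE_arb[OF fP])
    show "(case (restrict f {1..m}, f (Suc m)) of (f, i) \<Rightarrow> f(Suc m := i)) = f"
      unfolding case_prod_conv
    proof (rule ext)
      fix j
      show "((restrict f {1..m})(Suc m := f (Suc m))) j = f j"
      proof (cases "j = Suc m")
        case ne: False
        show ?thesis
        proof (cases "j \<in> {1..m}")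
          case False
          then have "j \<notin> {1..Suc m}" using ne by auto
          then show ?thesis using ne False undef[of j]
            by (simp only: fun_upd_other restrict_apply if_False not_False_eq_True simp_thms)
        qed (use ne in simp)
      qed simp
    qed
    have sub: "{1..m} \<subseteq> {1..Suc m}" by simp
    have "inj_on f {1..m}" by (rule inj_on_subset[OF fi sub])
    moreover have "f (Suc m) \<notin> f ` {1..m}"
    proof
      assume "f (Suc m) \<in> f ` {1..m}"
      then obtain j where j: "j \<in> {1..m}" "f (Suc m) = f j" by blast
      have "Suc m = j" by (rule inj_onD[OF fi j(2)]) (use j(1) in simp_all)
      with j show False by simp
    qed
    moreover have "f (Suc m) \<in> {1..n}" by (rule PiE_mem[OF fP]) simp
    moreover have "inj_on (restrict f {1..m}) {1..m} \<longleftrightarrow> inj_on f {1..m}" by (rule inj_on_cong) simp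
    moreover have "restrict f {1..m} ` {1..m} = f ` {1..m}" by (rule image_cong) simp_all
    moreover have "restrict f {1..m} \<in> PiE {1..m} (\<lambda>_. {1..n})"
    proof (rule PiE_I)
      fix j assume j: "j \<in> {1..m}"
      then have "f j \<in> {1..n}" using sub by (intro PiE_mem[OF fP]) blast
      then show "restrict f {1..m} j \<in> {1..n}" using j by simp
    qed (simp only: restrict_apply if_False)
    ultimately show "(restrict f {1..m}, f (Suc m)) \<in> ?P" by (simp add: injections_def)
    show "(case (restrict f {1..m}, f (Suc m)) of (f, i) \<Rightarrow> xv i ^ ?k * ?t u f) = (\<Prod>j=1..Suc m. xv (f j) ^ u j)"
      by (simp add: mult.commute)
  next
    fix q assume "q \<in> ?P"
    then obtain f i where q: "q = (f, i)" and f: "f \<in> injections m n" and i: "i \<in> {1..n}" "i \<notin> f ` {1..m}" by blast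
    have fP: "f \<in> PiE {1..m} (\<lambda>_. {1..n})" and fi: "inj_on f {1..m}" using f by (simp_all add: injections_def)
    have eq: "(f(Suc m := i)) j = f j" if "j \<in> {1..m}" for j using that by simp
    have "restrict (f(Suc m := i)) {1..m} = f"
    proof (rule ext)
      fix j
      show "restrict (f(Suc m := i)) {1..m} j = f j"
        using PiE_arb[OF fP, of j] by (cases "j \<in> {1..m}") (simp_all add: restrict_def)
    qed
    then show "(restrict (case q of (f, i) \<Rightarrow> f(Suc m := i)) {1..m}, (case q of (f, i) \<Rightarrow> f(Suc m := i)) (Suc m)) = q"
      by (simp only: q case_prod_conv fun_upd_same)
    have "{1..Suc m} = insert (Suc m) {1..m}" by auto
    moreover have "inj_on (f(Suc m := i)) {1..m}" using fi by (subst inj_on_cong[OF eq])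
    moreover have "(f(Suc m := i)) ` {1..m} = f ` {1..m}" by (rule image_cong[OF refl eq])
    moreover have "f(Suc m := i) \<in> PiE {1..Suc m} (\<lambda>_. {1..n})"
    proof (rule PiE_I)
      fix j assume "j \<in> {1..Suc m}"
      then show "(f(Suc m := i)) j \<in> {1..n}" using i(1) PiE_mem[OF fP, of j] by (cases "j = Suc m") auto
    next
      fix j assume "j \<notin> {1..Suc m}"
      then show "(f(Suc m := i)) j = undefined" using PiE_arb[OF fP, of j] by auto
    qed
    ultimately show "(case q of (f, i) \<Rightarrow> f(Suc m := i)) \<in> injections (Suc m) n"
      unfolding q case_prod_conv injections_def mem_Collect_eq using i(2) by (simp only: inj_on_insert) simp
  qed
  also have "\<dots> = (\<Sum>f\<in>injections m n. \<Sum>i\<in>{1..n} - f ` {1..m}. xv i ^ ?k * ?t u f)"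
    by (rule sum.Sigma[symmetric]) (simp_all add: finite_injections)
  also have "\<dots> = (\<Sum>f\<in>injections m n. (\<Sum>i=1..n. xv i ^ ?k) * ?t u f - (\<Sum>j=1..m. xv (f j) ^ ?k * ?t u f))"
  proof (rule sum.cong[OF refl])
    fix f assume "f \<in> injections m n"
    then have fP: "f \<in> PiE {1..m} (\<lambda>_. {1..n})" and fi: "inj_on f {1..m}" by (simp_all add: injections_def)
    have "f ` {1..m} \<subseteq> {1..n}" using PiE_mem[OF fP] by blast
    then have "(\<Sum>i\<in>{1..n} - f ` {1..m}. xv i ^ ?k * ?t u f) =
        (\<Sum>i=1..n. xv i ^ ?k * ?t u f) - (\<Sum>i\<in>f ` {1..m}. xv i ^ ?k * ?t u f)"
      by (intro sum_diff) simp_all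
    also have "(\<Sum>i\<in>f ` {1..m}. xv i ^ ?k * ?t u f) = (\<Sum>j=1..m. xv (f j) ^ ?k * ?t u f)"
      using fi by (simp only: sum.reindex o_def)
    finally show "(\<Sum>i\<in>{1..n} - f ` {1..m}. xv i ^ ?k * ?t u f) =
        (\<Sum>i=1..n. xv i ^ ?k) * ?t u f - (\<Sum>j=1..m. xv (f j) ^ ?k * ?t u f)"
      by (simp only: sum_distrib_right)
  qed
  also have "\<dots> = (\<Sum>i=1..n. xv i ^ ?k) * msum n m u - (\<Sum>j=1..m. \<Sum>f\<in>injections m n. xv (f j) ^ ?k * ?t u f)"
    unfolding sum_subtractf msum_def sum_distrib_left by (subst (2) sum.swap) (rule refl)
  also have "(\<Sum>j=1..m. \<Sum>f\<in>injections m n. xv (f j) ^ ?k * ?t u f) = (\<Sum>j=1..m. msum n m (u(j := u j + ?k)))"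
    unfolding msum_def by (rule sum.cong[OF refl], rule sum.cong[OF refl]) (rule pw[symmetric])
  finally show ?thesis .
qed

text \<open>Partitions of size at most d have at most d parts, so all their coefficients are visible
  in d variables.\<close>

lemma dsym_eq_at_level:
  assumes P: "\<And>n. xbound {1..n} d (Rep_dsym P n)" and Q: "\<And>n. xbound {1..n} d (Rep_dsym Q n)"
    and eq: "Rep_dsym P d = Rep_dsym Q d"
  shows "P = Q"
proof -
  have "schur_coeff_at (plength \<kappa>) P \<kappa> = schur_coeff_at (plength \<kappa>) Q \<kappa>" if "psize \<kappa> \<le> d" for \<kappa>
  proof -
    have len: "plength \<kappa> \<le> d" using that plength_le_psize[of \<kappa>] by linarith
    have "schur_coeff_at d P \<kappa> = schur_coeff_at d Q \<kappa>" by (simp only: schur_coeff_at_def eq)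
    then show ?thesis unfolding schur_coeff_at_plength[OF len] .
  qed
  then have "(\<Sum>\<kappa> | psize \<kappa> \<le> d. dscale (schur_coeff_at (plength \<kappa>) P \<kappa>) (dschur \<kappa>)) =
      (\<Sum>\<kappa> | psize \<kappa> \<le> d. dscale (schur_coeff_at (plength \<kappa>) Q \<kappa>) (dschur \<kappa>))"
    by (intro sum.cong refl) simp
  then show ?thesis
    using schur_expansion_bounded[of d P, OF P] schur_expansion_bounded[of d Q, OF Q] by simp
qed

lemma dscale_eq: "dscale c P = dconst c * P"
  by (rule dsym_eqI) simp

text \<open>Symmetrising the monomials of a component \<open>P\<^sub>n\<close> with \<open>n\<close> large expresses a multiple of
  \<open>P\<close> through the functions \<open>msum\<close>, and these are polynomials in power sums.\<close>

lemma dsym_generated: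
  assumes const: "\<And>c. dconst c \<in> S" and add: "\<And>P Q. P \<in> S \<Longrightarrow> Q \<in> S \<Longrightarrow> P + Q \<in> S"
    and mult: "\<And>P Q. P \<in> S \<Longrightarrow> Q \<in> S \<Longrightarrow> P * Q \<in> S" and pow: "\<And>k. k \<ge> 1 \<Longrightarrow> dpow k \<in> S"
  shows "P \<in> S"
proof -
  \<comment> \<open>The degree bound is carried along with membership, since the final equality is
    tested in d variables only.\<close>
  define G where "G d = {Q \<in> S. \<forall>n. xbound {1..n} d (Rep_dsym Q n)}" for d
  have G_mono: "Q \<in> G e" if "Q \<in> G d" "d \<le> e" for Q d e
    using that xbound_mono[of "{1.._}" d _ e] by (simp add: G_def)
  have G_const: "dconst c \<in> G d" for c d
    unfolding G_def using const[of c] by simp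
  have G_add: "P + Q \<in> G d" if "P \<in> G d" "Q \<in> G d" for P Q d
    using that add[of P Q] xbound_add by (simp add: G_def)
  have G_mult: "P * Q \<in> G (d + e)" if "P \<in> G d" "Q \<in> G e" for P Q d e
    using that mult[of P Q] xbound_mult by (simp add: G_def)
  have G_scale: "dscale c Q \<in> G d" if "Q \<in> G d" for c Q d
    using G_mult[OF G_const[of c 0] that] by (simp add: dscale_eq)
  have G_sum: "(\<Sum>i\<in>A. f i) \<in> G d" if "\<And>i. i \<in> A \<Longrightarrow> f i \<in> G d" for f :: "'i \<Rightarrow> dsym" and A d
    using that
  proof (induction A rule: infinite_finite_induct)
    case (insert i A)
    then show ?case by (simp add: G_add)
  qed (use G_const[of 0] dsym_eqI[of "dconst 0" 0] in \<open>simp_all add: xconst.hom_zero\<close>)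
  have G_pow: "\<exists>Q\<in>G k. Rep_dsym Q n = (\<Sum>i=1..n. xv i ^ k)" for k n
  proof (cases "k = 0")
    case True
    have "Rep_dsym (dconst (of_nat n)) n = (\<Sum>i=1..n. xv i ^ k)"
      by (simp add: True xconst.hom_of_nat)
    then show ?thesis using G_const by blast
  next
    case False
    have "xbound {1..m} k (Rep_dsym (dpow k) m)" for m
      unfolding Rep_dpow
    proof (intro xbound_sum xbound_diff)
      fix i assume "i \<in> {1..m}"
      then show "xbound {1..m} k (xv i ^ k)" using xbound_power[OF xbound_xv[of i "{1..m}" 1], of k] by simp
      show "xbound {1..m} k (xconst (av (int i)) ^ k)"
        using xbound_const[of "{1..m}" k "av (int i) ^ k"] by (simp add: xconst.hom_power)
    qed
    then have "dpow k \<in> G k" using pow[of k] False by (simp add: G_def)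
    \<comment> \<open>The constant restores the a_i^k that p_k subtracts. It depends on n, so the
      element has the plain power sum only as its n-th component.\<close>
    then have "dpow k + dconst (\<Sum>i=1..n. av (int i) ^ k) \<in> G k" by (intro G_add G_const)
    moreover have "Rep_dsym (dpow k + dconst (\<Sum>i=1..n. av (int i) ^ k)) n = (\<Sum>i=1..n. xv i ^ k)"
      by (simp add: Rep_dpow sum_subtractf xconst.hom_sum xconst.hom_power)
    ultimately show ?thesis by blast
  qed
  have G_msum: "\<exists>Q\<in>G (\<Sum>j=1..m. u j). Rep_dsym Q n = msum n m u" for m n u
  proof (induction m arbitrary: u)
    case 0
    have "Rep_dsym (dconst 1) n = msum n 0 u" by (simp add: msum_0 xconst.hom_one)
    then show ?case using G_const by blast
  next
    case (Suc m)
    let ?k = "u (Suc m)" and ?d = "\<Sum>j=1..Suc m. u j"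
    obtain A where A: "A \<in> G ?k" "Rep_dsym A n = (\<Sum>i=1..n. xv i ^ ?k)" using G_pow by blast
    obtain B where B: "B \<in> G (\<Sum>j=1..m. u j)" "Rep_dsym B n = msum n m u" using Suc.IH by blast
    have "\<exists>C\<in>G ?d. Rep_dsym C n = msum n m (u(j := u j + ?k))" if j: "j \<in> {1..m}" for j
    proof -
      have "(\<Sum>i=1..m. (u(j := u j + ?k)) i) = (\<Sum>i=1..m. (if i = j then ?k else 0) + u i)"
        by (rule sum.cong[OF refl]) simp
      also have "\<dots> = ?d" using j by (simp add: sum.distrib)
      finally have "(\<Sum>i=1..m. (u(j := u j + ?k)) i) = ?d" .
      with Suc.IH[of "u(j := u j + ?k)"] show ?thesis by (simp only:)
    qed
    then obtain C where C: "\<And>j. j \<in> {1..m} \<Longrightarrow> C j \<in> G ?d"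
        "\<And>j. j \<in> {1..m} \<Longrightarrow> Rep_dsym (C j) n = msum n m (u(j := u j + ?k))"
      by metis
    let ?Q = "A * B + dscale (- 1) (\<Sum>j=1..m. C j)"
    have "A * B \<in> G ?d" using G_mult[OF A(1) B(1)] by (simp add: add.commute)
    then have "?Q \<in> G ?d" by (intro G_add G_scale G_sum C(1))
    moreover have "Rep_dsym ?Q n = msum n (Suc m) u"
      unfolding msum_Suc using C(2) by (simp add: A B Rep_dsym_sum xconst.hom_uminus xconst.hom_one)
    ultimately show ?case by blast
  qed
  obtain d where d: "\<And>n. xbound {1..n} d (Rep_dsym P n)" using Rep_dsym_xbound by blast
  let ?R = "Rep_dsym P d" and ?I = "injections d d"
  have sym: "xsubst (\<lambda>i. xv (f i)) ?R = ?R" if f: "f \<in> ?I" for f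
  proof -
    define p where "p i = (if i \<in> {1..d} then f i else i)" for i
    have "inj_on p {1..d} \<longleftrightarrow> inj_on f {1..d}" by (rule inj_on_cong) (simp add: p_def)
    moreover have "p ` {1..d} = f ` {1..d}" by (rule image_cong) (simp_all add: p_def)
    moreover have "inj_on f {1..d}" "f \<in> PiE {1..d} (\<lambda>_. {1..d})" using f by (simp_all add: injections_def)
    moreover have "f ` {1..d} = {1..d}"
    proof (rule endo_inj_surj)
      show "f ` {1..d} \<subseteq> {1..d}" using PiE_mem[OF \<open>f \<in> PiE {1..d} (\<lambda>_. {1..d})\<close>] by blast
    qed (use \<open>inj_on f {1..d}\<close> in simp_all)
    ultimately have bij: "bij_betw p {1..d} {1..d}" by (simp add: bij_betw_def)
    have "p permutes {1..d}"
    proof (rule bij_imp_permutes[OF bij])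
      fix i assume "i \<notin> {1..d}"
      then show "p i = i" unfolding p_def by (rule if_not_P)
    qed
    from Rep_dsym_symmetric[OF this, of P] have "xsubst (\<lambda>i. xv (p i)) ?R = ?R" .
    moreover have "xsubst (\<lambda>i. xv (p i)) ?R = xsubst (\<lambda>i. xv (f i)) ?R"
      by (rule poly_subst_cong[OF xconst.comm_ring_hom_axioms Rep_dsym_xin]) (simp add: p_def)
    ultimately show ?thesis by simp
  qed
  let ?K = "Poly_Mapping.keys ?R" and ?c = "\<lambda>u. xconst (Poly_Mapping.lookup ?R u)"
  have keys: "Poly_Mapping.keys u \<subseteq> {1..d}" "mdeg u \<le> d" if "u \<in> ?K" for u
    using d[of d] that unfolding xbound_def xin_def by blast+
  have "of_nat (card ?I) * ?R = (\<Sum>f\<in>?I. xsubst (\<lambda>i. xv (f i)) ?R)" by (simp add: sym)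
  also have "\<dots> = (\<Sum>f\<in>?I. \<Sum>u\<in>?K. ?c u * (\<Prod>j=1..d. xv (f j) ^ Poly_Mapping.lookup u j))"
    unfolding poly_subst_def
    by (intro sum.cong refl arg_cong2[where f = times] monom_val_superset keys) simp_all
  also have "\<dots> = (\<Sum>u\<in>?K. ?c u * msum d d (Poly_Mapping.lookup u))"
    unfolding msum_def sum_distrib_left by (rule sum.swap)
  finally have R: "of_nat (card ?I) * ?R = (\<Sum>u\<in>?K. ?c u * msum d d (Poly_Mapping.lookup u))" .
  have "\<exists>Q\<in>G d. Rep_dsym Q d = msum d d (Poly_Mapping.lookup u)" if u: "u \<in> ?K" for u
  proof -
    have "(\<Sum>j=1..d. Poly_Mapping.lookup u j) = mdeg u"
      unfolding mdeg_def by (rule sum.mono_neutral_right) (use keys(1)[OF u] in \<open>auto simp: in_keys_iff\<close>)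
    then have sum: "(\<Sum>j=1..d. Poly_Mapping.lookup u j) \<le> d" using keys(2)[OF u] by simp
    have "\<exists>Q\<in>G (\<Sum>j=1..d. Poly_Mapping.lookup u j). Rep_dsym Q d = msum d d (Poly_Mapping.lookup u)"
      by (rule G_msum)
    then show ?thesis using G_mono[OF _ sum] by blast
  qed
  then obtain Q where Q: "\<And>u. u \<in> ?K \<Longrightarrow> Q u \<in> G d"
      "\<And>u. u \<in> ?K \<Longrightarrow> Rep_dsym (Q u) d = msum d d (Poly_Mapping.lookup u)"
    by metis
  have "restrict (\<lambda>i. i) {1..d} \<in> ?I"
    by (auto simp: injections_def inj_on_def)
  then have pos: "card ?I \<noteq> 0" using finite_injections by (auto simp: card_eq_0_iff)
  let ?r = "Poly_Mapping.single 0 (1 / of_nat (card ?I)) :: qa"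
  have "?r * of_nat (card ?I) = ?r * Poly_Mapping.single 0 (of_nat (card ?I))" by (simp only: single_of_nat)
  also have "\<dots> = 1" using pos by (simp add: mult_single del: single_of_nat)
  finally have r: "?r * of_nat (card ?I) = 1" .
  let ?Q = "dscale ?r (\<Sum>u\<in>?K. dscale (Poly_Mapping.lookup ?R u) (Q u))"
  have QG: "?Q \<in> G d" by (intro G_scale G_sum Q)
  have "Rep_dsym ?Q d = xconst ?r * (\<Sum>u\<in>?K. ?c u * msum d d (Poly_Mapping.lookup u))"
    using Q(2) by (simp add: Rep_dsym_sum)
  also have "\<dots> = xconst (?r * of_nat (card ?I)) * ?R"
    unfolding R[symmetric] by (simp add: xconst.hom_mult xconst.hom_of_nat mult.assoc)
  also have "\<dots> = ?R" unfolding r by (simp add: xconst.hom_one)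
  finally have "P = ?Q"
    using QG by (intro dsym_eq_at_level[of d] d) (simp_all add: G_def)
  then show ?thesis using QG by (simp add: G_def)
qed


subsection \<open>Evaluation of tensors\<close>

text \<open>The tensor \<open>P \<otimes> Q\<close> is evaluated to
  \<open>P(x\<^sub>1, \<dots>, x\<^sub>n) Q(a\<^sub>1, \<dots>, a\<^sub>n, x\<^bsub>n+1\<^esub>, \<dots>, x\<^sub>N)\<close>. The coproduct is then the inverse of these
  evaluations, since \<open>p\<^sub>k \<otimes> 1 + 1 \<otimes> p\<^sub>k\<close> goes to \<open>p\<^sub>k(x\<^sub>1, \<dots>, x\<^sub>N)\<close>.\<close>

fun pair_val :: "nat \<Rightarrow> nat \<Rightarrow> dpair \<Rightarrow> xpoly" where
  "pair_val n N (DPair P Q) = Rep_dsym P n * xsubst (spec n) (Rep_dsym Q N)"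

lemma pair_val_add: "pair_val n N (q + r) = pair_val n N q * pair_val n N r"
  by (cases q; cases r) (simp add: xsubst.hom_mult mult_ac)

lemma pair_val_0: "pair_val n N 0 = 1"
  by (simp add: zero_dpair_def xsubst.hom_one)

definition monoid_val :: "nat \<Rightarrow> nat \<Rightarrow> (dpair \<Rightarrow>\<^sub>0 int) \<Rightarrow> xpoly" where
  "monoid_val n N t = (\<Sum>q\<in>Poly_Mapping.keys t. of_int (Poly_Mapping.lookup t q) * pair_val n N q)"

lemma monoid_val_superset:
  assumes "finite K" "Poly_Mapping.keys t \<subseteq> K"
  shows "monoid_val n N t = (\<Sum>q\<in>K. of_int (Poly_Mapping.lookup t q) * pair_val n N q)"
  unfolding monoid_val_def
  by (rule sum.mono_neutral_left) (use assms in \<open>auto simp: in_keys_iff\<close>)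

lemma monoid_val_add: "monoid_val n N (s + t) = monoid_val n N s + monoid_val n N t"
proof -
  let ?K = "Poly_Mapping.keys s \<union> Poly_Mapping.keys t"
  have "Poly_Mapping.keys (s + t) \<subseteq> ?K" by (rule Poly_Mapping.keys_add)
  then show ?thesis
    by (simp add: monoid_val_superset[of ?K] lookup_add distrib_right sum.distrib)
qed

lemma monoid_val_0: "monoid_val n N 0 = 0"
  by (simp add: monoid_val_def)

lemma monoid_val_diff: "monoid_val n N (s - t) = monoid_val n N s - monoid_val n N t"
  using monoid_val_add[of n N "s - t" t] by simp

lemma monoid_val_sum: "monoid_val n N (\<Sum>i\<in>A. f i) = (\<Sum>i\<in>A. monoid_val n N (f i))"
  by (induction A rule: infinite_finite_induct) (simp_all add: monoid_val_add monoid_val_0)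

lemma monoid_val_single: "monoid_val n N (Poly_Mapping.single q k) = of_int k * pair_val n N q"
  by (subst monoid_val_superset[of "{q}"]) simp_all

lemma sum_singles: "t = (\<Sum>q\<in>Poly_Mapping.keys t. Poly_Mapping.single q (Poly_Mapping.lookup t q))"
proof (rule poly_mapping_eqI)
  fix r
  have "(\<Sum>q\<in>Poly_Mapping.keys t. Poly_Mapping.lookup t q when q = r) = Poly_Mapping.lookup t r"
  proof (cases "r \<in> Poly_Mapping.keys t")
    case True
    have "(\<Sum>q\<in>Poly_Mapping.keys t. Poly_Mapping.lookup t q when q = r) =
        (\<Sum>q\<in>{r}. Poly_Mapping.lookup t q when q = r)"
      by (rule sum.mono_neutral_right) (use True in \<open>simp_all add: when_def\<close>)
    then show ?thesis by simp
  next
    case False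
    then have "Poly_Mapping.lookup t r = 0" by (simp add: in_keys_iff)
    moreover have "(\<Sum>q\<in>Poly_Mapping.keys t. Poly_Mapping.lookup t q when q = r) = 0"
      by (rule sum.neutral) (use False in \<open>auto simp: when_def\<close>)
    ultimately show ?thesis by simp
  qed
  then show "Poly_Mapping.lookup t r =
      Poly_Mapping.lookup (\<Sum>q\<in>Poly_Mapping.keys t. Poly_Mapping.single q (Poly_Mapping.lookup t q)) r"
    by (simp only: lookup_sum lookup_single)
qed

lemma monoid_val_mult: "monoid_val n N (s * t) = monoid_val n N s * monoid_val n N t"
proof -
  let ?s = "Poly_Mapping.lookup s" and ?t = "Poly_Mapping.lookup t"
  have "s * t = (\<Sum>q\<in>Poly_Mapping.keys s. \<Sum>r\<in>Poly_Mapping.keys t.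
      Poly_Mapping.single q (?s q) * Poly_Mapping.single r (?t r))"
    by (rule trans[OF arg_cong2[OF sum_singles sum_singles, of times] sum_product])
  then have "monoid_val n N (s * t) = (\<Sum>q\<in>Poly_Mapping.keys s. \<Sum>r\<in>Poly_Mapping.keys t.
      (of_int (?s q) * pair_val n N q) * (of_int (?t r) * pair_val n N r))"
    by (simp add: monoid_val_sum mult_single monoid_val_single pair_val_add mult_ac)
  then show ?thesis unfolding monoid_val_def[of n N s] monoid_val_def[of n N t] sum_product .
qed

lemma monoid_val_bilinear_ideal: "t \<in> bilinear_ideal \<Longrightarrow> monoid_val n N t = 0"
proof (induction rule: bilinear_ideal.induct)
  case (scale c P Q)
  then show ?case
    by (simp add: monoid_val_diff pair_gen_def monoid_val_single xsubst.hom_mult xconst.hom_zero xconst.hom_one)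
qed (simp_all add: monoid_val_0 monoid_val_diff monoid_val_add monoid_val_mult pair_gen_def
    monoid_val_single xsubst.hom_add algebra_simps)

lift_definition dev :: "nat \<Rightarrow> nat \<Rightarrow> dtensor \<Rightarrow> xpoly" is monoid_val
proof -
  fix n N s t assume "s - t \<in> bilinear_ideal"
  from monoid_val_bilinear_ideal[OF this, of n N] show "monoid_val n N s = monoid_val n N t"
    by (simp add: monoid_val_diff)
qed

lemma dev_add: "dev n N (s + t) = dev n N s + dev n N t"
  by transfer (rule monoid_val_add)

lemma dev_mult: "dev n N (s * t) = dev n N s * dev n N t"
  by transfer (rule monoid_val_mult)

lemma dev_0: "dev n N 0 = 0"
  by transfer (rule monoid_val_0)

lemma dev_1: "dev n N 1 = 1"
  by transfer (simp add: single_one[symmetric] monoid_val_single pair_val_0 del: single_one)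

lemma dev_diff: "dev n N (s - t) = dev n N s - dev n N t"
  by transfer (rule monoid_val_diff)

lemma dev_sum: "dev n N (\<Sum>i\<in>A. f i) = (\<Sum>i\<in>A. dev n N (f i))"
  by (induction A rule: infinite_finite_induct) (simp_all add: dev_add dev_0)

lemma dev_tensor: "dev n N (tensor P Q) = Rep_dsym P n * xsubst (spec n) (Rep_dsym Q N)"
  by transfer (simp add: pair_gen_def monoid_val_single)

lemma dev_tscale: "dev n N (tscale c t) = xconst c * dev n N t"
  by (simp add: tscale_def dev_mult dev_tensor xsubst.hom_one)

lemma tensor_add_left: "tensor (P + P') Q = tensor P Q + tensor P' Q"
  by transfer (use bilinear_ideal.add_left in \<open>simp only: diff_diff_eq\<close>)

lemma tensor_add_right: "tensor P (Q + Q') = tensor P Q + tensor P Q'"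
  by transfer (use bilinear_ideal.add_right in \<open>simp only: diff_diff_eq\<close>)

lemma tensor_dscale: "tensor (dscale c P) Q = tensor P (dscale c Q)"
  by transfer (rule bilinear_ideal.scale)

lemma tensor_mult: "tensor P Q * tensor P' Q' = tensor (P * P') (Q * Q')"
  by transfer (simp add: pair_gen_def mult_single bilinear_ideal.zero)

lemma tscale_tensor: "tscale c (tensor P Q) = tensor (dscale c P) Q"
  by (simp add: tscale_def tensor_mult dscale_eq)

lemma tensor_0_left: "tensor 0 Q = 0"
  using tensor_add_left[of 0 0 Q] by simp

lemma tensor_0_right: "tensor P 0 = 0"
  using tensor_add_right[of P 0 0] by simp

lemma tensor_sum_left: "tensor (\<Sum>i\<in>A. f i) Q = (\<Sum>i\<in>A. tensor (f i) Q)"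
  by (induction A rule: infinite_finite_induct) (simp_all add: tensor_add_left tensor_0_left)

lemma tensor_sum_right: "tensor P (\<Sum>i\<in>A. f i) = (\<Sum>i\<in>A. tensor P (f i))"
  by (induction A rule: infinite_finite_induct) (simp_all add: tensor_add_right tensor_0_right)

lemma dconst_simps: "dconst (c + d) = dconst c + dconst d" "dconst 0 = 0" "dconst 1 = 1"
    "dconst (c * d) = dconst c * dconst d"
  by (rule dsym_eqI; simp add: xconst.hom_add xconst.hom_mult xconst.hom_zero xconst.hom_one)+

lemma tensor_1_1: "tensor 1 1 = 1"
  by transfer (simp add: pair_gen_def zero_dpair_def[symmetric] bilinear_ideal.zero)

lemma tscale_simps: "tscale (c + d) t = tscale c t + tscale d t" "tscale 0 t = 0" "tscale 1 t = t"
    "tscale c (s + t) = tscale c s + tscale c t"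
  by (simp_all add: tscale_def dconst_simps tensor_add_left tensor_0_left tensor_1_1 distrib_left distrib_right)

section \<open>Tensors of Schur functions span and are independent\<close>

abbreviation schur_tensor :: "partition \<times> partition \<Rightarrow> dtensor" where
  "schur_tensor q \<equiv> tensor (dschur (fst q)) (dschur (snd q))"

definition tspan :: "dtensor set" where
  "tspan = {t. \<exists>c. finite {q. c q \<noteq> 0} \<and> t = (\<Sum>q | c q \<noteq> 0. tscale (c q) (schur_tensor q))}"

lemma sum_schur_tensor_superset:
  assumes "finite F" "{q. c q \<noteq> 0} \<subseteq> F"
  shows "(\<Sum>q | c q \<noteq> 0. tscale (c q) (schur_tensor q)) = (\<Sum>q\<in>F. tscale (c q) (schur_tensor q))"
  by (rule sum.mono_neutral_left) (use assms in \<open>auto simp: tscale_simps\<close>)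

lemma tspanI:
  assumes "finite F" "t = (\<Sum>q\<in>F. tscale (c q) (schur_tensor q))"
  shows "t \<in> tspan"
proof -
  let ?c = "\<lambda>q. if q \<in> F then c q else 0"
  have sub: "{q. ?c q \<noteq> 0} \<subseteq> F" by auto
  have "t = (\<Sum>q\<in>F. tscale (?c q) (schur_tensor q))" unfolding assms(2) by (rule sum.cong) simp_all
  then have eq: "t = (\<Sum>q | ?c q \<noteq> 0. tscale (?c q) (schur_tensor q))"
    by (simp only: sum_schur_tensor_superset[OF assms(1) sub])
  show ?thesis
    unfolding tspan_def mem_Collect_eq by (rule exI[of _ ?c], rule conjI[OF finite_subset[OF sub assms(1)] eq])
qed

lemma tspan_add:
  assumes "s \<in> tspan" "t \<in> tspan"
  shows "s + t \<in> tspan"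
proof -
  obtain c d where c: "finite {q. c q \<noteq> 0}" "s = (\<Sum>q | c q \<noteq> 0. tscale (c q) (schur_tensor q))"
    and d: "finite {q. d q \<noteq> 0}" "t = (\<Sum>q | d q \<noteq> 0. tscale (d q) (schur_tensor q))"
    using assms unfolding tspan_def by blast
  let ?F = "{q. c q \<noteq> 0} \<union> {q. d q \<noteq> 0}"
  have F: "finite ?F" using c(1) d(1) by simp
  have "s + t = (\<Sum>q\<in>?F. tscale (c q + d q) (schur_tensor q))"
    unfolding c(2) d(2) sum_schur_tensor_superset[OF F Un_upper1] sum_schur_tensor_superset[OF F Un_upper2]
    by (simp only: sum.distrib tscale_simps)
  then show ?thesis by (rule tspanI[OF F])
qed

lemma tspan_0: "0 \<in> tspan"
  by (rule tspanI[of "{}"]) simp_all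

lemma tspan_sum: "(\<And>i. i \<in> A \<Longrightarrow> f i \<in> tspan) \<Longrightarrow> (\<Sum>i\<in>A. f i) \<in> tspan"
  by (induction A rule: infinite_finite_induct) (simp_all add: tspan_0 tspan_add)

lemma finite_schur_coeffs: "finite {\<kappa>. schur_coeffs P \<kappa> \<noteq> 0}"
proof -
  obtain F where F: "finite F" "\<And>\<kappa>. \<kappa> \<notin> F \<Longrightarrow> schur_coeffs P \<kappa> = 0" by (rule schur_expansion[of P], rule that)
  show ?thesis by (rule finite_subset[OF _ F(1)]) (use F(2) in blast)
qed

lemma schur_expansion_support: "P = (\<Sum>\<kappa> | schur_coeffs P \<kappa> \<noteq> 0. dscale (schur_coeffs P \<kappa>) (dschur \<kappa>))"
proof -
  obtain F where F: "finite F" "P = (\<Sum>\<kappa>\<in>F. dscale (schur_coeffs P \<kappa>) (dschur \<kappa>))"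
    "\<And>\<kappa>. \<kappa> \<notin> F \<Longrightarrow> schur_coeffs P \<kappa> = 0" by (rule schur_expansion[of P], rule that)
  have "(\<Sum>\<kappa> | schur_coeffs P \<kappa> \<noteq> 0. dscale (schur_coeffs P \<kappa>) (dschur \<kappa>)) =
      (\<Sum>\<kappa>\<in>F. dscale (schur_coeffs P \<kappa>) (dschur \<kappa>))"
  proof (rule sum.mono_neutral_left[OF F(1)])
    show "{\<kappa>. schur_coeffs P \<kappa> \<noteq> 0} \<subseteq> F" using F(3) by blast
  qed (auto intro: dsym_eqI simp: xconst.hom_zero)
  then show ?thesis by (rule trans[OF F(2) sym])
qed

lemma tspan_tensor: "tensor P Q \<in> tspan"
proof -
  let ?F = "\<lambda>P. {\<kappa>. schur_coeffs P \<kappa> \<noteq> 0}"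
  have "tensor (dscale c (dschur \<kappa>)) (dscale d (dschur \<mu>)) \<in> tspan" for c d \<kappa> \<mu>
  proof (rule tspanI[of "{(\<kappa>, \<mu>)}" _ "\<lambda>_. d * c"])
    have "tensor (dscale c (dschur \<kappa>)) (dscale d (dschur \<mu>)) = tensor (dscale d (dscale c (dschur \<kappa>))) (dschur \<mu>)"
      by (simp only: tensor_dscale)
    also have "dscale d (dscale c (dschur \<kappa>)) = dscale (d * c) (dschur \<kappa>)"
      by (simp only: dscale_eq dconst_simps mult.assoc)
    finally show "tensor (dscale c (dschur \<kappa>)) (dscale d (dschur \<mu>)) =
        (\<Sum>q\<in>{(\<kappa>, \<mu>)}. tscale (d * c) (schur_tensor q))" by (simp add: tscale_tensor)
  qed simp
  then have "tensor (\<Sum>\<kappa>\<in>?F P. dscale (schur_coeffs P \<kappa>) (dschur \<kappa>)) (\<Sum>\<kappa>\<in>?F Q. dscale (schur_coeffs Q \<kappa>) (dschur \<kappa>)) \<in> tspan"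
    unfolding tensor_sum_left tensor_sum_right by (intro tspan_sum)
  then show ?thesis unfolding schur_expansion_support[symmetric] .
qed

lemma tspan_UNIV: "t \<in> tspan"
proof (induction t rule: dtensor.abs_induct)
  case (1 m)
  have minus: "tensor (- P) Q = - tensor P Q" for P Q
    using tensor_add_left[of P "- P" Q] by (simp add: tensor_0_left eq_neg_iff_add_eq_0 add.commute)
  have one: "abs_dtensor (Poly_Mapping.single (DPair P Q) 1) = tensor P Q" for P Q
    by (simp add: tensor.abs_eq pair_gen_def)
  have single: "abs_dtensor (Poly_Mapping.single q k) \<in> tspan" for q and k :: int
  proof -
    obtain P Q where q: "q = DPair P Q" by (cases q)
    show ?thesis
    proof (induction k rule: int_induct[of _ 0])
      case base
      then show ?case by (simp add: tspan_0 zero_dtensor.abs_eq[symmetric])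
    next
      case (step1 k)
      have "abs_dtensor (Poly_Mapping.single q (k + 1)) = abs_dtensor (Poly_Mapping.single q k) + tensor P Q"
        unfolding single_add plus_dtensor.abs_eq[symmetric] q one ..
      then show ?case using step1 tspan_tensor tspan_add by simp
    next
      case (step2 k)
      have "Poly_Mapping.single q (k - 1) = Poly_Mapping.single q k - Poly_Mapping.single q 1"
        by (simp add: single_diff)
      then have "abs_dtensor (Poly_Mapping.single q (k - 1)) = abs_dtensor (Poly_Mapping.single q k) - tensor P Q"
        by (simp only: minus_dtensor.abs_eq[symmetric] q one)
      also have "\<dots> = abs_dtensor (Poly_Mapping.single q k) + tensor (- P) Q" by (simp add: minus)
      finally show ?case using step2 tspan_tensor tspan_add by simp
    qed
  qed
  have sums: "abs_dtensor (\<Sum>q\<in>K. Poly_Mapping.single q (f q)) \<in> tspan" if "finite K" for K and f :: "dpair \<Rightarrow> int"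
    using that
  proof induction
    case empty
    then show ?case by (simp add: tspan_0 zero_dtensor.abs_eq[symmetric])
  next
    case (insert q K)
    then show ?case by (simp add: plus_dtensor.abs_eq[symmetric] tspan_add single)
  qed
  from sums[of "Poly_Mapping.keys m" "Poly_Mapping.lookup m"] show ?case
    by (simp only: sum_singles[of m, symmetric] finite_keys simp_thms)
qed

lemma interval_same: "interval \<mu> \<mu> = {\<mu>}"
  unfolding interval_def using part_le_antisym part_le_refl by blast

lemma hiter_diag: "hiter w n \<mu> \<mu> = 1"
proof (induction n)
  case (Suc n)
  have "hstrip \<mu> \<mu>" unfolding hstrip_def by (simp add: part_Suc_le)
  then show ?case by (simp add: conv_def interval_same hmat_def Suc)
qed (simp add: pdelta_def)

lemma xin_hiter_aweight: "xin S (hiter aweight n \<mu> \<nu>)"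
proof -
  have "hiter aweight n \<mu> \<nu> = xconst (hiter (\<lambda>k c. av (int k) - av (int k - c)) n \<mu> \<nu>)"
    unfolding hom_hiter[OF xconst.comm_ring_hom_axioms] by (simp add: aweight_def[abs_def] xconst.hom_minus)
  then show ?thesis by simp
qed

text \<open>The second factor, evaluated at a_1, ..., a_n, x_(n+1), ..., x_(2n), is expanded in the
  independent \<open>gsch\<close> polynomials of the last n variables. Its coefficient matrix is
  unitriangular for containment, so the combinations of first factors belonging to each \<mu>
  vanish, and these are Schur expansions in x_1, ..., x_n.\<close>

lemma schur_tensor_independent:
  assumes F: "finite F" and dev: "\<And>n. dev n (n + n) (\<Sum>q\<in>F. tscale (c q) (schur_tensor q)) = 0"
    and q: "q \<in> F"
  shows "c q = 0"
proof -
  \<comment> \<open>Bounds the length of every partition involved, so that n variables in each half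
    suffice.\<close>
  define n where "n = (\<Sum>q\<in>F. plength (fst q) + plength (snd q))"
  let ?N = "n + n" and ?M = "snd ` F"
  have len: "plength (fst q) \<le> n" "plength (snd q) \<le> n" if "q \<in> F" for q
    using member_le_sum[of q F "\<lambda>q. plength (fst q) + plength (snd q)"] F that unfolding n_def by simp_all
  define b where "b \<mu> = (\<Sum>\<kappa> | (\<kappa>, \<mu>) \<in> F. xconst (c (\<kappa>, \<mu>)) * dschur_poly \<kappa> n)" for \<mu>
  define R where "R = (\<Union>\<mu>\<in>?M. interval empty_part \<mu>)"
  have finR: "finite R" unfolding R_def using F by simp
  let ?h = "hiter aweight n"
  have ev: "xsubst (spec n) (dschur_poly \<mu> ?N) = (\<Sum>\<rho>\<in>R. gsch ?N n \<rho> * ?h \<rho> \<mu>)" if "\<mu> \<in> ?M" for \<mu>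
  proof -
    have "xsubst (spec n) (dschur_poly \<mu> ?N) = (\<Sum>\<rho>\<in>interval empty_part \<mu>. gsch ?N n \<rho> * ?h \<rho> \<mu>)"
      using xsubst_spec_dschur_poly[of n ?N \<mu>] by (simp add: conv_def)
    also have "\<dots> = (\<Sum>\<rho>\<in>R. gsch ?N n \<rho> * ?h \<rho> \<mu>)"
    proof (rule sum.mono_neutral_left[OF finR])
      show "interval empty_part \<mu> \<subseteq> R" unfolding R_def using that by blast
      show "\<forall>\<rho>\<in>R - interval empty_part \<mu>. gsch ?N n \<rho> * ?h \<rho> \<mu> = 0"
      proof
        fix \<rho> assume "\<rho> \<in> R - interval empty_part \<mu>"
        then have "\<not> part_le \<rho> \<mu>" using part_le_empty by (simp add: interval_def)
        then have "?h \<rho> \<mu> = 0" using psupp_hiter unfolding psupp_def by blast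
        then show "gsch ?N n \<rho> * ?h \<rho> \<mu> = 0" by simp
      qed
    qed
    finally show ?thesis .
  qed
  have "0 = (\<Sum>q\<in>F. xconst (c q) * (dschur_poly (fst q) n * xsubst (spec n) (dschur_poly (snd q) ?N)))"
    using dev[of n] by (simp only: dev_sum dev_tscale dev_tensor Rep_dschur)
  also have "\<dots> = (\<Sum>\<mu>\<in>?M. \<Sum>q | q \<in> F \<and> snd q = \<mu>.
      xconst (c q) * (dschur_poly (fst q) n * xsubst (spec n) (dschur_poly (snd q) ?N)))"
    by (rule sum.image_gen[OF F])
  also have "\<dots> = (\<Sum>\<mu>\<in>?M. b \<mu> * (\<Sum>\<rho>\<in>R. gsch ?N n \<rho> * ?h \<rho> \<mu>))"
  proof (rule sum.cong[OF refl])
    fix \<mu> assume \<mu>: "\<mu> \<in> ?M"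
    have "(\<Sum>q | q \<in> F \<and> snd q = \<mu>. xconst (c q) * (dschur_poly (fst q) n * xsubst (spec n) (dschur_poly (snd q) ?N))) =
        (\<Sum>\<kappa> | (\<kappa>, \<mu>) \<in> F. xconst (c (\<kappa>, \<mu>)) * dschur_poly \<kappa> n * xsubst (spec n) (dschur_poly \<mu> ?N))"
      by (rule sum.reindex_bij_witness[of _ "\<lambda>\<kappa>. (\<kappa>, \<mu>)" fst]) (auto simp: mult.assoc)
    then show "(\<Sum>q | q \<in> F \<and> snd q = \<mu>. xconst (c q) * (dschur_poly (fst q) n * xsubst (spec n) (dschur_poly (snd q) ?N))) =
        b \<mu> * (\<Sum>\<rho>\<in>R. gsch ?N n \<rho> * ?h \<rho> \<mu>)"
      by (simp only: b_def sum_distrib_right[symmetric] ev[OF \<mu>])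
  qed
  also have "\<dots> = (\<Sum>\<mu>\<in>?M. \<Sum>\<rho>\<in>R. gsch ?N n \<rho> * (b \<mu> * ?h \<rho> \<mu>))"
    by (simp only: sum_distrib_left mult_ac)
  also have "\<dots> = (\<Sum>\<rho>\<in>R. gsch ?N n \<rho> * (\<Sum>\<mu>\<in>?M. b \<mu> * ?h \<rho> \<mu>))"
    unfolding sum_distrib_left by (rule sum.swap)
  finally have eq: "(\<Sum>\<rho>\<in>R. gsch ?N (?N - n) \<rho> * (\<Sum>\<mu>\<in>?M. b \<mu> * ?h \<rho> \<mu>)) = 0" by simp
  have bh: "(\<Sum>\<mu>\<in>?M. b \<mu> * ?h \<rho> \<mu>) = 0" if "\<rho> \<in> R" for \<rho>
  proof (rule gsch_independent[OF le_add1 finR _ _ eq that])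
    fix \<rho> assume "\<rho> \<in> R"
    then obtain q where "q \<in> F" "part_le \<rho> (snd q)" unfolding R_def interval_def by blast
    then show "plength \<rho> \<le> ?N - n" using part_le_plength[of \<rho> "snd q"] len(2)[of q] by simp
  next
    fix \<rho> assume "\<rho> \<in> R"
    have "xin {1..n} (dschur_poly \<kappa> n)" for \<kappa> using xbound_dschur_poly unfolding xbound_def by blast
    then show "xin {1..n} (\<Sum>\<mu>\<in>?M. b \<mu> * ?h \<rho> \<mu>)"
      unfolding b_def by (intro xin_sum xin_mult xin_const xin_hiter_aweight)
  qed
  have b0: "b \<mu> = 0" if "\<mu> \<in> ?M" for \<mu>
  proof (rule ccontr)
    assume "b \<mu> \<noteq> 0"
    \<comment> \<open>For a \<mu> of maximal size with nonzero combination, the relation at \<rho> =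
      \<mu> has no other terms: a further one would come from a strictly larger partition.\<close>
    let ?A = "{\<mu>\<in>?M. b \<mu> \<noteq> 0}"
    have A: "finite ?A" "?A \<noteq> {}" using F that \<open>b \<mu> \<noteq> 0\<close> by auto
    then have "Max (psize ` ?A) \<in> psize ` ?A" by (intro Max_in) simp_all
    then obtain \<mu>\<^sub>0 where \<mu>\<^sub>0: "\<mu>\<^sub>0 \<in> ?A" "Max (psize ` ?A) = psize \<mu>\<^sub>0" by blast
    have max: "psize \<mu> \<le> psize \<mu>\<^sub>0" if "\<mu> \<in> ?A" for \<mu>
      unfolding \<mu>\<^sub>0(2)[symmetric] using A(1) that by (intro Max_ge) simp_all
    have "(\<Sum>\<mu>\<in>?M. b \<mu> * ?h \<mu>\<^sub>0 \<mu>) = (\<Sum>\<mu>\<in>{\<mu>\<^sub>0}. b \<mu> * ?h \<mu>\<^sub>0 \<mu>)"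
    proof (rule sum.mono_neutral_right)
      show "\<forall>\<mu>\<in>?M - {\<mu>\<^sub>0}. b \<mu> * ?h \<mu>\<^sub>0 \<mu> = 0"
      proof
        fix \<mu> assume \<mu>: "\<mu> \<in> ?M - {\<mu>\<^sub>0}"
        show "b \<mu> * ?h \<mu>\<^sub>0 \<mu> = 0"
        proof (rule ccontr)
          assume nz: "b \<mu> * ?h \<mu>\<^sub>0 \<mu> \<noteq> 0"
          then have "?h \<mu>\<^sub>0 \<mu> \<noteq> 0" "b \<mu> \<noteq> 0" by auto
          then have "part_le \<mu>\<^sub>0 \<mu>" using psupp_hiter unfolding psupp_def by blast
          then have "psize \<mu>\<^sub>0 < psize \<mu>" using \<mu> by (intro part_le_psize_less) auto
          moreover have "psize \<mu> \<le> psize \<mu>\<^sub>0" using \<mu> \<open>b \<mu> \<noteq> 0\<close> by (intro max) blast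
          ultimately show False by simp
        qed
      qed
    qed (use F \<mu>\<^sub>0 in auto)
    moreover have "\<mu>\<^sub>0 \<in> R" using \<mu>\<^sub>0(1) part_le_empty part_le_refl unfolding R_def interval_def by blast
    ultimately have "b \<mu>\<^sub>0 = 0" using bh[of \<mu>\<^sub>0] by (simp add: hiter_diag)
    then show False using \<mu>\<^sub>0(1) by simp
  qed
  obtain \<kappa> \<mu> where q': "q = (\<kappa>, \<mu>)" by (cases q)
  let ?F = "{\<kappa>. (\<kappa>, \<mu>) \<in> F}"
  have finF: "finite ?F" by (rule finite_subset[OF _ finite_imageI[OF F, of fst]]) force
  have "b \<mu> = 0" using q q' by (intro b0) force
  then have "Rep_dsym 0 n = (\<Sum>\<kappa>\<in>?F. xconst (c (\<kappa>, \<mu>)) * dschur_poly \<kappa> n)" by (simp add: b_def)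
  from schur_coeff_at_sum[OF this finF, of \<kappa>] have "schur_coeff_at n 0 \<kappa> = c q"
    using q q' len(1)[OF q] by simp
  moreover have "schur_coeff_at n 0 \<kappa> = 0"
    using schur_coeff_at_sum[of 0 n "\<lambda>_. 0" "{}" \<kappa>] q' len(1)[OF q] by simp
  ultimately show "c q = 0" by simp
qed

text \<open>The difference is a combination of Schur tensors and evaluates to 0 everywhere.
  Additivity reduces the claim to independence, and identities of tensors become identities of
  polynomials.\<close>

lemma dev_inject:
  assumes "\<And>n. dev n (n + n) s = dev n (n + n) t"
  shows "s = t"
proof -
  obtain c where c: "finite {q. c q \<noteq> 0}" "s - t = (\<Sum>q | c q \<noteq> 0. tscale (c q) (schur_tensor q))"
    using tspan_UNIV[of "s - t"] unfolding tspan_def by blast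
  have "dev n (n + n) (\<Sum>q | c q \<noteq> 0. tscale (c q) (schur_tensor q)) = 0" for n
    unfolding c(2)[symmetric] by (simp add: dev_diff assms)
  then have E: "{q. c q \<noteq> 0} = {}" using schur_tensor_independent[OF c(1)] by blast
  have "s - t = 0" unfolding c(2) E by simp
  then show ?thesis by simp
qed

lemma schur_tensor_coeffs_unique:
  assumes c: "finite {q. c q \<noteq> 0}" and d: "finite {q. d q \<noteq> 0}"
    and eq: "(\<Sum>q | c q \<noteq> 0. tscale (c q) (schur_tensor q)) = (\<Sum>q | d q \<noteq> 0. tscale (d q) (schur_tensor q))"
  shows "c = d"
proof
  fix q
  let ?F = "insert q ({q. c q \<noteq> 0} \<union> {q. d q \<noteq> 0})"
  have F: "finite ?F" using c d by simp
  have sub: "{q. c q \<noteq> 0} \<subseteq> ?F" "{q. d q \<noteq> 0} \<subseteq> ?F" by auto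
  have e: "(\<Sum>q\<in>?F. tscale (c q) (schur_tensor q)) = (\<Sum>q\<in>?F. tscale (d q) (schur_tensor q))"
    using eq unfolding sum_schur_tensor_superset[OF F sub(1)] sum_schur_tensor_superset[OF F sub(2)] .
  have "(\<Sum>q\<in>?F. tscale (c q - d q + d q) (schur_tensor q)) = (\<Sum>q\<in>?F. tscale (d q) (schur_tensor q))"
    using e by simp
  then have "(\<Sum>q\<in>?F. tscale (c q - d q) (schur_tensor q)) = 0"
    unfolding tscale_simps(1) sum.distrib by simp
  then have "dev n (n + n) (\<Sum>q\<in>?F. tscale (c q - d q) (schur_tensor q)) = 0" for n by (simp only: dev_0)
  from schur_tensor_independent[OF F this, of q] show "c q = d q" by simp
qed


subsection \<open>The coproduct\<close>

text \<open>The candidate for the coproduct: the expected formula on Schur functions, extended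
  linearly.\<close>

definition dsplit :: "dsym \<Rightarrow> dtensor" where
  "dsplit P = (\<Sum>\<nu> | schur_coeffs P \<nu> \<noteq> 0. tscale (schur_coeffs P \<nu>)
     (\<Sum>\<mu>\<in>interval empty_part \<nu>. tensor (dskew \<nu> \<mu>) (dschur \<mu>)))"

text \<open>The splitting of each s_\<nu> is undone by evaluation. As taking components is a ring
  homomorphism, all laws of the coproduct follow by injectivity of the evaluations.\<close>

lemma dev_dsplit:
  assumes "n \<le> N"
  shows "dev n N (dsplit P) = Rep_dsym P N"
proof -
  have "dev n N (dsplit P) = (\<Sum>\<nu> | schur_coeffs P \<nu> \<noteq> 0. xconst (schur_coeffs P \<nu>) * dschur_poly \<nu> N)"
    unfolding dsplit_def dev_sum dev_tscale dev_tensor Rep_dskew Rep_dschur dschur_poly_split[OF assms, symmetric] ..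
  also have "\<dots> = Rep_dsym (\<Sum>\<kappa> | schur_coeffs P \<kappa> \<noteq> 0. dscale (schur_coeffs P \<kappa>) (dschur \<kappa>)) N"
    by (simp add: Rep_dsym_sum Rep_dschur)
  finally show ?thesis unfolding schur_expansion_support[of P, symmetric] .
qed

lemma dsplit_dpow: "dsplit (dpow k) = tensor (dpow k) 1 + tensor 1 (dpow k)"
proof (rule dev_inject)
  fix n
  let ?t = "\<lambda>i. xv i ^ k - xconst (av (int i)) ^ k"
  have "(\<Sum>i=1..n. ?t i) = (\<Sum>i=1..n + n. if i \<le> n then ?t i else 0)"
    by (rule sum.mono_neutral_cong_left) auto
  moreover have "xsubst (spec n) (\<Sum>i=1..n + n. ?t i) = (\<Sum>i=1..n + n. if i \<le> n then 0 else ?t i)"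
    unfolding xsubst.hom_sum
    by (rule sum.cong[OF refl]) (simp add: xsubst.hom_minus xsubst.hom_power xconst.hom_zero xconst.hom_one)
  ultimately have "dev n (n + n) (tensor (dpow k) 1 + tensor 1 (dpow k)) =
      (\<Sum>i=1..n + n. (if i \<le> n then ?t i else 0) + (if i \<le> n then 0 else ?t i))"
    unfolding dev_add dev_tensor Rep_dpow by (simp add: xsubst.hom_one sum.distrib)
  also have "\<dots> = (\<Sum>i=1..n + n. ?t i)" by (rule sum.cong[OF refl]) simp
  finally show "dev n (n + n) (dsplit (dpow k)) = dev n (n + n) (tensor (dpow k) 1 + tensor 1 (dpow k))"
    by (simp only: dev_dsplit le_add1 Rep_dpow)
qed

lemma dsplit_hom:
  "dsplit (P + Q) = dsplit P + dsplit Q" "dsplit (P * Q) = dsplit P * dsplit Q" "dsplit 1 = 1"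
  "dsplit (dscale c P) = tscale c (dsplit P)"
  by (rule dev_inject; simp add: dev_dsplit dev_add dev_mult dev_1 dev_tscale)+

text \<open>Existence is the preceding construction. Any other such homomorphism agrees with it on
  constants and power sums, which generate the ring.\<close>

lemma comult_eq: "comult = dsplit"
  unfolding comult_def
proof (rule the_equality)
  show "(\<forall>P Q. dsplit (P + Q) = dsplit P + dsplit Q) \<and> (\<forall>P Q. dsplit (P * Q) = dsplit P * dsplit Q) \<and>
      dsplit 1 = 1 \<and> (\<forall>c P. dsplit (dscale c P) = tscale c (dsplit P)) \<and>
      (\<forall>k\<ge>1. dsplit (dpow k) = tensor (dpow k) 1 + tensor 1 (dpow k))"
    by (intro conjI allI impI dsplit_hom dsplit_dpow)
next
  fix D
  assume "(\<forall>P Q. D (P + Q) = D P + D Q) \<and> (\<forall>P Q. D (P * Q) = D P * D Q) \<and> D 1 = 1 \<and>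
      (\<forall>c P. D (dscale c P) = tscale c (D P)) \<and>
      (\<forall>k\<ge>1. D (dpow k) = tensor (dpow k) 1 + tensor 1 (dpow k))"
  then have D: "\<And>P Q. D (P + Q) = D P + D Q" "\<And>P Q. D (P * Q) = D P * D Q" "D 1 = 1"
    "\<And>c P. D (dscale c P) = tscale c (D P)" "\<And>k. k \<ge> 1 \<Longrightarrow> D (dpow k) = tensor (dpow k) 1 + tensor 1 (dpow k)"
    by blast+
  show "D = dsplit"
  proof
    fix P
    have "P \<in> {P. D P = dsplit P}"
    proof (rule dsym_generated)
      fix c
      have c: "dconst c = dscale c 1" by (simp add: dscale_eq)
      show "dconst c \<in> {P. D P = dsplit P}" unfolding c mem_Collect_eq D(3,4) dsplit_hom(3,4) ..
    qed (simp_all add: D dsplit_hom dsplit_dpow)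
    then show "D P = dsplit P" by simp
  qed
qed

lemma comult_dschur:
  "comult (dschur \<nu>) = (\<Sum>\<mu>\<in>interval empty_part \<nu>. tensor (dskew \<nu> \<mu>) (dschur \<mu>))"
proof -
  have "{\<kappa>. schur_coeffs (dschur \<nu>) \<kappa> \<noteq> 0} = {\<nu>}" by (auto simp: schur_coeffs_dschur)
  then show ?thesis by (simp add: comult_eq dsplit_def schur_coeffs_dschur tscale_simps)
qed

lemma dual_lr_coeff_eq:
  assumes "part_le \<mu> \<nu>"
  shows "dual_lr_coeff \<kappa> \<mu> \<nu> = schur_coeffs (dskew \<nu> \<mu>) \<kappa>"
proof -
  \<comment> \<open>The coproduct of s_\<nu> is organized by its second tensor factor s_\<mu> with
    \<mu> inside \<nu>; each s_(\<nu>/\<mu>) is then expanded into first factors. Other second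
    indices get the coefficient 0.\<close>
  define c where "c q = (if part_le (snd q) \<nu> then schur_coeffs (dskew \<nu> (snd q)) (fst q) else 0)" for q
  let ?I = "interval empty_part \<nu>"
  let ?A = "SIGMA \<mu>:?I. {\<kappa>. schur_coeffs (dskew \<nu> \<mu>) \<kappa> \<noteq> 0}"
  have fin: "finite ?A" by (rule finite_SigmaI) (simp_all add: finite_schur_coeffs)
  have sub: "{q. c q \<noteq> 0} \<subseteq> prod.swap ` ?A"
  proof
    fix q assume "q \<in> {q. c q \<noteq> 0}"
    then have "part_le (snd q) \<nu>" "schur_coeffs (dskew \<nu> (snd q)) (fst q) \<noteq> 0"
      by (auto simp: c_def split: if_splits)
    moreover obtain a b where "q = (a, b)" by (cases q)
    ultimately have "prod.swap q \<in> ?A" using part_le_empty by (simp add: interval_def)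
    then show "q \<in> prod.swap ` ?A" by (rule image_eqI[rotated]) simp
  qed
  have finc: "finite {q. c q \<noteq> 0}" by (rule finite_subset[OF sub finite_imageI[OF fin]])
  have "(\<Sum>q | c q \<noteq> 0. tscale (c q) (schur_tensor q)) = (\<Sum>q\<in>prod.swap ` ?A. tscale (c q) (schur_tensor q))"
    by (rule sum_schur_tensor_superset[OF finite_imageI[OF fin] sub])
  also have "\<dots> = (\<Sum>(\<mu>, \<kappa>)\<in>?A. tscale (c (\<kappa>, \<mu>)) (tensor (dschur \<kappa>) (dschur \<mu>)))"
    by (subst sum.reindex) (simp_all add: case_prod_unfold o_def prod.swap_def)
  also have "\<dots> = (\<Sum>\<mu>\<in>?I. \<Sum>\<kappa> | schur_coeffs (dskew \<nu> \<mu>) \<kappa> \<noteq> 0.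
      tscale (c (\<kappa>, \<mu>)) (tensor (dschur \<kappa>) (dschur \<mu>)))"
    by (rule sum.Sigma[symmetric]) (simp_all add: finite_schur_coeffs)
  also have "\<dots> = (\<Sum>\<mu>\<in>?I. tensor (dskew \<nu> \<mu>) (dschur \<mu>))"
  proof (rule sum.cong[OF refl])
    fix \<mu> assume "\<mu> \<in> ?I"
    then have "c (\<kappa>, \<mu>) = schur_coeffs (dskew \<nu> \<mu>) \<kappa>" for \<kappa> by (simp add: c_def interval_def)
    then have "(\<Sum>\<kappa> | schur_coeffs (dskew \<nu> \<mu>) \<kappa> \<noteq> 0. tscale (c (\<kappa>, \<mu>)) (tensor (dschur \<kappa>) (dschur \<mu>))) =
        tensor (\<Sum>\<kappa> | schur_coeffs (dskew \<nu> \<mu>) \<kappa> \<noteq> 0. dscale (schur_coeffs (dskew \<nu> \<mu>) \<kappa>) (dschur \<kappa>)) (dschur \<mu>)"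
      by (simp only: tscale_tensor tensor_sum_left)
    then show "(\<Sum>\<kappa> | schur_coeffs (dskew \<nu> \<mu>) \<kappa> \<noteq> 0. tscale (c (\<kappa>, \<mu>)) (tensor (dschur \<kappa>) (dschur \<mu>))) =
        tensor (dskew \<nu> \<mu>) (dschur \<mu>)"
      unfolding schur_expansion_support[of "dskew \<nu> \<mu>", symmetric] .
  qed
  finally have c: "comult (dschur \<nu>) = (\<Sum>q | c q \<noteq> 0. tscale (c q) (schur_tensor q))"
    unfolding comult_dschur by (rule sym)
  have "(THE c. finite {q. c q \<noteq> 0} \<and> comult (dschur \<nu>) = (\<Sum>q | c q \<noteq> 0. tscale (c q) (schur_tensor q))) = c"
  proof (rule the_equality)
    fix d assume d: "finite {q. d q \<noteq> 0} \<and> comult (dschur \<nu>) = (\<Sum>q | d q \<noteq> 0. tscale (d q) (schur_tensor q))"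
    show "d = c"
      by (rule schur_tensor_coeffs_unique[OF conjunct1[OF d] finc trans[OF conjunct2[OF d, symmetric] c]])
  qed (use finc c in blast)
  then show ?thesis using assms by (simp add: dual_lr_coeff_def c_def)
qed

lemma dual_lr_coeff_eq_chain_sum:
  "part_le \<mu> \<nu> \<Longrightarrow> to_fract (dual_lr_coeff \<kappa> \<mu> \<nu>) = chain_sum (dskew \<nu> \<mu>) empty_part \<kappa>"
  unfolding dual_lr_coeff_eq by (rule schur_coeffs_eq_chain_sum_empty)

theorem proposition6p1:
  fixes \<kappa> \<mu> \<nu> :: partition
  shows
    "to_fract (dual_kostka \<kappa> \<mu>) = chain_sum (dcomplete_part \<mu>) empty_part \<kappa> \<and>
     to_fract (dchar \<kappa> \<mu>) = chain_sum (dpow_part \<mu>) empty_part \<kappa> \<and>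
     (part_le \<mu> \<nu> \<longrightarrow>
       to_fract (dual_lr_coeff \<kappa> \<mu> \<nu>) = chain_sum (dskew \<nu> \<mu>) empty_part \<kappa>) \<and>
     to_fract (lr_coeff \<kappa> \<mu> \<nu>) = chain_sum (dschur \<kappa>) \<mu> \<nu>"
  using dual_kostka_eq_chain_sum[of \<kappa> \<mu>] dchar_eq_chain_sum[of \<kappa> \<mu>]
    dual_lr_coeff_eq_chain_sum[of \<mu> \<nu> \<kappa>] lr_coeff_eq_chain_sum[of \<kappa> \<mu> \<nu>] by blast

end
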